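(* Let $\kappa_\rho,\kappa_i\in\frac12\mathbb N$ with $2\kappa_\rho/3\notin\mathbb N$ and $\kappa_i\notin\mathbb N$; let $z_1,\dots,z_m\in\mathbb H$ be points that are pairwise inequivalent under $\mathrm{SL}(2,\mathbb Z)$ and not equivalent to $i$ or $\rho$; let $\kappa_1,\dots,\kappa_m\in\frac12\mathbb N$ with $\kappa_j>\frac12$; and let $\kappa_\infty$ be a positive real number. Then there exist meromorphic modular forms $Q$ of weight $4$ on $\mathrm{SL}(2,\mathbb Z)$ that are equipped with the data $(\kappa_\rho,\kappa_i,(z_j,\kappa_j)_{1\le j\le m},\kappa_\infty)$. Moreover, the number of such $Q$ is at most $\prod_{j=1}^m(2\kappa_j)$.
   Context: $\mathbb H$ is the upper half-plane, $\mathbb N=\{1,2,\dots\}$, $i=\sqrt{-1}$, $\rho=(1+\sqrt{-3})/2$, $q=e^{2\pi iz}$. A meromorphic modular form $Q$ of weight $4$ on $\mathrm{SL}(2,\mathbb Z)$ is a meromorphic function on $\mathbb H$, meromorphic at $\infty$, with $Q(\gamma z)=(cz+d)^4Q(z)$ for all $\gamma=\begin{pmatrix}a&b\\c&d\end{pmatrix}\in\mathrm{SL}(2,\mathbb Z)$. Local exponents of $Q$ mean local exponents of $y''=Q(z)y$ ($'=d/dz$), which is required to be Fuchsian: poles of $Q$ on $\mathbb H$ have order at most $2$ and $Q$ is holomorphic at $\infty$. Local exponents at $\infty$ are exponents in $q$ of $(q\,d/dq)^2y=-\frac{Q}{4\pi^2}y$. $Q$ is apparent on $\mathbb H$ if at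 every pole of $Q$ in $\mathbb H$ the local exponents are $\frac12\pm\kappa$ with $\kappa\in\frac12\mathbb Z_{\ge0}$ and no solution of $y''=Qy$ has a logarithmic singularity there. $Q$ is equipped with the data $(\kappa_\rho,\kappa_i,(z_j,\kappa_j)_j,\kappa_\infty)$ if: (i) up to $\mathrm{SL}(2,\mathbb Z)$-equivalence the poles of $Q$ in $\mathbb H$ are the points $\rho,i,z_1,\dots,z_m$ (where $\rho$, resp. $i$, is a regular point of $Q$ when $\kappa_\rho=\frac12$, resp. $\kappa_i=\frac12$); (ii) the local exponents of $Q$ at $\rho$, $i$, $z_j$ are $\frac12\pm\kappa_\rho$, $\frac12\pm\kappa_i$, $\frac12\pm\kappa_j$, respectively; (iii) $Q$ is apparent on $\mathbb H$; (iv) the local exponents at $\infty$ are $\pm\kappa_\infty$. *)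

theory Defs
  imports "HOL-Complex_Analysis.Complex_Analysis" "HOL-Computational_Algebra.Polynomial"
begin

definition upper_half_plane :: "complex set" where
  "upper_half_plane = {z. Im z > 0}"

definition SL2Z_equiv :: "complex \<Rightarrow> complex \<Rightarrow> bool" where
  "SL2Z_equiv z w \<longleftrightarrow>
     (\<exists>a b c d :: int. a * d - b * c = 1 \<and>
        w = (of_int a * z + of_int b) / (of_int c * z + of_int d))"

definition rho :: complex where
  "rho = (1 + \<i> * complex_of_real (sqrt 3)) / 2"

text \<open>
  \<open>F\<close> is \<open>Q\<close> in the coordinate \<open>q = exp (2 \<pi> i z)\<close> at the cusp: \<open>Q z = F q\<close> for all \<open>z\<close> with
  sufficiently large imaginary part.
\<close>

definition q_expansion_at_infinity :: "(complex \<Rightarrow> complex) \<Rightarrow> (complex \<Rightarrow> complex) \<Rightarrow> bool" where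
  "q_expansion_at_infinity Q F \<longleftrightarrow>
     (\<exists>B>0. \<forall>z. Im z > B \<longrightarrow> Q z = F (exp (2 * complex_of_real pi * \<i> * z)))"

text \<open>
  In order that a meromorphic function on the upper half-plane is the same thing as a value of type
  \<^typ>\<open>complex \<Rightarrow> complex\<close> (so that modular forms can be counted), the irrelevant values are
  normalised: removable singularities are removed, the value at a pole is \<open>0\<close>
  (both are part of \<^const>\<open>nicely_meromorphic_on\<close>), and the value outside the upper half-plane
  is \<open>0\<close>.  With these conventions the transformation law holds at the poles as well.
\<close>

definition meromorphic_modular_form :: "nat \<Rightarrow> (complex \<Rightarrow> complex) \<Rightarrow> bool" where
  "meromorphic_modular_form k Q \<longleftrightarrow>
     Q nicely_meromorphic_on upper_half_plane \<and>
     (\<forall>z. z \<notin> upper_half_plane \<longrightarrow> Q z = 0) \<and>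
     (\<forall>a b c d :: int. a * d - b * c = 1 \<longrightarrow>
        (\<forall>z\<in>upper_half_plane.
           Q ((of_int a * z + of_int b) / (of_int c * z + of_int d)) =
             (of_int c * z + of_int d) ^ k * Q z)) \<and>
     (\<exists>F. F meromorphic_on {0} \<and> q_expansion_at_infinity Q F)"

definition fuchsian :: "(complex \<Rightarrow> complex) \<Rightarrow> bool" where
  "fuchsian Q \<longleftrightarrow>
     (\<forall>z\<in>upper_half_plane. is_pole Q z \<longrightarrow> zorder Q z \<ge> -2) \<and>
     (\<exists>F. F analytic_on {0} \<and> q_expansion_at_infinity Q F)"

text \<open>
  Inserting \<open>y = (z - z0)\<^sup>x (1 + \<dots>)\<close> into \<open>y'' = Q y\<close> gives the indicial polynomial
  \<open>x (x - 1) - A\<close> with \<open>A = lim (z - z0)\<^sup>2 Q(z)\<close>; the local exponents are its two roots, counted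
  with multiplicity.
\<close>

definition local_exponents :: "(complex \<Rightarrow> complex) \<Rightarrow> complex \<Rightarrow> complex \<Rightarrow> complex \<Rightarrow> bool" where
  "local_exponents Q z0 \<alpha> \<beta> \<longleftrightarrow>
     (\<exists>A. ((\<lambda>z. (z - z0)\<^sup>2 * Q z) \<longlongrightarrow> A) (at z0) \<and>
          [:- A, -1, 1:] = [:- \<alpha>, 1:] * [:- \<beta>, 1:])"

text \<open>
  At the cusp, \<open>y'' = Q y\<close> becomes \<open>(q d/dq)\<^sup>2 y = - F(q) / (4 \<pi>\<^sup>2) y\<close>, with indicial polynomial
  \<open>x\<^sup>2 + F(0) / (4 \<pi>\<^sup>2)\<close>.
\<close>

definition local_exponents_at_infinity :: "(complex \<Rightarrow> complex) \<Rightarrow> complex \<Rightarrow> complex \<Rightarrow> bool" where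
  "local_exponents_at_infinity Q \<alpha> \<beta> \<longleftrightarrow>
     (\<exists>F. F analytic_on {0} \<and> q_expansion_at_infinity Q F \<and>
          [:F 0 / (4 * (complex_of_real pi)\<^sup>2), 0, 1:] = [:- \<alpha>, 1:] * [:- \<beta>, 1:])"

text \<open>Cut from \<open>z0\<close> to the left, so that \<open>Ln (z - z0)\<close> and \<open>(z - z0) powr e\<close> are holomorphic.\<close>

definition slit_disc :: "complex \<Rightarrow> real \<Rightarrow> complex set" where
  "slit_disc z0 r = {z \<in> ball z0 r. z - z0 \<notin> \<real>\<^sub>\<le>\<^sub>0}"

definition solution_on :: "(complex \<Rightarrow> complex) \<Rightarrow> complex set \<Rightarrow> (complex \<Rightarrow> complex) \<Rightarrow> bool" where
  "solution_on Q S y \<longleftrightarrow> y holomorphic_on S \<and> (\<forall>z\<in>S. deriv (deriv y) z = Q z * y z)"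

text \<open>
  When the local exponents differ by an integer, every solution near \<open>z0\<close> has the form
  \<open>(z - z0)\<^sup>e (h0 + h1 log (z - z0))\<close> with \<open>h0\<close>, \<open>h1\<close> holomorphic at \<open>z0\<close>.  The singularity is
  logarithmic if \<open>h1\<close> does not vanish identically; this depends neither on the branch of the
  logarithm nor on the choice of \<open>e\<close> modulo integers.
\<close>

definition logarithmic_singularity :: "(complex \<Rightarrow> complex) \<Rightarrow> complex \<Rightarrow> bool" where
  "logarithmic_singularity y z0 \<longleftrightarrow>
     (\<exists>r>0. \<exists>e h0 h1. h0 holomorphic_on ball z0 r \<and> h1 holomorphic_on ball z0 r \<and>
        (\<exists>z\<in>ball z0 r. h1 z \<noteq> 0) \<and>
        (\<forall>z\<in>slit_disc z0 r. y z = (z - z0) powr e * (h0 z + h1 z * Ln (z - z0))))"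

definition apparent_at :: "(complex \<Rightarrow> complex) \<Rightarrow> complex \<Rightarrow> bool" where
  "apparent_at Q z0 \<longleftrightarrow>
     (\<exists>n::nat. local_exponents Q z0 (1/2 + of_nat n / 2) (1/2 - of_nat n / 2)) \<and>
     (\<forall>r>0. \<forall>y. Q holomorphic_on (ball z0 r - {z0}) \<and> solution_on Q (slit_disc z0 r) y
        \<longrightarrow> \<not> logarithmic_singularity y z0)"

definition apparent :: "(complex \<Rightarrow> complex) \<Rightarrow> bool" where
  "apparent Q \<longleftrightarrow> (\<forall>z0\<in>upper_half_plane. is_pole Q z0 \<longrightarrow> apparent_at Q z0)"

text \<open>\<open>\<kappa>\<^sub>q\<close> is the exponent at the cusp. If \<open>\<kappa>\<^sub>\<rho> = 1/2\<close> (or \<open>\<kappa>\<^sub>i = 1/2\<close>), then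
  \<open>rho\<close> (or \<open>\<i>\<close>) is a regular point.\<close>

definition equipped ::
  "(complex \<Rightarrow> complex) \<Rightarrow> real \<Rightarrow> real \<Rightarrow> nat \<Rightarrow> (nat \<Rightarrow> complex) \<Rightarrow> (nat \<Rightarrow> real) \<Rightarrow> real \<Rightarrow> bool" where
  "equipped Q \<kappa>\<^sub>\<rho> \<kappa>\<^sub>i m z \<kappa> \<kappa>\<^sub>q \<longleftrightarrow>
     fuchsian Q \<and>
     (\<forall>w\<in>upper_half_plane. is_pole Q w \<longleftrightarrow>
        (\<kappa>\<^sub>\<rho> \<noteq> 1/2 \<and> SL2Z_equiv rho w) \<or> (\<kappa>\<^sub>i \<noteq> 1/2 \<and> SL2Z_equiv \<i> w) \<or>
        (\<exists>j\<in>{1..m}. SL2Z_equiv (z j) w)) \<and>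
     local_exponents Q rho (1/2 + of_real \<kappa>\<^sub>\<rho>) (1/2 - of_real \<kappa>\<^sub>\<rho>) \<and>
     local_exponents Q \<i> (1/2 + of_real \<kappa>\<^sub>i) (1/2 - of_real \<kappa>\<^sub>i) \<and>
     (\<forall>j\<in>{1..m}. local_exponents Q (z j) (1/2 + of_real (\<kappa> j)) (1/2 - of_real (\<kappa> j))) \<and>
     apparent Q \<and>
     local_exponents_at_infinity Q (of_real \<kappa>\<^sub>q) (- of_real \<kappa>\<^sub>q)"

definition pos_nats :: "real set" where
  "pos_nats = {real n |n. n \<ge> 1}"

definition half_pos_nats :: "real set" where
  "half_pos_nats = {real n / 2 |n. n \<ge> 1}"

end

theory Submission
  imports Defs "HOL-Computational_Algebra.Fundamental_Theorem_Algebra"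
begin

text \<open>
  Dividing \<open>Q\<close> by \<open>E\<^sub>4\<close> gives a rational function of \<open>j\<close>. Its poles are prescribed, and the double
  pole coefficients are determined by the exponents, as is the value at the cusp; only the
  coefficients \<open>x\<^sub>1, \<dots>, x\<^sub>m\<close> of the simple poles at \<open>j = j(z\<^sub>k)\<close> remain free (a simple pole at
  \<open>j = 0\<close> or \<open>j = j(\<i>)\<close> is fixed by the exponents at \<open>\<rho>\<close> or \<open>\<i>\<close>). At \<open>\<rho>\<close> and \<open>\<i>\<close>
  apparentness is automatic: in the Cayley coordinate \<open>Q\<close> is invariant under a rotation \<open>\<zeta>\<close> with
  \<open>\<zeta>\<^sup>n \<noteq> 1\<close>, \<open>n\<close> being the exponent difference, and the obstruction to a solution without logarithm
  has to vanish. At \<open>z\<^sub>k\<close> the Frobenius recursion shows that the obstruction is a polynomial in \<open>x\<close>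
  of degree \<open>n\<^sub>k = 2 \<kappa>\<^sub>k\<close> whose top-degree part is a nonzero multiple of \<open>x\<^sub>k\<close> to the power \<open>n\<^sub>k\<close>. So
  the admissible \<open>x\<close> solve \<open>m\<close> polynomial equations in \<open>m\<close> unknowns without solutions at infinity:
  there is at least one and at most \<open>n\<^sub>1 \<cdots> n\<^sub>m\<close>.
\<close>

text \<open>Apparentness quantifies over all solutions on a slit disc, which is awkward to move
  along the modular group. The proof passes through a Riccati equation for the logarithmic
  derivative of one solution: it transforms by an explicit formula under Moebius maps, it follows
  from a vanishing obstruction, and by reduction of order it excludes logarithms. Conversely, a
  nonzero obstruction is refuted by exhibiting a logarithmic solution. The stabilisers act on the
  local parameter at i by -1 and at rho by a primitive cube root of unity. This is where the
  arithmetic conditions come from: the exponent difference \<open>2 * \<kappa>\<^sub>i\<close> must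
  be odd and \<open>2 * \<kappa>\<^sub>\<rho>\<close> must not be divisible by 3. The modular forms
  are symmetric expressions in differences of half-period values of the Weierstrass function; the
  differences transform with weight 2 because an additive constant, common to the three values,
  cancels. A zero of the polynomial system is found by a Nullstellensatz argument, and the number of
  zeros is bounded by a dimension.\<close>

section \<open>Polynomial systems without zeros at infinity\<close>

text \<open>Gaussian elimination, one equation per induction step; the surplus of unknowns over
  equations survives each step. It serves as the dimension argument in
  \<open>algebraic_mod_J0\<close> and \<open>finite_zero_set\<close>.\<close>

lemma underdetermined_linear_system:
  fixes a :: "'k \<Rightarrow> 'l \<Rightarrow> complex"
  assumes "finite L" "finite K" "card L < card K"
  shows "\<exists>c. (\<exists>k\<in>K. c k \<noteq> 0) \<and> (\<forall>l\<in>L. (\<Sum>k\<in>K. c k * a k l) = 0)"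
  using assms
proof (induction L arbitrary: K a rule: finite_induct)
  case empty
  then show ?case by (intro exI[of _ "\<lambda>_. 1"]) (auto simp: card_gt_0_iff)
next
  case (insert l L)
  show ?case
  proof (cases "\<forall>k\<in>K. a k l = 0")
    case True
    have "card L < card K" using insert by simp
    then obtain c where "\<exists>k\<in>K. c k \<noteq> 0" "\<forall>l\<in>L. (\<Sum>k\<in>K. c k * a k l) = 0"
      using insert.IH[of K a] insert.prems by blast
    with True show ?thesis by (intro exI[of _ c]) auto
  next
    case False
    then obtain k0 where k0: "k0 \<in> K" "a k0 l \<noteq> 0" by blast
    \<comment> \<open>Coefficients after the pivot unknown \<open>k0\<close> has been eliminated by
      means of equation \<open>l\<close>.\<close>
    define a' where "a' k l' = a k l' - a k l / a k0 l * a k0 l'" for k l'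
    have "card L < card (K - {k0})" using insert k0 by simp
    then obtain c where c: "\<exists>k\<in>K - {k0}. c k \<noteq> 0"
        "\<forall>l\<in>L. (\<Sum>k\<in>K - {k0}. c k * a' k l) = 0"
      using insert.IH[of "K - {k0}" a'] insert.prems by blast
    define c' where "c' = c(k0 := - (\<Sum>k\<in>K - {k0}. c k * a k l) / a k0 l)"
    have S: "(\<Sum>k\<in>K. c' k * a k l') = c' k0 * a k0 l' + (\<Sum>k\<in>K - {k0}. c k * a k l')" for l'
    proof -
      have "(\<Sum>k\<in>K - {k0}. c' k * a k l') = (\<Sum>k\<in>K - {k0}. c k * a k l')"
        by (rule sum.cong) (auto simp: c'_def)
      then show ?thesis using insert.prems k0 by (subst sum.remove[of _ k0]) auto
    qed
    have "(\<Sum>k\<in>K. c' k * a k l') = 0" if "l' \<in> insert l L" for l'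
    proof (cases "l' = l")
      case True
      then show ?thesis using k0 unfolding S by (simp add: c'_def)
    next
      case False
      then have "l' \<in> L" using that by simp
      then have "0 = (\<Sum>k\<in>K - {k0}. c k * a' k l')" using c by simp
      also have "\<dots> = (\<Sum>k\<in>K - {k0}. c k * a k l') - (\<Sum>k\<in>K - {k0}. c k * a k l) / a k0 l * a k0 l'"
        by (simp add: a'_def right_diff_distrib sum_subtractf sum_divide_distrib sum_distrib_right mult.assoc)
      finally show ?thesis unfolding S by (simp add: c'_def)
    qed
    moreover have "\<exists>k\<in>K. c' k \<noteq> 0" using c by (auto simp: c'_def)
    ultimately show ?thesis by blast
  qed
qed

section \<open>Spans of functions, and polynomial functions with their degrees\<close>

definition lspan :: "('e \<Rightarrow> 'x \<Rightarrow> complex) \<Rightarrow> 'e set \<Rightarrow> ('x \<Rightarrow> complex) set" where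
  "lspan M A = {f. \<exists>c T. finite T \<and> T \<subseteq> A \<and> (\<forall>x. f x = (\<Sum>e\<in>T. c e * M e x))}"

lemma lspan_zero: "(\<lambda>_. 0) \<in> lspan M A"
  unfolding lspan_def by (auto intro!: exI[of _ "{}"])

lemma lspan_base: "e \<in> A \<Longrightarrow> M e \<in> lspan M A"
  unfolding lspan_def by (auto intro!: exI[of _ "{e}"] exI[of _ "\<lambda>_. 1"])

lemma lspan_mono: "f \<in> lspan M A \<Longrightarrow> A \<subseteq> B \<Longrightarrow> f \<in> lspan M B"
  unfolding lspan_def by blast

lemma lspan_scale: "f \<in> lspan M A \<Longrightarrow> (\<lambda>x. a * f x) \<in> lspan M A"
proof -
  assume "f \<in> lspan M A"
  then obtain c T where "finite T" "T \<subseteq> A" "\<forall>x. f x = (\<Sum>e\<in>T. c e * M e x)"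
    unfolding lspan_def by blast
  then show ?thesis unfolding lspan_def
    by (auto intro!: exI[of _ T] exI[of _ "\<lambda>e. a * c e"] simp: sum_distrib_left mult.assoc)
qed

lemma lspan_add:
  assumes "f \<in> lspan M A" "g \<in> lspan M A"
  shows "(\<lambda>x. f x + g x) \<in> lspan M A"
proof -
  obtain c T where 1: "finite T" "T \<subseteq> A" "\<forall>x. f x = (\<Sum>e\<in>T. c e * M e x)"
    using assms unfolding lspan_def by blast
  obtain d S where 2: "finite S" "S \<subseteq> A" "\<forall>x. g x = (\<Sum>e\<in>S. d e * M e x)"
    using assms unfolding lspan_def by blast
  define b where "b e = (if e \<in> T then c e else 0) + (if e \<in> S then d e else 0)" for e
  have "f x + g x = (\<Sum>e\<in>T \<union> S. b e * M e x)" for x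
  proof -
    have "f x = (\<Sum>e\<in>T \<union> S. (if e \<in> T then c e else 0) * M e x)"
      using 1 2 by (auto intro!: sum.mono_neutral_cong_left)
    moreover have "g x = (\<Sum>e\<in>T \<union> S. (if e \<in> S then d e else 0) * M e x)"
      using 1 2 by (auto intro!: sum.mono_neutral_cong_left)
    ultimately show ?thesis by (simp add: b_def distrib_right sum.distrib)
  qed
  then show ?thesis unfolding lspan_def using 1 2 by (auto intro!: exI[of _ "T \<union> S"] exI[of _ b])
qed

lemma lspan_sum:
  "(\<And>k. k \<in> K \<Longrightarrow> f k \<in> lspan M A) \<Longrightarrow> (\<lambda>x. \<Sum>k\<in>K. f k x) \<in> lspan M A"
  by (induction K rule: infinite_finite_induct) (auto intro: lspan_zero lspan_add)

text \<open>Polynomials in the coordinates \<open>I\<close> are kept as functions, since only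
  values, degree bounds and top-degree parts matter. \<open>pol_Suc\<close> makes \<open>d\<close>
  an upper bound, not the exact degree.\<close>

inductive pol :: "'i set \<Rightarrow> nat \<Rightarrow> (('i \<Rightarrow> complex) \<Rightarrow> complex) \<Rightarrow> bool" for I where
  pol_const: "pol I d (\<lambda>_. c)"
| pol_var: "i \<in> I \<Longrightarrow> pol I d f \<Longrightarrow> pol I (Suc d) (\<lambda>x. x i * f x)"
| pol_add: "pol I d f \<Longrightarrow> pol I d g \<Longrightarrow> pol I d (\<lambda>x. f x + g x)"
| pol_Suc: "pol I d f \<Longrightarrow> pol I (Suc d) f"

lemma pol_mono: "pol I d f \<Longrightarrow> d \<le> d' \<Longrightarrow> pol I d' f"
  by (rule dec_induct[of d d' "\<lambda>e. pol I e f"]) (auto intro: pol_Suc)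

lemma pol_scale: "pol I d f \<Longrightarrow> pol I d (\<lambda>x. c * f x)"
proof (induction rule: pol.induct)
  case (pol_var i d f)
  then show ?case using pol.pol_var[of i I d "\<lambda>x. c * f x"] by (simp add: mult_ac)
qed (auto intro: pol.intros simp: algebra_simps)

lemma pol_mult: "pol I d f \<Longrightarrow> pol I e g \<Longrightarrow> pol I (d + e) (\<lambda>x. f x * g x)"
proof (induction rule: pol.induct)
  case (pol_const d c)
  then show ?case using pol_scale[of I e g c] pol_mono by (metis le_add2)
next
  case (pol_var i d f)
  then show ?case using pol.pol_var[of i I "d + e" "\<lambda>x. f x * g x"] by (simp add: mult_ac)
qed (auto intro: pol.intros simp: algebra_simps)

lemma pol_uminus: "pol I d f \<Longrightarrow> pol I d (\<lambda>x. - f x)"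
  using pol_scale[of I d f "-1"] by simp

lemma pol_sum: "(\<And>k. k \<in> K \<Longrightarrow> pol I d (f k)) \<Longrightarrow> pol I d (\<lambda>x. \<Sum>k\<in>K. f k x)"
  by (induction K rule: infinite_finite_induct) (auto intro: pol.intros)

lemma pol_coord: "i \<in> I \<Longrightarrow> pol I 1 (\<lambda>x. x i)"
  using pol_var[of i I 0 "\<lambda>_. 1"] pol_const by fastforce

lemma pol_power: "pol I d f \<Longrightarrow> pol I (d * k) (\<lambda>x. f x ^ k)"
  by (induction k) (auto intro: pol_const pol_mult simp: algebra_simps)

text \<open>On a line through the origin a polynomial becomes univariate; this separates a
  homogeneous part from parts of lower degree.\<close>

lemma pol_along_ray:
  "pol I d f \<Longrightarrow> \<exists>p. degree p \<le> d \<and> (\<forall>t. f (\<lambda>i. t * x i) = poly p t)"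
proof (induction rule: pol.induct)
  case (pol_const d c)
  show ?case by (intro exI[of _ "[:c:]"]) auto
next
  case (pol_var i d f)
  then obtain p where "degree p \<le> d" "\<forall>t. f (\<lambda>i. t * x i) = poly p t" by blast
  then show ?case
    by (intro exI[of _ "pCons 0 (smult (x i) p)"]) (auto simp: degree_pCons_eq_if)
next
  case (pol_add d f g)
  then obtain p q where "degree p \<le> d" "\<forall>t. f (\<lambda>i. t * x i) = poly p t"
    "degree q \<le> d" "\<forall>t. g (\<lambda>i. t * x i) = poly q t" by blast
  then show ?case by (intro exI[of _ "p + q"]) (auto intro: degree_add_le)
next
  case (pol_Suc d f)
  then show ?case by (meson le_SucI)
qed

text \<open>Degree strictly below \<open>d\<close>. The first alternative keeps this meaningful at
  \<open>d = 0\<close>, where only the zero function qualifies.\<close>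

definition lowpol :: "'i set \<Rightarrow> nat \<Rightarrow> (('i \<Rightarrow> complex) \<Rightarrow> complex) \<Rightarrow> bool" where
  "lowpol I d f \<longleftrightarrow> (\<forall>x. f x = 0) \<or> (\<exists>d'<d. pol I d' f)"

lemma lowpol_zero: "lowpol I d (\<lambda>_. 0)"
  by (simp add: lowpol_def)

lemma lowpol_imp_pol: "lowpol I d f \<Longrightarrow> pol I d f"
proof -
  assume "lowpol I d f"
  then consider "f = (\<lambda>_. 0)" | d' where "d' < d" "pol I d' f" unfolding lowpol_def by blast
  then show ?thesis by cases (auto intro: pol_const pol_mono)
qed

lemma lowpol_Suc: "lowpol I (Suc d) f \<longleftrightarrow> pol I d f"
proof
  assume "lowpol I (Suc d) f"
  then consider "f = (\<lambda>_. 0)" | d' where "d' \<le> d" "pol I d' f" unfolding lowpol_def less_Suc_eq_le by blast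
  then show "pol I d f" by cases (auto intro: pol_const pol_mono)
qed (auto simp: lowpol_def)

lemma lowpol_add: "lowpol I d f \<Longrightarrow> lowpol I d g \<Longrightarrow> lowpol I d (\<lambda>x. f x + g x)"
  by (cases d) (auto simp: lowpol_Suc pol_add, auto simp: lowpol_def)

lemma lowpol_sum: "(\<And>k. k \<in> K \<Longrightarrow> lowpol I d (f k)) \<Longrightarrow> lowpol I d (\<lambda>x. \<Sum>k\<in>K. f k x)"
  by (induction K rule: infinite_finite_induct) (auto intro: lowpol_zero lowpol_add)

lemma lowpol_mult: "pol I d f \<Longrightarrow> lowpol I e g \<Longrightarrow> lowpol I (d + e) (\<lambda>x. f x * g x)"
  by (cases e) (auto simp: lowpol_Suc pol_mult, auto simp: lowpol_def)

lemma lowpol_scale: "lowpol I e g \<Longrightarrow> lowpol I e (\<lambda>x. c * g x)"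
  using lowpol_mult[of I 0 "\<lambda>_. c" e g] pol_const by fastforce

text \<open>\<open>f'\<close> plays the role of the top-degree part of \<open>f\<close>; comparing
  modulo lower degree makes products and powers immediate.\<close>

definition lead :: "'i set \<Rightarrow> nat \<Rightarrow> (('i \<Rightarrow> complex) \<Rightarrow> complex) \<Rightarrow> (('i \<Rightarrow> complex) \<Rightarrow> complex) \<Rightarrow> bool" where
  "lead I d f f' \<longleftrightarrow> pol I d f' \<and> lowpol I d (\<lambda>x. f x - f' x)"

lemma lead_imp_pol: "lead I d f f' \<Longrightarrow> pol I d f"
  using pol_add[of I d f' "\<lambda>x. f x - f' x"] by (auto simp: lead_def dest: lowpol_imp_pol)

lemma lead_refl: "pol I d f \<Longrightarrow> lead I d f f"
  by (simp add: lead_def lowpol_zero)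

lemma lead_mult:
  assumes "lead I d f f'" "lead I e g g'"
  shows "lead I (d + e) (\<lambda>x. f x * g x) (\<lambda>x. f' x * g' x)"
proof -
  have "lowpol I (d + e) (\<lambda>x. f x * (g x - g' x))"
    using assms lead_imp_pol[OF assms(1)] by (intro lowpol_mult) (auto simp: lead_def)
  moreover have "lowpol I (e + d) (\<lambda>x. g' x * (f x - f' x))"
    using assms by (auto simp: lead_def intro: lowpol_mult)
  ultimately have "lowpol I (d + e) (\<lambda>x. f x * (g x - g' x) + g' x * (f x - f' x))"
    by (intro lowpol_add) (simp_all add: add.commute)
  moreover have "(\<lambda>x. f x * (g x - g' x) + g' x * (f x - f' x)) = (\<lambda>x. f x * g x - f' x * g' x)"
    by (auto simp: algebra_simps)
  ultimately show ?thesis using assms by (auto simp: lead_def intro: pol_mult)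
qed

lemma lead_power: "lead I d f f' \<Longrightarrow> lead I (d * k) (\<lambda>x. f x ^ k) (\<lambda>x. f' x ^ k)"
proof (induction k)
  case (Suc k)
  then show ?case using lead_mult[of I d f f' "d * k" "\<lambda>x. f x ^ k" "\<lambda>x. f' x ^ k"] by simp
qed (auto intro: lead_refl pol_const)

lemma lead_prod:
  assumes "\<And>k. k \<in> K \<Longrightarrow> lead I (d k) (f k) (f' k)"
  shows "lead I (sum d K) (\<lambda>x. \<Prod>k\<in>K. f k x) (\<lambda>x. \<Prod>k\<in>K. f' k x)"
  using assms
proof (induction K rule: infinite_finite_induct)
  case (insert k K)
  then show ?case by (simp add: lead_mult)
qed (auto intro: lead_refl pol_const)

definition exps :: "'i set \<Rightarrow> ('i \<Rightarrow> nat) set" where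
  "exps I = {e. \<forall>i. i \<notin> I \<longrightarrow> e i = 0}"

definition mon :: "'i set \<Rightarrow> ('i \<Rightarrow> nat) \<Rightarrow> ('i \<Rightarrow> complex) \<Rightarrow> complex" where
  "mon I e x = (\<Prod>i\<in>I. x i ^ e i)"

text \<open>Induction on the variables: with the other coordinates frozen, the combination is a
  univariate polynomial in \<open>x i\<close> that vanishes everywhere, so each of its coefficients
  is a vanishing combination in fewer variables.\<close>

lemma mon_independent:
  assumes "finite I" "finite T" "T \<subseteq> exps I" "\<forall>x. (\<Sum>e\<in>T. c e * mon I e x) = 0" "e \<in> T"
  shows "c e = 0"
  using assms
proof (induction I arbitrary: T c e rule: finite_induct)
  case empty
  then have "T \<subseteq> {\<lambda>_. 0}" by (auto simp: exps_def)
  then have "T = {e}" using empty by blast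
  with empty show ?case by (simp add: mon_def)
next
  case (insert i I)
  define k where "k = e i"
  have I: "(\<Sum>e\<in>{e\<in>T. e i = k}. c e * mon I e x) = 0" for x k
  proof -
    define p where "p = (\<Sum>e\<in>T. monom (c e * mon I e x) (e i))"
    have "poly p t = 0" for t
    proof -
      have "poly p t = (\<Sum>e\<in>T. c e * mon (insert i I) e (x(i := t)))"
        unfolding p_def mon_def poly_sum using insert.hyps
      proof (intro sum.cong refl)
        fix e
        have "(\<Prod>k\<in>I. (x(i := t)) k ^ e k) = (\<Prod>k\<in>I. x k ^ e k)"
          using insert.hyps by (intro prod.cong) auto
        then show "poly (monom (c e * (\<Prod>k\<in>I. x k ^ e k)) (e i)) t = c e * (\<Prod>k\<in>insert i I. (x(i := t)) k ^ e k)"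
          using insert.hyps by (simp add: poly_monom)
      qed
      then show ?thesis using insert.prems by simp
    qed
    then have "p = 0" using poly_all_0_iff_0 by blast
    then have "coeff p k = 0" by simp
    then show ?thesis unfolding p_def coeff_sum coeff_monom
      using insert.prems by (simp add: sum.inter_filter)
  qed
  \<comment> \<open>On the exponents with fixed entry \<open>k\<close> at \<open>i\<close>, erasing
    that entry loses nothing, so the induction hypothesis applies to the image.\<close>
  let ?r = "\<lambda>e. e(i := 0::nat)"
  have inj: "inj_on ?r {e\<in>T. e i = k}"
    by (rule inj_onI) (metis (mono_tags, lifting) fun_upd_triv fun_upd_upd mem_Collect_eq)
  have mon_r: "mon I (?r e) x = mon I e x" for e and x :: "'a \<Rightarrow> complex"
    unfolding mon_def using insert.hyps by (auto intro!: prod.cong)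
  define c' where "c' e = c (e(i := k))" for e
  have "(\<Sum>e\<in>?r ` {e\<in>T. e i = k}. c' e * mon I e x) = 0" for x
  proof -
    have "(\<Sum>e\<in>?r ` {e\<in>T. e i = k}. c' e * mon I e x) = (\<Sum>e\<in>{e\<in>T. e i = k}. c' (?r e) * mon I (?r e) x)"
      by (rule sum.reindex_cong[OF inj]) auto
    also have "\<dots> = (\<Sum>e\<in>{e\<in>T. e i = k}. c e * mon I e x)"
      unfolding mon_r c'_def by (rule sum.cong) auto
    finally show ?thesis using I by simp
  qed
  moreover have "?r ` {e\<in>T. e i = k} \<subseteq> exps I" using insert.prems by (auto simp: exps_def)
  ultimately have "c' (?r e) = 0"
    using insert.prems by (intro insert.IH[of "?r ` {e\<in>T. e i = k}" c']) (auto simp: k_def simp del: fun_upd_apply)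
  then show ?case by (simp add: c'_def k_def)
qed

definition polyfun :: "'i set \<Rightarrow> (('i \<Rightarrow> complex) \<Rightarrow> complex) \<Rightarrow> bool" where
  "polyfun I f \<longleftrightarrow> (\<exists>d. pol I d f)"

lemma polyfun_const: "polyfun I (\<lambda>_. c)"
  by (auto simp: polyfun_def intro: pol_const)

lemma polyfun_add: "polyfun I f \<Longrightarrow> polyfun I g \<Longrightarrow> polyfun I (\<lambda>x. f x + g x)"
proof -
  assume "polyfun I f" "polyfun I g"
  then obtain d e where "pol I d f" "pol I e g" unfolding polyfun_def by blast
  then have "pol I (max d e) f" "pol I (max d e) g" by (auto elim: pol_mono)
  from pol_add[OF this] show ?thesis unfolding polyfun_def by blast
qed

lemma polyfun_mult: "polyfun I f \<Longrightarrow> polyfun I g \<Longrightarrow> polyfun I (\<lambda>x. f x * g x)"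
  unfolding polyfun_def by (blast intro: pol_mult)

lemma polyfun_coord: "i \<in> I \<Longrightarrow> polyfun I (\<lambda>x. x i)"
  unfolding polyfun_def by (blast intro: pol_coord)

lemma polyfun_uminus: "polyfun I f \<Longrightarrow> polyfun I (\<lambda>x. - f x)"
  unfolding polyfun_def by (blast intro: pol_uminus)

lemma polyfun_diff: "polyfun I f \<Longrightarrow> polyfun I g \<Longrightarrow> polyfun I (\<lambda>x. f x - g x)"
  using polyfun_add[of I f "\<lambda>x. - g x", OF _ polyfun_uminus] by simp

lemma polyfun_prod: "(\<And>k. k \<in> K \<Longrightarrow> polyfun I (f k)) \<Longrightarrow> polyfun I (\<lambda>x. \<Prod>k\<in>K. f k x)"
  by (induction K rule: infinite_finite_induct) (auto intro: polyfun_const polyfun_mult)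

lemma polyfun_poly: "polyfun I u \<Longrightarrow> polyfun I (\<lambda>x. poly p (u x))"
  by (induction p) (auto intro: polyfun_const polyfun_add polyfun_mult)

section \<open>Ideals of polynomial functions\<close>

definition pideal :: "'i set \<Rightarrow> (('i \<Rightarrow> complex) \<Rightarrow> complex) set \<Rightarrow> bool" where
  "pideal I J \<longleftrightarrow> (\<lambda>_. 0) \<in> J \<and> (\<forall>f\<in>J. \<forall>g\<in>J. (\<lambda>x. f x + g x) \<in> J)
      \<and> (\<forall>f\<in>J. \<forall>g. polyfun I g \<longrightarrow> (\<lambda>x. g x * f x) \<in> J)"

lemma pideal_add: "pideal I J \<Longrightarrow> f \<in> J \<Longrightarrow> g \<in> J \<Longrightarrow> (\<lambda>x. f x + g x) \<in> J"
  by (simp add: pideal_def)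

lemma pideal_mult: "pideal I J \<Longrightarrow> f \<in> J \<Longrightarrow> polyfun I g \<Longrightarrow> (\<lambda>x. g x * f x) \<in> J"
  by (simp add: pideal_def)

lemma pideal_scale: "pideal I J \<Longrightarrow> f \<in> J \<Longrightarrow> (\<lambda>x. c * f x) \<in> J"
  by (rule pideal_mult[OF _ _ polyfun_const])

lemma pideal_sum: "pideal I J \<Longrightarrow> (\<And>k. k \<in> K \<Longrightarrow> f k \<in> J) \<Longrightarrow> (\<lambda>x. \<Sum>k\<in>K. f k x) \<in> J"
  by (induction K rule: infinite_finite_induct) (auto simp: pideal_def)

text \<open>The ideal \<open>J + (v)\<close>.\<close>

definition adjoin where
  "adjoin I J v = {f. \<exists>a\<in>J. \<exists>g. polyfun I g \<and> (\<forall>x. f x = a x + g x * v x)}"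

lemma adjoin_pideal:
  assumes "pideal I J"
  shows "pideal I (adjoin I J v)"
  unfolding pideal_def
proof (intro conjI ballI allI impI)
  show "(\<lambda>_. 0) \<in> adjoin I J v" using assms unfolding adjoin_def pideal_def
    by (auto intro!: bexI[of _ "\<lambda>_. 0"] exI[of _ "\<lambda>_. 0"] polyfun_const)
next
  fix f g assume "f \<in> adjoin I J v" "g \<in> adjoin I J v"
  then obtain a b p q where "a \<in> J" "b \<in> J" "polyfun I p" "polyfun I q"
     "\<forall>x. f x = a x + p x * v x" "\<forall>x. g x = b x + q x * v x"
    unfolding adjoin_def by blast
  then show "(\<lambda>x. f x + g x) \<in> adjoin I J v" using assms unfolding adjoin_def pideal_def
    by (auto intro!: bexI[of _ "\<lambda>x. a x + b x"] exI[of _ "\<lambda>x. p x + q x"] polyfun_add simp: algebra_simps)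
next
  fix f g assume "f \<in> adjoin I J v" "polyfun I g"
  then obtain a p where "a \<in> J" "polyfun I p" "\<forall>x. f x = a x + p x * v x"
    unfolding adjoin_def by blast
  then show "(\<lambda>x. g x * f x) \<in> adjoin I J v" using assms \<open>polyfun I g\<close> unfolding adjoin_def pideal_def
    by (auto intro!: bexI[of _ "\<lambda>x. g x * a x"] exI[of _ "\<lambda>x. g x * p x"] polyfun_mult simp: algebra_simps)
qed

lemma adjoin_superset: "J \<subseteq> adjoin I J v"
  unfolding adjoin_def by (auto intro!: bexI exI[of _ "\<lambda>_. 0"] polyfun_const)

lemma adjoin_member: "pideal I J \<Longrightarrow> v \<in> adjoin I J v"
  unfolding adjoin_def pideal_def by (auto intro!: bexI[of _ "\<lambda>_. 0"] exI[of _ "\<lambda>_. 1"] polyfun_const)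

text \<open>Otherwise \<open>u - c\<close> would be a unit modulo \<open>J\<close> for every
  \<open>c\<close>; splitting \<open>p\<close> into linear factors and cancelling them one by one
  would put a nonzero constant into \<open>J\<close>.\<close>

lemma adjoin_root:
  assumes J: "pideal I J" "(\<lambda>_. 1) \<notin> J" and u: "polyfun I u"
    and p: "p \<noteq> 0" "(\<lambda>x. poly p (u x)) \<in> J"
  shows "\<exists>c. (\<lambda>_. 1) \<notin> adjoin I J (\<lambda>x. u x - c)"
  using p
proof (induction "degree p" arbitrary: p)
  case 0
  then obtain a where a: "p = [:a:]" "a \<noteq> 0" by (metis degree_eq_zeroE pCons_0_0)
  have "(\<lambda>x. inverse a * poly p (u x)) \<in> J"
    using J 0 by (intro pideal_scale)
  then show ?case using a J by simp
next
  case (Suc d)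
  have "degree p > 0" using Suc by simp
  have "\<not> constant (poly p)"
  proof
    assume "constant (poly p)"
    then have "poly p = poly [:poly p 0:]" by (auto simp: constant_def)
    then have "p = [:poly p 0:]" by (simp only: poly_eq_poly_eq_iff)
    then have "degree p = 0" by (metis degree_pCons_0)
    then show False using \<open>degree p > 0\<close> by simp
  qed
  then obtain c where "poly p c = 0" using fundamental_theorem_of_algebra by blast
  then obtain q where q: "p = [:- c, 1:] * q" by (auto simp: poly_eq_0_iff_dvd)
  then have "q \<noteq> 0" using Suc.prems by auto
  then have "degree p = degree [:- c, 1:] + degree q" unfolding q by (intro degree_mult_eq) auto
  then have "degree q = d" using Suc.hyps(2) by simp
  show ?case
  proof (rule ccontr)
    assume contra: "\<not> ?thesis"
    then have "(\<lambda>_. 1) \<in> adjoin I J (\<lambda>x. u x - c)" by blast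
    then obtain a g where ag: "a \<in> J" "polyfun I g" "\<forall>x. 1 = a x + g x * (u x - c)"
      unfolding adjoin_def by blast
    \<comment> \<open>Multiplying \<open>1 = a + g * (u - c)\<close> by \<open>q(u)\<close> turns
      the second term into \<open>g * p(u)\<close>, so both terms lie in \<open>J\<close>.\<close>
    have "(\<lambda>x. poly q (u x) * a x + g x * poly p (u x)) \<in> J"
      using J ag Suc.prems polyfun_poly[OF u, of q] by (intro pideal_add pideal_mult)
    moreover have "(\<lambda>x. poly q (u x) * a x + g x * poly p (u x)) = (\<lambda>x. poly q (u x))"
    proof
      fix x
      have "poly q (u x) * a x + g x * poly p (u x) = poly q (u x) * (a x + g x * (u x - c))"
        by (simp add: q algebra_simps)
      then show "poly q (u x) * a x + g x * poly p (u x) = poly q (u x)" using ag by simp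
    qed
    ultimately have "(\<lambda>x. poly q (u x)) \<in> J" by simp
    then show False using Suc.hyps(1)[of q] \<open>q \<noteq> 0\<close> \<open>degree q = d\<close> contra by blast
  qed
qed

text \<open>Modulo the \<open>x i - c i\<close> every coordinate may be replaced by its value, hence
  so may every polynomial.\<close>

lemma polyfun_minus_value_in_ideal:
  assumes J: "pideal I J" and c: "\<And>i. i \<in> I \<Longrightarrow> (\<lambda>x. x i - c i) \<in> J"
  shows "pol I d f \<Longrightarrow> (\<lambda>x. f x - f c) \<in> J"
proof (induction rule: pol.induct)
  case (pol_const d c)
  then show ?case using J by (simp add: pideal_def)
next
  case (pol_var i d f)
  then have "(\<lambda>x. x i * (f x - f c) + f c * (x i - c i)) \<in> J"
    using J c by (intro pideal_add pideal_scale pideal_mult polyfun_coord) auto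
  then show ?case by (simp add: algebra_simps)
next
  case (pol_add d f g)
  then have "(\<lambda>x. (f x - f c) + (g x - g c)) \<in> J" using J by (intro pideal_add)
  then show ?case by (simp add: algebra_simps)
qed


text \<open>
  The products \<open>Mon e\<close> of monomials below the exponents \<open>n\<close> with powers of the \<open>P i\<close> have the
  monomials \<open>x\<^sup>e\<close> as top-degree parts, so they form a basis of the polynomials. Hence \<open>1\<close> is not in
  the ideal of the \<open>P i\<close>, and modulo this ideal the polynomials have dimension \<open>prod n I\<close>.
\<close>

locale power_system =
  fixes I :: "'i set" and n :: "'i \<Rightarrow> nat" and P :: "'i \<Rightarrow> ('i \<Rightarrow> complex) \<Rightarrow> complex"
  assumes finite_I: "finite I" and n_pos: "i \<in> I \<Longrightarrow> n i \<ge> 1"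
    and P_lead: "i \<in> I \<Longrightarrow> lead I (n i) (P i) (\<lambda>x. x i ^ n i)"
begin

definition Mon :: "('i \<Rightarrow> nat) \<Rightarrow> ('i \<Rightarrow> complex) \<Rightarrow> complex" where
  "Mon e x = (\<Prod>i\<in>I. x i ^ (e i mod n i) * P i x ^ (e i div n i))"

text \<open>Division with remainder of \<open>e i\<close> by \<open>n i\<close>: the remainder stays
  as a power of \<open>x i\<close>, the quotient becomes a power of \<open>P i\<close>, whose
  top-degree part restores the missing power of \<open>x i\<close>.\<close>

lemma Mon_lead: "lead I (sum e I) (Mon e) (mon I e)"
proof -
  have "lead I (sum e I) (\<lambda>x. \<Prod>i\<in>I. x i ^ (e i mod n i) * P i x ^ (e i div n i)) (\<lambda>x. \<Prod>i\<in>I. x i ^ e i)"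
  proof (rule lead_prod)
    fix i assume i: "i \<in> I"
    have "lead I (1 * (e i mod n i)) (\<lambda>x. x i ^ (e i mod n i)) (\<lambda>x. x i ^ (e i mod n i))"
      using i by (intro lead_refl pol_power pol_coord)
    from lead_mult[OF this lead_power[OF P_lead[OF i], of "e i div n i"]]
    show "lead I (e i) (\<lambda>x. x i ^ (e i mod n i) * P i x ^ (e i div n i)) (\<lambda>x. x i ^ e i)"
      by (simp flip: power_mult power_add)
  qed
  then show ?thesis by (simp add: Mon_def[abs_def] mon_def[abs_def])
qed

lemma Mon_0: "Mon (\<lambda>_. 0) = (\<lambda>_. 1)"
  by (auto simp: Mon_def)

text \<open>Multiplying \<open>Mon e\<close> by \<open>x i\<close> gives \<open>Mon\<close> of the
  raised exponent up to lower degree, and the lower degree is covered by the outer induction on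
  \<open>d\<close>; the inner induction follows the rules of \<open>pol\<close>.\<close>

lemma pol_in_lspan_Mon: "pol I d f \<Longrightarrow> f \<in> lspan Mon {e \<in> exps I. sum e I \<le> d}"
proof (induction d arbitrary: f)
  case 0
  have const: "(\<lambda>_. c) \<in> lspan Mon {e \<in> exps I. sum e I \<le> d}" for c d
    using lspan_scale[OF lspan_base[of "\<lambda>_. 0" "{e \<in> exps I. sum e I \<le> d}" Mon], of c]
    by (simp add: Mon_0 exps_def del: sum_eq_0_iff)
  have "pol I D f \<Longrightarrow> D = 0 \<Longrightarrow> f \<in> lspan Mon {e \<in> exps I. sum e I \<le> D}" for D
  proof (induction rule: pol.induct)
    case (pol_const d c)
    then show ?case by (rule_tac const)
  qed (auto intro: lspan_add)
  then show ?case using 0 by auto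
next
  case (Suc d)
  have const: "(\<lambda>_. c) \<in> lspan Mon {e \<in> exps I. sum e I \<le> d}" for c d
    using lspan_scale[OF lspan_base[of "\<lambda>_. 0" "{e \<in> exps I. sum e I \<le> d}" Mon], of c]
    by (simp add: Mon_0 exps_def)
  have "pol I D f \<Longrightarrow> D = Suc d \<Longrightarrow> f \<in> lspan Mon {e \<in> exps I. sum e I \<le> D}" for D
  proof (induction rule: pol.induct)
    case (pol_const D c)
    then show ?case by (rule_tac const)
  next
    case (pol_var i D f)
    then have "f \<in> lspan Mon {e \<in> exps I. sum e I \<le> d}" using Suc.IH by simp
    then obtain c T where T: "finite T" "T \<subseteq> {e \<in> exps I. sum e I \<le> d}"
      and f: "\<forall>x. f x = (\<Sum>e\<in>T. c e * Mon e x)"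
      unfolding lspan_def by blast
    have main: "(\<lambda>x. x i * Mon e x) \<in> lspan Mon {e \<in> exps I. sum e I \<le> Suc d}" if e: "e \<in> T" for e
    proof -
      define e' where "e' = e(i := Suc (e i))"
      have s: "sum e' I = Suc (sum e I)"
      proof -
        have "sum e' I = e' i + sum e' (I - {i})" using pol_var finite_I by (intro sum.remove)
        also have "sum e' (I - {i}) = sum e (I - {i})" by (rule sum.cong) (auto simp: e'_def)
        finally show ?thesis using pol_var finite_I by (simp add: sum.remove[of I i e] e'_def)
      qed
      have m: "mon I e' x = x i * mon I e x" for x
      proof -
        have "mon I e' x = x i ^ e' i * (\<Prod>i\<in>I - {i}. x i ^ e' i)"
          unfolding mon_def using pol_var finite_I by (intro prod.remove)
        also have "(\<Prod>i\<in>I - {i}. x i ^ e' i) = (\<Prod>i\<in>I - {i}. x i ^ e i)"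
          by (rule prod.cong) (auto simp: e'_def)
        finally show ?thesis using pol_var finite_I by (simp add: prod.remove[of I i] mon_def e'_def)
      qed
      have "lead I (1 + sum e I) (\<lambda>x. x i * Mon e x) (\<lambda>x. x i * mon I e x)"
        using pol_var by (intro lead_mult lead_refl pol_coord Mon_lead)
      then have 1: "lowpol I (Suc (sum e I)) (\<lambda>x. x i * Mon e x - mon I e' x)"
        by (simp add: lead_def m)
      have 2: "lowpol I (Suc (sum e I)) (\<lambda>x. (-1) * (Mon e' x - mon I e' x))"
        using Mon_lead[of e'] s by (intro lowpol_scale) (simp add: lead_def)
      \<comment> \<open>Both products have the same top-degree part \<open>mon I e'\<close>, which
        cancels in the difference.\<close>
      have "lowpol I (Suc (sum e I)) (\<lambda>x. x i * Mon e x - mon I e' x + (-1) * (Mon e' x - mon I e' x))"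
        by (rule lowpol_add[OF 1 2])
      then have "pol I (sum e I) (\<lambda>x. x i * Mon e x - Mon e' x)"
        by (simp add: lowpol_Suc)
      then have "pol I d (\<lambda>x. x i * Mon e x - Mon e' x)" using e T by (auto intro: pol_mono)
      then have A: "(\<lambda>x. x i * Mon e x - Mon e' x) \<in> lspan Mon {e \<in> exps I. sum e I \<le> Suc d}"
        by (rule lspan_mono[OF Suc.IH]) auto
      have "e' \<in> {e \<in> exps I. sum e I \<le> Suc d}"
        using e T s pol_var by (auto simp: exps_def e'_def)
      from lspan_add[OF A lspan_base[OF this]] show ?thesis by simp
    qed
    have "(\<lambda>x. \<Sum>e\<in>T. c e * (x i * Mon e x)) \<in> lspan Mon {e \<in> exps I. sum e I \<le> Suc d}"
      by (intro lspan_sum lspan_scale main)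
    moreover have "(\<lambda>x. \<Sum>e\<in>T. c e * (x i * Mon e x)) = (\<lambda>x. x i * f x)"
      using f by (auto simp: sum_distrib_left mult_ac)
    ultimately show ?case using pol_var by simp
  next
    case (pol_add D f g)
    then show ?case by (auto intro: lspan_add)
  next
    case (pol_Suc D f)
    then have "f \<in> lspan Mon {e \<in> exps I. sum e I \<le> d}" using Suc.IH by simp
    then have "f \<in> lspan Mon {e \<in> exps I. sum e I \<le> Suc d}" by (rule lspan_mono) auto
    then show ?case using pol_Suc by simp
  qed
  then show ?case using Suc.prems by simp
qed

lemma polyfun_in_lspan_Mon: "polyfun I f \<Longrightarrow> f \<in> lspan Mon (exps I)"
  unfolding polyfun_def using pol_in_lspan_Mon by (auto intro: lspan_mono)

text \<open>In a vanishing combination the summands of highest total degree leave, up to lower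
  degree, a combination of distinct monomials; being homogeneous, it must vanish identically,
  against \<open>mon_independent\<close>.\<close>

lemma Mon_independent:
  assumes T: "finite T" "T \<subseteq> exps I" and 0: "\<forall>x. (\<Sum>e\<in>T. c e * Mon e x) = 0" and "e0 \<in> T"
  shows "c e0 = 0"
proof (rule ccontr)
  assume "c e0 \<noteq> 0"
  define T' where "T' = {e\<in>T. c e \<noteq> 0}"
  have T': "finite T'" "T' \<noteq> {}" using T \<open>e0 \<in> T\<close> \<open>c e0 \<noteq> 0\<close> by (auto simp: T'_def)
  define d where "d = Max ((\<lambda>e. sum e I) ` T')"
  have le: "sum e I \<le> d" if "e \<in> T'" for e using T' that by (auto simp: d_def)
  have "d \<in> (\<lambda>e. sum e I) ` T'" using T' unfolding d_def by (intro Max_in) auto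
  then obtain e1 where e1: "e1 \<in> T'" "sum e1 I = d" by auto
  define Td where "Td = {e\<in>T'. sum e I = d}"
  define f where "f x = (\<Sum>e\<in>Td. c e * mon I e x)" for x
  have eq: "f x = (\<Sum>e\<in>Td. (- c e) * (Mon e x - mon I e x)) + (\<Sum>e\<in>T'-Td. (- c e) * Mon e x)" for x
  proof -
    have "0 = (\<Sum>e\<in>T'. c e * Mon e x)"
      using 0 T by (subst sum.mono_neutral_left[of T T']) (auto simp: T'_def)
    also have "\<dots> = (\<Sum>e\<in>Td. c e * Mon e x) + (\<Sum>e\<in>T'-Td. c e * Mon e x)"
      using T' by (subst sum.subset_diff[of Td]) (auto simp: Td_def)
    finally show ?thesis by (simp add: f_def algebra_simps sum.distrib sum_subtractf sum_negf)
  qed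
  have "lowpol I d f"
    unfolding eq[abs_def]
  proof (intro lowpol_add lowpol_sum lowpol_scale)
    fix e assume "e \<in> Td"
    then show "lowpol I d (\<lambda>x. Mon e x - mon I e x)" using Mon_lead[of e] by (auto simp: lead_def Td_def)
  next
    fix e assume "e \<in> T' - Td"
    then have "sum e I < d" using le by (auto simp: Td_def intro: le_neq_trans)
    then show "lowpol I d (Mon e)" using lead_imp_pol[OF Mon_lead[of e]] by (auto simp: lowpol_def)
  qed
  have "f x = 0" for x
  proof -
    from \<open>lowpol I d f\<close> consider "\<forall>x. f x = 0" | d' where "d' < d" "pol I d' f"
      unfolding lowpol_def by blast
    then show ?thesis
    proof cases
      case 2
      then obtain p where p: "degree p \<le> d'" "\<forall>t. f (\<lambda>i. t * x i) = poly p t"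
        using pol_along_ray by blast
      \<comment> \<open>Homogeneity makes \<open>f x\<close> the coefficient of \<open>t ^ d\<close>
        in a polynomial in \<open>t\<close> of degree below \<open>d\<close>.\<close>
      have "f (\<lambda>i. t * x i) = t ^ d * f x" for t
        unfolding f_def sum_distrib_left
        by (intro sum.cong) (auto simp: Td_def mon_def power_mult_distrib prod.distrib power_sum)
      then have "poly p = poly (monom (f x) d)" using p by (auto simp: poly_monom mult.commute)
      then have "p = monom (f x) d" by (simp add: poly_eq_poly_eq_iff)
      then have "f x = coeff p d" by simp
      also have "\<dots> = 0" using p \<open>d' < d\<close> by (intro coeff_eq_0) simp
      finally show ?thesis .
    qed auto
  qed
  then have "c e1 = 0"
    using finite_I T e1 T' by (intro mon_independent[of I Td c]) (auto simp: f_def Td_def T'_def)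
  then show False using e1 by (simp add: T'_def)
qed

definition J0 :: "(('i \<Rightarrow> complex) \<Rightarrow> complex) set" where
  "J0 = {f. \<exists>g. (\<forall>i\<in>I. polyfun I (g i)) \<and> (\<forall>x. f x = (\<Sum>i\<in>I. g i x * P i x))}"

lemma pideal_J0: "pideal I J0"
  unfolding pideal_def
proof (intro conjI ballI allI impI)
  show "(\<lambda>_. 0) \<in> J0" unfolding J0_def by (auto intro!: exI[of _ "\<lambda>_ _. 0"] polyfun_const)
next
  fix f g assume "f \<in> J0" "g \<in> J0"
  then obtain a b where "\<forall>i\<in>I. polyfun I (a i)" "\<forall>i\<in>I. polyfun I (b i)"
    "\<forall>x. f x = (\<Sum>i\<in>I. a i x * P i x)" "\<forall>x. g x = (\<Sum>i\<in>I. b i x * P i x)"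
    unfolding J0_def by blast
  then show "(\<lambda>x. f x + g x) \<in> J0" unfolding J0_def
    by (auto intro!: exI[of _ "\<lambda>i x. a i x + b i x"] polyfun_add simp: algebra_simps sum.distrib)
next
  fix f g assume "f \<in> J0" "polyfun I g"
  then obtain a where "\<forall>i\<in>I. polyfun I (a i)" "\<forall>x. f x = (\<Sum>i\<in>I. a i x * P i x)"
    unfolding J0_def by blast
  then show "(\<lambda>x. g x * f x) \<in> J0" using \<open>polyfun I g\<close> unfolding J0_def
    by (auto intro!: exI[of _ "\<lambda>i x. g x * a i x"] polyfun_mult simp: algebra_simps sum_distrib_left)
qed

lemma P_in_J0:
  assumes "i \<in> I"
  shows "P i \<in> J0"
proof -
  have "P i x = (\<Sum>j\<in>I. (\<lambda>j _. if j = i then 1 else 0) j x * P j x)" for x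
  proof -
    have "(\<Sum>j\<in>I. (if j = i then 1 else 0) * P j x) = (\<Sum>j\<in>I. if j = i then P j x else 0)"
      by (rule sum.cong) auto
    then show ?thesis using finite_I assms by (simp add: sum.delta)
  qed
  moreover have "\<forall>j\<in>I. polyfun I ((\<lambda>j _. if j = i then 1 else 0) j)"
    by (auto intro: polyfun_const)
  ultimately show ?thesis unfolding J0_def mem_Collect_eq
    by (intro exI[of _ "\<lambda>j _. if j = i then 1 else 0"] conjI allI)
qed

text \<open>Raising the exponent by \<open>n i\<close> leaves the remainder alone and raises the
  quotient by one.\<close>

lemma Mon_mult_P:
  assumes "i \<in> I"
  shows "Mon e x * P i x = Mon (e(i := e i + n i)) x"
proof -
  have "Mon (e(i := e i + n i)) x = (x i ^ (e i mod n i) * P i x ^ (e i div n i)) * P i x *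
     (\<Prod>k\<in>I - {i}. x k ^ (e k mod n k) * P k x ^ (e k div n k))"
    unfolding Mon_def using n_pos[OF assms] by (subst prod.remove[OF finite_I assms]) (simp add: mult_ac)
  then show ?thesis unfolding Mon_def by (subst prod.remove[OF finite_I assms]) (simp add: mult_ac)
qed

text \<open>Multiplication by \<open>P i\<close> shifts an exponent by \<open>n i \<ge> 1\<close>,
  so the ideal lies in the span of the \<open>Mon e\<close> with \<open>e\<close> nonzero, and
  \<open>1\<close>, which is \<open>Mon\<close> of the zero exponent, is independent of
  these.\<close>

lemma one_notin_J0: "(\<lambda>_. 1) \<notin> J0"
proof
  assume "(\<lambda>_. 1) \<in> J0"
  then obtain g where g: "\<forall>i\<in>I. polyfun I (g i)" "\<forall>x. 1 = (\<Sum>i\<in>I. g i x * P i x)"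
    unfolding J0_def by blast
  have "(\<lambda>x. g i x * P i x) \<in> lspan Mon (exps I - {\<lambda>_. 0})" if i: "i \<in> I" for i
  proof -
    obtain c T where T: "finite T" "T \<subseteq> exps I" "\<forall>x. g i x = (\<Sum>e\<in>T. c e * Mon e x)"
      using polyfun_in_lspan_Mon[of "g i"] g i unfolding lspan_def by blast
    have eq: "(\<lambda>x. g i x * P i x) = (\<lambda>x. \<Sum>e\<in>T. c e * Mon (e(i := e i + n i)) x)"
      using T by (simp add: sum_distrib_right mult.assoc Mon_mult_P[OF i])
    have "e(i := e i + n i) \<in> exps I - {\<lambda>_. 0}" if "e \<in> T" for e
      using that T i n_pos[OF i] by (auto simp: exps_def fun_eq_iff intro!: exI[of _ i])
    then show ?thesis unfolding eq by (intro lspan_sum lspan_scale lspan_base)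
  qed
  then have "(\<lambda>x. \<Sum>i\<in>I. g i x * P i x) \<in> lspan Mon (exps I - {\<lambda>_. 0})" by (rule lspan_sum)
  then obtain c T where T: "finite T" "T \<subseteq> exps I - {\<lambda>_. 0}" "\<forall>x. 1 = (\<Sum>e\<in>T. c e * Mon e x)"
    using g unfolding lspan_def by auto
  \<comment> \<open>The value -1 at the zero exponent moves the constant 1 to the other side of the
    identity.\<close>
  define c' where "c' e = (if e = (\<lambda>_. 0) then -1 else c e)" for e
  have "(\<Sum>e\<in>insert (\<lambda>_. 0) T. c' e * Mon e x) = 0" for x
  proof -
    have "(\<Sum>e\<in>T. c' e * Mon e x) = (\<Sum>e\<in>T. c e * Mon e x)"
      using T by (intro sum.cong) (auto simp: c'_def)
    then show ?thesis using T by (subst sum.insert) (auto simp: c'_def Mon_0)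
  qed
  then have "c' (\<lambda>_. 0) = 0"
    using T by (intro Mon_independent[of "insert (\<lambda>_. 0) T"]) (auto simp: exps_def)
  then show False by (simp add: c'_def)
qed

text \<open>The exponents whose \<open>Mon e\<close> span the polynomials modulo
  \<open>J0\<close>.\<close>

definition box :: "('i \<Rightarrow> nat) set" where
  "box = {e \<in> exps I. \<forall>i\<in>I. e i < n i}"

lemma box_finite_card: "finite box" "card box \<le> prod n I"
proof -
  have sub: "box \<subseteq> (\<lambda>f i. if i \<in> I then f i else 0) ` (PiE I (\<lambda>i. {..<n i}))"
  proof
    fix e assume e: "e \<in> box"
    then show "e \<in> (\<lambda>f i. if i \<in> I then f i else 0) ` (PiE I (\<lambda>i. {..<n i}))"
      by (intro image_eqI[of _ _ "restrict e I"]) (auto simp: exps_def box_def)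
  qed
  have fin: "finite (PiE I (\<lambda>i. {..<n i}))" using finite_I by (intro finite_PiE) auto
  show "finite box" using sub fin finite_subset by blast
  have "card box \<le> card (PiE I (\<lambda>i. {..<n i}))"
    using sub fin by (meson card_image_le card_mono finite_imageI le_trans)
  then show "card box \<le> prod n I" using finite_I by (simp add: card_PiE)
qed

lemma Mon_in_J0:
  assumes "e \<in> exps I" "e \<notin> box"
  shows "Mon e \<in> J0"
proof -
  obtain i where i: "i \<in> I" "e i \<ge> n i" using assms by (auto simp: box_def not_less)
  define e' where "e' = e(i := e i - n i)"
  have "e = e'(i := e' i + n i)" using i by (auto simp: e'_def fun_eq_iff)
  then have "Mon e = (\<lambda>x. Mon e' x * P i x)" using Mon_mult_P[OF i(1), of e'] by auto
  moreover have "polyfun I (Mon e')" using lead_imp_pol[OF Mon_lead] by (auto simp: polyfun_def)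
  ultimately show ?thesis using P_in_J0[OF i(1)] pideal_J0 unfolding pideal_def by auto
qed

lemma polyfun_mod_J0:
  assumes "polyfun I f"
  shows "\<exists>c. (\<lambda>x. f x - (\<Sum>e\<in>box. c e * Mon e x)) \<in> J0"
proof -
  obtain c T where T: "finite T" "T \<subseteq> exps I" "\<forall>x. f x = (\<Sum>e\<in>T. c e * Mon e x)"
    using polyfun_in_lspan_Mon[OF assms] unfolding lspan_def by blast
  define c' where "c' e = (if e \<in> T then c e else 0)" for e
  have "(\<lambda>x. \<Sum>e\<in>T - box. c e * Mon e x) \<in> J0"
    using T Mon_in_J0 by (intro pideal_sum[OF pideal_J0] pideal_scale[OF pideal_J0]) auto
  moreover have "f x - (\<Sum>e\<in>box. c' e * Mon e x) = (\<Sum>e\<in>T - box. c e * Mon e x)" for x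
  proof -
    have "(\<Sum>e\<in>box. c' e * Mon e x) = (\<Sum>e\<in>T \<inter> box. c e * Mon e x)"
      using box_finite_card T by (intro sum.mono_neutral_cong_right) (auto simp: c'_def)
    then show ?thesis using T sum.Int_Diff[of T "\<lambda>e. c e * Mon e x" box] by simp
  qed
  ultimately show ?thesis by (intro exI[of _ c']) simp
qed

text \<open>The powers of \<open>u\<close> from 0 to \<open>card box\<close> are one more than the
  \<open>card box\<close> functions that span everything modulo \<open>J0\<close>, so a nontrivial
  combination of them lies in \<open>J0\<close>.\<close>

lemma algebraic_mod_J0:
  assumes "polyfun I u"
  shows "\<exists>p. p \<noteq> 0 \<and> (\<lambda>x. poly p (u x)) \<in> J0"
proof -
  have "\<exists>c. (\<lambda>x. u x ^ k - (\<Sum>e\<in>box. c e * Mon e x)) \<in> J0" for k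
  proof (rule polyfun_mod_J0)
    show "polyfun I (\<lambda>x. u x ^ k)"
      using assms by (induction k) (auto intro: polyfun_const polyfun_mult)
  qed
  then obtain c where c: "\<And>k. (\<lambda>x. u x ^ k - (\<Sum>e\<in>box. c k e * Mon e x)) \<in> J0"
    using choice[of "\<lambda>k c. (\<lambda>x. u x ^ k - (\<Sum>e\<in>box. c e * Mon e x)) \<in> J0"] by blast
  have "card box < card {..card box}" by simp
  then obtain a where a: "\<exists>k\<in>{..card box}. a k \<noteq> 0" "\<forall>e\<in>box. (\<Sum>k\<in>{..card box}. a k * c k e) = 0"
    using underdetermined_linear_system[of box "{..card box}" c] box_finite_card by blast
  define p where "p = (\<Sum>k\<le>card box. monom (a k) k)"
  have "p \<noteq> 0"
  proof
    assume "p = 0"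
    then have "coeff p k = 0" for k by simp
    moreover have "coeff p k = a k" if "k \<le> card box" for k
      using that unfolding p_def coeff_sum by (simp add: sum.delta')
    ultimately have "\<forall>k\<le>card box. a k = 0" by simp
    then show False using a by blast
  qed
  have "(\<lambda>x. \<Sum>k\<le>card box. a k * (u x ^ k - (\<Sum>e\<in>box. c k e * Mon e x))) \<in> J0"
    using c by (intro pideal_sum[OF pideal_J0] pideal_scale[OF pideal_J0])
  moreover have "(\<Sum>k\<le>card box. a k * (u x ^ k - (\<Sum>e\<in>box. c k e * Mon e x))) = poly p (u x)" for x
  proof -
    have "(\<Sum>k\<le>card box. a k * (\<Sum>e\<in>box. c k e * Mon e x)) = (\<Sum>e\<in>box. (\<Sum>k\<le>card box. a k * c k e) * Mon e x)"
      unfolding sum_distrib_left sum_distrib_right by (subst sum.swap) (simp add: mult.assoc)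
    also have "\<dots> = 0" using a by (intro sum.neutral) auto
    finally show ?thesis
      by (simp add: p_def poly_sum poly_monom right_diff_distrib sum_subtractf)
  qed
  ultimately show ?thesis using \<open>p \<noteq> 0\<close> by auto
qed

text \<open>A weak Nullstellensatz: one coordinate after the other is fixed to a value
  \<open>c i\<close> by adjoining \<open>x i - c i\<close> while 1 stays outside the ideal. In the
  end each \<open>P i\<close> is congruent to the constant \<open>P i c\<close>, which a proper
  ideal containing \<open>P i\<close> forces to be 0.\<close>

lemma exists_zero: "\<exists>x. (\<forall>i\<in>I. P i x = 0) \<and> (\<forall>i. i \<notin> I \<longrightarrow> x i = 0)"
proof -
  have "\<exists>J c. pideal I J \<and> (\<lambda>_. 1) \<notin> J \<and> J0 \<subseteq> J \<and> (\<forall>i\<in>K. (\<lambda>x. x i - c i) \<in> J)"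
    if "finite K" "K \<subseteq> I" for K
    using that
  proof (induction K rule: finite_induct)
    case empty
    then show ?case using pideal_J0 one_notin_J0 by blast
  next
    case (insert i K)
    then obtain J c where J: "pideal I J" "(\<lambda>_. 1) \<notin> J" "J0 \<subseteq> J" "\<forall>i\<in>K. (\<lambda>x. x i - c i) \<in> J" by auto
    have i: "polyfun I (\<lambda>x. x i)" using insert.prems by (auto intro: polyfun_coord)
    obtain p where "p \<noteq> 0" "(\<lambda>x. poly p (x i)) \<in> J0" using algebraic_mod_J0[OF i] by blast
    then obtain b where b: "(\<lambda>_. 1) \<notin> adjoin I J (\<lambda>x. x i - b)"
      using adjoin_root[OF J(1,2) i] J(3) by blast
    show ?case
      using b J insert.hyps adjoin_pideal[OF J(1)] adjoin_superset[of J I "\<lambda>x. x i - b"]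
        adjoin_member[OF J(1), of "\<lambda>x. x i - b"]
      by (intro exI[of _ "adjoin I J (\<lambda>x. x i - b)"] exI[of _ "c(i := b)"]) auto
  qed
  from this[OF finite_I order.refl] obtain J c
    where J: "pideal I J" "(\<lambda>_. 1) \<notin> J" "J0 \<subseteq> J" "\<forall>i\<in>I. (\<lambda>x. x i - c i) \<in> J" by blast
  have agree: "pol I d f \<Longrightarrow> (\<And>i. i \<in> I \<Longrightarrow> x i = y i) \<Longrightarrow> f x = f y" for d f and x y :: "'i \<Rightarrow> complex"
    by (induction rule: pol.induct) auto
  have "P i c = 0" if i: "i \<in> I" for i
  proof (rule ccontr)
    assume nz: "P i c \<noteq> 0"
    have "(\<lambda>x. P i x - P i c) \<in> J"
      using polyfun_minus_value_in_ideal[OF J(1)] J(4) lead_imp_pol[OF P_lead[OF i]] by blast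
    moreover have "P i \<in> J" using P_in_J0[OF i] J(3) by blast
    ultimately have "(\<lambda>x. inverse (P i c) * (P i x + (-1) * (P i x - P i c))) \<in> J"
      using J(1) by (intro pideal_scale pideal_add)
    then show False using J(2) nz by simp
  qed
  \<comment> \<open>The coordinates outside \<open>I\<close> are reset to 0; by \<open>agree\<close>
    this does not change the values of the \<open>P i\<close>.\<close>
  then show ?thesis
    using agree[OF lead_imp_pol[OF P_lead], of _ "\<lambda>i. if i \<in> I then c i else 0" c]
    by (intro exI[of _ "\<lambda>i. if i \<in> I then c i else 0"]) auto
qed

text \<open>Interpolation polynomials of finitely many zeros are independent modulo
  \<open>J0\<close>, because evaluation at a zero kills \<open>J0\<close>; hence there are at most
  \<open>card box\<close> zeros.\<close>

lemma finite_zero_set: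
  defines "Z \<equiv> {x. (\<forall>i\<in>I. P i x = 0) \<and> (\<forall>i. i \<notin> I \<longrightarrow> x i = 0)}"
  shows "finite Z" "card Z \<le> prod n I"
proof -
  have J0: "f x = 0" if "f \<in> J0" "x \<in> Z" for f x
    using that by (auto simp: J0_def Z_def)
  have le: "card Z0 \<le> card box" if Z0: "finite Z0" "Z0 \<subseteq> Z" for Z0
  proof (rule ccontr)
    assume "\<not> card Z0 \<le> card box"
    \<comment> \<open>A polynomial vanishing at all points of \<open>Z0\<close> except
      \<open>z\<close>; for each other point it uses some coordinate in which the two
      differ.\<close>
    define L where "L z x = (\<Prod>z'\<in>Z0 - {z}. x (SOME i. z i \<noteq> z' i) - z' (SOME i. z i \<noteq> z' i))"
      for z x :: "'i \<Rightarrow> complex"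
    have some: "(SOME i. z i \<noteq> z' i) \<in> I \<and> z (SOME i. z i \<noteq> z' i) \<noteq> z' (SOME i. z i \<noteq> z' i)"
      if "z \<in> Z0" "z' \<in> Z0 - {z}" for z z'
    proof -
      have "\<exists>i. z i \<noteq> z' i" using that by auto
      then have *: "z (SOME i. z i \<noteq> z' i) \<noteq> z' (SOME i. z i \<noteq> z' i)" by (rule someI_ex)
      
      moreover have "z i = z' i" if "i \<notin> I" for i
      proof -
        have "z \<in> Z" "z' \<in> Z" using \<open>z \<in> Z0\<close> \<open>z' \<in> Z0 - {z}\<close> Z0 by auto
        then show ?thesis using that by (simp add: Z_def)
      qed
      ultimately show ?thesis by blast
    qed
    have "polyfun I (L z)" if "z \<in> Z0" for z
      unfolding L_def using some[OF that] by (intro polyfun_prod polyfun_diff polyfun_coord polyfun_const) auto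
    then have "\<forall>z\<in>Z0. \<exists>c. (\<lambda>x. L z x - (\<Sum>e\<in>box. c e * Mon e x)) \<in> J0" using polyfun_mod_J0 by blast
    then obtain c where c: "\<And>z. z \<in> Z0 \<Longrightarrow> (\<lambda>x. L z x - (\<Sum>e\<in>box. c z e * Mon e x)) \<in> J0"
      using bchoice[of Z0 "\<lambda>z c. (\<lambda>x. L z x - (\<Sum>e\<in>box. c e * Mon e x)) \<in> J0"] by blast
    obtain a where a: "\<exists>z\<in>Z0. a z \<noteq> 0" "\<forall>e\<in>box. (\<Sum>z\<in>Z0. a z * c z e) = 0"
      using underdetermined_linear_system[of box Z0 c] box_finite_card Z0 \<open>\<not> card Z0 \<le> card box\<close> by auto
    have "a y = 0" if y: "y \<in> Z0" for y
    proof -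
      have "(\<Sum>z\<in>Z0. a z * L z y) = (\<Sum>z\<in>Z0. a z * (\<Sum>e\<in>box. c z e * Mon e y))"
        using J0[OF c] y Z0 by (intro sum.cong) auto
      also have "\<dots> = (\<Sum>e\<in>box. (\<Sum>z\<in>Z0. a z * c z e) * Mon e y)"
        unfolding sum_distrib_left sum_distrib_right by (subst sum.swap) (simp add: mult.assoc)
      also have "\<dots> = 0" using a by (intro sum.neutral) auto
      finally have "0 = a y * L y y + (\<Sum>z\<in>Z0 - {y}. a z * L z y)"
        using y Z0 by (simp add: sum.remove)
      also have "(\<Sum>z\<in>Z0 - {y}. a z * L z y) = 0"
        using y Z0 by (intro sum.neutral) (auto simp: L_def)
      finally have "a y * L y y = 0" by simp
      moreover have "L y y \<noteq> 0" unfolding L_def using Z0 some[OF y] by (subst prod_zero_iff) auto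
      ultimately show ?thesis by simp
    qed
    then show False using a by blast
  qed
  show "finite Z"
  proof (rule ccontr)
    assume "infinite Z"
    then obtain Z0 where "Z0 \<subseteq> Z" "finite Z0" "card Z0 = Suc (card box)"
      using infinite_arbitrarily_large by blast
    then show False using le[of Z0] by simp
  qed
  then show "card Z \<le> prod n I" using le[of Z] box_finite_card by simp
qed

end

section \<open>The Frobenius method and logarithmic singularities\<close>

text \<open>Geometric growth of the coefficients, with \<open>C ^ Suc i\<close> so that one constant
  serves both as factor and as base.\<close>

lemma fps_conv_radius_pos_iff:
  fixes F :: "complex fps"
  shows "fps_conv_radius F > 0 \<longleftrightarrow> (\<exists>C>0. \<forall>i. norm (F $ i) \<le> C ^ Suc i)"
proof
  assume "fps_conv_radius F > 0"
  then obtain r where r: "ereal r > 0" "ereal r < fps_conv_radius F"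
    using ereal_dense2 by blast
  then have "r > 0" by simp
  have "summable (\<lambda>i. F $ i * of_real r ^ i)"
    using r \<open>r > 0\<close> by (intro summable_fps) simp
  then have "Bseq (\<lambda>i. F $ i * of_real r ^ i)"
    by (meson summable_LIMSEQ_zero convergentI convergent_imp_Bseq)
  then obtain K where K: "K > 0" "\<And>i. norm (F $ i * of_real r ^ i) \<le> K" unfolding Bseq_def by blast
  define C where "C = max K (max 1 (1 / r))"
  have C: "C \<ge> 1" "C \<ge> K" "C \<ge> 1 / r" by (auto simp: C_def)
  have "norm (F $ i) \<le> C ^ Suc i" for i
  proof -
    have "norm (F $ i) = norm (F $ i * of_real r ^ i) * (1 / r) ^ i"
      using \<open>r > 0\<close> by (simp add: norm_mult norm_power power_one_over)
    also have "\<dots> \<le> C * C ^ i"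
      using K C \<open>r > 0\<close> by (intro mult_mono power_mono) (auto intro: order_trans)
    finally show ?thesis by simp
  qed
  then show "\<exists>C>0. \<forall>i. norm (F $ i) \<le> C ^ Suc i" using C by (intro exI[of _ C]) auto
next
  assume "\<exists>C>0. \<forall>i. norm (F $ i) \<le> C ^ Suc i"
  then obtain C where C: "C > 0" "\<And>i. norm (F $ i) \<le> C ^ Suc i" by blast
  have "summable (\<lambda>i. F $ i * of_real (1 / (2 * C)) ^ i)"
  proof (rule summable_comparison_test)
    show "summable (\<lambda>i. C * (1 / 2) ^ i :: real)" by (intro summable_mult summable_geometric) auto
    show "\<exists>N. \<forall>i\<ge>N. norm (F $ i * of_real (1 / (2 * C)) ^ i) \<le> C * (1 / 2) ^ i"
    proof (intro exI allI impI)
      fix i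
      have "norm (F $ i * of_real (1 / (2 * C)) ^ i) = norm (F $ i) * (1 / (2 * C)) ^ i"
        using C by (simp add: norm_mult norm_power norm_divide)
      also have "\<dots> \<le> C ^ Suc i * (1 / (2 * C)) ^ i"
        using C by (intro mult_right_mono) auto
      also have "\<dots> = C * (1 / 2) ^ i" using C by (simp add: power_divide field_simps power_mult_distrib)
      finally show "norm (F $ i * of_real (1 / (2 * C)) ^ i) \<le> C * (1 / 2) ^ i" .
    qed
  qed
  then have "fps_conv_radius F \<ge> norm (of_real (1 / (2 * C)) :: complex)"
    unfolding fps_conv_radius_def by (rule conv_radius_geI)
  moreover have "ereal (norm (of_real (1 / (2 * C)) :: complex)) > 0" using C by simp
  ultimately show "fps_conv_radius F > 0" by order
qed

text \<open>
  The coefficients of the solution \<open>h = 1 + \<dots>\<close> of \<open>s h'' + (1 + \<nu>) h' = d h - t\<close>.  At a resonance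
  \<open>k = - \<nu>\<close> division by zero selects the value \<open>0\<close>.
\<close>

fun frob :: "int \<Rightarrow> (nat \<Rightarrow> complex) \<Rightarrow> (nat \<Rightarrow> complex) \<Rightarrow> nat \<Rightarrow> complex" where
  "frob \<nu> d t k = (if k = 0 then 1 else
     ((\<Sum>i<k. d (k - 1 - i) * frob \<nu> d t i) - t (k - 1)) / (of_nat k * (of_nat k + of_int \<nu>)))"

declare frob.simps [simp del]

lemma frob_0 [simp]: "frob \<nu> d t 0 = 1"
  by (simp add: frob.simps)

text \<open>Away from resonance \<open>k + \<nu>\<close> is a nonzero integer, so the denominator is
  at least \<open>k\<close> in modulus and pays for the \<open>k\<close> summands of the
  numerator.\<close>

lemma frob_bound:
  assumes d: "\<And>i. norm (d i) \<le> C ^ Suc i" and t: "\<And>i. norm (t i) \<le> C ^ Suc i" and C: "C > 0"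
  shows "norm (frob \<nu> d t k) \<le> (2 * C + 1) ^ k"
proof (induction k rule: less_induct)
  case (less k)
  show ?case
  proof (cases "k = 0 \<or> of_nat k + of_int \<nu> = (0 :: complex)")
    case True
    then show ?thesis using C by (subst frob.simps) auto
  next
    case False
    \<comment> \<open>The sum and the term \<open>t\<close> each contribute at most
      \<open>k * C * L ^ (k - 1)\<close>, so the base must dominate \<open>2 * C\<close>; the 1
      keeps it at least 1.\<close>
    define L where "L = 2 * C + 1"
    have L: "L \<ge> 1" "C \<le> L" using C by (auto simp: L_def)
    have "int k + \<nu> \<noteq> 0" using False by (metis of_int_0 of_int_add of_int_of_nat_eq)
    then have "1 \<le> \<bar>int k + \<nu>\<bar>" by linarith
    then have "1 \<le> norm (of_int (int k + \<nu>) :: complex)" by (simp only: norm_of_int of_int_1_le_iff flip: of_int_abs)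
    then have k: "real k \<le> norm (of_nat k * (of_nat k + of_int \<nu>) :: complex)"
      by (simp add: norm_mult mult_le_cancel_left1)
    have "norm ((\<Sum>i<k. d (k - 1 - i) * frob \<nu> d t i) - t (k - 1)) \<le>
        (\<Sum>i<k. norm (d (k - 1 - i)) * norm (frob \<nu> d t i)) + norm (t (k - 1))"
      by (intro order_trans[OF norm_triangle_ineq4] add_mono order.refl sum_norm_le) (simp add: norm_mult)
    also have "\<dots> \<le> (\<Sum>i<k. C ^ Suc (k - 1 - i) * L ^ i) + C ^ k"
    proof (intro add_mono sum_mono mult_mono)
      show "norm (t (k - 1)) \<le> C ^ k" using t[of "k - 1"] False by (simp flip: power_Suc)
    qed (use d less.IH C in \<open>auto simp: L_def simp del: power_Suc\<close>)
    also have "(\<Sum>i<k. C ^ Suc (k - 1 - i) * L ^ i) \<le> (\<Sum>i<k. C * L ^ (k - 1))"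
    proof (rule sum_mono)
      fix i assume "i \<in> {..<k}"
      then have "C ^ Suc (k - 1 - i) * L ^ i \<le> C * (L ^ (k - 1 - i) * L ^ i)"
        using C L by (simp add: mult.assoc) (intro mult_right_mono power_mono, auto)
      also have "L ^ (k - 1 - i) * L ^ i = L ^ (k - 1)"
        using \<open>i \<in> {..<k}\<close> by (simp flip: power_add)
      finally show "C ^ Suc (k - 1 - i) * L ^ i \<le> C * L ^ (k - 1)" .
    qed
    also have "C ^ k \<le> real k * C * L ^ (k - 1)"
    proof -
      have "C ^ k = C * C ^ (k - 1)" using False by (simp flip: power_Suc)
      also have "\<dots> \<le> C * L ^ (k - 1)" using C L by (intro mult_left_mono power_mono) auto
      also have "\<dots> \<le> real k * (C * L ^ (k - 1))"
        using False C L mult_right_mono[of 1 "real k" "C * L ^ (k - 1)"] by simp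
      finally show ?thesis by (simp add: mult.assoc)
    qed
    finally have "norm ((\<Sum>i<k. d (k - 1 - i) * frob \<nu> d t i) - t (k - 1)) \<le> real k * (2 * C * L ^ (k - 1))"
      by (simp add: algebra_simps)
    also have "\<dots> \<le> real k * L ^ k"
    proof (rule mult_left_mono)
      have "2 * C * L ^ (k - 1) \<le> L * L ^ (k - 1)" using L C by (intro mult_right_mono) (auto simp: L_def)
      then show "2 * C * L ^ (k - 1) \<le> L ^ k" using False by (simp flip: power_Suc)
    qed auto
    finally have "norm ((\<Sum>i<k. d (k - 1 - i) * frob \<nu> d t i) - t (k - 1)) / norm (of_nat k * (of_nat k + of_int \<nu>) :: complex)
        \<le> real k * L ^ k / real k"
      using k False L by (intro frac_le) auto
    then show ?thesis using False by (subst frob.simps) (simp add: norm_divide L_def)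
  qed
qed

lemma frob_conv_radius:
  assumes "fps_conv_radius D > 0" "fps_conv_radius T > 0"
  shows "fps_conv_radius (Abs_fps (frob \<nu> (fps_nth D) (fps_nth T))) > 0"
proof -
  obtain C1 where C1: "C1 > 0" "\<And>i. norm (D $ i) \<le> C1 ^ Suc i" using assms fps_conv_radius_pos_iff by blast
  obtain C2 where C2: "C2 > 0" "\<And>i. norm (T $ i) \<le> C2 ^ Suc i" using assms fps_conv_radius_pos_iff by blast
  define C where "C = max C1 C2"
  have le: "C1 ^ Suc i \<le> C ^ Suc i" "C2 ^ Suc i \<le> C ^ Suc i" for i
    using C1(1) C2(1) by (auto simp: C_def intro!: power_mono simp del: power_Suc)
  have "norm (Abs_fps (frob \<nu> (fps_nth D) (fps_nth T)) $ i) \<le> (2 * C + 1) ^ Suc i" for i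
  proof -
    have "norm (frob \<nu> (fps_nth D) (fps_nth T) i) \<le> (2 * C + 1) ^ i"
    proof (rule frob_bound)
      show "norm (D $ i) \<le> C ^ Suc i" "norm (T $ i) \<le> C ^ Suc i" for i
        using C1(2)[of i] C2(2)[of i] le[of i] by linarith+
    qed (use C1 in \<open>auto simp: C_def\<close>)
    also have "\<dots> \<le> (2 * C + 1) ^ Suc i" using C1 by (intro power_increasing) (auto simp: C_def)
    finally show ?thesis by simp
  qed
  moreover have "2 * C + 1 > 0" using C1 by (auto simp: C_def)
  ultimately show ?thesis unfolding fps_conv_radius_pos_iff by blast
qed

text \<open>The equation of \<open>frob\<close> for formal series; for \<open>\<nu> = - n\<close>
  and \<open>T = 0\<close> it is the condition on \<open>h\<close> for
  \<open>s ^ ((1 - n) / 2) * h\<close> to solve the differential equation.\<close>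

definition frob_eq :: "int \<Rightarrow> complex fps \<Rightarrow> complex fps \<Rightarrow> complex fps \<Rightarrow> bool" where
  "frob_eq \<nu> D T H \<longleftrightarrow>
     fps_X * fps_deriv (fps_deriv H) + fps_const (1 + of_int \<nu>) * fps_deriv H = D * H - T"

lemma frob_eq_iff:
  "frob_eq \<nu> D T H \<longleftrightarrow> (\<forall>k>0. of_nat k * (of_nat k + of_int \<nu>) * H $ k =
      (\<Sum>i<k. D $ (k - 1 - i) * H $ i) - T $ (k - 1))" (is "?l \<longleftrightarrow> ?r")
proof -
  have "?l \<longleftrightarrow> (\<forall>k. of_nat (Suc k) * (of_nat (Suc k) + of_int \<nu>) * H $ Suc k =
      (\<Sum>i<Suc k. D $ (k - i) * H $ i) - T $ k)"
    unfolding frob_eq_def fps_eq_iff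
  proof (intro all_cong1)
    fix k
    have 1: "(fps_X * fps_deriv (fps_deriv H) + fps_const (1 + of_int \<nu>) * fps_deriv H) $ k
        = of_nat (Suc k) * (of_nat (Suc k) + of_int \<nu>) * H $ Suc k"
      by (cases k) (auto simp: algebra_simps)
    have "(D * H) $ k = (\<Sum>i<Suc k. D $ (k - i) * H $ i)"
      unfolding fps_mult_nth atLeast0AtMost lessThan_Suc_atMost
      by (rule sum.reindex_bij_witness[of _ "\<lambda>i. k - i" "\<lambda>i. k - i"]) auto
    then show "((fps_X * fps_deriv (fps_deriv H) + fps_const (1 + of_int \<nu>) * fps_deriv H) $ k = (D * H - T) $ k)
       \<longleftrightarrow> of_nat (Suc k) * (of_nat (Suc k) + of_int \<nu>) * H $ Suc k =
      (\<Sum>i<Suc k. D $ (k - i) * H $ i) - T $ k"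
      unfolding 1 by simp
  qed
  also have "\<dots> \<longleftrightarrow> ?r"
  proof
    assume *: "\<forall>k. of_nat (Suc k) * (of_nat (Suc k) + of_int \<nu>) * H $ Suc k =
      (\<Sum>i<Suc k. D $ (k - i) * H $ i) - T $ k"
    show ?r
    proof (intro allI impI)
      fix k :: nat assume "k > 0"
      then show "of_nat k * (of_nat k + of_int \<nu>) * H $ k = (\<Sum>i<k. D $ (k - 1 - i) * H $ i) - T $ (k - 1)"
        using *[rule_format, of "k - 1"] by simp
    qed
  next
    assume *: ?r
    show "\<forall>k. of_nat (Suc k) * (of_nat (Suc k) + of_int \<nu>) * H $ Suc k =
      (\<Sum>i<Suc k. D $ (k - i) * H $ i) - T $ k"
      using *[rule_format, of "Suc _"] by simp
  qed
  finally show ?thesis .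
qed

text \<open>The right-hand side of the homogeneous recursion at the resonance \<open>k = n\<close>
  of \<open>\<nu> = - n\<close>. There the unknown coefficient is multiplied by 0, so this value
  must vanish for a series with the smaller exponent to exist.\<close>

definition obstr :: "nat \<Rightarrow> (nat \<Rightarrow> complex) \<Rightarrow> complex" where
  "obstr n d = (\<Sum>i<n. d (n - 1 - i) * frob (- int n) d (\<lambda>_. 0) i)"

lemma frob_cong_below:
  "(\<And>i. Suc i < n \<Longrightarrow> t i = t' i) \<Longrightarrow> k < n \<Longrightarrow> frob \<nu> d t k = frob \<nu> d t' k"
proof (induction k rule: less_induct)
  case (less k)
  then have "(\<Sum>i<k. d (k - 1 - i) * frob \<nu> d t i) = (\<Sum>i<k. d (k - 1 - i) * frob \<nu> d t' i)"
    by (intro sum.cong) auto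
  then show ?case using less.prems by (cases "k = 0") (auto simp: frob.simps[of _ _ _ k])
qed

text \<open>At a nonresonant \<open>k\<close> the recursion is the equation solved for its top
  coefficient; at a resonance the left-hand side is 0, and the hypothesis says that the right-hand
  side is 0 too.\<close>

lemma frob_eq_frob:
  assumes "\<And>k. k > 0 \<Longrightarrow> of_nat k + of_int \<nu> = (0::complex) \<Longrightarrow>
     (\<Sum>i<k. D $ (k - 1 - i) * frob \<nu> (fps_nth D) (fps_nth T) i) = T $ (k - 1)"
  shows "frob_eq \<nu> D T (Abs_fps (frob \<nu> (fps_nth D) (fps_nth T)))"
  unfolding frob_eq_iff
proof (intro allI impI)
  fix k :: nat assume "k > 0"
  then show "of_nat k * (of_nat k + of_int \<nu>) * Abs_fps (frob \<nu> (fps_nth D) (fps_nth T)) $ k =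
      (\<Sum>i<k. D $ (k - 1 - i) * Abs_fps (frob \<nu> (fps_nth D) (fps_nth T)) $ i) - T $ (k - 1)"
    using assms[of k] by (cases "of_nat k + of_int \<nu> = (0::complex)")
      (simp_all add: frob.simps[of _ _ _ k])
qed

section \<open>From formal series to solutions near a singular point\<close>

lemma deriv2_powr_times:
  fixes f f1 f2 :: "complex \<Rightarrow> complex"
  assumes S: "open S" "\<And>z. z \<in> S \<Longrightarrow> z - z0 \<notin> \<real>\<^sub>\<le>\<^sub>0"
    and f: "\<And>z. z \<in> S \<Longrightarrow> (f has_field_derivative f1 z) (at z)"
    and f1: "\<And>z. z \<in> S \<Longrightarrow> (f1 has_field_derivative f2 z) (at z)"
    and z: "z \<in> S"
  shows "deriv (deriv (\<lambda>z. (z - z0) powr e * f z)) z =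
     (z - z0) powr e * (e * (e - 1) / (z - z0)\<^sup>2 * f z + 2 * e / (z - z0) * f1 z + f2 z)"
proof -
  have p: "((\<lambda>z. (z - z0) powr a) has_field_derivative a * (z - z0) powr (a - 1)) (at z)"
    if "z \<in> S" for a z
    using S(2)[OF that] by (auto intro!: derivative_eq_intros simp del: complex_nonpos_Reals_iff)
  have nz: "z \<noteq> z0" if "z \<in> S" for z using S(2)[OF that] by auto
  have pm: "(z - z0) powr (a - 1) = (z - z0) powr a / (z - z0)" if "z \<in> S" for a z
    using nz[OF that] by (simp add: powr_diff)
  have d1: "deriv (\<lambda>z. (z - z0) powr e * f z) z = e * (z - z0) powr (e - 1) * f z + (z - z0) powr e * f1 z"
    if "z \<in> S" for z
    using DERIV_mult[OF p[OF that] f[OF that]] by (intro DERIV_imp_deriv) (simp add: mult_ac add_ac)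
  have "deriv (deriv (\<lambda>z. (z - z0) powr e * f z)) z
      = deriv (\<lambda>z. e * (z - z0) powr (e - 1) * f z + (z - z0) powr e * f1 z) z"
    using d1 eventually_nhds_in_open[OF S(1) z] by (intro deriv_cong_ev) (auto elim: eventually_mono)
  also have "\<dots> = e * ((e - 1) * (z - z0) powr (e - 1 - 1)) * f z + e * (z - z0) powr (e - 1) * f1 z
      + (e * (z - z0) powr (e - 1) * f1 z + (z - z0) powr e * f2 z)"
  proof (rule DERIV_imp_deriv)
    show "((\<lambda>z. e * (z - z0) powr (e - 1) * f z + (z - z0) powr e * f1 z) has_field_derivative
      e * ((e - 1) * (z - z0) powr (e - 1 - 1)) * f z + e * (z - z0) powr (e - 1) * f1 z
      + (e * (z - z0) powr (e - 1) * f1 z + (z - z0) powr e * f2 z)) (at z)"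
      using DERIV_add[OF DERIV_mult[OF DERIV_cmult[OF p[OF z, of "e - 1"], of e] f[OF z]] DERIV_mult[OF p[OF z, of e] f1[OF z]]]
      by (simp add: mult_ac add_ac)
  qed
  also have "\<dots> = (z - z0) powr e * (e * (e - 1) / (z - z0)\<^sup>2 * f z + 2 * e / (z - z0) * f1 z + f2 z)"
  proof -
    have *: "s \<noteq> 0 \<Longrightarrow> e * ((e - 1) * (p / s / s)) * a + e * (p / s) * b + (e * (p / s) * b + p * c) =
        p * (e * (e - 1) / s\<^sup>2 * a + 2 * e / s * b + c)" for s p a b c :: complex
      by (simp add: field_simps power2_eq_square)
    show ?thesis unfolding pm[OF z] using nz[OF z] by (intro *) simp
  qed
  finally show ?thesis .
qed

lemma open_slit_disc: "open (slit_disc z0 r)"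
proof -
  have "slit_disc z0 r = ball z0 r \<inter> (\<lambda>z. z - z0) -` (- \<real>\<^sub>\<le>\<^sub>0)" by (auto simp: slit_disc_def)
  moreover have "open ((\<lambda>z. z - z0) -` (- \<real>\<^sub>\<le>\<^sub>0))"
    by (intro continuous_open_vimage continuous_intros) (auto simp: closed_nonpos_Reals_complex)
  ultimately show ?thesis by auto
qed

text \<open>Starlike about the point at distance \<open>r / 2\<close> on the positive ray, opposite
  to the cut.\<close>

lemma connected_slit_disc: "connected (slit_disc z0 r)"
proof (cases "r > 0")
  case True
  define a where "a = z0 + of_real (r / 2)"
  have "starlike (slit_disc z0 r)"
    unfolding starlike_def
  proof (intro bexI[of _ a] ballI)
    show "a \<in> slit_disc z0 r"
      using True by (auto simp: a_def slit_disc_def dist_norm complex_nonpos_Reals_iff)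
    fix x assume x: "x \<in> slit_disc z0 r"
    show "closed_segment a x \<subseteq> slit_disc z0 r"
    proof
      fix y assume y: "y \<in> closed_segment a x"
      have "y \<in> ball z0 r"
        using y x \<open>a \<in> slit_disc z0 r\<close> closed_segment_subset[of a "ball z0 r" x]
        by (auto simp: slit_disc_def)
      moreover obtain t where t: "0 \<le> t" "t \<le> 1" "y = (1 - t) *\<^sub>R a + t *\<^sub>R x"
        using y by (auto simp: in_segment)
      have "y - z0 \<notin> \<real>\<^sub>\<le>\<^sub>0"
      proof
        assume "y - z0 \<in> \<real>\<^sub>\<le>\<^sub>0"
        moreover have "y - z0 = of_real ((1 - t) * (r / 2)) + of_real t * (x - z0)"
          unfolding t(3) a_def by (simp add: algebra_simps scaleR_conv_of_real)
        ultimately have 1: "(1 - t) * (r / 2) + t * Re (x - z0) \<le> 0" "t * Im (x - z0) = 0"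
          by (auto simp: complex_nonpos_Reals_iff)
        have x': "Re (x - z0) > 0 \<or> Im (x - z0) \<noteq> 0"
          using x by (auto simp: slit_disc_def complex_nonpos_Reals_iff)
        show False
        proof (cases "t = 0")
          case False
          then have "Re (x - z0) > 0" using 1 x' by auto
          then have "t * Re (x - z0) > 0" using False t by (intro mult_pos_pos) auto
          moreover have "(1 - t) * (r / 2) \<ge> 0" using t True by auto
          ultimately show False using 1 by linarith
        qed (use 1 True in auto)
      qed
      ultimately show "y \<in> slit_disc z0 r" by (auto simp: slit_disc_def)
    qed
  qed
  then show ?thesis by (rule starlike_imp_connected)
next
  case False
  then have "slit_disc z0 r = {}" by (auto simp: slit_disc_def) (smt (verit) zero_le_dist)
  then show ?thesis by simp
qed

text \<open>The double pole coefficient belongs to the exponents \<open>(1 + n) / 2\<close> and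
  \<open>(1 - n) / 2\<close>; \<open>D\<close> collects the simple pole, as \<open>D $ 0\<close>,
  and the regular part of \<open>Q\<close>.\<close>

definition expands :: "nat \<Rightarrow> (complex \<Rightarrow> complex) \<Rightarrow> complex \<Rightarrow> complex fps \<Rightarrow> bool" where
  "expands n Q z0 D \<longleftrightarrow> fps_conv_radius D > 0 \<and>
     (\<forall>\<^sub>F s in at 0. Q (z0 + s) = ((of_nat n)\<^sup>2 - 1) / 4 / s\<^sup>2 + eval_fps D s / s)"

lemma eventually_at_0_ball:
  "(\<forall>\<^sub>F s in at 0. P (s::complex)) \<longleftrightarrow> (\<exists>r>0. \<forall>s. s \<noteq> 0 \<longrightarrow> norm s < r \<longrightarrow> P s)"
  by (auto simp: eventually_at dist_norm)

lemma fps_common_radius: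
  assumes "fps_conv_radius (A :: complex fps) > 0" "fps_conv_radius (B :: complex fps) > 0"
    "fps_conv_radius (C :: complex fps) > 0" "(r0 :: real) > 0"
  obtains r where "r > 0" "r \<le> r0" "ereal r \<le> fps_conv_radius A" "ereal r \<le> fps_conv_radius B"
    "ereal r \<le> fps_conv_radius C"
proof -
  have "0 < min (ereal r0) (min (fps_conv_radius A) (min (fps_conv_radius B) (fps_conv_radius C)))"
    using assms by auto
  then obtain r where "ereal 0 < ereal r" "ereal r < min (ereal r0) (min (fps_conv_radius A) (min (fps_conv_radius B) (fps_conv_radius C)))"
    by (metis ereal_dense2 zero_ereal_def)
  then show ?thesis by (intro that[of r]) auto
qed

lemma eventually_analytic_at:
  assumes "f analytic_on {z :: complex}"
  shows "\<forall>\<^sub>F w in nhds z. f analytic_on {w}"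
proof -
  obtain S where S: "open S" "z \<in> S" "f holomorphic_on S" using assms by (auto simp: analytic_at)
  then have "\<forall>w\<in>S. f analytic_on {w}" by (auto simp: analytic_at)
  then show ?thesis using S unfolding eventually_nhds by blast
qed

text \<open>Inserting \<open>s ^ e * (h0 + h1 * log s)\<close> into the equation, the terms with
  \<open>log s\<close> give the homogeneous equation for \<open>h1\<close>, the others the equation
  for \<open>h0\<close> with inhomogeneity \<open>t = 2 h1' - n h1 / s\<close>.\<close>

lemma logarithmic_solution:
  assumes D: "expands n Q z0 D"
    and H0: "fps_conv_radius H0 > 0" "frob_eq (- int n) D T H0"
    and H1: "fps_conv_radius H1 > 0" "frob_eq (- int n) D 0 H1"
    and T: "fps_X * T = 2 * fps_X * fps_deriv H1 - of_nat n * H1"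
    and "r0 > 0"
  obtains r where "r > 0" "r \<le> r0" "eval_fps H0 holomorphic_on ball 0 r" "eval_fps H1 holomorphic_on ball 0 r"
    "Q holomorphic_on (ball z0 r - {z0})"
    "solution_on Q (slit_disc z0 r) (\<lambda>z. (z - z0) powr ((1 - of_nat n) / 2) *
        (eval_fps H0 (z - z0) + eval_fps H1 (z - z0) * Ln (z - z0)))"
proof -
  have D1: "fps_conv_radius D > 0" using D by (simp add: expands_def)
  from D obtain r1 where r1: "r1 > 0"
    "\<And>s. s \<noteq> 0 \<Longrightarrow> norm s < r1 \<Longrightarrow> Q (z0 + s) = ((of_nat n)\<^sup>2 - 1) / 4 / s\<^sup>2 + eval_fps D s / s"
    unfolding expands_def eventually_at_0_ball by blast
  have "min r0 r1 > 0" using r1 \<open>r0 > 0\<close> by simp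
  from fps_common_radius[OF D1 H0(1) H1(1) this] obtain r where r: "r > 0" "r \<le> min r0 r1"
    "ereal r \<le> fps_conv_radius D" "ereal r \<le> fps_conv_radius H0" "ereal r \<le> fps_conv_radius H1" .
  have conv: "ereal (norm s) < fps_conv_radius F" if "norm s < r" "ereal r \<le> fps_conv_radius F" for s :: complex and F :: "complex fps"
    using that by (meson less_ereal.simps(1) order_less_le_trans)
  have der: "(eval_fps F has_field_derivative eval_fps (fps_deriv F) s) (at s)"
    if "norm s < r" "ereal r \<le> fps_conv_radius F" for s :: complex and F :: "complex fps"
    by (rule has_field_derivative_eval_fps) (use conv that in auto)
  have rd: "ereal r \<le> fps_conv_radius (fps_deriv F)" if "ereal r \<le> fps_conv_radius F" for F :: "complex fps"
    using that fps_conv_radius_deriv[of F] by order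
  have Qs: "Q z = ((of_nat n)\<^sup>2 - 1) / 4 / (z - z0)\<^sup>2 + eval_fps D (z - z0) / (z - z0)"
    if "z \<in> ball z0 r - {z0}" for z
    using that r1(2)[of "z - z0"] r by (auto simp: dist_norm norm_minus_commute)
  have holD: "(\<lambda>z. eval_fps D (z - z0)) holomorphic_on ball z0 r"
  proof -
    have "eval_fps D \<circ> (\<lambda>z. z - z0) holomorphic_on ball z0 r"
    proof (rule holomorphic_on_compose_gen)
      show "eval_fps D holomorphic_on ball 0 r"
        using r conv by (intro holomorphic_intros) (auto simp: dist_norm)
    qed (auto intro!: holomorphic_intros simp: dist_norm norm_minus_commute)
    then show ?thesis by (simp add: o_def)
  qed
  have holQ: "Q holomorphic_on (ball z0 r - {z0})"
  proof (subst holomorphic_cong[OF refl Qs])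
    show "(\<lambda>z. ((of_nat n)\<^sup>2 - 1) / 4 / (z - z0)\<^sup>2 + eval_fps D (z - z0) / (z - z0)) holomorphic_on ball z0 r - {z0}"
      using holD by (intro holomorphic_intros) (auto intro: holomorphic_on_subset)
  qed
  define e :: complex where "e = (1 - of_nat n) / 2"
  define f where "f z = eval_fps H0 (z - z0) + eval_fps H1 (z - z0) * Ln (z - z0)" for z
  define f1 where "f1 z = eval_fps (fps_deriv H0) (z - z0) + (eval_fps (fps_deriv H1) (z - z0) * Ln (z - z0)
     + eval_fps H1 (z - z0) / (z - z0))" for z
  define f2 where "f2 z = eval_fps (fps_deriv (fps_deriv H0)) (z - z0)
     + (eval_fps (fps_deriv (fps_deriv H1)) (z - z0) * Ln (z - z0)
     + 2 * eval_fps (fps_deriv H1) (z - z0) / (z - z0) - eval_fps H1 (z - z0) / (z - z0)\<^sup>2)" for z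
  let ?S = "slit_disc z0 r"
  have S: "norm (z - z0) < r" "z - z0 \<notin> \<real>\<^sub>\<le>\<^sub>0" "z \<noteq> z0" if "z \<in> ?S" for z
    using that by (auto simp: slit_disc_def dist_norm norm_minus_commute)
  have der': "((\<lambda>z. eval_fps F (z - z0)) has_field_derivative eval_fps (fps_deriv F) (z - z0)) (at z)"
    if "z \<in> ?S" "ereal r \<le> fps_conv_radius F" for z and F :: "complex fps"
  proof -
    have "((\<lambda>z. z - z0) has_field_derivative 1) (at z)" by (auto intro!: derivative_eq_intros)
    from DERIV_chain2[OF der[OF S(1)[OF that(1)] that(2)] this] show ?thesis by simp
  qed
  have derL: "((\<lambda>z. Ln (z - z0)) has_field_derivative 1 / (z - z0)) (at z)" if "z \<in> ?S" for z
    using S(2)[OF that] by (auto intro!: derivative_eq_intros simp: divide_inverse)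
  have F1: "(f has_field_derivative f1 z) (at z)" if z: "z \<in> ?S" for z
    unfolding f_def[abs_def] f1_def
    using DERIV_add[OF der'[OF z r(4)] DERIV_mult[OF der'[OF z r(5)] derL[OF z]]] by simp
  have F2: "(f1 has_field_derivative f2 z) (at z)" if z: "z \<in> ?S" for z
  proof -
    have "((\<lambda>z. z - z0) has_field_derivative 1) (at z)" by (auto intro!: derivative_eq_intros)
    from DERIV_add[OF der'[OF z rd[OF r(4)]] DERIV_add[OF DERIV_mult[OF der'[OF z rd[OF r(5)]] derL[OF z]]
      DERIV_divide[OF der'[OF z r(5)] this]]] S(3)[OF z]
    have *: "((\<lambda>z. eval_fps (fps_deriv H0) (z - z0) + (eval_fps (fps_deriv H1) (z - z0) * Ln (z - z0)
         + eval_fps H1 (z - z0) / (z - z0))) has_field_derivative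
         eval_fps (fps_deriv (fps_deriv H0)) (z - z0) +
         (eval_fps (fps_deriv (fps_deriv H1)) (z - z0) * Ln (z - z0) +
          1 / (z - z0) * eval_fps (fps_deriv H1) (z - z0) +
          (eval_fps (fps_deriv H1) (z - z0) * (z - z0) - eval_fps H1 (z - z0) * 1) /
          ((z - z0) * (z - z0)))) (at z)" by simp
    show ?thesis unfolding f1_def[abs_def] f2_def
      by (rule DERIV_cong[OF *]) (use S(3)[OF z] in \<open>simp add: diff_divide_distrib power2_eq_square\<close>)
  qed
  have main: "deriv (deriv (\<lambda>z. (z - z0) powr e * f z)) z = Q z * ((z - z0) powr e * f z)" if z: "z \<in> ?S" for z
  proof -
    define s where "s = z - z0"
    have s: "norm s < r" "s \<noteq> 0" using S[OF z] by (auto simp: s_def)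
    define x0 x1 x2 y0 y1 y2 d t where xy: "x0 = eval_fps H0 s" "x1 = eval_fps (fps_deriv H0) s"
      "x2 = eval_fps (fps_deriv (fps_deriv H0)) s" "y0 = eval_fps H1 s" "y1 = eval_fps (fps_deriv H1) s"
      "y2 = eval_fps (fps_deriv (fps_deriv H1)) s" "d = eval_fps D s" "t = 2 * y1 - of_nat n * y0 / s"
    have exp1: "(\<lambda>s. s * eval_fps (fps_deriv (fps_deriv H)) s + (1 - of_nat n) * eval_fps (fps_deriv H) s)
       has_fps_expansion (fps_X * fps_deriv (fps_deriv H) + fps_const (1 - of_nat n) * fps_deriv H)"
      if "fps_conv_radius H > 0" for H :: "complex fps"
      using that fps_conv_radius_deriv[of H] fps_conv_radius_deriv[of "fps_deriv H"]
      by (intro fps_expansion_intros eval_fps_has_fps_expansion) order+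
    have rH1'': "ereal r \<le> fps_conv_radius (fps_deriv (fps_deriv H1))"
      "ereal r \<le> fps_conv_radius (fps_deriv (fps_deriv H0))"
      "ereal r \<le> fps_conv_radius (fps_deriv H1)" "ereal r \<le> fps_conv_radius (fps_deriv H0)"
      using rd r by auto
    have cm: "eval_fps (A * B) s = eval_fps A s * eval_fps B s" if "ereal r \<le> fps_conv_radius A" "ereal r \<le> fps_conv_radius B" for A B
      using conv[OF s(1)] that by (intro eval_fps_mult) auto
    have rm: "ereal r \<le> fps_conv_radius (A * B)" if "ereal r \<le> fps_conv_radius A" "ereal r \<le> fps_conv_radius B" for A B :: "complex fps"
      using that fps_conv_radius_mult[of A B] by (meson min.boundedI order_trans)
    have ca: "eval_fps (A + B) s = eval_fps A s + eval_fps B s" if "ereal r \<le> fps_conv_radius A" "ereal r \<le> fps_conv_radius B" for A B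
      using conv[OF s(1)] that by (intro eval_fps_add) auto
    have X: "ereal r \<le> fps_conv_radius (fps_X :: complex fps)" "ereal r \<le> fps_conv_radius (fps_const c :: complex fps)" for c
      by auto
    have lhs: "eval_fps (fps_X * fps_deriv (fps_deriv H) + fps_const (1 + of_int (- int n)) * fps_deriv H) s
      = s * eval_fps (fps_deriv (fps_deriv H)) s + (1 - of_nat n) * eval_fps (fps_deriv H) s"
      if "ereal r \<le> fps_conv_radius H" for H
      using that rd rm X by (simp add: ca cm)
    have e1: "s * y2 + (1 - of_nat n) * y1 = d * y0"
      using lhs[OF r(5)] H1(2) cm[OF r(3,5)] unfolding frob_eq_def xy by simp
    \<comment> \<open>This equation is multiplied by \<open>s\<close> because \<open>T\<close> is
      given only through \<open>fps_X * T\<close>.\<close>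
    have e0: "s * (s * x2 + (1 - of_nat n) * x1) = s * (d * x0) - (2 * s * y1 - of_nat n * y0)"
    proof -
      have "fps_X * (fps_X * fps_deriv (fps_deriv H0) + fps_const (1 + of_int (- int n)) * fps_deriv H0)
          + (fps_const 2 * fps_X * fps_deriv H1 + fps_const (- of_nat n) * H1) = fps_X * (D * H0)"
      proof -
        have N: "fps_const (- of_nat n :: complex) = - of_nat n" "fps_const (2 :: complex) = 2"
          by (simp_all add: fps_of_nat numeral_fps_const flip: fps_const_neg)
        have "fps_X * (fps_X * fps_deriv (fps_deriv H0) + fps_const (1 + of_int (- int n)) * fps_deriv H0)
          = fps_X * (D * H0) - fps_X * T"
          using H0(2) unfolding frob_eq_def by (simp only: right_diff_distrib)
        then show ?thesis unfolding N T by simp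
      qed
      then have eq: "eval_fps (fps_X * (fps_X * fps_deriv (fps_deriv H0) + fps_const (1 + of_int (- int n)) * fps_deriv H0)
          + (fps_const 2 * fps_X * fps_deriv H1 + fps_const (- of_nat n) * H1)) s = eval_fps (fps_X * (D * H0)) s" by simp
      have rA: "ereal r \<le> fps_conv_radius (fps_X * fps_deriv (fps_deriv H0) + fps_const (1 + of_int (- int n)) * fps_deriv H0)"
        using rm[OF X(1) rH1''(2)] rm[OF X(2) rH1''(4)] by (meson fps_conv_radius_add min.boundedI order_trans)
      have rB1: "ereal r \<le> fps_conv_radius (fps_const 2 * fps_X * fps_deriv H1)"
        by (rule rm[OF rm[OF X(2) X(1)] rH1''(3)])
      have rB2: "ereal r \<le> fps_conv_radius (fps_const (- of_nat n) * H1)" by (rule rm[OF X(2) r(5)])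
      have rB: "ereal r \<le> fps_conv_radius (fps_const 2 * fps_X * fps_deriv H1 + fps_const (- of_nat n) * H1)"
        using rB1 rB2 by (meson fps_conv_radius_add min.boundedI order_trans)
      have "eval_fps (fps_const 2 * fps_X * fps_deriv H1) s = 2 * s * y1"
        unfolding cm[OF rm[OF X(2) X(1)] rH1''(3)] cm[OF X(2) X(1)] xy by simp
      moreover have "eval_fps (fps_const (- of_nat n) * H1) s = - of_nat n * y0"
        unfolding cm[OF X(2) r(5)] xy by simp
      ultimately show ?thesis
        using eq unfolding ca[OF rm[OF X(1) rA] rB] ca[OF rB1 rB2] cm[OF X(1) rA] lhs[OF r(4)]
          cm[OF X(1) rm[OF r(3,4)]] cm[OF r(3,4)] by (simp add: xy algebra_simps)
    qed
    define L where "L = Ln s"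
    have fz: "f z = x0 + y0 * L" "f1 z = x1 + (y1 * L + y0 / s)" "f2 z = x2 + (y2 * L + 2 * y1 / s - y0 / s\<^sup>2)"
      by (simp_all add: f_def f1_def f2_def xy L_def s_def)
    have Qz: "Q z = ((of_nat n)\<^sup>2 - 1) / 4 / s\<^sup>2 + d / s"
      using Qs[of z] s by (simp add: s_def xy dist_norm norm_minus_commute)
    have x2: "x2 = (s * (d * x0) - (2 * s * y1 - of_nat n * y0) - s * (1 - of_nat n) * x1) / s\<^sup>2"
      using e0 s by (simp add: field_simps power2_eq_square)
    have y2: "y2 = (d * y0 - (1 - of_nat n) * y1) / s"
      using e1 s by (simp add: field_simps)
    have "e * (e - 1) / s\<^sup>2 * f z + 2 * e / s * f1 z + f2 z = Q z * f z"
      unfolding fz Qz x2 y2 e_def using s by (simp add: field_simps power2_eq_square)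
    moreover have "deriv (deriv (\<lambda>z. (z - z0) powr e * f z)) z =
        s powr e * (e * (e - 1) / s\<^sup>2 * f z + 2 * e / s * f1 z + f2 z)"
      unfolding s_def using S F1 F2 z open_slit_disc by (intro deriv2_powr_times[of ?S]) auto
    ultimately show ?thesis by (simp add: s_def)
  qed
  have "(\<lambda>z. (z - z0) powr e * f z) holomorphic_on ?S"
  proof (intro holomorphic_on_mult)
    show "f holomorphic_on ?S" using F1 open_slit_disc by (auto simp: holomorphic_on_open)
    show "(\<lambda>z. (z - z0) powr e) holomorphic_on ?S" using S by (auto intro!: holomorphic_intros)
  qed
  then have "solution_on Q ?S (\<lambda>z. (z - z0) powr e * f z)" using main by (simp add: solution_on_def)
  then show ?thesis
    using r conv holQ by (intro that[of r] holomorphic_intros) (auto simp: e_def f_def dist_norm)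
qed


lemma fps_deriv_X_power_Suc: "fps_deriv (fps_X ^ Suc m) = (of_nat (Suc m) * fps_X ^ m :: complex fps)"
  by (rule fps_ext) (auto simp: fps_X_power_iff fps_mult_of_nat_nth simp del: power_Suc of_nat_Suc)

text \<open>A nonzero obstruction makes a logarithmic solution possible: the series
  \<open>h1\<close> belongs to the larger exponent, and the inhomogeneity that it creates balances
  the obstruction at the resonance of \<open>h0\<close>.\<close>

lemma apparent_at_imp_obstr_zero:
  assumes D: "expands n Q z0 D" and n: "n \<ge> 1" and app: "apparent_at Q z0"
  shows "obstr n (fps_nth D) = 0"
proof (rule ccontr)
  assume nz: "obstr n (fps_nth D) \<noteq> 0"
  \<comment> \<open>Scaled so that the coefficient \<open>n * b\<close> which \<open>T\<close> has
    at the resonance equals the obstruction.\<close>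
  define b where "b = obstr n (fps_nth D) / of_nat n"
  have b: "b \<noteq> 0" "of_nat n * b = obstr n (fps_nth D)" using nz n by (auto simp: b_def)
  have rD: "fps_conv_radius D > 0" using D by (simp add: expands_def)
  \<comment> \<open>The solution for the larger exponent \<open>(1 + n) / 2\<close>; for
    \<open>\<nu> = n\<close> there is no resonance.\<close>
  define G where "G = Abs_fps (frob (int n) (fps_nth D) (fps_nth 0))"
  have G: "frob_eq (int n) D 0 G"
    unfolding G_def
  proof (rule frob_eq_frob)
    fix k :: nat assume "k > 0" "of_nat k + of_int (int n) = (0::complex)"
    then show "(\<Sum>i<k. D $ (k - 1 - i) * frob (int n) (fps_nth D) (fps_nth 0) i) = 0 $ (k - 1)"
      using of_nat_eq_0_iff[of "k + n", where 'a = complex] by simp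
  qed
  have rG: "fps_conv_radius G > 0" unfolding G_def by (intro frob_conv_radius rD) auto
  define H1 where "H1 = fps_const b * fps_X ^ n * G"
  have rH1: "fps_conv_radius H1 > 0"
    unfolding H1_def using rG fps_conv_radius_mult[of "fps_const b * fps_X ^ n" G]
      fps_conv_radius_mult[of "fps_const b" "fps_X ^ n"] by (auto simp: min_def split: if_splits)
  obtain m where m: "n = Suc m" using n by (cases n) auto
  define T where "T = fps_const b * (of_nat n * fps_X ^ m * G + 2 * fps_X ^ n * fps_deriv G)"
  have rT: "fps_conv_radius T > 0"
  proof -
    have "T = fps_const (of_nat n * b) * fps_X ^ m * G + fps_const (2 * b) * fps_X ^ n * fps_deriv G"
      by (simp add: T_def algebra_simps numeral_fps_const fps_of_nat flip: fps_const_mult)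
    moreover have "fps_conv_radius (fps_const (of_nat n * b) * fps_X ^ m * G) > 0"
      using rG fps_conv_radius_mult[of "fps_const (of_nat n * b) * fps_X ^ m" G]
      fps_conv_radius_mult[of "fps_const (of_nat n * b)" "fps_X ^ m"] by (auto simp: min_def split: if_splits)
    moreover have "fps_conv_radius (fps_const (2 * b) * fps_X ^ n * fps_deriv G) > 0"
      using rG fps_conv_radius_deriv[of G] fps_conv_radius_mult[of "fps_const (2 * b) * fps_X ^ n" "fps_deriv G"]
      fps_conv_radius_mult[of "fps_const (2 * b)" "fps_X ^ n"] by (auto simp: min_def split: if_splits)
    ultimately show ?thesis
      using order_less_le_trans[OF _ fps_conv_radius_add[of "fps_const (of_nat n * b) * fps_X ^ m * G" "fps_const (2 * b) * fps_X ^ n * fps_deriv G"], of 0]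
      by simp
  qed
  have dX: "fps_deriv (fps_X ^ n) = (of_nat n * fps_X ^ m :: complex fps)"
    unfolding m by (rule fps_deriv_X_power_Suc)
  have dH1: "fps_deriv H1 = fps_const b * (of_nat n * fps_X ^ m * G + fps_X ^ n * fps_deriv G)"
    unfolding H1_def by (simp add: dX algebra_simps)
  have XT: "fps_X * T = 2 * fps_X * fps_deriv H1 - of_nat n * H1"
    unfolding dH1 by (simp add: T_def H1_def m algebra_simps)
  have frobH1: "frob_eq (- int n) D 0 H1"
  proof -
    have X2: "fps_X * (of_nat n * fps_deriv (fps_X ^ m)) = (of_nat n * of_nat m * fps_X ^ m :: complex fps)"
    proof -
      have "fps_X * fps_deriv (fps_X ^ m) = (of_nat m * fps_X ^ m :: complex fps)"
      proof (induction m)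
        case (Suc m)
        have "fps_X * fps_deriv (fps_X ^ Suc m) = fps_X * fps_X ^ m + fps_X * (fps_X * fps_deriv (fps_X ^ m :: complex fps))"
          unfolding power_Suc fps_deriv_mult fps_deriv_fps_X by (simp only: algebra_simps mult_1_left)
        also have "\<dots> = of_nat (Suc m) * fps_X ^ Suc m" unfolding Suc.IH by (simp add: algebra_simps)
        finally show ?case .
      qed simp
      then show ?thesis by (simp only: mult.assoc mult.left_commute[of fps_X])
    qed
    have "fps_X * fps_deriv (fps_deriv H1) = fps_const b * (fps_X * (of_nat n * fps_deriv (fps_X ^ m)) * G
        + 2 * fps_X * of_nat n * fps_X ^ m * fps_deriv G + fps_X ^ n * (fps_X * fps_deriv (fps_deriv G)))"
      unfolding dH1 by (simp add: dX algebra_simps)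
    also have "\<dots> = fps_const b * (of_nat n * of_nat m * fps_X ^ m * G
        + 2 * of_nat n * fps_X ^ n * fps_deriv G + fps_X ^ n * (D * G - fps_const (1 + of_int (int n)) * fps_deriv G))"
    proof -
      have GE: "fps_X * fps_deriv (fps_deriv G) = D * G - fps_const (1 + of_int (int n)) * fps_deriv G"
        using G unfolding frob_eq_def by (simp add: eq_diff_eq)
      show ?thesis unfolding X2 GE by (simp add: m mult.assoc)
    qed
    finally have 1: "fps_X * fps_deriv (fps_deriv H1) = fps_const b * (of_nat n * of_nat m * fps_X ^ m * G
        + 2 * of_nat n * fps_X ^ n * fps_deriv G + fps_X ^ n * (D * G - (1 + of_nat n) * fps_deriv G))"
      by (simp add: fps_of_nat flip: fps_const_add)
    have 2: "fps_const (1 + of_int (- int n)) = (1 - of_nat n :: complex fps)"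
      by (simp add: fps_of_nat flip: fps_const_sub)
    show ?thesis unfolding frob_eq_def 1 unfolding 2 dH1 unfolding H1_def m
      by (simp add: algebra_simps)
  qed
  have T': "T = fps_X ^ m * (fps_const b * (of_nat n * G + fps_X * (2 * fps_deriv G)))"
    by (simp add: T_def m algebra_simps)
  \<comment> \<open>The inhomogeneity starts at index \<open>n - 1\<close>, so below the resonance
    \<open>H0\<close> has the coefficients of the homogeneous recursion.\<close>
  have Tlow: "T $ k = 0" if "Suc k < n" for k
    using that by (simp add: T' m fps_X_power_mult_nth)
  have Tm: "T $ m = obstr n (fps_nth D)"
    using b(2) by (simp add: T' fps_X_power_mult_nth G_def mult.commute)
  define H0 where "H0 = Abs_fps (frob (- int n) (fps_nth D) (fps_nth T))"
  have H0: "frob_eq (- int n) D T H0"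
    unfolding H0_def
  proof (rule frob_eq_frob)
    fix k :: nat assume k: "k > 0" "of_nat k + of_int (- int n) = (0::complex)"
    then have "k = n" by simp
    have "(\<Sum>i<n. D $ (n - 1 - i) * frob (- int n) (fps_nth D) (fps_nth T) i) =
       (\<Sum>i<n. D $ (n - 1 - i) * frob (- int n) (fps_nth D) (\<lambda>_. 0) i)"
      using Tlow by (intro sum.cong arg_cong2[of _ _ _ _ "(*)"] refl frob_cong_below) auto
    then show "(\<Sum>i<k. D $ (k - 1 - i) * frob (- int n) (fps_nth D) (fps_nth T) i) = T $ (k - 1)"
      using Tm m unfolding \<open>k = n\<close> obstr_def by simp
  qed
  have rH0: "fps_conv_radius H0 > 0" unfolding H0_def by (intro frob_conv_radius rD rT)
  obtain r where r: "r > 0" "r \<le> 1" "eval_fps H0 holomorphic_on ball 0 r" "eval_fps H1 holomorphic_on ball 0 r"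
    "Q holomorphic_on (ball z0 r - {z0})"
    "solution_on Q (slit_disc z0 r) (\<lambda>z. (z - z0) powr ((1 - of_nat n) / 2) *
        (eval_fps H0 (z - z0) + eval_fps H1 (z - z0) * Ln (z - z0)))"
    by (rule logarithmic_solution[OF D rH0 H0 rH1 frobH1 XT zero_less_one])
  have "\<exists>z\<in>ball z0 r. eval_fps H1 (z - z0) \<noteq> 0"
  proof (rule ccontr)
    assume "\<not> ?thesis"
    then have "eval_fps H1 s = 0" if "s \<in> ball 0 r" for s
      using that by (auto simp: dist_norm norm_minus_commute dest!: bspec[of _ _ "z0 + s"])
    then have "\<forall>\<^sub>F s in nhds 0. eval_fps H1 s = 0"
      using r(1) unfolding eventually_nhds by (intro exI[of _ "ball 0 r"]) auto
    then have "(\<lambda>_. 0 :: complex) has_fps_expansion H1"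
      using rH1 unfolding has_fps_expansion_def by auto
    then have "H1 = 0" using has_fps_expansion_0 fps_expansion_unique_complex by blast
    then have "H1 $ n = 0" by simp
    moreover have "H1 $ n = b * G $ 0" by (simp add: H1_def mult.assoc fps_X_power_mult_nth)
    ultimately show False using b(1) by (simp add: G_def)
  qed
  moreover have "(\<lambda>z. eval_fps H (z - z0)) holomorphic_on ball z0 r"
    if "eval_fps H holomorphic_on ball 0 r" for H
  proof -
    have "eval_fps H \<circ> (\<lambda>z. z - z0) holomorphic_on ball z0 r"
    proof (rule holomorphic_on_compose_gen[OF _ that])
      show "(\<lambda>z. z - z0) holomorphic_on ball z0 r" by (intro holomorphic_intros)
    qed (auto simp: dist_norm norm_minus_commute)
    then show ?thesis by (simp add: o_def)
  qed
  ultimately have "logarithmic_singularity (\<lambda>z. (z - z0) powr ((1 - of_nat n) / 2) *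
        (eval_fps H0 (z - z0) + eval_fps H1 (z - z0) * Ln (z - z0))) z0"
    unfolding logarithmic_singularity_def using r
    by (intro exI[of _ r] conjI exI[of _ "(1 - of_nat n) / 2"] exI[of _ "\<lambda>z. eval_fps H0 (z - z0)"]
        exI[of _ "\<lambda>z. eval_fps H1 (z - z0)"]) auto
  then show False using app r unfolding apparent_at_def by blast
qed

text \<open>
  The logarithmic derivative \<open>(1 - n) / (2 (z - z0)) + u\<close> of a solution with the smaller exponent,
  characterised by its Riccati equation.
\<close>

definition riccati :: "nat \<Rightarrow> (complex \<Rightarrow> complex) \<Rightarrow> complex \<Rightarrow> bool" where
  "riccati n Q z0 \<longleftrightarrow> (\<exists>u. u analytic_on {z0} \<and> (\<forall>\<^sub>F z in at z0.
     deriv u z + (u z)\<^sup>2 - (of_nat n - 1) * u z / (z - z0) + ((of_nat n)\<^sup>2 - 1) / 4 / (z - z0)\<^sup>2 = Q z))"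

text \<open>The Frobenius series \<open>h\<close> exists because the resonance equation holds, and
  \<open>h 0 = 1\<close> makes \<open>u = h' / h\<close> holomorphic; the linear equation for
  \<open>h\<close> becomes the Riccati equation for \<open>u\<close>.\<close>

lemma obstr_zero_imp_riccati:
  assumes D: "expands n Q z0 D" and n: "n \<ge> 1" and ob: "obstr n (fps_nth D) = 0"
  shows "riccati n Q z0"
proof -
  have rD: "fps_conv_radius D > 0" using D by (simp add: expands_def)
  define H where "H = Abs_fps (frob (- int n) (fps_nth D) (fps_nth 0))"
  have H: "frob_eq (- int n) D 0 H"
    unfolding H_def
  proof (rule frob_eq_frob)
    fix k :: nat assume k: "k > 0" "of_nat k + of_int (- int n) = (0::complex)"
    then have "k = n" by simp
    have "fps_nth 0 = (\<lambda>_. 0 :: complex)" by auto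
    then show "(\<Sum>i<k. D $ (k - 1 - i) * frob (- int n) (fps_nth D) (fps_nth 0) i) = 0 $ (k - 1)"
      using ob unfolding \<open>k = n\<close> obstr_def by simp
  qed
  have rH: "fps_conv_radius H > 0" unfolding H_def by (intro frob_conv_radius rD) auto
  have rH': "fps_conv_radius (fps_deriv H) > 0" "fps_conv_radius (fps_deriv (fps_deriv H)) > 0"
    using rH fps_conv_radius_deriv[of H] fps_conv_radius_deriv[of "fps_deriv H"] by order+
  define h where "h = eval_fps H"
  have h: "h has_fps_expansion H" unfolding h_def by (rule eval_fps_has_fps_expansion[OF rH])
  have h': "deriv h has_fps_expansion fps_deriv H" by (intro has_fps_expansion_deriv h)
  have h'': "deriv (deriv h) has_fps_expansion fps_deriv (fps_deriv H)" by (intro has_fps_expansion_deriv h')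
  have h0: "h 0 = 1" by (simp add: h_def eval_fps_at_0 H_def)
  have an: "h analytic_on {0}" "deriv h analytic_on {0}" using h h' by (auto intro: has_fps_expansion_imp_analytic_0)
  define u where "u s = deriv h s / h s" for s
  have u: "u analytic_on {0}" unfolding u_def using an h0 by (intro analytic_intros) auto
  have eqn: "\<forall>\<^sub>F s in nhds 0. s * deriv (deriv h) s + (1 - of_nat n) * deriv h s = eval_fps D s * h s"
  proof -
    have "(\<lambda>s. s * deriv (deriv h) s + (1 - of_nat n) * deriv h s - eval_fps D s * h s) has_fps_expansion
      (fps_X * fps_deriv (fps_deriv H) + fps_const (1 - of_nat n) * fps_deriv H - D * H)"
      by (intro fps_expansion_intros h h' h'' eval_fps_has_fps_expansion rD)
    moreover have "fps_X * fps_deriv (fps_deriv H) + fps_const (1 - of_nat n) * fps_deriv H - D * H = 0"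
      using H unfolding frob_eq_def by simp
    ultimately have "\<forall>\<^sub>F s in nhds 0. s * deriv (deriv h) s + (1 - of_nat n) * deriv h s - eval_fps D s * h s = 0"
      by (simp add: has_fps_expansion_0_iff)
    then show ?thesis by eventually_elim simp
  qed
  have hnz: "\<forall>\<^sub>F s in nhds 0. h s \<noteq> 0"
  proof -
    have "(h \<longlongrightarrow> h 0) (nhds 0)"
      using analytic_at_imp_isCont[OF an(1)] by (simp add: isCont_def tendsto_at_iff_tendsto_nhds)
    then show ?thesis by (rule tendsto_imp_eventually_ne) (simp add: h0)
  qed
  have anh: "\<forall>\<^sub>F s in nhds 0. h analytic_on {s}" "\<forall>\<^sub>F s in nhds 0. deriv h analytic_on {s}"
    using an by (auto intro: eventually_analytic_at)
  have ric0: "\<forall>\<^sub>F s in nhds 0. s \<noteq> 0 \<longrightarrow> deriv u s + (u s)\<^sup>2 - (of_nat n - 1) * u s / s = eval_fps D s / s"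
    using eqn hnz anh
  proof eventually_elim
    case (elim s)
    have "(h has_field_derivative deriv h s) (at s)" "(deriv h has_field_derivative deriv (deriv h) s) (at s)"
      using elim analytic_on_imp_differentiable_at field_differentiable_derivI by blast+
    then have du: "deriv u s = (deriv (deriv h) s * h s - deriv h s * deriv h s) / (h s * h s)"
      unfolding u_def using elim by (intro DERIV_imp_deriv DERIV_divide) auto
    show ?case
    proof
      assume "s \<noteq> 0"
      then have "deriv (deriv h) s = (eval_fps D s * h s - (1 - of_nat n) * deriv h s) / s"
        using elim(1) by (simp add: field_simps)
      then show "deriv u s + (u s)\<^sup>2 - (of_nat n - 1) * u s / s = eval_fps D s / s"
        unfolding du unfolding u_def using elim \<open>s \<noteq> 0\<close> by (simp add: field_simps power2_eq_square)
    qed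
  qed
  have "\<forall>\<^sub>F s in at 0. deriv u s + (u s)\<^sup>2 - (of_nat n - 1) * u s / s + ((of_nat n)\<^sup>2 - 1) / 4 / s\<^sup>2 = Q (z0 + s)"
    using D[unfolded expands_def, THEN conjunct2] ric0[unfolded eventually_nhds_conv_at, THEN conjunct1]
      eventually_neq_at_within[of 0 0 UNIV]
    by eventually_elim auto
  then have ev: "\<forall>\<^sub>F z in at z0. deriv u (z - z0) + (u (z - z0))\<^sup>2 - (of_nat n - 1) * u (z - z0) / (z - z0)
      + ((of_nat n)\<^sup>2 - 1) / 4 / (z - z0)\<^sup>2 = Q z"
    unfolding at_to_0[of z0] eventually_filtermap by (simp add: add.commute)
  have an': "(\<lambda>z. u (z - z0)) analytic_on {z0}"
  proof -
    have "u \<circ> (\<lambda>z. z - z0) analytic_on {z0}"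
      by (intro analytic_on_compose_gen[where T = "{0}"] analytic_intros) (use u in auto)
    then show ?thesis by (simp add: o_def)
  qed
  have "deriv (\<lambda>z. u (z - z0)) z = deriv u (z - z0)" for z
    using deriv_shift_0[of "\<lambda>z. u (z - z0)" z] deriv_shift_0[of u "z - z0"] by (simp add: o_def algebra_simps)
  then show ?thesis unfolding riccati_def using ev an'
    by (intro exI[of _ "\<lambda>z. u (z - z0)"]) simp
qed

text \<open>A solution \<open>y\<close> of the equation for \<open>Q\<close> gives the solution
  \<open>(c z + d) * y (g z)\<close> of the equation for \<open>Q'\<close>; logarithmic derivatives
  turn this into a formula for \<open>u\<close> free of branches. It moves singular points along the
  group and into the Cayley coordinate.\<close>

lemma riccati_moebius:
  fixes a b c d :: complex
  defines "\<delta> \<equiv> a * d - b * c"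
  assumes ric: "riccati n Q ((a * z0 + b) / (c * z0 + d))" and nz: "c * z0 + d \<noteq> 0" "\<delta> \<noteq> 0"
    and Q': "\<forall>\<^sub>F z in at z0. Q' z = \<delta>\<^sup>2 / (c * z + d) ^ 4 * Q ((a * z + b) / (c * z + d))"
  shows "riccati n Q' z0"
proof -
  define g where "g z = (a * z + b) / (c * z + d)" for z
  define w0 where "w0 = g z0"
  obtain u where u: "u analytic_on {w0}" and ev: "\<forall>\<^sub>F w in at w0.
     deriv u w + (u w)\<^sup>2 - (of_nat n - 1) * u w / (w - w0) + ((of_nat n)\<^sup>2 - 1) / 4 / (w - w0)\<^sup>2 = Q w"
    using ric unfolding riccati_def w0_def g_def by blast
  have g_an: "g analytic_on {z0}" unfolding g_def using nz by (intro analytic_intros) auto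
  have cont: "((\<lambda>z. c * z + d) \<longlongrightarrow> c * z0 + d) (nhds z0)"
    by (intro tendsto_intros filterlim_ident)
  have ev_nz: "\<forall>\<^sub>F z in nhds z0. c * z + d \<noteq> 0"
    using tendsto_imp_eventually_ne[OF cont nz(1)] .
  have diff: "g z - w0 = \<delta> * (z - z0) / ((c * z + d) * (c * z0 + d))" if "c * z + d \<noteq> 0" for z
    using that nz by (simp add: g_def w0_def \<delta>_def field_simps)
  have "filterlim g (nhds w0) (at z0)"
    using analytic_at_imp_isCont[OF g_an] unfolding isCont_def w0_def .
  moreover have "\<forall>\<^sub>F z in at z0. g z \<noteq> w0"
    using ev_nz[unfolded eventually_nhds_conv_at, THEN conjunct1] eventually_neq_at_within[of z0 z0 UNIV]
  proof eventually_elim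
    case (elim z)
    then show ?case using diff[OF elim(1)] nz by auto
  qed
  ultimately have lim: "filterlim g (at w0) (at z0)" by (simp add: filterlim_at)
  have ev1: "\<forall>\<^sub>F z in at z0. deriv u (g z) + (u (g z))\<^sup>2 - (of_nat n - 1) * u (g z) / (g z - w0)
      + ((of_nat n)\<^sup>2 - 1) / 4 / (g z - w0)\<^sup>2 = Q (g z)"
    using ev lim by (rule eventually_compose_filterlim)
  have "filterlim g (nhds w0) (nhds z0)"
    using analytic_at_imp_isCont[OF g_an] unfolding w0_def by (simp add: isCont_def tendsto_at_iff_tendsto_nhds)
  then have ev2: "\<forall>\<^sub>F z in nhds z0. u analytic_on {g z}"
    using eventually_compose_filterlim[OF eventually_analytic_at[OF u]] by blast
  \<comment> \<open>The regular part of the new logarithmic derivative: \<open>c / (c z + d)\<close>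
    comes once from the factor \<open>c z + d\<close> and \<open>(n - 1) / 2\<close> times from
    \<open>g' / (g - w0) = 1 / (z - z0) - c / (c z + d)\<close>.\<close>
  define U where "U z = (of_nat n + 1) / 2 * (c / (c * z + d)) + \<delta> * u (g z) / (c * z + d)\<^sup>2" for z
  have U_an: "U analytic_on {z0}"
  proof -
    have "u \<circ> g analytic_on {z0}" by (intro analytic_on_compose_gen[where T = "{w0}"] g_an u) (auto simp: w0_def)
    then show ?thesis unfolding U_def using nz by (intro analytic_intros) (auto simp: o_def)
  qed
  have "\<forall>\<^sub>F z in at z0. deriv U z + (U z)\<^sup>2 - (of_nat n - 1) * U z / (z - z0)
      + ((of_nat n)\<^sup>2 - 1) / 4 / (z - z0)\<^sup>2 = Q' z"
    using ev1 Q' ev_nz[unfolded eventually_nhds_conv_at, THEN conjunct1] ev2[unfolded eventually_nhds_conv_at, THEN conjunct1]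
      eventually_neq_at_within[of z0 z0 UNIV]
  proof eventually_elim
    case (elim z)
    define q where "q = c * z + d"
    have q: "q \<noteq> 0" using elim by (simp add: q_def)
    have dq: "((\<lambda>z. c * z + d) has_field_derivative c) (at z)" by (auto intro!: derivative_eq_intros)
    have dg: "(g has_field_derivative \<delta> / q\<^sup>2) (at z)"
      unfolding g_def using elim(3)
      by (auto intro!: derivative_eq_intros simp: q_def \<delta>_def power2_eq_square field_simps)
    have du: "(u has_field_derivative deriv u (g z)) (at (g z))"
      using elim(4) analytic_on_imp_differentiable_at field_differentiable_derivI by blast
    have dug: "((\<lambda>z. u (g z)) has_field_derivative deriv u (g z) * (\<delta> / q\<^sup>2)) (at z)"
      using DERIV_chain2[OF du dg] .
    have dU: "deriv U z = - (of_nat n + 1) / 2 * (c / q)\<^sup>2 + (\<delta> / q\<^sup>2)\<^sup>2 * deriv u (g z)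
        - 2 * (c / q) * (\<delta> / q\<^sup>2) * u (g z)"
      unfolding U_def
    proof (rule DERIV_imp_deriv)
      have "((\<lambda>z. (of_nat n + 1) / 2 * (c / (c * z + d)) + \<delta> * u (g z) / (c * z + d)\<^sup>2) has_field_derivative
         (of_nat n + 1) / 2 * ((0 * (c * z + d) - c * c) / ((c * z + d) * (c * z + d)))
         + (\<delta> * (deriv u (g z) * (\<delta> / q\<^sup>2)) * (c * z + d)\<^sup>2 - \<delta> * u (g z) * (of_nat 2 * (c * z + d) ^ (2 - 1) * c))
           / ((c * z + d)\<^sup>2 * (c * z + d)\<^sup>2)) (at z)"
        using elim(3) by (intro DERIV_add DERIV_cmult DERIV_divide DERIV_const dq dug DERIV_power[OF dq, THEN DERIV_cong]) auto
      then show "((\<lambda>z. (of_nat n + 1) / 2 * (c / (c * z + d)) + \<delta> * u (g z) / (c * z + d)\<^sup>2) has_field_derivative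
         - (of_nat n + 1) / 2 * (c / q)\<^sup>2 + (\<delta> / q\<^sup>2)\<^sup>2 * deriv u (g z) - 2 * (c / q) * (\<delta> / q\<^sup>2) * u (g z)) (at z)"
      proof (rule DERIV_cong)
        show "(of_nat n + 1) / 2 * ((0 * (c * z + d) - c * c) / ((c * z + d) * (c * z + d)))
         + (\<delta> * (deriv u (g z) * (\<delta> / q\<^sup>2)) * (c * z + d)\<^sup>2 - \<delta> * u (g z) * (of_nat 2 * (c * z + d) ^ (2 - 1) * c))
           / ((c * z + d)\<^sup>2 * (c * z + d)\<^sup>2) = - (of_nat n + 1) / 2 * (c / q)\<^sup>2 + (\<delta> / q\<^sup>2)\<^sup>2 * deriv u (g z)
           - 2 * (c / q) * (\<delta> / q\<^sup>2) * u (g z)"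
          unfolding q_def[symmetric] using q by (simp add: field_simps power2_eq_square)
      qed
    qed
    define X p t where "X = 1 / (z - z0)" and "p = c / q" and "t = \<delta> / q\<^sup>2"
    have q0: "c * z0 + d = q - c * (z - z0)" by (simp add: q_def algebra_simps)
    have *: "\<delta> / q\<^sup>2 / (\<delta> * h / (q * (q - c * h))) = 1 / h - c / q" if "h \<noteq> 0" "q - c * h \<noteq> 0" for h
      using q nz that by (simp add: field_simps power2_eq_square)
    have X: "t / (g z - w0) = X - p"
      unfolding diff[OF elim(3)] X_def p_def t_def q_def[symmetric] unfolding q0
      using elim(5) nz(1) q0 by (intro *) auto
    have "\<delta>\<^sup>2 / q ^ 4 = t\<^sup>2" by (simp add: t_def power_divide flip: power_mult)
    then have "Q' z = t\<^sup>2 * (deriv u (g z) + (u (g z))\<^sup>2 - (of_nat n - 1) * u (g z) / (g z - w0)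
      + ((of_nat n)\<^sup>2 - 1) / 4 / (g z - w0)\<^sup>2)"
      using elim(1,2) by (simp add: q_def g_def)
    also have "\<dots> = t\<^sup>2 * deriv u (g z) + t\<^sup>2 * (u (g z))\<^sup>2 - (of_nat n - 1) * (t * u (g z)) * (t / (g z - w0))
      + ((of_nat n)\<^sup>2 - 1) / 4 * (t / (g z - w0))\<^sup>2"
    proof -
      have "t\<^sup>2 * (x + y\<^sup>2 - N * y / h + B / h\<^sup>2) = t\<^sup>2 * x + t\<^sup>2 * y\<^sup>2 - N * (t * y) * (t / h) + B * (t / h)\<^sup>2"
        for x y N h B by (simp add: divide_inverse algebra_simps power2_eq_square)
      then show ?thesis .
    qed
    finally have Q'z: "Q' z = t\<^sup>2 * deriv u (g z) + t\<^sup>2 * (u (g z))\<^sup>2 - (of_nat n - 1) * (t * u (g z)) * (X - p)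
      + ((of_nat n)\<^sup>2 - 1) / 4 * (X - p)\<^sup>2" unfolding X .
    have Uz: "U z = (of_nat n + 1) / 2 * p + t * u (g z)" by (simp add: U_def p_def t_def q_def)
    have inv: "A / (z - z0) = A * X" "A / (z - z0)\<^sup>2 = A * X\<^sup>2" for A by (simp_all add: X_def divide_inverse power_inverse)
    show ?case unfolding Q'z dU Uz inv p_def[symmetric] t_def[symmetric]
      by (simp add: field_simps power2_eq_square)
  qed
  then show ?thesis unfolding riccati_def using U_an by blast
qed


text \<open>Reduction of order: \<open>y1 = s ^ e * exp U\<close> is one solution, and the quotient
  of any other by \<open>y1\<close> has as derivative a multiple of
  \<open>y1 ^ (-2) = s ^ (n - 1) * exp (- 2 * U)\<close>, which has a holomorphic primitive because
  \<open>n \<ge> 1\<close>.\<close>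

lemma solution_eq_powr_times_holomorphic:
  assumes u: "u holomorphic_on ball z0 r" and n: "n \<ge> 1" and r: "r > 0"
    and ric: "\<And>z. z \<in> ball z0 r \<Longrightarrow> z \<noteq> z0 \<Longrightarrow> deriv u z + (u z)\<^sup>2 - (of_nat n - 1) * u z / (z - z0)
        + ((of_nat n)\<^sup>2 - 1) / 4 / (z - z0)\<^sup>2 = Q z"
    and y: "solution_on Q (slit_disc z0 r) y"
  obtains F where "F holomorphic_on ball z0 r"
    "\<And>z. z \<in> slit_disc z0 r \<Longrightarrow> y z = (z - z0) powr ((1 - of_nat n) / 2) * F z"
proof -
  let ?S = "slit_disc z0 r" and ?B = "ball z0 r"
  define e :: complex where "e = (1 - of_nat n) / 2"
  have S: "z \<in> ?B" "z - z0 \<notin> \<real>\<^sub>\<le>\<^sub>0" "z \<noteq> z0" if "z \<in> ?S" for z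
    using that by (auto simp: slit_disc_def)
  obtain U where "\<And>z. z \<in> ?B \<Longrightarrow> (U has_field_derivative u z) (at z within ?B)"
    using holomorphic_convex_primitive'[OF convex_ball open_ball u] by blast
  then have U: "\<And>z. z \<in> ?B \<Longrightarrow> (U has_field_derivative u z) (at z)"
    using at_within_open[OF _ open_ball] by metis
  have holU: "U holomorphic_on ?B" using U unfolding holomorphic_on_open[OF open_ball] by blast
  have "(\<lambda>z. (z - z0) ^ (n - 1) * exp (- 2 * U z)) holomorphic_on ?B" using holU by (intro holomorphic_intros)
  then obtain P where "\<And>z. z \<in> ?B \<Longrightarrow> (P has_field_derivative (z - z0) ^ (n - 1) * exp (- 2 * U z)) (at z within ?B)"
    using holomorphic_convex_primitive'[OF convex_ball open_ball] by blast
  then have P: "\<And>z. z \<in> ?B \<Longrightarrow> (P has_field_derivative (z - z0) ^ (n - 1) * exp (- 2 * U z)) (at z)"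
    using at_within_open[OF _ open_ball] by metis
  have holP: "P holomorphic_on ?B" using P unfolding holomorphic_on_open[OF open_ball] by blast
  define y1 where "y1 z = (z - z0) powr e * exp (U z)" for z
  define v where "v z = e / (z - z0) + u z" for z
  have y1nz: "y1 z \<noteq> 0" if "z \<in> ?S" for z using S[OF that] by (simp add: y1_def)
  have dy1: "(y1 has_field_derivative v z * y1 z) (at z)" if z: "z \<in> ?S" for z
  proof -
    have p: "((\<lambda>z. (z - z0) powr e) has_field_derivative e * (z - z0) powr (e - 1)) (at z)"
      using S(2)[OF z] by (auto intro!: derivative_eq_intros simp del: complex_nonpos_Reals_iff)
    have E: "((\<lambda>z. exp (U z)) has_field_derivative exp (U z) * u z) (at z)"
      using DERIV_chain2[OF DERIV_exp U[OF S(1)[OF z]]] .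
    have pm: "(z - z0) powr (e - 1) = (z - z0) powr e / (z - z0)"
      using S(3)[OF z] by (simp add: powr_diff)
    show ?thesis unfolding y1_def[abs_def]
    proof (rule DERIV_cong[OF DERIV_mult[OF p E]])
      show "e * (z - z0) powr (e - 1) * exp (U z) + exp (U z) * u z * (z - z0) powr e = v z * ((z - z0) powr e * exp (U z))"
        unfolding pm v_def by (simp add: algebra_simps)
    qed
  qed
  have y1sq: "(y1 z)\<^sup>2 * ((z - z0) ^ (n - 1) * exp (- 2 * U z)) = 1" if z: "z \<in> ?S" for z
  proof -
    have "((z - z0) powr e)\<^sup>2 = (z - z0) powr (2 * e)"
      by (simp add: power2_eq_square flip: powr_add)
    moreover have "(z - z0) powr (2 * e) * (z - z0) ^ (n - 1) = 1"
    proof -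
      have "(z - z0) ^ (n - 1) = (z - z0) powr of_nat (n - 1)" using S(3)[OF z] by (simp add: powr_nat')
      moreover have "2 * e + of_nat (n - 1) = 0" using n by (simp add: e_def of_nat_diff field_simps)
      ultimately have "(z - z0) powr (2 * e) * (z - z0) ^ (n - 1) = (z - z0) powr 0"
        by (simp only: powr_add[symmetric])
      then show ?thesis using S(3)[OF z] by simp
    qed
    moreover have "(exp (U z))\<^sup>2 * exp (- 2 * U z) = 1"
      by (simp add: power2_eq_square flip: exp_add)
    ultimately show ?thesis unfolding y1_def power_mult_distrib
      by (metis mult.assoc mult.left_commute mult.right_neutral)
  qed
  have hol: "y holomorphic_on ?S" "deriv y holomorphic_on ?S"
    using y open_slit_disc by (auto simp: solution_on_def intro: holomorphic_deriv)
  have dy: "(y has_field_derivative deriv y z) (at z)" "(deriv y has_field_derivative Q z * y z) (at z)" if z: "z \<in> ?S" for z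
    using holomorphic_derivI[OF hol(1) open_slit_disc z] holomorphic_derivI[OF hol(2) open_slit_disc z] y z
    by (auto simp: solution_on_def)
  have dv: "(v has_field_derivative - e / (z - z0)\<^sup>2 + deriv u z) (at z)" if z: "z \<in> ?S" for z
  proof -
    have "((\<lambda>z. z - z0) has_field_derivative 1) (at z)" by (auto intro!: derivative_eq_intros)
    from DERIV_add[OF DERIV_divide[OF DERIV_const[of e] this] holomorphic_derivI[OF u open_ball S(1)[OF z]]] S(3)[OF z]
    show ?thesis unfolding v_def[abs_def] by (simp add: power2_eq_square)
  qed
  have ric': "- e / (z - z0)\<^sup>2 + deriv u z + (v z)\<^sup>2 = Q z" if z: "z \<in> ?S" for z
  proof -
    have *: "s \<noteq> 0 \<Longrightarrow> - e / s\<^sup>2 + d + (e / s + a)\<^sup>2 = d + a\<^sup>2 - (of_nat n - 1) * a / s + ((of_nat n)\<^sup>2 - 1) / 4 / s\<^sup>2"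
      for s d a by (simp add: e_def field_simps power2_eq_square)
    show ?thesis using ric[OF S(1,3)[OF z]] *[of "z - z0" "deriv u z" "u z"] S(3)[OF z] by (simp add: v_def)
  qed
  \<comment> \<open>The Wronskian of \<open>y1\<close> and \<open>y\<close>, using
    \<open>y1' = v * y1\<close>; it is constant.\<close>
  define W where "W z = y1 z * (deriv y z - v z * y z)" for z
  have "(W has_field_derivative 0) (at z)" if z: "z \<in> ?S" for z
    unfolding W_def[abs_def]
  proof (rule DERIV_cong[OF DERIV_mult[OF dy1[OF z] DERIV_diff[OF dy(2)[OF z] DERIV_mult[OF dv[OF z] dy(1)[OF z]]]]])
    show "v z * y1 z * (deriv y z - v z * y z) +
        (Q z * y z - ((- e / (z - z0)\<^sup>2 + deriv u z) * y z + deriv y z * v z)) * y1 z = 0"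
      unfolding ric'[OF z, symmetric] by (simp add: algebra_simps power2_eq_square)
  qed
  then obtain c where c: "\<And>z. z \<in> ?S \<Longrightarrow> W z = c"
    using DERIV_zero_connected_constant[OF connected_slit_disc open_slit_disc, of "{}" z0 r W]
    by (metis Diff_empty continuous_at_imp_continuous_on DERIV_isCont finite.emptyI)
  define R where "R z = y z / y1 z - c * P z" for z
  have "(R has_field_derivative 0) (at z)" if z: "z \<in> ?S" for z
    unfolding R_def[abs_def]
  proof (rule DERIV_cong[OF DERIV_diff[OF DERIV_divide[OF dy(1)[OF z] dy1[OF z] y1nz[OF z]] DERIV_cmult[OF P[OF S(1)[OF z]]]]])
    have "(deriv y z * y1 z - y z * (v z * y1 z)) = c" using c[OF z] by (simp add: W_def algebra_simps)
    moreover have "c / (y1 z * y1 z) = c * ((z - z0) ^ (n - 1) * exp (- 2 * U z))"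
      using y1sq[OF z] y1nz[OF z] by (simp add: field_simps power2_eq_square)
    ultimately show "(deriv y z * y1 z - y z * (v z * y1 z)) / (y1 z * y1 z) - c * ((z - z0) ^ (n - 1) * exp (- 2 * U z)) = 0"
      by simp
  qed
  then obtain c' where c': "\<And>z. z \<in> ?S \<Longrightarrow> R z = c'"
    using DERIV_zero_connected_constant[OF connected_slit_disc open_slit_disc, of "{}" z0 r R]
    by (metis Diff_empty continuous_at_imp_continuous_on DERIV_isCont finite.emptyI)
  show ?thesis
  proof (rule that[of "\<lambda>z. exp (U z) * (c' + c * P z)"])
    show "(\<lambda>z. exp (U z) * (c' + c * P z)) holomorphic_on ?B" using holU holP by (intro holomorphic_intros)
    fix z assume z: "z \<in> ?S"
    have "y z = y1 z * (c' + c * P z)" using c'[OF z] y1nz[OF z] by (simp add: R_def field_simps)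
    then show "y z = (z - z0) powr ((1 - of_nat n) / 2) * (exp (U z) * (c' + c * P z))"
      by (simp add: y1_def e_def mult.assoc)
  qed
qed

text \<open>
  In the coordinate \<open>z = z0 + exp w\<close> both sides continue to the half-plane \<open>Re w < ln r\<close>, and the
  second difference under \<open>w \<mapsto> w + 2 \<pi> i\<close> isolates the logarithmic term.
\<close>

lemma no_logarithm:
  assumes r: "r > 0" and F: "F holomorphic_on ball z0 r" and h0: "h0 holomorphic_on ball z0 r"
    and h1: "h1 holomorphic_on ball z0 r"
    and eq: "\<And>z. z \<in> slit_disc z0 r \<Longrightarrow>
        (z - z0) powr a * F z = (z - z0) powr b * (h0 z + h1 z * Ln (z - z0))"
    and z: "z \<in> ball z0 r" "z \<noteq> z0"
  shows "h1 z = 0"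
proof -
  define H where "H = {w. Re w < ln r}"
  define \<Psi> where "\<Psi> w = h0 (z0 + exp w) + h1 (z0 + exp w) * w - F (z0 + exp w) * exp ((a - b) * w)" for w
  have H: "open H" "convex H" unfolding H_def by (auto intro: open_halfspace_Re_lt convex_halfspace_Re_lt)
  have ball: "z0 + exp w \<in> ball z0 r" if "w \<in> H" for w
  proof -
    have "exp (Re w) < exp (ln r)" using that by (simp only: H_def mem_Collect_eq exp_less_mono)
    then show ?thesis using r by (simp add: dist_norm)
  qed
  have "(\<lambda>w. f (z0 + exp w)) holomorphic_on H" if "f holomorphic_on ball z0 r" for f
  proof -
    have "f \<circ> (\<lambda>w. z0 + exp w) holomorphic_on H"
      using ball by (intro holomorphic_on_compose_gen[OF _ that] holomorphic_intros) auto
    then show ?thesis by (simp add: o_def)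
  qed
  then have hol: "\<Psi> holomorphic_on H" unfolding \<Psi>_def using F h0 h1 by (intro holomorphic_intros) auto
  \<comment> \<open>The strip that \<open>exp\<close> maps into the slit disc with \<open>Ln\<close>
    as inverse, so that \<open>eq\<close> is available there.\<close>
  define H' where "H' = H \<inter> {w. \<bar>Im w\<bar> < pi}"
  have H': "open H'"
  proof -
    have "{w. \<bar>Im w\<bar> < pi} = {w. Im w < pi} \<inter> {w. Im w > - pi}" by auto
    then show ?thesis unfolding H'_def using H by (auto intro!: open_Int open_halfspace_Im_lt open_halfspace_Im_gt)
  qed
  have zero: "\<Psi> w = 0" if w: "w \<in> H'" for w
  proof -
    have im: "- pi < Im w" "Im w < pi" using w by (auto simp: H'_def)
    have Ln: "Ln (exp w) = w" using im by (intro Ln_exp) auto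
    have "exp w \<notin> \<real>\<^sub>\<le>\<^sub>0"
    proof
      assume "exp w \<in> \<real>\<^sub>\<le>\<^sub>0"
      then have "Im (Ln (exp w)) = pi"
        by (metis complex_nonpos_Reals_iff exp_not_eq_zero Im_Ln_eq_pi complex_eq_iff less_eq_real_def zero_complex.sel)
      then show False using Ln im by simp
    qed
    then have "z0 + exp w \<in> slit_disc z0 r" using ball w by (auto simp: slit_disc_def H'_def)
    from eq[OF this] have "exp (a * w) * F (z0 + exp w) = exp (b * w) * (h0 (z0 + exp w) + h1 (z0 + exp w) * w)"
      by (simp add: powr_def Ln)
    moreover have "exp (a * w) = exp (b * w) * exp ((a - b) * w)" by (simp add: algebra_simps flip: exp_add)
    ultimately have "exp (b * w) * \<Psi> w = 0" unfolding \<Psi>_def by (simp add: algebra_simps)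
    then show ?thesis by simp
  qed
  define w1 where "w1 = complex_of_real (ln r - 1)"
  have w1: "w1 \<in> H'" by (auto simp: w1_def H'_def H_def)
  have zeroH: "\<Psi> w = 0" if w: "w \<in> H" for w
  proof (rule analytic_continuation[OF hol H(1) convex_connected[OF H(2)], of H' w1])
    show "H' \<subseteq> H" "w1 \<in> H" using w1 by (auto simp: H'_def)
    show "w1 islimpt H'" using w1 H' interior_limit_point[of w1 H'] by (simp add: interior_open)
  qed (use zero w in auto)
  define w where "w = Ln (z - z0)"
  have ew: "exp w = z - z0" using z by (simp add: w_def)
  have wH: "w \<in> H"
  proof -
    have "Re w = ln (cmod (z - z0))" unfolding w_def using z by (intro Re_Ln) auto
    moreover have "ln (cmod (z - z0)) < ln r" using z r by (simp add: dist_norm norm_minus_commute)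
    ultimately show ?thesis by (simp add: H_def)
  qed
  define p where "p = 2 * of_real pi * \<i>"
  define l where "l = exp ((a - b) * p)"
  define X where "X = F z * exp ((a - b) * w)"
  have per: "exp (w + p) = z - z0" "exp (w + 2 * p) = z - z0"
  proof -
    have "exp p = 1" unfolding p_def by (rule exp_two_pi_i)
    then show "exp (w + p) = z - z0" "exp (w + 2 * p) = z - z0"
      using ew by (simp_all add: exp_add exp_double)
  qed
  have "w + p \<in> H" "w + 2 * p \<in> H" using wH by (simp_all add: H_def p_def)
  then have "\<Psi> w = 0" "\<Psi> (w + p) = 0" "\<Psi> (w + 2 * p) = 0" using zeroH wH by auto
  then have 1: "h0 z + h1 z * w = X" "h0 z + h1 z * (w + p) = X * l" "h0 z + h1 z * (w + 2 * p) = X * l * l"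
    unfolding \<Psi>_def per ew by (simp_all add: X_def l_def algebra_simps flip: exp_add)
  \<comment> \<open>The logarithmic side is affine in \<open>w\<close>, so its second difference is
    0; hence already the first difference \<open>X * (l - 1)\<close>, which is
    \<open>h1 z * p\<close>, is 0.\<close>
  have "X * (l - 1) * (l - 1) = (h0 z + h1 z * (w + 2 * p)) - 2 * (h0 z + h1 z * (w + p)) + (h0 z + h1 z * w)"
    unfolding 1 by (simp add: algebra_simps)
  also have "\<dots> = 0" by (simp add: algebra_simps)
  finally have "X * (l - 1) = 0" by auto
  moreover have "h1 z * p = X * (l - 1)"
  proof -
    have "h1 z * p = (h0 z + h1 z * (w + p)) - (h0 z + h1 z * w)" by (simp add: algebra_simps)
    then show ?thesis unfolding 1 by (simp add: algebra_simps)
  qed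
  ultimately have "h1 z * p = 0" by simp
  then show ?thesis by (simp add: p_def)
qed

lemma riccati_imp_not_logarithmic:
  assumes ric: "riccati n Q z0" and n: "n \<ge> 1" and "r > 0" and y: "solution_on Q (slit_disc z0 r) y"
  shows "\<not> logarithmic_singularity y z0"
proof
  assume "logarithmic_singularity y z0"
  then obtain r2 b h0 h1 where r2: "r2 > 0" "h0 holomorphic_on ball z0 r2" "h1 holomorphic_on ball z0 r2"
    "\<exists>z\<in>ball z0 r2. h1 z \<noteq> 0" "\<forall>z\<in>slit_disc z0 r2. y z = (z - z0) powr b * (h0 z + h1 z * Ln (z - z0))"
    unfolding logarithmic_singularity_def by blast
  obtain u where u: "u analytic_on {z0}" and ev: "\<forall>\<^sub>F z in at z0.
     deriv u z + (u z)\<^sup>2 - (of_nat n - 1) * u z / (z - z0) + ((of_nat n)\<^sup>2 - 1) / 4 / (z - z0)\<^sup>2 = Q z"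
    using ric unfolding riccati_def by blast
  obtain r3 where r3: "r3 > 0" "u holomorphic_on ball z0 r3" using u by (auto simp: analytic_on_def)
  obtain r4 where r4: "r4 > 0" "\<And>z. z \<noteq> z0 \<Longrightarrow> dist z z0 < r4 \<Longrightarrow>
     deriv u z + (u z)\<^sup>2 - (of_nat n - 1) * u z / (z - z0) + ((of_nat n)\<^sup>2 - 1) / 4 / (z - z0)\<^sup>2 = Q z"
    using ev unfolding eventually_at by auto
  define R where "R = min (min r r2) (min r3 r4)"
  have R: "R > 0" "R \<le> r" "R \<le> r2" "R \<le> r3" "R \<le> r4" using r2 r3 r4 \<open>r > 0\<close> by (auto simp: R_def)
  have sub: "slit_disc z0 R \<subseteq> slit_disc z0 t" if "R \<le> t" for t using that by (auto simp: slit_disc_def)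
  have y': "solution_on Q (slit_disc z0 R) y"
    using y sub[OF R(2)] unfolding solution_on_def by (auto intro: holomorphic_on_subset)
  have u': "u holomorphic_on ball z0 R" using r3 R by (auto intro: holomorphic_on_subset)
  have ric': "deriv u z + (u z)\<^sup>2 - (of_nat n - 1) * u z / (z - z0) + ((of_nat n)\<^sup>2 - 1) / 4 / (z - z0)\<^sup>2 = Q z"
    if "z \<in> ball z0 R" "z \<noteq> z0" for z
    using that R by (intro r4(2)) (auto simp: dist_commute)
  obtain F where F: "F holomorphic_on ball z0 R"
    "\<And>z. z \<in> slit_disc z0 R \<Longrightarrow> y z = (z - z0) powr ((1 - of_nat n) / 2) * F z"
    using solution_eq_powr_times_holomorphic[OF u' n R(1) ric' y'] by blast
  have h: "h0 holomorphic_on ball z0 R" "h1 holomorphic_on ball z0 R"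
    using r2 R by (auto intro: holomorphic_on_subset)
  have eq: "(z - z0) powr ((1 - of_nat n) / 2) * F z = (z - z0) powr b * (h0 z + h1 z * Ln (z - z0))"
    if "z \<in> slit_disc z0 R" for z using F(2)[OF that] r2(5) sub[OF R(3)] that by auto
  have h1z: "h1 z = 0" if "z \<in> ball z0 R" "z \<noteq> z0" for z
    using no_logarithm[OF R(1) F(1) h eq that] by blast
  \<comment> \<open>The identity theorem extends the vanishing from the smaller punctured disc to
    the full domain of \<open>h1\<close>.\<close>
  have "h1 z = 0" if "z \<in> ball z0 r2" for z
  proof (rule analytic_continuation[OF r2(3) open_ball connected_ball, of "ball z0 R - {z0}" z0])
    show "z0 islimpt ball z0 R - {z0}" using R(1)
      unfolding islimpt_punctured[symmetric] by (intro interior_limit_point) (simp add: interior_open)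
  qed (use h1z that R r2 in auto)
  then show False using r2(4) by blast
qed

lemma riccati_imp_apparent_at:
  assumes "riccati n Q z0" "n \<ge> 1"
    and "local_exponents Q z0 (1/2 + of_nat n / 2) (1/2 - of_nat n / 2)"
  shows "apparent_at Q z0"
  using assms riccati_imp_not_logarithmic unfolding apparent_at_def by blast

section \<open>The modular group\<close>

definition mob :: "int \<Rightarrow> int \<Rightarrow> int \<Rightarrow> int \<Rightarrow> complex \<Rightarrow> complex" where
  "mob a b c d z = (of_int a * z + of_int b) / (of_int c * z + of_int d)"

lemma SL2Z_equiv_mob: "SL2Z_equiv z w \<longleftrightarrow> (\<exists>a b c d. a * d - b * c = 1 \<and> w = mob a b c d z)"
  by (simp add: SL2Z_equiv_def mob_def)

lemma uhp_iff: "z \<in> upper_half_plane \<longleftrightarrow> Im z > 0"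
  by (simp add: upper_half_plane_def)

lemma open_uhp: "open upper_half_plane"
  unfolding upper_half_plane_def by (rule open_halfspace_Im_gt)

lemma convex_uhp: "convex upper_half_plane"
  unfolding upper_half_plane_def by (rule convex_halfspace_Im_gt)

lemma mob_denom_nonzero:
  assumes "Im z > 0" "a * d - b * c = 1"
  shows "of_int c * z + of_int d \<noteq> 0"
proof
  assume *: "of_int c * z + of_int d = 0"
  then have "Im (of_int c * z + of_int d) = 0" by simp
  then have "c = 0" using assms by simp
  then have "d = 0" using * by simp
  then show False using assms \<open>c = 0\<close> by simp
qed

lemma Im_mob:
  assumes "a * d - b * c = 1"
  shows "Im (mob a b c d z) = Im z / (cmod (of_int c * z + of_int d))\<^sup>2"
proof -
  have "real_of_int a * real_of_int d - real_of_int b * real_of_int c = 1"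
    using assms by (metis of_int_1 of_int_diff of_int_mult)
  then have "Im z * (of_int a * of_int d - of_int b * of_int c) = Im z" by simp
  then have "of_int a * Im z * (of_int c * Re z + of_int d) - (of_int a * Re z + of_int b) * (of_int c * Im z) = Im z"
    by (simp add: algebra_simps)
  then show ?thesis
    unfolding mob_def Im_divide cmod_power2 by simp
qed

lemma mob_uhp: "Im z > 0 \<Longrightarrow> a * d - b * c = 1 \<Longrightarrow> Im (mob a b c d z) > 0"
  using mob_denom_nonzero[of z a d b c] by (simp add: Im_mob)

lemma mob_mob:
  assumes "Im z > 0" "a * d - b * c = 1" "a' * d' - b' * c' = 1"
  shows "mob a' b' c' d' (mob a b c d z) =
    mob (a' * a + b' * c) (a' * b + b' * d) (c' * a + d' * c) (c' * b + d' * d) z"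
    "(a' * a + b' * c) * (c' * b + d' * d) - (a' * b + b' * d) * (c' * a + d' * c) = 1"
proof -
  have nz: "of_int c * z + of_int d \<noteq> 0" using mob_denom_nonzero assms by blast
  show "mob a' b' c' d' (mob a b c d z) =
    mob (a' * a + b' * c) (a' * b + b' * d) (c' * a + d' * c) (c' * b + d' * d) z"
    unfolding mob_def using nz by (simp add: divide_simps) (simp add: algebra_simps)
  have "(a' * a + b' * c) * (c' * b + d' * d) - (a' * b + b' * d) * (c' * a + d' * c)
     = (a * d - b * c) * (a' * d' - b' * c')" by (simp add: algebra_simps)
  then show "(a' * a + b' * c) * (c' * b + d' * d) - (a' * b + b' * d) * (c' * a + d' * c) = 1"
    using assms by simp
qed

lemma mob_inverse:
  assumes "Im z > 0" "a * d - b * c = 1"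
  shows "mob d (- b) (- c) a (mob a b c d z) = z"
proof -
  have "mob d (- b) (- c) a (mob a b c d z) = mob (d * a + - b * c) (d * b + - b * d) (- c * a + a * c) (- c * b + a * d) z"
    using assms by (intro mob_mob(1)) (simp_all add: algebra_simps)
  also have "\<dots> = mob (a * d - b * c) 0 0 (a * d - b * c) z" by (simp add: algebra_simps)
  also have "\<dots> = z" using assms by (simp add: mob_def)
  finally show ?thesis .
qed

lemma SL2Z_equiv_refl: "SL2Z_equiv z z"
  unfolding SL2Z_equiv_mob by (intro exI[of _ 1] exI[of _ 0]) (simp add: mob_def)

lemma SL2Z_equiv_sym:
  assumes "Im z > 0" "SL2Z_equiv z w"
  shows "SL2Z_equiv w z"
proof -
  obtain a b c d where g: "a * d - b * c = 1" "w = mob a b c d z" using assms SL2Z_equiv_mob by blast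
  then have "z = mob d (- b) (- c) a w" using assms mob_inverse by simp
  moreover have "d * a - (- b) * (- c) = 1" using g by (simp add: algebra_simps)
  ultimately show ?thesis unfolding SL2Z_equiv_mob by blast
qed

lemma SL2Z_equiv_trans:
  assumes "Im z > 0" "SL2Z_equiv z w" "SL2Z_equiv w v"
  shows "SL2Z_equiv z v"
proof -
  obtain a b c d where g: "a * d - b * c = 1" "w = mob a b c d z" using assms SL2Z_equiv_mob by blast
  obtain a' b' c' d' where g': "a' * d' - b' * c' = 1" "v = mob a' b' c' d' w" using assms SL2Z_equiv_mob by blast
  show ?thesis unfolding SL2Z_equiv_mob using mob_mob[OF assms(1) g(1) g'(1)] g(2) g'(2) by blast
qed

lemma SL2Z_equiv_add_int: "SL2Z_equiv z (z + of_int n)"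
  unfolding SL2Z_equiv_mob
  by (intro exI[of _ 1] exI[of _ n] exI[of _ 0]) (simp add: mob_def)

lemma SL2Z_equiv_neg_inverse: "SL2Z_equiv z (- 1 / z)"
  unfolding SL2Z_equiv_mob
  by (intro exI[of _ 0] exI[of _ "-1"] exI[of _ 1]) (simp add: mob_def)

text \<open>The imaginary part \<open>c * Im z\<close> bounds \<open>c\<close>, and the triangle
  inequality then bounds \<open>d\<close>.\<close>

lemma bounded_denominators:
  assumes "y > 0"
  shows "\<exists>N::int. \<forall>z c d. Im z \<ge> y \<longrightarrow> cmod z \<le> R \<longrightarrow> cmod (of_int c * z + of_int d) \<le> K \<longrightarrow> \<bar>c\<bar> \<le> N \<and> \<bar>d\<bar> \<le> N"
proof (intro exI allI impI)
  fix z and c d :: int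
  assume z: "Im z \<ge> y" "cmod z \<le> R" and K: "cmod (of_int c * z + of_int d) \<le> K"
  have "0 \<le> K" using K norm_ge_zero order_trans by blast
  have "0 \<le> R" using z norm_ge_zero order_trans by blast
  have "\<bar>of_int c\<bar> * y \<le> \<bar>of_int c * Im z\<bar>"
    using z assms by (simp add: abs_mult mult_left_mono)
  also have "\<dots> = \<bar>Im (of_int c * z + of_int d)\<bar>" by simp
  also have "\<dots> \<le> K" using abs_Im_le_cmod K order_trans by blast
  finally have c: "\<bar>of_int c\<bar> \<le> K / y" using assms by (simp add: field_simps)
  have "\<bar>of_int d\<bar> = cmod ((of_int c * z + of_int d) - of_int c * z)" by simp
  also have "\<dots> \<le> cmod (of_int c * z + of_int d) + cmod (of_int c * z)" by (rule norm_triangle_ineq4)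
  also have "\<dots> \<le> K + \<bar>of_int c\<bar> * R" using K z by (simp add: norm_mult add_mono mult_left_mono)
  also have "\<dots> \<le> K + K / y * R" using mult_right_mono[OF c \<open>0 \<le> R\<close>] by simp
  finally have d: "\<bar>of_int d\<bar> \<le> K + K / y * R" .
  have "K / y \<ge> 0" "K / y * R \<ge> 0" using \<open>0 \<le> K\<close> \<open>0 \<le> R\<close> assms by auto
  then have "real_of_int \<bar>c\<bar> \<le> K / y + K + K / y * R" "real_of_int \<bar>d\<bar> \<le> K / y + K + K / y * R"
    using c d \<open>0 \<le> K\<close> by auto
  then show "\<bar>c\<bar> \<le> \<lceil>K / y + K + K / y * R\<rceil> \<and> \<bar>d\<bar> \<le> \<lceil>K / y + K + K / y * R\<rceil>"
    by (meson le_of_int_ceiling of_int_le_iff order_trans)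
qed

text \<open>A bottom row with minimal \<open>cmod (c * z + d)\<close> gives the largest imaginary
  part in the orbit; after an integral translation, \<open>- 1 / w\<close> would be higher still if
  \<open>cmod w < 1\<close>.\<close>

lemma fundamental_domain:
  assumes "Im z > 0"
  obtains w where "SL2Z_equiv z w" "\<bar>Re w\<bar> \<le> 1/2" "cmod w \<ge> 1" "Im w > 0"
proof -
  \<comment> \<open>Restricted to rows of modulus at most 1: a finite set containing
    \<open>(0, 1)\<close>, so its minimum is the minimum over all rows.\<close>
  define C where "C = {(c, d). (\<exists>a b. a * d - b * c = (1::int)) \<and> cmod (of_int c * z + of_int d) \<le> 1}"
  obtain N where N: "\<And>c d. cmod (of_int c * z + of_int d) \<le> 1 \<Longrightarrow> \<bar>c\<bar> \<le> N \<and> \<bar>d\<bar> \<le> N"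
    using bounded_denominators[OF assms, of "cmod z" 1] by blast
  have "C \<subseteq> {- N..N} \<times> {- N..N}" using N by (fastforce simp: C_def abs_le_iff)
  then have fin: "finite C" by (rule finite_subset) auto
  have ne: "(0, 1) \<in> C" by (auto simp: C_def)
  let ?f = "\<lambda>(c, d). cmod (of_int c * z + of_int d)"
  obtain p where p: "p \<in> C" "\<And>p'. p' \<in> C \<Longrightarrow> ?f p \<le> ?f p'"
    using arg_min_if_finite[OF fin, of ?f] ne by (metis empty_iff not_le)
  obtain c d where cd: "p = (c, d)" by (cases p)
  obtain a b where ab: "a * d - b * c = 1" using p(1) by (auto simp: C_def cd)
  have min: "cmod (of_int c * z + of_int d) \<le> cmod (of_int c' * z + of_int d')" if "a' * d' - b' * c' = 1" for a' b' c' d'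
  proof (cases "cmod (of_int c' * z + of_int d') \<le> 1")
    case True
    then show ?thesis using p(2)[of "(c', d')"] that by (auto simp: C_def cd)
  next
    case False
    then show ?thesis using p(1) by (auto simp: C_def cd)
  qed
  define w0 where "w0 = mob a b c d z"
  define n where "n = - round (Re w0)"
  define w where "w = w0 + of_int n"
  have w0: "Im w0 > 0" using mob_uhp[OF assms ab] by (simp add: w0_def)
  have zw: "SL2Z_equiv z w"
  proof -
    have "SL2Z_equiv z w0" unfolding SL2Z_equiv_mob w0_def using ab by blast
    then show ?thesis unfolding w_def using SL2Z_equiv_trans[OF assms _ SL2Z_equiv_add_int] by blast
  qed
  have "\<bar>Re w\<bar> \<le> 1/2" using of_int_round_abs_le[of "Re w0"] by (simp add: w_def n_def abs_minus_commute)
  moreover have "Im w > 0" using w0 by (simp add: w_def)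
  moreover have "cmod w \<ge> 1"
  proof (rule ccontr)
    assume "\<not> cmod w \<ge> 1"
    have Imw: "Im w = Im z / (cmod (of_int c * z + of_int d))\<^sup>2" by (simp add: w_def w0_def Im_mob[OF ab])
    have "SL2Z_equiv z (- 1 / w)" using SL2Z_equiv_trans[OF assms zw SL2Z_equiv_neg_inverse] .
    then obtain a' b' c' d' where g: "a' * d' - b' * c' = 1" "- 1 / w = mob a' b' c' d' z"
      unfolding SL2Z_equiv_mob by blast
    have "Im (- 1 / w) = Im w / (cmod w)\<^sup>2" by (simp add: Im_divide cmod_power2)
    also have "\<dots> > Im w"
      using \<open>\<not> cmod w \<ge> 1\<close> \<open>Im w > 0\<close> by (simp add: divide_simps power_less_one_iff abs_square_less_1) (use \<open>Im w > 0\<close> in auto)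
    finally have "Im z / (cmod (of_int c' * z + of_int d'))\<^sup>2 > Im z / (cmod (of_int c * z + of_int d))\<^sup>2"
      unfolding g(2) Im_mob[OF g(1)] Imw .
    moreover have "cmod (of_int c * z + of_int d) > 0" using mob_denom_nonzero[OF assms ab] by simp
    ultimately show False using min[OF g(1)] assms
      by (smt (verit) divide_left_mono mult_pos_pos power_mono zero_less_power)
  qed
  ultimately show ?thesis using that zw by blast
qed

text \<open>The heights of \<open>z\<close> and of its image bound the bottom row by
  \<open>sqrt (R / y)\<close>; multiplied by the size of the image this bounds the top row, and both
  rows fall under \<open>bounded_denominators\<close>.\<close>

lemma finite_transporter:
  assumes "y > 0"
  shows "finite {(a, b, c, d). a * d - b * c = 1 \<and>
     (\<exists>z. Im z \<ge> y \<and> cmod z \<le> R \<and> Im (mob a b c d z) \<ge> y \<and> cmod (mob a b c d z) \<le> R)}" (is "finite ?S")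
proof -
  define K where "K = sqrt (R / y)"
  obtain N1 where N1: "\<And>z c d. Im z \<ge> y \<Longrightarrow> cmod z \<le> R \<Longrightarrow> cmod (of_int c * z + of_int d) \<le> K \<Longrightarrow> \<bar>c\<bar> \<le> N1 \<and> \<bar>d\<bar> \<le> N1"
    using bounded_denominators[OF assms] by blast
  obtain N2 where N2: "\<And>z c d. Im z \<ge> y \<Longrightarrow> cmod z \<le> R \<Longrightarrow> cmod (of_int c * z + of_int d) \<le> R * K \<Longrightarrow> \<bar>c\<bar> \<le> N2 \<and> \<bar>d\<bar> \<le> N2"
    using bounded_denominators[OF assms] by blast
  define N where "N = max N1 N2"
  have "?S \<subseteq> {- N..N} \<times> {- N..N} \<times> {- N..N} \<times> {- N..N}"
  proof
    fix g assume "g \<in> ?S"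
    then obtain a b c d z where g: "g = (a, b, c, d)" and det: "a * d - b * c = 1" and z: "Im z \<ge> y" "cmod z \<le> R"
      and gz: "Im (mob a b c d z) \<ge> y" "cmod (mob a b c d z) \<le> R" by auto
    have "Im z > 0" using z assms by simp
    have nz: "of_int c * z + of_int d \<noteq> 0" using mob_denom_nonzero[OF \<open>Im z > 0\<close> det] .
    have "Im z \<le> R" using z abs_Im_le_cmod[of z] by linarith
    have "(cmod (of_int c * z + of_int d))\<^sup>2 * y \<le> Im z"
      using gz(1) nz unfolding Im_mob[OF det] by (simp add: field_simps)
    then have "(cmod (of_int c * z + of_int d))\<^sup>2 \<le> R / y"
      using assms \<open>Im z \<le> R\<close> by (simp add: field_simps)
    then have K: "cmod (of_int c * z + of_int d) \<le> K" unfolding K_def by (rule real_le_rsqrt)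
    have "cmod (of_int a * z + of_int b) = cmod (mob a b c d z) * cmod (of_int c * z + of_int d)"
      using nz by (simp add: mob_def flip: norm_mult)
    also have "\<dots> \<le> R * K" using K gz(2) by (intro mult_mono) (auto intro: order_trans[OF norm_ge_zero])
    finally show "g \<in> {- N..N} \<times> {- N..N} \<times> {- N..N} \<times> {- N..N}"
      using N1[OF z K] N2[OF z, of a b] by (auto simp: N_def g abs_le_iff)
  qed
  then show ?thesis by (rule finite_subset) auto
qed

text \<open>Only finitely many matrices connect neighbourhoods of \<open>z1\<close> and
  \<open>z2\<close>; each one that does not carry \<open>z1\<close> to \<open>z2\<close> is excluded
  on smaller neighbourhoods by continuity.\<close>

lemma properly_discontinuous:
  assumes "Im z1 > 0" "Im z2 > 0"
  obtains \<epsilon> where "\<epsilon> > 0" "\<And>w1 w2 a b c d. dist w1 z1 < \<epsilon> \<Longrightarrow> dist w2 z2 < \<epsilon> \<Longrightarrow> a * d - b * c = 1 \<Longrightarrow>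
      w2 = mob a b c d w1 \<Longrightarrow> z2 = mob a b c d z1"
proof -
  \<comment> \<open>Balls of radius \<open>y\<close> stay above height \<open>y\<close> and within
    radius \<open>R\<close>, the region of \<open>finite_transporter\<close>.\<close>
  define y where "y = min (Im z1) (Im z2) / 2"
  define R where "R = max (cmod z1) (cmod z2) + y"
  have y: "y > 0" "y \<le> Im z1 / 2" "y \<le> Im z2 / 2" using assms by (auto simp: y_def)
  define S where "S = {(a, b, c, d). a * d - b * c = 1 \<and>
     (\<exists>z. Im z \<ge> y \<and> cmod z \<le> R \<and> Im (mob a b c d z) \<ge> y \<and> cmod (mob a b c d z) \<le> R)}"
  have S: "finite S" unfolding S_def by (rule finite_transporter[OF y(1)])
  define P where "P = (\<lambda>(a, b, c, d) (p :: complex \<times> complex). z2 \<noteq> mob a b c d z1 \<longrightarrow> snd p \<noteq> mob a b c d (fst p))"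
  have "\<forall>m\<in>S. \<forall>\<^sub>F p in nhds (z1, z2). P m p"
  proof
    fix m assume "m \<in> S"
    obtain a b c d where m: "m = (a, b, c, d)" by (cases m)
    have det: "a * d - b * c = 1" using \<open>m \<in> S\<close> by (auto simp: S_def m)
    show "\<forall>\<^sub>F p in nhds (z1, z2). P m p"
    proof (cases "z2 = mob a b c d z1")
      case False
      have nz: "of_int c * z1 + of_int d \<noteq> 0" using mob_denom_nonzero[OF assms(1) det] .
      have f: "((\<lambda>p. fst p) \<longlongrightarrow> z1) (nhds (z1, z2))" "((\<lambda>p. snd p) \<longlongrightarrow> z2) (nhds (z1, z2))"
        using tendsto_fst[OF filterlim_ident[of "nhds (z1, z2)"]] tendsto_snd[OF filterlim_ident[of "nhds (z1, z2)"]]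
        by simp_all
      have "((\<lambda>p. snd p - mob a b c d (fst p)) \<longlongrightarrow> z2 - mob a b c d z1) (nhds (z1, z2))"
        unfolding mob_def using nz by (intro tendsto_intros f)
      then have "\<forall>\<^sub>F p in nhds (z1, z2). snd p - mob a b c d (fst p) \<noteq> 0"
        by (rule tendsto_imp_eventually_ne) (use False in simp)
      then show ?thesis by eventually_elim (auto simp: P_def m)
    qed (simp add: P_def m)
  qed
  from eventually_ball_finite[OF S this] have "\<forall>\<^sub>F p in nhds (z1, z2). \<forall>m\<in>S. P m p" .
  then obtain e where e: "e > 0" "\<And>p. dist p (z1, z2) < e \<Longrightarrow> \<forall>m\<in>S. P m p"
    unfolding eventually_nhds_metric by blast
  show ?thesis
  proof (rule that[of "min (e / 2) y"])
    show "min (e / 2) y > 0" using e y by simp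
    fix w1 w2 a b c d
    assume w: "dist w1 z1 < min (e / 2) y" "dist w2 z2 < min (e / 2) y" and det: "a * d - b * c = 1" and g: "w2 = mob a b c d w1"
    have near: "Im w \<ge> y \<and> cmod w \<le> R" if "dist w z < y" "z = z1 \<or> z = z2" for w z
    proof -
      have "\<bar>Im w - Im z\<bar> < y" using that(1) abs_Im_le_cmod[of "w - z"] by (simp add: dist_norm)
      moreover have "cmod w \<le> cmod z + cmod (w - z)" using norm_triangle_ineq[of z "w - z"] by simp
      ultimately show ?thesis using that y by (auto simp: R_def dist_norm)
    qed
    have "(a, b, c, d) \<in> S" unfolding S_def using det near[of w1 z1] near[of w2 z2] w g by auto
    moreover have "dist (w1, w2) (z1, z2) < e"
    proof -
      have "dist (w1, w2) (z1, z2) \<le> dist w1 z1 + dist w2 z2"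
        unfolding dist_Pair_Pair by (rule sqrt_sum_squares_le_sum) auto
      then show ?thesis using w by simp
    qed
    ultimately show "z2 = mob a b c d z1" using e(2)[of "(w1, w2)"] g by (auto simp: P_def)
  qed
qed

lemma int_abs_le_1: "\<bar>x::int\<bar> \<le> 1 \<Longrightarrow> x = -1 \<or> x = 0 \<or> x = 1"
  by linarith

lemma rho_facts: "Im rho > 0" "Re rho = 1/2" "Im rho = sqrt 3 / 2" "rho\<^sup>2 = rho - 1" "rho \<noteq> 0" "cmod rho = 1"
proof -
  show R: "Im rho > 0" "Re rho = 1/2" "Im rho = sqrt 3 / 2" by (simp_all add: rho_def)
  then show "rho \<noteq> 0" by auto
  show "rho\<^sup>2 = rho - 1"
    by (simp add: complex_eq_iff power2_eq_square R(2,3))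
  show "cmod rho = 1" by (simp add: cmod_def R(2,3) power2_eq_square)
qed

text \<open>Fixing i means \<open>a = d\<close> and \<open>b = - c\<close>, so the determinant
  condition reads \<open>c * c + d * d = 1\<close>.\<close>

lemma stabilizer_i:
  assumes "a * d - b * c = 1" "mob a b c d \<i> = \<i>" "Im z > 0"
  shows "mob a b c d z = z \<or> mob a b c d z = - 1 / z"
proof -
  have nz: "of_int c * \<i> + of_int d \<noteq> (0::complex)" using mob_denom_nonzero[OF _ assms(1), of \<i>] by simp
  have "of_int a * \<i> + of_int b = \<i> * (of_int c * \<i> + of_int d)"
    using assms(2) nz by (simp add: mob_def divide_eq_eq)
  then have "a = d" "b = - c" by (auto simp: complex_eq_iff)
  then have det: "d * d + c * c = 1" using assms(1) by simp
  have "c = 0 \<or> d = 0"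
  proof (rule ccontr)
    assume "\<not> ?thesis"
    then have "d * d \<ge> 1" "c * c \<ge> 1" by (auto simp: zero_less_mult_iff int_one_le_iff_zero_less)
    then show False using det by simp
  qed
  then show ?thesis
  proof
    assume "c = 0"
    then have "d * d = 1" using det by simp
    then have "(of_int d :: complex) \<noteq> 0" by auto
    then show ?thesis using \<open>a = d\<close> \<open>b = - c\<close> \<open>c = 0\<close> by (simp add: mob_def)
  next
    assume "d = 0"
    then have "c * c = 1" using det by simp
    then have "(of_int c :: complex) \<noteq> 0" by auto
    then show ?thesis using \<open>a = d\<close> \<open>b = - c\<close> \<open>d = 0\<close> by (simp add: mob_def)
  qed
qed

text \<open>Comparing real and imaginary parts gives \<open>a = c + d\<close> and
  \<open>b = - c\<close>, so the determinant condition is \<open>c * c + c * d + d * d = 1\<close>;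
  its six integer solutions induce three maps.\<close>

lemma stabilizer_rho:
  assumes "a * d - b * c = 1" "mob a b c d rho = rho" "Im z > 0"
  shows "mob a b c d z = z \<or> mob a b c d z = (z - 1) / z \<or> mob a b c d z = - 1 / (z - 1)"
proof -
  have nz: "of_int c * rho + of_int d \<noteq> (0::complex)" using mob_denom_nonzero[OF rho_facts(1) assms(1)] .
  have "of_int a * rho + of_int b = rho * (of_int c * rho + of_int d)"
    using assms(2) nz by (simp add: mob_def divide_eq_eq)
  also have "\<dots> = of_int (c + d) * rho - of_int c"
  proof -
    have "rho * (of_int c * rho + of_int d) = of_int c * rho\<^sup>2 + of_int d * rho"
      by (simp add: algebra_simps power2_eq_square)
    then show ?thesis unfolding rho_facts(4) by (simp add: algebra_simps)
  qed
  finally have "Re (of_int a * rho + of_int b) = Re (of_int (c + d) * rho - of_int c)"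
    "Im (of_int a * rho + of_int b) = Im (of_int (c + d) * rho - of_int c)" by simp_all
  then have "of_int a * Re rho + of_int b = of_int (c + d) * Re rho - of_int c" "of_int a * Im rho = of_int (c + d) * Im rho"
    by simp_all
  moreover have "Im rho \<noteq> 0" using rho_facts(1) by simp
  ultimately have "real_of_int a * (1/2) + of_int b = of_int (c + d) * (1/2) - of_int c" "real_of_int a = of_int (c + d)"
    unfolding rho_facts(2) mult_right_cancel[OF \<open>Im rho \<noteq> 0\<close>] by blast+
  then have *: "real_of_int a / 2 + of_int b = of_int (c + d) / 2 - of_int c" "real_of_int a = of_int (c + d)"
    by linarith+
  then have a: "a = c + d" by linarith
  then have "real_of_int b = - real_of_int c" using *(1) by (simp add: field_simps)
  then have b: "b = - c" by linarith
  have det: "c * c + c * d + d * d = 1" using assms(1) unfolding a b by (simp add: algebra_simps)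
  have "3 * (c * c) \<le> 3 * (c * c) + (c + 2 * d) * (c + 2 * d)" by simp
  also have "\<dots> = 4 * (c * c + c * d + d * d)" by (simp add: algebra_simps)
  finally have c: "c * c \<le> 1" using det by simp
  have "3 * (d * d) \<le> 3 * (d * d) + (d + 2 * c) * (d + 2 * c)" by simp
  also have "\<dots> = 4 * (c * c + c * d + d * d)" by (simp add: algebra_simps)
  finally have d: "d * d \<le> 1" using det by simp
  from c d have "\<bar>c\<bar> \<le> 1" "\<bar>d\<bar> \<le> 1" by (auto simp: abs_square_le_1[of c, unfolded power2_eq_square] abs_square_le_1[of d, unfolded power2_eq_square])
  then have "(c = -1 \<or> c = 0 \<or> c = 1) \<and> (d = -1 \<or> d = 0 \<or> d = 1)" using int_abs_le_1 by blast
  then have "(c, d) \<in> {(0, 1), (0, -1), (1, 0), (-1, 0), (1, -1), (-1, 1)}" using det by auto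
  moreover have "z \<noteq> 0" "z \<noteq> 1" using assms(3) by auto
  ultimately show ?thesis unfolding a b mob_def by (auto simp: divide_simps algebra_simps)
qed

text \<open>After conjugation the fixed point \<open>w0\<close> lies in the fundamental domain,
  where a nonzero lower left entry is possible only at i, rho and rho - 1.\<close>

lemma stabilizer_trivial:
  assumes det: "a * d - b * c = 1" and fixed: "mob a b c d z0 = z0" and z0: "Im z0 > 0"
    and i: "\<not> SL2Z_equiv z0 \<i>" and rho: "\<not> SL2Z_equiv z0 rho" and z: "Im z > 0"
  shows "mob a b c d z = z"
proof -
  obtain w0 where w0: "SL2Z_equiv z0 w0" "\<bar>Re w0\<bar> \<le> 1/2" "cmod w0 \<ge> 1" "Im w0 > 0"
    using fundamental_domain[OF z0] by blast
  obtain p q r s where g: "p * s - q * r = 1" "w0 = mob p q r s z0" using w0 SL2Z_equiv_mob by blast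
  have g': "s * p - (- q) * (- r) = 1" using g by (simp add: algebra_simps)
  have z0': "z0 = mob s (- q) (- r) p w0" using mob_inverse[OF z0 g(1)] g(2) by simp
  \<comment> \<open>The stabiliser element, conjugated so that it fixes \<open>w0\<close>.\<close>
  obtain A B C D where M: "A * D - B * C = 1"
    "\<And>x. Im x > 0 \<Longrightarrow> mob A B C D x = mob p q r s (mob a b c d (mob s (- q) (- r) p x))"
  proof -
    define a1 where "a1 = a * s + b * - r"
    define b1 where "b1 = a * - q + b * p"
    define c1 where "c1 = c * s + d * - r"
    define d1 where "d1 = c * - q + d * p"
    note 1 = mob_mob[OF _ g' det, folded a1_def b1_def c1_def d1_def]
    have d1: "a1 * d1 - b1 * c1 = 1" using 1(2)[of \<i>] by simp
    note 2 = mob_mob[OF _ d1 g(1)]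
    have "(p * a1 + q * c1) * (r * b1 + s * d1) - (p * b1 + q * d1) * (r * a1 + s * c1) = 1"
      using 2(2)[of \<i>] by simp
    moreover have "\<And>x. Im x > 0 \<Longrightarrow> mob (p * a1 + q * c1) (p * b1 + q * d1) (r * a1 + s * c1) (r * b1 + s * d1) x =
         mob p q r s (mob a b c d (mob s (- q) (- r) p x))"
      by (simp only: 1(1) 2(1))
    ultimately show ?thesis by (rule that)
  qed
  have fixw: "mob A B C D w0 = w0"
    using M(2)[OF w0(4)] unfolding z0'[symmetric] fixed unfolding g(2)[symmetric] .
  define cd where "cd = of_int C * w0 + of_int D"
  have nz: "cd \<noteq> 0" using mob_denom_nonzero[OF w0(4) M(1)] by (simp add: cd_def)
  \<comment> \<open>A fixed point keeps its height, so the automorphy factor has modulus 1.\<close>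
  have "Im w0 = Im w0 / (cmod cd)\<^sup>2" using Im_mob[OF M(1), of w0] fixw by (simp add: cd_def)
  then have norm1: "(cmod cd)\<^sup>2 = 1" using w0(4) nz by (simp add: field_simps)
  have Imw0: "(Im w0)\<^sup>2 \<ge> 3/4"
  proof -
    have "1 \<le> (cmod w0)\<^sup>2" using w0(3) by simp
    moreover have "(Re w0)\<^sup>2 \<le> (1/2)\<^sup>2" using w0(2) by (intro abs_le_square_iff[THEN iffD1]) simp
    ultimately show ?thesis unfolding cmod_power2 by (simp add: power_divide)
  qed
  have sq: "(of_int C * Re w0 + of_int D)\<^sup>2 + (of_int C)\<^sup>2 * (Im w0)\<^sup>2 = 1"
    using norm1 unfolding cd_def cmod_power2 by (simp add: power_mult_distrib)
  have eqw: "of_int A * w0 + of_int B = w0 * cd"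
    using fixw nz by (simp add: mob_def cd_def divide_eq_eq)
  have C0: "C = 0"
  proof (rule ccontr)
    assume "C \<noteq> 0"
    have "(of_int C)\<^sup>2 * (3/4) \<le> (of_int C)\<^sup>2 * (Im w0)\<^sup>2" using Imw0 by (intro mult_left_mono) auto
    then have "(real_of_int C)\<^sup>2 \<le> 4/3" using sq zero_le_power2[of "of_int C * Re w0 + of_int D"] by linarith
    then have "(real_of_int C)\<^sup>2 < 2\<^sup>2" by simp
    then have "\<bar>real_of_int C\<bar>\<^sup>2 < 2\<^sup>2" by simp
    then have "\<bar>real_of_int C\<bar> < 2" by (rule power2_less_imp_less) simp
    then have C1: "\<bar>C\<bar> = 1" using \<open>C \<noteq> 0\<close> by linarith
    then have C2: "(real_of_int C)\<^sup>2 = 1" by (metis of_int_1 of_int_abs one_power2 power2_abs)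
    have w0sq: "(Re w0)\<^sup>2 + (Im w0)\<^sup>2 \<ge> 1" using w0(3) unfolding cmod_power2[symmetric] by simp
    have "(of_int C * Re w0 + of_int D)\<^sup>2 = (Re w0)\<^sup>2 + 2 * of_int C * of_int D * Re w0 + (of_int D)\<^sup>2"
      using C2 by (simp add: power2_eq_square algebra_simps)
    then have key: "(Re w0)\<^sup>2 + (Im w0)\<^sup>2 + 2 * of_int C * of_int D * Re w0 + (of_int D)\<^sup>2 = 1" using sq C2 by simp
    have "\<bar>2 * of_int C * of_int D * Re w0\<bar> \<le> \<bar>of_int D\<bar>"
    proof -
      have "\<bar>2 * of_int C * of_int D * Re w0\<bar> = 2 * \<bar>of_int D\<bar> * \<bar>Re w0\<bar>" using C1 by (simp add: abs_mult flip: of_int_abs)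
      also have "\<dots> \<le> 2 * \<bar>of_int D\<bar> * (1/2)" using w0(2) by (intro mult_left_mono) auto
      finally show ?thesis by simp
    qed
    then have "2 * of_int C * of_int D * Re w0 \<ge> - \<bar>of_int D\<bar>" by linarith
    then have D: "(of_int D)\<^sup>2 \<le> \<bar>real_of_int D\<bar>" using key w0sq by linarith
    have "\<bar>D\<bar> \<le> 1"
    proof (rule ccontr)
      assume "\<not> ?thesis"
      then have "\<bar>real_of_int D\<bar> > 1" by linarith
      then have "\<bar>real_of_int D\<bar> * \<bar>real_of_int D\<bar> > 1 * \<bar>real_of_int D\<bar>" by (intro mult_strict_right_mono) auto
      then show False using D by (simp add: power2_eq_square)
    qed
    have "Re w0 \<in> {-1/2, 0, 1/2} \<and> (Re w0)\<^sup>2 + (Im w0)\<^sup>2 = 1"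
    proof (cases "D = 0")
      case True
      have "w0 * cd = of_int C * w0\<^sup>2" by (simp add: cd_def True power2_eq_square)
      have n1: "(Re w0)\<^sup>2 + (Im w0)\<^sup>2 = 1" using key True by simp
      have "Im (of_int A * w0 + of_int B) = Im (of_int C * w0\<^sup>2)" using eqw \<open>w0 * cd = _\<close> by simp
      then have "of_int A * Im w0 = of_int C * (2 * Re w0) * Im w0" by (simp add: power2_eq_square)
      then have A: "real_of_int A = of_int C * (2 * Re w0)" using w0(4) by simp
      have "\<bar>real_of_int A\<bar> \<le> 1" unfolding A using C1 w0(2) by (simp add: abs_mult flip: of_int_abs)
      then have "\<bar>A\<bar> \<le> 1" by linarith
      then have "A = -1 \<or> A = 0 \<or> A = 1" by (rule int_abs_le_1)
      moreover have "C = 1 \<or> C = -1" using C1 by linarith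
      ultimately show ?thesis using A n1 by auto
    next
      case False
      then have D1: "D = 1 \<or> D = -1" using \<open>\<bar>D\<bar> \<le> 1\<close> by linarith
      then have "(real_of_int D)\<^sup>2 = 1" by auto
      then have k: "(Re w0)\<^sup>2 + (Im w0)\<^sup>2 + 2 * of_int C * of_int D * Re w0 = 0" using key by simp
      have "C = 1 \<or> C = -1" using C1 by linarith
      then have "\<bar>2 * of_int C * of_int D * Re w0\<bar> \<le> 1" using D1 w0(2) by auto
      then have n1: "(Re w0)\<^sup>2 + (Im w0)\<^sup>2 = 1" "2 * of_int C * of_int D * Re w0 = -1" using k w0sq by linarith+
      then show ?thesis using D1 \<open>C = 1 \<or> C = -1\<close> by auto
    qed
    then have cases: "Re w0 = -1/2 \<or> Re w0 = 0 \<or> Re w0 = 1/2" and n1: "(Re w0)\<^sup>2 + (Im w0)\<^sup>2 = 1" by auto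
    have "w0 = \<i> \<or> w0 = rho \<or> w0 = rho + of_int (-1)"
    proof (cases "Re w0 = 0")
      case True
      then have "Im w0 = 1" using n1 w0(4) by (simp add: power2_eq_1_iff)
      then show ?thesis using True by (simp add: complex_eq_iff)
    next
      case False
      then have "(Re w0)\<^sup>2 = (1/2)\<^sup>2" using cases unfolding power2_eq_iff by auto
      then have "(Re w0)\<^sup>2 = 1/4" by (simp add: power_divide)
      then have "(Im w0)\<^sup>2 = (sqrt 3 / 2)\<^sup>2" using n1 by (simp add: power_divide)
      then have "Im w0 = sqrt 3 / 2" using w0(4) by (simp add: power2_eq_iff) (auto dest: sym)
      then show ?thesis using False cases by (auto simp: complex_eq_iff rho_facts)
    qed
    then consider "w0 = \<i>" | "w0 = rho" | "w0 + of_int 1 = rho" by auto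
    then have "SL2Z_equiv z0 \<i> \<or> SL2Z_equiv z0 rho"
      using w0(1) SL2Z_equiv_trans[OF z0 w0(1) SL2Z_equiv_add_int[of w0 1]] by cases auto
    then show False using i rho by blast
  qed
  then have "A * D = 1" using M(1) by simp
  then have AD: "A = D" "D = 1 \<or> D = -1" by (auto simp: zmult_eq_1_iff)
  have "of_int A * w0 + of_int B = w0 * of_int D" using eqw C0 by (simp add: cd_def)
  then have "B = 0" using AD(1) by simp
  have id: "mob A B C D x = x" for x using AD \<open>B = 0\<close> C0 by (auto simp: mob_def)
  define x where "x = mob p q r s z"
  have x: "Im x > 0" using mob_uhp[OF z g(1)] by (simp add: x_def)
  have zx: "mob s (- q) (- r) p x = z" using mob_inverse[OF z g(1)] by (simp add: x_def)
  have "x = mob p q r s (mob a b c d z)" using M(2)[OF x] unfolding id zx .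
  then have "mob s (- q) (- r) p x = mob a b c d z"
    using mob_inverse[OF mob_uhp[OF z det] g(1)] by simp
  then show ?thesis using zx by simp
qed

text \<open>Euclidean algorithm on the left column: translations replace \<open>a\<close> by its
  remainder modulo \<open>c\<close>, and the inversion swaps the rows, so
  \<open>\<bar>c\<bar>\<close> decreases.\<close>

lemma modular_if_S_T:
  fixes f :: "complex \<Rightarrow> complex"
  assumes T: "\<And>z. Im z > 0 \<Longrightarrow> f (z + 1) = f z" and S: "\<And>z. Im z > 0 \<Longrightarrow> f (- 1 / z) = z ^ k * f z"
    and k: "even k" and det: "a * d - b * c = 1" and z: "Im z > 0"
  shows "f (mob a b c d z) = (of_int c * z + of_int d) ^ k * f z"
  using det
proof (induction "nat \<bar>c\<bar>" arbitrary: a b c d rule: less_induct)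
  case less
  have Tn: "f (z + of_nat n) = f z" if "Im z > 0" for z n
  proof (induction n)
    case (Suc n)
    then show ?case using T[of "z + of_nat n"] that by (simp add: algebra_simps)
  qed simp
  have Ti: "f (z + of_int n) = f z" if "Im z > 0" for z n
  proof (cases "n \<ge> 0")
    case True
    then show ?thesis using Tn[OF that, of "nat n"] by (simp add: of_nat_nat)
  next
    case False
    then show ?thesis using Tn[of "z + of_int n" "nat (- n)"] that by (simp add: of_nat_nat)
  qed
  show ?case
  proof (cases "c = 0")
    case True
    then have "a * d = 1" using less.prems by simp
    then have ad: "a = d" "d = 1 \<or> d = -1" by (auto simp: zmult_eq_1_iff)
    then have "mob a b c d z = z + of_int (b * d)" using True by (auto simp: mob_def)
    moreover have "(of_int d :: complex) ^ k = 1" using ad k by (auto simp: power_minus_even)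
    ultimately show ?thesis using Ti[OF z, of "b * d"] True by simp
  next
    case False
    define q a' b' where "q = a div c" and "a' = a mod c" and "b' = b - q * d"
    have aa: "a = c * q + a'" by (simp add: q_def a'_def)
    have det': "a' * d - b' * c = 1" using less.prems unfolding aa b'_def by (simp add: algebra_simps)
    have det'': "(- c) * b' - (- d) * a' = 1" using det' by (simp add: algebra_simps)
    have small: "nat \<bar>a'\<bar> < nat \<bar>c\<bar>" using False by (simp add: a'_def abs_mod_less)
    have IH: "f (mob (- c) (- d) a' b' z) = (of_int a' * z + of_int b') ^ k * f z"
      by (rule less.hyps[OF small det''])
    define w where "w = mob (- c) (- d) a' b' z"
    have w: "Im w > 0" unfolding w_def by (rule mob_uhp[OF z det''])
    have nz: "of_int c * z + of_int d \<noteq> 0" "of_int a' * z + of_int b' \<noteq> 0"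
      using mob_denom_nonzero[OF z less.prems] mob_denom_nonzero[OF z det''] by auto
    have "- 1 / w = (of_int a' * z + of_int b') / (of_int c * z + of_int d)"
    proof -
      have "w = - (of_int c * z + of_int d) / (of_int a' * z + of_int b')" by (simp add: w_def mob_def)
      moreover have "- 1 / (- x / y) = y / x" for x y :: complex by simp
      ultimately show ?thesis by metis
    qed
    then have eq: "mob a b c d z = - 1 / w + of_int q"
      using nz unfolding mob_def aa b'_def by (simp add: field_simps)
    have "Im (- 1 / w) > 0" using mob_uhp[OF w, of 0 0 "-1" 1] by (simp add: mob_def)
    then have "f (mob a b c d z) = f (- 1 / w)" unfolding eq by (rule Ti)
    also have "\<dots> = w ^ k * ((of_int a' * z + of_int b') ^ k * f z)" using S[OF w] IH by (simp add: w_def)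
    also have "\<dots> = (w * (of_int a' * z + of_int b')) ^ k * f z" by (simp add: power_mult_distrib)
    also have "w * (of_int a' * z + of_int b') = - (of_int c * z + of_int d)"
      using nz by (simp add: w_def mob_def)
    finally show ?thesis by (simp only: power_minus_even[OF k])
  qed
qed

section \<open>Modular forms from the Weierstrass function\<close>

lemma removable_to_limit:
  assumes "r > 0" and f: "f holomorphic_on ball p r - {p}" and lim: "((\<lambda>z. (z - p) ^ Suc k * f z) \<longlongrightarrow> 0) (at (p::complex))"
  shows "\<exists>L. ((\<lambda>z. (z - p) ^ k * f z) \<longlongrightarrow> L) (at p)"
proof -
  define g where "g z = (if z = p then 0 else (z - p) ^ Suc k * f z)" for z
  have "(\<lambda>z. (z - p) ^ Suc k * f z) holomorphic_on ball p r - {p}" using f by (intro holomorphic_intros)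
  then have "g holomorphic_on ball p r - {p}" by (rule holomorphic_transform) (auto simp: g_def)
  moreover have "g \<midarrow>p\<rightarrow> 0"
    by (rule Lim_transform_eventually[OF lim]) (auto simp: g_def eventually_at_filter)
  ultimately have "g holomorphic_on ball p r"
    by (intro removable_singularity[of g "ball p r" p 0, THEN holomorphic_transform] open_ball) (auto simp: g_def)
  then have "(g has_field_derivative deriv g p) (at p)" using \<open>r > 0\<close> by (intro holomorphic_derivI[of g "ball p r"]) auto
  then have "((\<lambda>z. (g z - g p) / (z - p)) \<longlongrightarrow> deriv g p) (at p)" unfolding has_field_derivative_iff .
  then have "((\<lambda>z. (z - p) ^ k * f z) \<longlongrightarrow> deriv g p) (at p)"
    by (rule Lim_transform_eventually) (auto simp: g_def eventually_at_filter)
  then show ?thesis by blast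
qed

text \<open>Only a simple pole could remain, and its coefficient \<open>L\<close> satisfies
  \<open>L = - L\<close> by evenness.\<close>

lemma even_pole_removable:
  assumes "r > 0" and f: "f holomorphic_on ball 0 r - {0}" and even: "\<And>z. z \<in> ball 0 r - {0} \<Longrightarrow> f (- z) = f z"
    and lim: "((\<lambda>z. z\<^sup>2 * f z) \<longlongrightarrow> 0) (at (0::complex))"
  shows "\<exists>L. (f \<longlongrightarrow> L) (at 0)"
proof -
  obtain L where L: "((\<lambda>z. z * f z) \<longlongrightarrow> L) (at 0)"
    using removable_to_limit[OF assms(1,2), of 1] lim by (auto simp: power2_eq_square)
  have "filterlim (\<lambda>z::complex. - z) (at 0) (at 0)"
    by (auto simp: filterlim_at eventually_at_filter intro!: tendsto_eq_intros)
  from filterlim_compose[OF L this] have "((\<lambda>z. - z * f (- z)) \<longlongrightarrow> L) (at 0)" by simp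
  moreover have "\<forall>\<^sub>F z in at 0. - z * f (- z) = - (z * f z)"
    using eventually_at_ball'[OF \<open>r > 0\<close>, of 0 UNIV] by eventually_elim (use even in auto)
  ultimately have "((\<lambda>z. - (z * f z)) \<longlongrightarrow> L) (at 0)" by (rule Lim_transform_eventually)
  then have "L = - L" using tendsto_minus[OF L] LIM_unique by blast
  then have "L = 0" by simp
  then show ?thesis using removable_to_limit[OF assms(1,2), of 0] L by simp
qed

text \<open>The real period \<open>h\<close> is variable because \<open>e1_neq_e2\<close> works with
  a function of real period 1/2.\<close>

definition lattice :: "real \<Rightarrow> complex \<Rightarrow> complex set" where
  "lattice h \<tau> = {of_int m * of_real h + of_int n * \<tau> | m n. True}"

lemma lattice_coords:
  assumes "h > 0" "Im \<tau> > 0"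
  shows "z = of_real ((Re z - Im z / Im \<tau> * Re \<tau>) / h) * of_real h + of_real (Im z / Im \<tau>) * \<tau>"
  using assms by (simp add: complex_eq_iff)

lemma lattice_iff:
  assumes "h > 0" "Im \<tau> > 0"
  shows "z \<in> lattice h \<tau> \<longleftrightarrow> Im z / Im \<tau> \<in> \<int> \<and> (Re z - Im z / Im \<tau> * Re \<tau>) / h \<in> \<int>"
proof
  assume "z \<in> lattice h \<tau>"
  then obtain m n where "z = of_int m * of_real h + of_int n * \<tau>" by (auto simp: lattice_def)
  then show "Im z / Im \<tau> \<in> \<int> \<and> (Re z - Im z / Im \<tau> * Re \<tau>) / h \<in> \<int>" using assms by simp
next
  assume "Im z / Im \<tau> \<in> \<int> \<and> (Re z - Im z / Im \<tau> * Re \<tau>) / h \<in> \<int>"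
  then obtain m n where mn: "Im z / Im \<tau> = of_int n" "(Re z - Im z / Im \<tau> * Re \<tau>) / h = of_int m"
    by (metis Ints_cases)
  have "z = of_int m * of_real h + of_int n * \<tau>"
    using lattice_coords[OF assms, of z] unfolding mn(2) unfolding mn(1) of_real_of_int_eq .
  then show "z \<in> lattice h \<tau>" by (auto simp: lattice_def)
qed

lemma closed_lattice:
  assumes "h > 0" "Im \<tau> > 0"
  shows "closed (lattice h \<tau>)"
proof -
  have "lattice h \<tau> = (\<lambda>z. Im z / Im \<tau>) -` \<int> \<inter> (\<lambda>z. (Re z - Im z / Im \<tau> * Re \<tau>) / h) -` \<int>"
    using lattice_iff[OF assms] by auto
  also have "closed \<dots>" using assms
    by (intro closed_Int continuous_closed_vimage closed_Ints continuous_intros) auto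
  finally show ?thesis .
qed

lemma lattice_isolated_0:
  assumes "h > 0" "Im \<tau> > 0"
  obtains r where "r > 0" "\<And>z. z \<in> ball 0 r \<Longrightarrow> z \<in> lattice h \<tau> \<Longrightarrow> z = 0"
proof -
  define V where "V = {z. \<bar>Im z / Im \<tau>\<bar> < 1} \<inter> {z. \<bar>(Re z - Im z / Im \<tau> * Re \<tau>) / h\<bar> < 1}"
  have "open V" unfolding V_def using assms by (intro open_Int open_Collect_less continuous_intros) auto
  moreover have "0 \<in> V" by (simp add: V_def)
  ultimately obtain r where r: "r > 0" "ball 0 r \<subseteq> V" using open_contains_ball by blast
  have "z = 0" if z: "z \<in> V" "z \<in> lattice h \<tau>" for z
  proof -
    have "Im z / Im \<tau> = 0" "(Re z - Im z / Im \<tau> * Re \<tau>) / h = 0"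
      using z unfolding lattice_iff[OF assms] V_def by (auto intro!: Ints_nonzero_abs_less1 simp del: divide_eq_0_iff)
    then show ?thesis using lattice_coords[OF assms, of z] by (simp only: of_real_0 mult_zero_left add_0)
  qed
  then show ?thesis using r that by blast
qed

lemma lattice_add: "z \<in> lattice h \<tau> \<Longrightarrow> w \<in> lattice h \<tau> \<Longrightarrow> z + w \<in> lattice h \<tau>"
  and lattice_uminus: "z \<in> lattice h \<tau> \<Longrightarrow> - z \<in> lattice h \<tau>"
  and lattice_0: "0 \<in> lattice h \<tau>"
  and lattice_gens: "of_real h \<in> lattice h \<tau>" "\<tau> \<in> lattice h \<tau>"
proof -
  assume "z \<in> lattice h \<tau>" "w \<in> lattice h \<tau>"
  then obtain m n m' n' where "z = of_int m * of_real h + of_int n * \<tau>" "w = of_int m' * of_real h + of_int n' * \<tau>"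
    by (auto simp: lattice_def)
  then have "z + w = of_int (m + m') * of_real h + of_int (n + n') * \<tau>" by (simp add: algebra_simps)
  then show "z + w \<in> lattice h \<tau>" unfolding lattice_def by blast
next
  assume "z \<in> lattice h \<tau>"
  then obtain m n where "z = of_int m * of_real h + of_int n * \<tau>" by (auto simp: lattice_def)
  then have "- z = of_int (- m) * of_real h + of_int (- n) * \<tau>" by simp
  then show "- z \<in> lattice h \<tau>" unfolding lattice_def by blast
next
  have "0 = of_int 0 * of_real h + of_int 0 * \<tau>" by simp
  then show "0 \<in> lattice h \<tau>" unfolding lattice_def by blast
next
  have "of_real h = of_int 1 * of_real h + of_int 0 * \<tau>" by simp
  then show "of_real h \<in> lattice h \<tau>" unfolding lattice_def by blast
next
  have "\<tau> = of_int 0 * of_real h + of_int 1 * \<tau>" by simp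
  then show "\<tau> \<in> lattice h \<tau>" unfolding lattice_def by blast
qed

lemma lattice_add_iff: "w \<in> lattice h \<tau> \<Longrightarrow> z + w \<in> lattice h \<tau> \<longleftrightarrow> z \<in> lattice h \<tau>"
  using lattice_add[of "z + w" h \<tau> "- w"] lattice_add[of z h \<tau> w] lattice_uminus[of w h \<tau>] by auto

lemma periodic_lattice:
  assumes "\<And>z. z \<notin> lattice h \<tau> \<Longrightarrow> f (z + of_real h) = f z" "\<And>z. z \<notin> lattice h \<tau> \<Longrightarrow> f (z + \<tau>) = f z"
    and w: "w \<in> lattice h \<tau>" and z: "z \<notin> lattice h \<tau>"
  shows "f (z + w) = f z"
proof -
  have nat1: "f (z + of_nat k * p) = f z" if "\<And>z. z \<notin> lattice h \<tau> \<Longrightarrow> f (z + p) = f z" "p \<in> lattice h \<tau>" "z \<notin> lattice h \<tau>" for k p z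
  proof (induction k)
    case (Suc k)
    have "of_nat k * p \<in> lattice h \<tau>" by (induction k) (auto simp: lattice_0 lattice_add that algebra_simps)
    then have "f (z + of_nat k * p + p) = f (z + of_nat k * p)" using that by (intro that(1)) (simp add: lattice_add_iff)
    then show ?case using Suc by (simp add: algebra_simps)
  qed simp
  have int1: "f (z + of_int k * p) = f z" if "\<And>z. z \<notin> lattice h \<tau> \<Longrightarrow> f (z + p) = f z" "p \<in> lattice h \<tau>" "z \<notin> lattice h \<tau>" for k p z
  proof (cases "k \<ge> 0")
    case True
    then show ?thesis using nat1[OF that, of "nat k"] by (simp add: of_nat_nat)
  next
    case False
    have "of_nat l * p \<in> lattice h \<tau>" for l by (induction l) (auto simp: lattice_0 lattice_add that algebra_simps)
    from lattice_uminus[OF this[of "nat (- k)"]] have "of_int k * p \<in> lattice h \<tau>" using False by (simp add: of_nat_nat)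
    then have "z + of_int k * p \<notin> lattice h \<tau>" using that lattice_add_iff by blast
    from nat1[OF that(1,2) this, of "nat (- k)"] show ?thesis using False by (simp add: of_nat_nat)
  qed
  obtain m n where mn: "w = of_int m * of_real h + of_int n * \<tau>" using w by (auto simp: lattice_def)
  have "of_int m * of_real h = of_int m * of_real h + of_int 0 * \<tau>" by simp
  then have "of_int m * of_real h \<in> lattice h \<tau>" unfolding lattice_def by blast
  then have "z + of_int m * of_real h \<notin> lattice h \<tau>" using z lattice_add_iff by blast
  then have "f (z + of_int m * of_real h + of_int n * \<tau>) = f (z + of_int m * of_real h)"
    using assms lattice_gens by (intro int1) auto
  also have "\<dots> = f z" using assms lattice_gens z by (intro int1) auto
  finally show ?thesis by (simp add: mn add.assoc)
qed

text \<open>Liouville: with the value \<open>L\<close> at the lattice points the function becomes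
  entire, and it takes all its values on a compact period parallelogram.\<close>

lemma elliptic_constant:
  assumes h: "h > 0" "Im \<tau> > 0" and hol: "f holomorphic_on - lattice h \<tau>"
    and per: "\<And>z. z \<notin> lattice h \<tau> \<Longrightarrow> f (z + of_real h) = f z" "\<And>z. z \<notin> lattice h \<tau> \<Longrightarrow> f (z + \<tau>) = f z"
    and lim: "(f \<longlongrightarrow> L) (at 0)"
  shows "z \<notin> lattice h \<tau> \<Longrightarrow> f z = L"
proof -
  define F where "F z = (if z \<in> lattice h \<tau> then L else f z)" for z
  have F_per: "F (z + w) = F z" if "w \<in> lattice h \<tau>" for z w
    using that lattice_add_iff[OF that] periodic_lattice[of h \<tau> f w z] per by (auto simp: F_def)
  obtain r where r: "r > 0" "\<And>z. z \<in> ball 0 r \<Longrightarrow> z \<in> lattice h \<tau> \<Longrightarrow> z = 0" using lattice_isolated_0[OF h] by blast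
  have F0: "F holomorphic_on ball 0 r"
  proof -
    define g where "g z = (if z = 0 then L else f z)" for z
    have "f holomorphic_on ball 0 r - {0}" using r by (intro holomorphic_on_subset[OF hol]) auto
    then have "g holomorphic_on ball 0 r - {0}" by (rule holomorphic_transform) (auto simp: g_def)
    moreover have "g \<midarrow>0\<rightarrow> L" by (rule Lim_transform_eventually[OF lim]) (auto simp: g_def eventually_at_filter)
    ultimately have "(\<lambda>z. if z = 0 then L else g z) holomorphic_on ball 0 r"
      by (intro removable_singularity open_ball) auto
    then show ?thesis by (rule holomorphic_transform) (use r lattice_0 in \<open>auto simp: g_def F_def\<close>)
  qed
  have "F holomorphic_on UNIV"
  proof -
    have "\<exists>S. open S \<and> z \<in> S \<and> F holomorphic_on S" for z
    proof (cases "z \<in> lattice h \<tau>")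
      case True
      have "F \<circ> (\<lambda>w. w + (- z)) holomorphic_on ball z r"
        using F0 by (intro holomorphic_on_compose_gen[of _ _ _ "ball 0 r"] holomorphic_intros) (auto simp: dist_norm norm_minus_commute)
      then have "F holomorphic_on ball z r"
        using F_per[OF lattice_uminus[OF True]] by (simp add: o_def)
      then show ?thesis using r by (intro exI[of _ "ball z r"]) auto
    next
      case False
      have "F holomorphic_on - lattice h \<tau>" using hol by (rule holomorphic_transform) (auto simp: F_def)
      then show ?thesis using False closed_lattice[OF h] by (intro exI[of _ "- lattice h \<tau>"]) auto
    qed
    then show ?thesis by (simp add: holomorphic_on_def) (metis at_within_open field_differentiable_def UNIV_I holomorphic_on_def)
  qed
  moreover have "bounded (range F)"
  proof -
    define K where "K = (\<lambda>(a, b). complex_of_real a * of_real h + of_real b * \<tau>) ` ({0..1} \<times> {0..1})"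
    have "compact K" unfolding K_def case_prod_unfold
      by (intro compact_continuous_image compact_Times continuous_intros) auto
    then have "bounded (F ` K)"
      using holomorphic_on_imp_continuous_on[OF \<open>F holomorphic_on UNIV\<close>] compact_continuous_image
      by (meson compact_imp_bounded continuous_on_subset subset_UNIV)
    moreover have "range F \<subseteq> F ` K"
    proof safe
      fix z
      define a b where "a = (Re z - Im z / Im \<tau> * Re \<tau>) / h" and "b = Im z / Im \<tau>"
      define w where "w = of_real (frac a) * of_real h + of_real (frac b) * \<tau>"
      have z: "z = of_real a * of_real h + of_real b * \<tau>" unfolding a_def b_def by (rule lattice_coords[OF h])
      have "z = w + (of_int \<lfloor>a\<rfloor> * of_real h + of_int \<lfloor>b\<rfloor> * \<tau>)"
        unfolding z w_def frac_def by (simp add: algebra_simps)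
      moreover have "of_int \<lfloor>a\<rfloor> * of_real h + of_int \<lfloor>b\<rfloor> * \<tau> \<in> lattice h \<tau>" unfolding lattice_def by blast
      ultimately have "F z = F w" using F_per by metis
      moreover have "w \<in> K" unfolding K_def w_def
        by (intro image_eqI[of _ _ "(frac a, frac b)"]) (auto simp: frac_lt_1 less_imp_le)
      ultimately show "F z \<in> F ` K" by blast
    qed
    ultimately show ?thesis using bounded_subset by blast
  qed
  ultimately have "F constant_on UNIV" by (rule Liouville_theorem)
  then obtain c where c: "\<And>z. F z = c" unfolding constant_on_def by blast
  have "L = c" using c[of 0] lattice_0 by (simp add: F_def)
  then show "z \<notin> lattice h \<tau> \<Longrightarrow> f z = L" using c[of z] by (simp add: F_def)
qed

section \<open>The Weierstrass function as a series in exponentials\<close>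

definition sfun :: "complex \<Rightarrow> complex" where
  "sfun y = y / (1 - y)\<^sup>2"

lemma sfun_inverse: "sfun (1 / y) = sfun y"
proof (cases "y = 0 \<or> y = 1")
  case False
  then have "1 - 1 / y = (y - 1) / y" "y - 1 \<noteq> 0" by (auto simp: field_simps)
  then show ?thesis using False unfolding sfun_def
    by (simp add: power2_eq_square power_divide) (simp add: algebra_simps)
qed (auto simp: sfun_def)

lemma sfun_bound:
  assumes "norm y \<le> 1/2"
  shows "norm (sfun y) \<le> 4 * norm y"
proof -
  have "1/2 \<le> norm (1 - y)" using norm_triangle_ineq2[of 1 y] assms by simp
  then have "(1/2)\<^sup>2 \<le> (norm (1 - y))\<^sup>2" by (intro power_mono) auto
  then have "1/4 \<le> (norm (1 - y))\<^sup>2" by (simp add: power_divide)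
  then have "norm y / (norm (1 - y))\<^sup>2 \<le> norm y / (1/4)" by (intro divide_left_mono) auto
  then show ?thesis by (simp add: sfun_def norm_divide norm_power)
qed

text \<open>A geometric majorant near each point gives locally uniform convergence.\<close>

lemma series_holomorphic:
  fixes f :: "nat \<Rightarrow> complex \<Rightarrow> complex"
  assumes U: "open U" and hol: "\<And>n. f n holomorphic_on U"
    and bd: "\<And>x. x \<in> U \<Longrightarrow> \<exists>d C r N. d > 0 \<and> 0 \<le> r \<and> r < 1 \<and> (\<forall>n\<ge>N. \<forall>y\<in>ball x d \<inter> U. norm (f n y) \<le> C * r ^ n)"
  shows "(\<lambda>x. \<Sum>n. f n x) holomorphic_on U" "\<And>x. x \<in> U \<Longrightarrow> summable (\<lambda>n. f n x)"
proof -
  have der: "(f n has_field_derivative deriv (f n) x) (at x)" if "x \<in> U" for n x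
    using holomorphic_derivI[OF hol U that] by simp
  have ex: "\<exists>d h. 0 < d \<and> summable h \<and> range h \<subseteq> \<real>\<^sub>\<ge>\<^sub>0 \<and>
      (\<forall>\<^sub>F n in sequentially. \<forall>y\<in>ball x d \<inter> U. cmod (f n y) \<le> cmod (h n))"
    if x: "x \<in> U" for x
  proof -
    obtain d C r N where *: "d > 0" "0 \<le> r" "r < 1" "\<forall>n\<ge>N. \<forall>y\<in>ball x d \<inter> U. norm (f n y) \<le> C * r ^ n"
      using bd[OF x] by blast
    have le: "norm (f n y) \<le> \<bar>C\<bar> * r ^ n" if "n \<ge> N" "y \<in> ball x d \<inter> U" for n y
    proof -
      have "C * r ^ n \<le> \<bar>C\<bar> * r ^ n" using * by (intro mult_right_mono) auto
      then show ?thesis using * that by (meson order_trans)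
    qed
    show ?thesis
    proof (intro exI conjI)
      show "summable (\<lambda>n. complex_of_real (\<bar>C\<bar> * r ^ n))"
        unfolding summable_of_real_iff using * by (intro summable_mult summable_geometric) auto
      show "range (\<lambda>n. complex_of_real (\<bar>C\<bar> * r ^ n)) \<subseteq> \<real>\<^sub>\<ge>\<^sub>0" using * by auto
      show "\<forall>\<^sub>F n in sequentially. \<forall>y\<in>ball x d \<inter> U. cmod (f n y) \<le> cmod (complex_of_real (\<bar>C\<bar> * r ^ n))"
        using le * unfolding eventually_sequentially by (intro exI[of _ N]) (auto simp: norm_mult norm_power)
    qed (rule *)
  qed
  from series_and_derivative_comparison_complex[OF U der ex]
  obtain g g' where g: "\<And>x. x \<in> U \<Longrightarrow> ((\<lambda>n. f n x) sums g x) \<and> ((\<lambda>n. deriv (f n) x) sums g' x) \<and> (g has_field_derivative g' x) (at x)"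
    by blast
  show "\<And>x. x \<in> U \<Longrightarrow> summable (\<lambda>n. f n x)" using g sums_summable by blast
  have "g holomorphic_on U" using g unfolding holomorphic_on_open[OF U] by blast
  then show "(\<lambda>x. \<Sum>n. f n x) holomorphic_on U"
    by (rule holomorphic_transform) (use g sums_unique in metis)
qed


definition ser :: "complex \<Rightarrow> complex \<Rightarrow> complex" where
  "ser q x = (\<Sum>n. sfun (x * q ^ n))"

lemma ser_term_bound:
  assumes "norm q \<le> r" "r < 1" "norm x \<le> X" "X * r ^ N \<le> 1/2" "n \<ge> N" "0 \<le> X"
  shows "norm (sfun (x * q ^ n)) \<le> 4 * X * r ^ n"
proof -
  have r0: "0 \<le> r" using assms(1) norm_ge_zero order_trans by blast
  have le: "norm (x * q ^ n) \<le> X * r ^ n"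
    unfolding norm_mult norm_power using assms by (intro mult_mono power_mono) auto
  have "r ^ n \<le> r ^ N" using assms r0 by (intro power_decreasing) auto
  then have "X * r ^ n \<le> X * r ^ N" using assms(6) by (rule mult_left_mono)
  then have "norm (x * q ^ n) \<le> 1/2" using le assms by linarith
  from sfun_bound[OF this] show ?thesis using le by simp
qed

lemma ex_power_small:
  assumes "0 \<le> (r::real)" "r < 1"
  shows "\<exists>N. X * r ^ N \<le> 1/2"
proof -
  have "(\<lambda>N. X * r ^ N) \<longlonglongrightarrow> X * 0" using assms by (intro tendsto_intros LIMSEQ_power_zero) auto
  then have "\<forall>\<^sub>F N in sequentially. X * r ^ N < 1/2" by (rule order_tendstoD) simp
  then show ?thesis by (meson eventually_happens' less_imp_le sequentially_bot)
qed

lemma ser_summable: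
  assumes "norm q < 1"
  shows "summable (\<lambda>n. sfun (x * q ^ n))"
proof -
  obtain N where N: "norm x * norm q ^ N \<le> 1/2" using ex_power_small[of "norm q"] assms by auto
  have "norm (sfun (x * q ^ n)) \<le> 4 * norm x * norm q ^ n" if "n \<ge> N" for n
    using ser_term_bound[of q "norm q" x "norm x" N n] assms N that by simp
  moreover have "summable (\<lambda>n. 4 * norm x * norm q ^ n)" using assms by (intro summable_mult summable_geometric) auto
  ultimately show ?thesis by (rule summable_comparison_test'[rotated])
qed

lemma ser_rec: "norm q < 1 \<Longrightarrow> ser q x = sfun x + ser q (x * q)"
  unfolding ser_def using suminf_split_head[OF ser_summable[of q x]] by (simp add: mult.assoc)

text \<open>
  Up to a factor and an additive constant, \<open>wp \<tau>\<close> is the Weierstrass function of the lattice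
  \<open>\<int> + \<int>\<tau>\<close>: it is the sum of \<open>sfun (x q\<^sup>n) = - 1 / (4 sin\<^sup>2 (\<pi> (z + n \<tau>)))\<close> over all integers \<open>n\<close>.
\<close>

definition wp :: "complex \<Rightarrow> complex \<Rightarrow> complex" where
  "wp \<tau> z = (let q = exp (2 * of_real pi * \<i> * \<tau>); x = exp (2 * of_real pi * \<i> * z) in ser q x + ser q (q / x))"

lemma norm_exp_2pii: "norm (exp (2 * of_real pi * \<i> * \<tau>)) = exp (- 2 * pi * Im \<tau>)"
  by simp

lemma exp_2pii_less_1: "Im \<tau> > 0 \<Longrightarrow> norm (exp (2 * of_real pi * \<i> * \<tau>)) < 1"
  by simp

lemma exp_2pii_add_1: "exp (2 * of_real pi * \<i> * (z + 1)) = exp (2 * of_real pi * \<i> * z)"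
  by (simp only: distrib_left mult_1_right exp_add exp_two_pi_i)

lemma wp_add_1: "wp \<tau> (z + 1) = wp \<tau> z"
  by (simp only: wp_def exp_2pii_add_1)

lemma wp_add_1_tau: "wp (\<tau> + 1) z = wp \<tau> z"
  by (simp only: wp_def exp_2pii_add_1)

text \<open>The shift replaces \<open>x\<close> by \<open>x * q\<close>: the term
  \<open>sfun x\<close> leaves one half of the sum and enters the other as
  \<open>sfun (1 / x)\<close>, which is the same.\<close>

lemma wp_add_tau:
  assumes "Im \<tau> > 0"
  shows "wp \<tau> (z + \<tau>) = wp \<tau> z"
proof -
  define q x where "q = exp (2 * of_real pi * \<i> * \<tau>)" and "x = exp (2 * of_real pi * \<i> * z)"
  have q: "norm q < 1" "q \<noteq> 0" "x \<noteq> 0" using exp_2pii_less_1[OF assms] by (simp_all add: q_def x_def)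
  have "exp (2 * of_real pi * \<i> * (z + \<tau>)) = x * q" by (simp add: x_def q_def algebra_simps flip: exp_add)
  then have "wp \<tau> (z + \<tau>) = ser q (x * q) + ser q (q / (x * q))" by (simp add: wp_def flip: q_def)
  also have "q / (x * q) = 1 / x" using q by simp
  also have "ser q (1 / x) = sfun x + ser q (q / x)" using ser_rec[OF q(1), of "1 / x"] by (simp add: sfun_inverse)
  also have "ser q (x * q) + (sfun x + ser q (q / x)) = wp \<tau> z"
    using ser_rec[OF q(1), of x] by (simp add: wp_def flip: q_def x_def)
  finally show ?thesis .
qed

lemma wp_uminus:
  assumes "Im \<tau> > 0"
  shows "wp \<tau> (- z) = wp \<tau> z"
proof -
  define q x where "q = exp (2 * of_real pi * \<i> * \<tau>)" and "x = exp (2 * of_real pi * \<i> * z)"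
  have q: "norm q < 1" "q \<noteq> 0" "x \<noteq> 0" using exp_2pii_less_1[OF assms] by (simp_all add: q_def x_def)
  have "exp (2 * of_real pi * \<i> * (- z)) = 1 / x" by (simp add: x_def exp_minus divide_inverse)
  then have "wp \<tau> (- z) = ser q (1 / x) + ser q (q * x)" by (simp add: wp_def flip: q_def)
  also have "ser q (1 / x) = sfun x + ser q (q / x)" using ser_rec[OF q(1), of "1 / x"] by (simp add: sfun_inverse)
  also have "sfun x + ser q (q / x) + ser q (q * x) = ser q x + ser q (q / x)"
    using ser_rec[OF q(1), of x] by (simp add: mult.commute)
  also have "\<dots> = wp \<tau> z" by (simp only: wp_def Let_def q_def x_def)
  finally show ?thesis .
qed

lemma exp_2pii_eq_1_iff: "exp (2 * of_real pi * \<i> * z) = 1 \<longleftrightarrow> z \<in> \<int>"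
proof -
  have "exp (2 * of_real pi * \<i> * z) = 1 \<longleftrightarrow> (\<exists>n::int. 2 * of_real pi * \<i> * z = of_int (2 * n) * (of_real pi * \<i>))"
    unfolding exp_eq_1 by (auto simp: complex_eq_iff)
  also have "\<dots> \<longleftrightarrow> (\<exists>n::int. z = of_int n)"
    by (intro ex_cong1) (auto simp: field_simps)
  finally show ?thesis by (auto elim: Ints_cases)
qed

text \<open>The parameters cover both halves of \<open>wp\<close> (\<open>c = 1\<close>,
  \<open>k = 0\<close> and \<open>c = -1\<close>, \<open>k = 1\<close>) and, with
  \<open>c = 1\<close>, \<open>k = 1\<close>, the first half without its singular term at 0.\<close>

lemma wp_series_holomorphic:
  assumes "Im \<tau> > 0" and U: "open U"
    and c: "c = 1 \<or> c = -1" and avoid: "\<And>n z. z \<in> U \<Longrightarrow> c * z + of_nat (n + k) * \<tau> \<notin> \<int>"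
  shows "(\<lambda>z. ser (exp (2 * of_real pi * \<i> * \<tau>)) (exp (2 * of_real pi * \<i> * (c * z + of_nat k * \<tau>)))) holomorphic_on U"
proof -
  define q where "q = exp (2 * of_real pi * \<i> * \<tau>)"
  define x where "x z = exp (2 * of_real pi * \<i> * (c * z + of_nat k * \<tau>))" for z
  have q: "norm q < 1" using exp_2pii_less_1[OF assms(1)] by (simp add: q_def)
  have xq: "x z * q ^ n = exp (2 * of_real pi * \<i> * (c * z + of_nat (n + k) * \<tau>))" for z n
    by (simp add: x_def q_def algebra_simps flip: exp_add exp_of_nat_mult)
  have "(\<lambda>z. \<Sum>n. sfun (x z * q ^ n)) holomorphic_on U"
  proof (rule series_holomorphic(1)[OF U])
    fix n
    have "x z * q ^ n \<noteq> 1" if "z \<in> U" for z unfolding xq exp_2pii_eq_1_iff using avoid that by blast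
    then show "(\<lambda>z. sfun (x z * q ^ n)) holomorphic_on U"
      unfolding sfun_def x_def by (intro holomorphic_intros) (auto simp: x_def)
  next
    fix z assume "z \<in> U"
    have "continuous_on (cball z 1) x" unfolding x_def by (intro continuous_intros)
    then have "bounded (x ` cball z 1)" by (intro compact_imp_bounded compact_continuous_image) auto
    then obtain X where "\<forall>w\<in>x ` cball z 1. norm w \<le> X" unfolding bounded_iff by blast
    then have X: "\<And>y. y \<in> cball z 1 \<Longrightarrow> norm (x y) \<le> X" by blast
    have "0 \<le> X" using order_trans[OF norm_ge_zero X[of z]] by simp
    obtain N where N: "X * norm q ^ N \<le> 1/2" using ex_power_small[of "norm q" X] q by auto
    show "\<exists>d C r N. d > 0 \<and> 0 \<le> r \<and> r < 1 \<and> (\<forall>n\<ge>N. \<forall>y\<in>ball z d \<inter> U. norm (sfun (x y * q ^ n)) \<le> C * r ^ n)"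
    proof (rule exI[of _ 1], rule exI[of _ "4 * X"], rule exI[of _ "norm q"], rule exI[of _ N], intro conjI allI impI ballI)
      fix n y assume "N \<le> n" "y \<in> ball z 1 \<inter> U"
      then show "norm (sfun (x y * q ^ n)) \<le> 4 * X * norm q ^ n"
        using X N q \<open>0 \<le> X\<close> by (intro ser_term_bound[where N = N]) auto
    qed (use q in auto)
  qed
  then show ?thesis by (simp add: ser_def q_def x_def)
qed

lemma lattice_1_iff: "c * z + of_int n * \<tau> \<in> \<int> \<Longrightarrow> c = 1 \<or> c = -1 \<Longrightarrow> z \<in> lattice 1 \<tau>"
proof -
  assume "c * z + of_int n * \<tau> \<in> \<int>" and c: "c = 1 \<or> c = -1"
  then obtain m where m: "c * z + of_int n * \<tau> = of_int m" by (auto elim: Ints_cases)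
  have "c * z = of_int m * of_real 1 + of_int (- n) * \<tau>" using m by (simp add: algebra_simps)
  then have *: "c * z \<in> lattice 1 \<tau>" unfolding lattice_def by blast
  from c show ?thesis using * lattice_uminus[of "- z" 1 \<tau>] by auto
qed

lemma lattice_1_nat: "c * z + of_nat n * \<tau> \<in> \<int> \<Longrightarrow> c = 1 \<or> c = -1 \<Longrightarrow> z \<in> lattice 1 \<tau>"
  using lattice_1_iff[of c z "int n" \<tau>] by simp

lemma wp_eq: "wp \<tau> z = ser (exp (2 * of_real pi * \<i> * \<tau>)) (exp (2 * of_real pi * \<i> * (1 * z + of_nat 0 * \<tau>)))
     + ser (exp (2 * of_real pi * \<i> * \<tau>)) (exp (2 * of_real pi * \<i> * (- 1 * z + of_nat 1 * \<tau>)))"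
proof -
  have "exp (2 * of_real pi * \<i> * \<tau>) / exp (2 * of_real pi * \<i> * z) = exp (2 * of_real pi * \<i> * (- 1 * z + of_nat 1 * \<tau>))"
    by (simp add: algebra_simps flip: exp_diff)
  then show ?thesis by (simp only: wp_def Let_def) simp
qed

lemma wp_holomorphic:
  assumes "Im \<tau> > 0"
  shows "wp \<tau> holomorphic_on - lattice 1 \<tau>"
proof -
  have "(\<lambda>z. ser (exp (2 * of_real pi * \<i> * \<tau>)) (exp (2 * of_real pi * \<i> * (1 * z + of_nat 0 * \<tau>)))
     + ser (exp (2 * of_real pi * \<i> * \<tau>)) (exp (2 * of_real pi * \<i> * (- 1 * z + of_nat 1 * \<tau>)))) holomorphic_on - lattice 1 \<tau>"
  proof (intro holomorphic_on_add wp_series_holomorphic)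
    show "open (- lattice 1 \<tau>)" using closed_lattice[of 1 \<tau>] assms by (simp add: open_Compl)
    show "open (- lattice 1 \<tau>)" by fact
    fix n z assume z: "z \<in> - lattice 1 \<tau>"
    show "1 * z + of_nat (n + 0) * \<tau> \<notin> \<int>" using lattice_1_nat[of 1 z "n + 0" \<tau>] z by blast
    show "- 1 * z + of_nat (n + 1) * \<tau> \<notin> \<int>" using lattice_1_nat[of "-1" z "n + 1" \<tau>] z by blast
  qed (use assms in auto)
  then show ?thesis unfolding wp_eq[abs_def] .
qed

text \<open>In the strip \<open>\<bar>Im z\<bar> < Im \<tau>\<close> only one term is singular at 0,
  and \<open>z\<^sup>2 * sfun (exp (a * z))\<close> tends to \<open>1 / a\<^sup>2\<close> with
  \<open>a = 2 \<pi> i\<close>.\<close>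

lemma wp_principal_part:
  assumes "Im \<tau> > 0"
  shows "((\<lambda>z. z\<^sup>2 * wp \<tau> z) \<longlongrightarrow> - 1 / (4 * of_real pi ^ 2)) (at 0)"
proof -
  define q where "q = exp (2 * of_real pi * \<i> * \<tau>)"
  have q: "norm q < 1" using exp_2pii_less_1[OF assms] by (simp add: q_def)
  define U where "U = {z. \<bar>Im z\<bar> < Im \<tau>}"
  have U: "open U" unfolding U_def by (intro open_Collect_less continuous_intros)
  define R where "R z = ser q (exp (2 * of_real pi * \<i> * (1 * z + of_nat 1 * \<tau>)))
     + ser q (exp (2 * of_real pi * \<i> * (- 1 * z + of_nat 1 * \<tau>)))" for z
  have av: "c * z + of_nat (n + 1) * \<tau> \<notin> \<int>" if "z \<in> U" "c = 1 \<or> c = -1" for c z n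
  proof
    assume "c * z + of_nat (n + 1) * \<tau> \<in> \<int>"
    then obtain m where "c * z + of_nat (n + 1) * \<tau> = of_int m" by (elim Ints_cases)
    then have "Im (c * z + of_nat (n + 1) * \<tau>) = Im (of_int m)" by (rule arg_cong)
    then have "Im (c * z) + of_nat (n + 1) * Im \<tau> = 0" by simp
    moreover have "\<bar>Im (c * z)\<bar> < Im \<tau>" using that by (auto simp: U_def)
    moreover have "of_nat (n + 1) * Im \<tau> \<ge> Im \<tau>" using assms by simp
    ultimately show False by linarith
  qed
  have R_hol: "R holomorphic_on U" unfolding R_def q_def
  proof (intro holomorphic_on_add wp_series_holomorphic)
    fix n z assume z: "z \<in> U"
    show "1 * z + of_nat (n + 1) * \<tau> \<notin> \<int>" using av[OF z, of 1 n] by blast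
    show "- 1 * z + of_nat (n + 1) * \<tau> \<notin> \<int>" using av[OF z, of "-1" n] by blast
  qed (use U assms in auto)
  have wp_R: "wp \<tau> z = sfun (exp (2 * of_real pi * \<i> * z)) + R z" for z
  proof -
    have "exp (2 * of_real pi * \<i> * z) * q = exp (2 * of_real pi * \<i> * (1 * z + of_nat 1 * \<tau>))"
      by (simp add: q_def algebra_simps flip: exp_add)
    then show ?thesis unfolding wp_eq R_def q_def[symmetric]
      using ser_rec[OF q, of "exp (2 * of_real pi * \<i> * z)"] by simp
  qed
  have lim1: "((\<lambda>z. z\<^sup>2 * R z) \<longlongrightarrow> 0\<^sup>2 * R 0) (at 0)"
  proof (intro tendsto_intros)
    have "isCont R 0" using holomorphic_on_imp_continuous_on[OF R_hol] U assms
      by (simp add: continuous_on_eq_continuous_at U_def)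
    then show "(R \<longlongrightarrow> R 0) (at 0)" by (simp add: isCont_def)
  qed
  define a where "a = 2 * of_real pi * \<i>"
  have d: "((\<lambda>z. (exp (a * z) - 1) / z) \<longlongrightarrow> a) (at 0)"
  proof -
    have "((\<lambda>z. exp (a * z)) has_field_derivative a) (at 0)" by (auto intro!: derivative_eq_intros)
    then show ?thesis unfolding has_field_derivative_iff by simp
  qed
  have "((\<lambda>z. exp (a * z) / ((exp (a * z) - 1) / z)\<^sup>2) \<longlongrightarrow> exp (a * 0) / a\<^sup>2) (at 0)"
    by (intro tendsto_intros d) (simp add: a_def)
  then have "((\<lambda>z. exp (a * z) / ((exp (a * z) - 1) / z)\<^sup>2) \<longlongrightarrow> 1 / a\<^sup>2) (at 0)" by simp
  then have lim2: "((\<lambda>z. z\<^sup>2 * sfun (exp (a * z))) \<longlongrightarrow> 1 / a\<^sup>2) (at 0)"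
    by (rule Lim_transform_eventually)
      (simp add: sfun_def power_divide eventually_at_filter power2_commute)
  from tendsto_add[OF lim2 lim1]
  have "((\<lambda>z. z\<^sup>2 * wp \<tau> z) \<longlongrightarrow> 1 / a\<^sup>2) (at 0)" by (simp add: wp_R a_def algebra_simps)
  then show ?thesis by (simp add: a_def power_mult_distrib)
qed

lemma neg_inverse_uhp: "Im \<tau> > 0 \<Longrightarrow> Im (- 1 / \<tau>) > 0"
  using mob_uhp[of \<tau> 0 0 "-1" 1] by (simp add: mob_def)

lemma lattice_neg_inverse: "Im \<tau> > 0 \<Longrightarrow> z / \<tau> \<in> lattice 1 (- 1 / \<tau>) \<longleftrightarrow> z \<in> lattice 1 \<tau>"
proof -
  assume t: "Im \<tau> > 0"
  then have nz: "\<tau> \<noteq> 0" by auto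
  show ?thesis
  proof
    assume "z / \<tau> \<in> lattice 1 (- 1 / \<tau>)"
    then obtain m n where "z / \<tau> = of_int m * of_real 1 + of_int n * (- 1 / \<tau>)" by (auto simp: lattice_def)
    then have "z = of_int (- n) * of_real 1 + of_int m * \<tau>" using nz by (simp add: field_simps)
    then show "z \<in> lattice 1 \<tau>" unfolding lattice_def by blast
  next
    assume "z \<in> lattice 1 \<tau>"
    then obtain m n where "z = of_int m * of_real 1 + of_int n * \<tau>" by (auto simp: lattice_def)
    then have "z / \<tau> = of_int n * of_real 1 + of_int (- m) * (- 1 / \<tau>)" using nz by (simp add: field_simps)
    then show "z / \<tau> \<in> lattice 1 (- 1 / \<tau>)" unfolding lattice_def by blast
  qed
qed

text \<open>Both sides are elliptic in \<open>z\<close> for the same lattice and have the same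
  double pole at 0, so their difference is an even elliptic function without pole, hence constant.
  The constant \<open>C\<close> reflects the additive normalisation of \<open>wp\<close>.\<close>

lemma wp_neg_inverse:
  assumes t: "Im \<tau> > 0"
  obtains C where "\<And>z. z \<notin> lattice 1 \<tau> \<Longrightarrow> wp (- 1 / \<tau>) (z / \<tau>) = \<tau>\<^sup>2 * wp \<tau> z + C"
proof -
  have nz: "\<tau> \<noteq> 0" using t by auto
  note t' = neg_inverse_uhp[OF t]
  define f where "f z = wp (- 1 / \<tau>) (z / \<tau>) - \<tau>\<^sup>2 * wp \<tau> z" for z
  have "wp (- 1 / \<tau>) \<circ> (\<lambda>z. z / \<tau>) holomorphic_on - lattice 1 \<tau>"
    using lattice_neg_inverse[OF t] nz
    by (intro holomorphic_on_compose_gen[OF _ wp_holomorphic[OF t']] holomorphic_intros) auto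
  then have hol: "f holomorphic_on - lattice 1 \<tau>"
    unfolding f_def using wp_holomorphic[OF t] by (intro holomorphic_intros) (auto simp: o_def)
  have even: "f (- z) = f z" for z using wp_uminus[OF t] wp_uminus[OF t', of "z / \<tau>"] by (simp add: f_def)
  obtain r where r: "r > 0" "\<And>z. z \<in> ball 0 r \<Longrightarrow> z \<in> lattice 1 \<tau> \<Longrightarrow> z = 0"
    using lattice_isolated_0[of 1 \<tau>] t by auto
  have lim: "((\<lambda>z. z\<^sup>2 * f z) \<longlongrightarrow> 0) (at 0)"
  proof -
    have "filterlim (\<lambda>z. z / \<tau>) (at 0) (at 0)"
      using nz by (auto simp: filterlim_at eventually_at_filter intro!: tendsto_eq_intros)
    from filterlim_compose[OF wp_principal_part[OF t'] this]
    have "((\<lambda>z. \<tau>\<^sup>2 * ((z / \<tau>)\<^sup>2 * wp (- 1 / \<tau>) (z / \<tau>)) - \<tau>\<^sup>2 * (z\<^sup>2 * wp \<tau> z)) \<longlongrightarrow>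
       \<tau>\<^sup>2 * (- 1 / (4 * of_real pi ^ 2)) - \<tau>\<^sup>2 * (- 1 / (4 * of_real pi ^ 2))) (at 0)"
      by (intro tendsto_intros wp_principal_part[OF t])
    then show ?thesis using nz by (simp add: f_def power_divide algebra_simps)
  qed
  obtain L where L: "(f \<longlongrightarrow> L) (at 0)"
    using even_pole_removable[OF r(1) holomorphic_on_subset[OF hol] even lim] r by blast
  have "f z = L" if "z \<notin> lattice 1 \<tau>" for z
  proof (rule elliptic_constant[OF _ t hol _ _ L that])
    fix z
    show "f (z + of_real 1) = f z"
      using wp_add_tau[OF t', of "z / \<tau> + 1"] wp_add_1[of "- 1 / \<tau>" "z / \<tau>"] wp_add_tau[OF t', of "(z + 1) / \<tau>"] nz
      by (simp add: f_def wp_add_1 add_divide_distrib)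
    show "f (z + \<tau>) = f z" using nz by (simp add: f_def wp_add_tau[OF t] add_divide_distrib wp_add_1)
  qed auto
  then show ?thesis by (intro that[of L]) (auto simp: f_def algebra_simps)
qed

lemma half_not_lattice:
  assumes "Im \<tau> > 0"
  shows "1/2 \<notin> lattice 1 \<tau>" "\<tau>/2 \<notin> lattice 1 \<tau>" "(1 + \<tau>)/2 \<notin> lattice 1 \<tau>" "\<tau>/2 \<notin> lattice (1/2) \<tau>"
proof -
  have half: "(1/2::real) \<notin> \<int>"
  proof
    assume "(1/2::real) \<in> \<int>"
    then obtain n where "1/2 = real_of_int n" by (auto elim: Ints_cases)
    then have "real_of_int (2 * n) = of_int 1" by simp
    then have "2 * n = 1" by (simp only: of_int_eq_iff)
    then show False by presburger
  qed
  show "1/2 \<notin> lattice 1 \<tau>" "\<tau>/2 \<notin> lattice 1 \<tau>" "(1 + \<tau>)/2 \<notin> lattice 1 \<tau>" "\<tau>/2 \<notin> lattice (1/2) \<tau>"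
    using half assms by (simp_all add: lattice_iff)
qed

section \<open>The half-period values\<close>

definition e1 where "e1 \<tau> = wp \<tau> (1/2)"
definition e2 where "e2 \<tau> = wp \<tau> (\<tau>/2)"
definition e3 where "e3 \<tau> = wp \<tau> ((1 + \<tau>)/2)"

lemma e_add_1: "Im \<tau> > 0 \<Longrightarrow> e1 (\<tau> + 1) = e1 \<tau>" "Im \<tau> > 0 \<Longrightarrow> e2 (\<tau> + 1) = e3 \<tau>" "Im \<tau> > 0 \<Longrightarrow> e3 (\<tau> + 1) = e2 \<tau>"
proof -
  show "e1 (\<tau> + 1) = e1 \<tau>" by (simp add: e1_def wp_add_1_tau)
  show "e2 (\<tau> + 1) = e3 \<tau>" unfolding e2_def e3_def wp_add_1_tau by (simp add: add.commute)
  have "(1 + (\<tau> + 1)) / 2 = \<tau> / 2 + 1" by (simp add: field_simps)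
  then show "e3 (\<tau> + 1) = e2 \<tau>" unfolding e2_def e3_def wp_add_1_tau by (simp only: wp_add_1)
qed

text \<open>The inversion permutes the half periods modulo the lattice and up to sign. The constant
  \<open>C\<close> is the same for all three values, so their differences transform with weight
  2.\<close>

lemma e_neg_inverse:
  assumes t: "Im \<tau> > 0"
  obtains C where "e1 (- 1 / \<tau>) = \<tau>\<^sup>2 * e2 \<tau> + C" "e2 (- 1 / \<tau>) = \<tau>\<^sup>2 * e1 \<tau> + C" "e3 (- 1 / \<tau>) = \<tau>\<^sup>2 * e3 \<tau> + C"
proof -
  have nz: "\<tau> \<noteq> 0" using t by auto
  obtain C where C: "\<And>z. z \<notin> lattice 1 \<tau> \<Longrightarrow> wp (- 1 / \<tau>) (z / \<tau>) = \<tau>\<^sup>2 * wp \<tau> z + C"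
    using wp_neg_inverse[OF t] by blast
  note h = half_not_lattice[OF t]
  show ?thesis
  proof (rule that)
    show "e1 (- 1 / \<tau>) = \<tau>\<^sup>2 * e2 \<tau> + C" using C[OF h(2)] nz by (simp add: e1_def e2_def)
    have "- (1/2) \<notin> lattice 1 \<tau>" using h(1) lattice_uminus[of "- (1/2)" 1 \<tau>] by auto
    from C[OF this] have "wp (- 1 / \<tau>) (- (1/2) / \<tau>) = \<tau>\<^sup>2 * wp \<tau> (1/2) + C"
      by (simp only: wp_uminus[OF t])
    moreover have "- (1/2) / \<tau> = (- 1 / \<tau>) / 2" by simp
    ultimately show "e2 (- 1 / \<tau>) = \<tau>\<^sup>2 * e1 \<tau> + C" by (simp only: e1_def e2_def)
    have "(1 + \<tau>)/2 + (-1) \<notin> lattice 1 \<tau>"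
      using h(3) lattice_add_iff[of "-1" 1 \<tau>] lattice_uminus[of 1 1 \<tau>] lattice_gens(1)[of 1 \<tau>] by simp
    from C[OF this] have "wp (- 1 / \<tau>) (((1 + \<tau>)/2 + (-1)) / \<tau>) = \<tau>\<^sup>2 * wp \<tau> ((1 + \<tau>)/2 + (-1)) + C" .
    moreover have "((1 + \<tau>)/2 + (-1)) / \<tau> = (1 + - 1 / \<tau>) / 2" using nz by (simp add: field_simps)
    moreover have "wp \<tau> ((1 + \<tau>)/2 + (-1)) = e3 \<tau>" using wp_add_1[of \<tau> "(1 + \<tau>)/2 + (-1)"] by (simp add: e3_def)
    ultimately show "e3 (- 1 / \<tau>) = \<tau>\<^sup>2 * e3 \<tau> + C" by (simp only: e3_def)
  qed
qed

lemma countable_lattice: "countable (lattice h \<tau>)"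
proof -
  have "lattice h \<tau> = (\<lambda>(m, n). of_int m * of_real h + of_int n * \<tau>) ` UNIV" by (auto simp: lattice_def)
  then show ?thesis by (simp only: countable_image[OF countableI_type])
qed

text \<open>
  Both zeros of \<open>wp \<tau> - e1 \<tau>\<close> at \<open>1/2\<close> cancel the double pole of its translate, so the product below
  is constant.
\<close>

lemma e1_neq_e2:
  assumes t: "Im \<tau> > 0"
  shows "e1 \<tau> \<noteq> e2 \<tau>"
proof
  assume eq: "e1 \<tau> = e2 \<tau>"
  define \<phi> where "\<phi> z = wp \<tau> (z + 1/2) - e1 \<tau>" for z
  define G where "G z = (wp \<tau> z - e1 \<tau>) * \<phi> z" for z
  note wph = wp_holomorphic[OF t]
  have sub: "lattice 1 \<tau> \<subseteq> lattice (1/2) \<tau>"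
  proof
    fix z assume "z \<in> lattice 1 \<tau>"
    then obtain m n where "z = of_int m * of_real 1 + of_int n * \<tau>" by (auto simp: lattice_def)
    then have "z = of_int (2 * m) * of_real (1/2) + of_int n * \<tau>" by simp
    then show "z \<in> lattice (1/2) \<tau>" unfolding lattice_def by blast
  qed
  have shift: "z + 1/2 \<in> lattice (1/2) \<tau> \<longleftrightarrow> z \<in> lattice (1/2) \<tau>" for z
    using lattice_add_iff[OF lattice_gens(1)[of "1/2" \<tau>], of z] by simp
  obtain r0 where r0: "r0 > 0" "\<And>z. z \<in> ball 0 r0 \<Longrightarrow> z \<in> lattice (1/2) \<tau> \<Longrightarrow> z = 0"
    using lattice_isolated_0[of "1/2" \<tau>] t by auto
  have wp1: "(\<lambda>z. wp \<tau> (z + 1/2)) holomorphic_on - {z. z + 1/2 \<in> lattice 1 \<tau>}"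
  proof -
    have "wp \<tau> \<circ> (\<lambda>z. z + 1/2) holomorphic_on - {z. z + 1/2 \<in> lattice 1 \<tau>}"
      by (intro holomorphic_on_compose_gen[OF _ wph] holomorphic_intros) auto
    then show ?thesis by (simp add: o_def)
  qed
  have \<phi>_hol: "\<phi> holomorphic_on - {z. z + 1/2 \<in> lattice 1 \<tau>}" unfolding \<phi>_def by (intro holomorphic_intros wp1)
  have \<phi>_sub: "\<phi> holomorphic_on ball 0 r0 - {0}"
    using r0 sub shift by (intro holomorphic_on_subset[OF \<phi>_hol]) blast
  have \<phi>_even: "\<phi> (- z) = \<phi> z" for z
  proof -
    have "- z + 1/2 = - (z - 1/2)" "z + 1/2 = z - 1/2 + 1" by simp_all
    then show ?thesis unfolding \<phi>_def by (simp only: wp_uminus[OF t] wp_add_1)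
  qed
  have \<phi>_lim: "(\<phi> \<longlongrightarrow> 0) (at 0)"
  proof -
    have "open (- {z. z + 1/2 \<in> lattice 1 \<tau>})"
    proof -
      have "- {z. z + 1/2 \<in> lattice 1 \<tau>} = (\<lambda>z. z + 1/2) -` (- lattice 1 \<tau>)" by auto
      moreover have "open ((\<lambda>z. z + 1/2) -` (- lattice 1 \<tau>))"
        using closed_lattice[of 1 \<tau>] t by (intro continuous_open_vimage continuous_intros) auto
      ultimately show ?thesis by simp
    qed
    moreover have "0 \<in> - {z. z + 1/2 \<in> lattice 1 \<tau>}" using half_not_lattice(1)[OF t] by simp
    ultimately have "isCont \<phi> 0"
      using holomorphic_on_imp_continuous_on[OF \<phi>_hol] continuous_on_eq_continuous_at by blast
    then show ?thesis by (simp add: isCont_def \<phi>_def e1_def)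
  qed
  have "\<exists>L. ((\<lambda>z. \<phi> z / z\<^sup>2) \<longlongrightarrow> L) (at 0)"
  proof (rule even_pole_removable[OF r0(1)])
    show "(\<lambda>z. \<phi> z / z\<^sup>2) holomorphic_on ball 0 r0 - {0}" by (intro holomorphic_intros \<phi>_sub) auto
    show "((\<lambda>z. z\<^sup>2 * (\<phi> z / z\<^sup>2)) \<longlongrightarrow> 0) (at 0)"
      by (rule Lim_transform_eventually[OF \<phi>_lim]) (auto simp: eventually_at_filter)
  qed (simp add: \<phi>_even)
  then obtain L where L: "((\<lambda>z. \<phi> z / z\<^sup>2) \<longlongrightarrow> L) (at 0)" by blast
  have wplim: "((\<lambda>z. z\<^sup>2 * (wp \<tau> z - e1 \<tau>)) \<longlongrightarrow> - 1 / (4 * of_real pi ^ 2) - 0\<^sup>2 * e1 \<tau>) (at 0)"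
    unfolding right_diff_distrib by (intro tendsto_intros wp_principal_part[OF t])
  have "((\<lambda>z. (z\<^sup>2 * (wp \<tau> z - e1 \<tau>)) * (\<phi> z / z\<^sup>2)) \<longlongrightarrow> (- 1 / (4 * of_real pi ^ 2) - 0\<^sup>2 * e1 \<tau>) * L) (at 0)"
    by (intro tendsto_mult wplim L)
  then have "(G \<longlongrightarrow> (- 1 / (4 * of_real pi ^ 2) - 0\<^sup>2 * e1 \<tau>) * L) (at 0)"
    by (rule Lim_transform_eventually) (auto simp: eventually_at_filter G_def)
  then obtain c where c: "(G \<longlongrightarrow> c) (at 0)" by blast
  have G_const: "G z = c" if "z \<notin> lattice (1/2) \<tau>" for z
  proof (rule elliptic_constant[OF _ t _ _ _ c that])
    show "G holomorphic_on - lattice (1/2) \<tau>"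
      unfolding G_def using sub shift
      by (intro holomorphic_intros holomorphic_on_subset[OF wph] holomorphic_on_subset[OF \<phi>_hol]) auto
    fix z :: complex
    have "z + 1/2 + 1/2 = z + 1" by simp
    then show "G (z + of_real (1/2)) = G z" using wp_add_1[of \<tau> z] by (simp add: G_def \<phi>_def add.assoc mult.commute)
    have "z + \<tau> + 1/2 = z + 1/2 + \<tau>" by simp
    from this show "G (z + \<tau>) = G z" by (simp only: G_def \<phi>_def wp_add_tau[OF t])
  qed auto
  \<comment> \<open>Here the assumption enters: the first factor of \<open>G\<close> vanishes at
    \<open>\<tau>/2\<close>, so the constant is 0, and the translated factor has to vanish near
    0.\<close>
  have "G (\<tau>/2) = 0" using eq by (simp add: G_def e2_def)
  then have "c = 0" using G_const[OF half_not_lattice(4)[OF t]] by simp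
  have "\<forall>\<^sub>F z in at 0. z\<^sup>2 * (wp \<tau> z - e1 \<tau>) \<noteq> 0"
    using wplim by (rule tendsto_imp_eventually_ne) simp
  moreover have "\<forall>\<^sub>F z in at 0. z \<in> ball 0 r0 - {0}" 
    unfolding eventually_at using r0(1) by (intro exI[of _ r0]) (auto simp: dist_commute)
  ultimately have "\<forall>\<^sub>F z in at 0. wp \<tau> (z + 1/2) = e1 \<tau>"
  proof eventually_elim
    case (elim z)
    then have "G z = 0" using G_const r0 \<open>c = 0\<close> by blast
    then show ?case using elim by (auto simp: G_def \<phi>_def)
  qed
  then obtain d where d: "d > 0" "\<And>z. z \<noteq> 0 \<Longrightarrow> dist z 0 < d \<Longrightarrow> wp \<tau> (z + 1/2) = e1 \<tau>"
    unfolding eventually_at by auto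
  have ball: "wp \<tau> z = e1 \<tau>" if "z \<in> ball (1/2) d" for z
  proof (cases "z = 1/2")
    case True
    then show ?thesis by (simp only: e1_def)
  next
    case False
    then show ?thesis using d(2)[of "z - 1/2"] that by (auto simp: dist_norm norm_minus_commute)
  qed
  have conn: "connected (- lattice 1 \<tau>)"
    by (intro path_connected_imp_connected path_connected_complement_countable countable_lattice) simp
  have const: "wp \<tau> z - e1 \<tau> = 0" if "z \<in> - lattice 1 \<tau>" for z
  proof (rule analytic_continuation[of _ _ "ball (1/2) d \<inter> - lattice 1 \<tau>" "1/2" z])
    show "(\<lambda>z. wp \<tau> z - e1 \<tau>) holomorphic_on - lattice 1 \<tau>" by (intro holomorphic_intros wph)
    show "1/2 islimpt ball (1/2) d \<inter> - lattice 1 \<tau>"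
    proof (rule interior_limit_point)
      have "open (ball (1/2) d \<inter> - lattice 1 \<tau>)"
        using closed_lattice[of 1 \<tau>] t by (intro open_Int open_ball open_Compl) auto
      then show "1/2 \<in> interior (ball (1/2) d \<inter> - lattice 1 \<tau>)"
        using half_not_lattice(1)[OF t] d(1) by (simp only: interior_open) auto
    qed
  qed (use closed_lattice[of 1 \<tau>] t conn half_not_lattice(1)[OF t] ball that in auto)
  \<comment> \<open>A constant \<open>wp\<close> contradicts its double pole at 0.\<close>
  have "\<forall>\<^sub>F z in at 0. z\<^sup>2 * (wp \<tau> z - e1 \<tau>) = 0"
    using \<open>\<forall>\<^sub>F z in at 0. z \<in> ball 0 r0 - {0}\<close>
  proof eventually_elim
    case (elim z)
    then have "z \<in> - lattice 1 \<tau>" using r0 sub by blast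
    then show ?case using const by simp
  qed
  then have "((\<lambda>z. z\<^sup>2 * (wp \<tau> z - e1 \<tau>)) \<longlongrightarrow> 0) (at 0)" by (rule tendsto_eventually)
  from LIM_unique[OF this wplim] show False by simp
qed

text \<open>Translation by 1 exchanges \<open>e2\<close> and \<open>e3\<close>, inversion exchanges
  \<open>e1\<close> and \<open>e2\<close>; this carries the inequality of \<open>e1\<close> and
  \<open>e2\<close> to the other pairs.\<close>

lemma e_distinct:
  assumes "Im \<tau> > 0"
  shows "e1 \<tau> \<noteq> e2 \<tau>" "e1 \<tau> \<noteq> e3 \<tau>" "e2 \<tau> \<noteq> e3 \<tau>"
proof -
  show "e1 \<tau> \<noteq> e2 \<tau>" by (rule e1_neq_e2[OF assms])
  have e13: "e1 \<tau> \<noteq> e3 \<tau>" if "Im \<tau> > 0" for \<tau> using e1_neq_e2[of "\<tau> + 1"] e_add_1[OF that] that by simp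
  show "e1 \<tau> \<noteq> e3 \<tau>" by (rule e13[OF assms])
  obtain C where "e1 (- 1 / \<tau>) = \<tau>\<^sup>2 * e2 \<tau> + C" "e3 (- 1 / \<tau>) = \<tau>\<^sup>2 * e3 \<tau> + C"
    using e_neg_inverse[OF assms] by blast
  then show "e2 \<tau> \<noteq> e3 \<tau>" using e13[OF neg_inverse_uhp[OF assms]] by auto
qed


section \<open>Behaviour at the cusp and expansions in the nome\<close>

definition cusp :: "complex filter" where
  "cusp = filtercomap Im at_top"

lemma eventually_cusp: "eventually P cusp \<longleftrightarrow> (\<exists>B. \<forall>z. Im z > B \<longrightarrow> P z)"
proof
  assume "eventually P cusp"
  then obtain B where "\<forall>z. Im z \<ge> B \<longrightarrow> P z"
    unfolding cusp_def eventually_filtercomap eventually_at_top_linorder by blast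
  then show "\<exists>B. \<forall>z. Im z > B \<longrightarrow> P z" by (meson less_imp_le)
next
  assume "\<exists>B. \<forall>z. Im z > B \<longrightarrow> P z"
  then obtain B where "\<forall>z. Im z > B \<longrightarrow> P z" by blast
  then show "eventually P cusp"
    unfolding cusp_def eventually_filtercomap
    by (intro exI[of _ "\<lambda>y. y > B"]) (auto simp: eventually_gt_at_top)
qed

lemma cusp_neq_bot: "cusp \<noteq> bot"
proof
  assume "cusp = bot"
  then have "eventually (\<lambda>_. False) cusp" by simp
  then obtain B where "\<forall>z. \<not> Im z > B" unfolding eventually_cusp by blast
  then have "\<not> Im (Complex 0 (B + 1)) > B" by blast
  then show False by simp
qed

lemma exp_cusp:
  assumes "c > 0"
  shows "filterlim (\<lambda>\<tau>. exp (of_real c * \<i> * \<tau>)) (at 0) cusp"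
proof -
  have "filterlim (\<lambda>x::real. - (c * x)) at_bot at_top"
    unfolding filterlim_uminus_at_bot using assms by (simp add: filterlim_tendsto_pos_mult_at_top[OF tendsto_const _ filterlim_ident])
  then have "((\<lambda>x::real. exp (- (c * x))) \<longlongrightarrow> 0) at_top" by (rule filterlim_compose[OF exp_at_bot])
  moreover have "filterlim Im at_top cusp" unfolding cusp_def by (rule filterlim_filtercomap)
  ultimately have "((\<lambda>\<tau>. exp (- (c * Im \<tau>))) \<longlongrightarrow> 0) cusp" by (rule filterlim_compose)
  then have "((\<lambda>\<tau>. exp (of_real c * \<i> * \<tau>)) \<longlongrightarrow> 0) cusp"
    by (subst tendsto_norm_zero_iff[symmetric]) simp
  then show ?thesis by (auto simp: filterlim_at)
qed

lemma ser_disc_holomorphic: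
  assumes c: "norm c = 1" and k: "k > 0"
  shows "(\<lambda>p. ser (p\<^sup>2) (c * p ^ k)) holomorphic_on ball 0 1"
  unfolding ser_def
proof (rule series_holomorphic(1)[OF open_ball])
  fix n
  have "c * p ^ k * (p\<^sup>2) ^ n \<noteq> 1" if "p \<in> ball 0 1" for p
  proof -
    have "norm p ^ k * ((norm p)\<^sup>2) ^ n \<le> norm p ^ k * 1"
      using that by (intro mult_left_mono power_le_one) auto
    also have "\<dots> < 1" using that k by (simp add: power_less_one_iff)
    finally have "norm p ^ k * ((norm p)\<^sup>2) ^ n < 1" .
    then have "norm (c * p ^ k * (p\<^sup>2) ^ n) < 1" by (simp add: norm_mult norm_power c)
    then show ?thesis by auto
  qed
  then show "(\<lambda>p. sfun (c * p ^ k * (p\<^sup>2) ^ n)) holomorphic_on ball 0 1"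
    unfolding sfun_def by (intro holomorphic_intros) auto
next
  fix x :: complex assume x: "x \<in> ball 0 1"
  define d r where "d = (1 - norm x) / 2" and "r = (1 + norm x) / 2"
  have dr: "d > 0" "0 < r" "r < 1" using x by (auto simp: d_def r_def add_pos_nonneg)
  obtain N where N: "1 * r ^ N \<le> 1/2" using ex_power_small[of r 1] dr by auto
  show "\<exists>d C r N. d > 0 \<and> 0 \<le> r \<and> r < 1 \<and> (\<forall>n\<ge>N. \<forall>y\<in>ball x d \<inter> ball 0 1. norm (sfun (c * y ^ k * (y\<^sup>2) ^ n)) \<le> C * r ^ n)"
  proof (rule exI[of _ d], rule exI[of _ "4 * 1"], rule exI[of _ r], rule exI[of _ N], intro conjI allI impI ballI)
    fix n y assume n: "N \<le> n" and y: "y \<in> ball x d \<inter> ball 0 1"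
    have "norm y \<le> norm x + norm (y - x)" using norm_triangle_ineq[of x "y - x"] by simp
    then have yr: "norm y \<le> r" using y by (auto simp: d_def r_def dist_norm norm_minus_commute field_simps)
    have "norm (y\<^sup>2) \<le> r"
    proof -
      have "norm y * norm y \<le> r * 1" using yr y dr by (intro mult_mono) auto
      then show ?thesis by (simp add: norm_power power2_eq_square norm_mult)
    qed
    moreover have "norm (c * y ^ k) \<le> 1" using y c by (simp add: norm_mult norm_power power_le_one)
    ultimately show "norm (sfun (c * y ^ k * (y\<^sup>2) ^ n)) \<le> 4 * 1 * r ^ n"
      using n dr N by (intro ser_term_bound[where N = N]) auto
  qed (use dr in auto)
qed

text \<open>The half-period values as functions of the nome \<open>p = exp (\<pi> i \<tau>)\<close>,
  whose square is \<open>q\<close>; at \<open>\<tau>/2\<close> half-integral powers of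
  \<open>q\<close> occur. The constant -1/4 is \<open>sfun (-1)\<close>.\<close>

definition pe1 where "pe1 p = - 1/4 + 2 * ser (p\<^sup>2) (- 1 * p ^ 2)"
definition pe2 where "pe2 p = 2 * ser (p\<^sup>2) (1 * p ^ 1)"
definition pe3 where "pe3 p = 2 * ser (p\<^sup>2) (- 1 * p ^ 1)"

lemma pe_holomorphic: "pe1 holomorphic_on ball 0 1" "pe2 holomorphic_on ball 0 1" "pe3 holomorphic_on ball 0 1"
  unfolding pe1_def pe2_def pe3_def by (intro holomorphic_intros ser_disc_holomorphic; simp)+

lemma norm_exp_pii: "Im \<tau> > 0 \<Longrightarrow> norm (exp (of_real pi * \<i> * \<tau>)) < 1"
  by simp

lemma e_eq_pe:
  assumes t: "Im \<tau> > 0"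
  defines "p \<equiv> exp (of_real pi * \<i> * \<tau>)"
  shows "e1 \<tau> = pe1 p" "e2 \<tau> = pe2 p" "e3 \<tau> = pe3 p"
proof -
  have q: "exp (2 * of_real pi * \<i> * \<tau>) = p\<^sup>2" 
    unfolding p_def exp_double[symmetric] by (simp only: mult.assoc)
  have p: "norm p < 1" "p \<noteq> 0" using norm_exp_pii[OF t] by (simp_all add: p_def)
  then have p2: "norm (p\<^sup>2) < 1" by (simp add: norm_power power_less_one_iff)
  have x1: "exp (2 * of_real pi * \<i> * (1/2)) = -1" by simp
  have x2: "exp (2 * of_real pi * \<i> * (\<tau>/2)) = p" by (simp add: p_def mult.assoc)
  have x3: "exp (2 * of_real pi * \<i> * ((1 + \<tau>)/2)) = - p"
  proof -
    have "2 * of_real pi * \<i> * ((1 + \<tau>)/2) = of_real pi * \<i> + of_real pi * \<i> * \<tau>" by (simp add: algebra_simps)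
    then have "exp (2 * of_real pi * \<i> * ((1 + \<tau>)/2)) = exp (of_real pi * \<i>) * p" by (simp only: exp_add p_def)
    then show ?thesis by simp
  qed
  have "e1 \<tau> = ser (p\<^sup>2) (-1) + ser (p\<^sup>2) (p\<^sup>2 / (-1))" unfolding e1_def wp_def Let_def q x1 ..
  also have "ser (p\<^sup>2) (-1) = -1/4 + ser (p\<^sup>2) (- 1 * p\<^sup>2)"
    unfolding ser_rec[OF p2, of "-1"] by (simp add: sfun_def)
  finally show "e1 \<tau> = pe1 p" by (simp add: pe1_def)
  show "e2 \<tau> = pe2 p" unfolding e2_def wp_def Let_def q x2 pe2_def using p(2) by (simp add: power2_eq_square)
  show "e3 \<tau> = pe3 p" unfolding e3_def wp_def Let_def q x3 pe3_def using p(2) by (simp add: power2_eq_square)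
qed

text \<open>All terms but the one with \<open>n = 0\<close> are of order \<open>p ^ 3\<close>. Since
  \<open>pe3 p = pe2 (- p)\<close>, this makes \<open>e2 - e3\<close> asymptotic to
  \<open>4 * p\<close>, which gives the order of \<open>DD\<close> at the cusp.\<close>

lemma pe2_limit: "((\<lambda>p. pe2 p / p) \<longlongrightarrow> 2) (at 0)"
proof -
  have bound: "norm (ser (p\<^sup>2) (p ^ 3)) \<le> 8 * norm p ^ 3" if p: "norm p \<le> 1/2" for p
  proof -
    have "norm p * norm p \<le> (1/2) * 1" using p by (intro mult_mono) auto
    then have p2: "norm (p\<^sup>2) \<le> 1/2" by (simp add: norm_power power2_eq_square norm_mult)
    have "norm p ^ 3 \<le> (1/2) ^ 3" using p by (intro power_mono) auto
    then have p3: "norm p ^ 3 \<le> 1/2" by (simp add: power_divide)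
    have t: "norm (sfun (p ^ 3 * (p\<^sup>2) ^ n)) \<le> 4 * norm p ^ 3 * (1/2) ^ n" for n
      using p2 p3 by (intro ser_term_bound[where N = 0]) (auto simp: norm_power)
    have sm: "summable (\<lambda>n. 4 * norm p ^ 3 * (1/2 :: real) ^ n)" by (intro summable_mult summable_geometric) auto
    have sn: "summable (\<lambda>n. norm (sfun (p ^ 3 * (p\<^sup>2) ^ n)))"
      by (rule summable_comparison_test'[OF sm]) (use t in auto)
    have "norm (ser (p\<^sup>2) (p ^ 3)) \<le> (\<Sum>n. norm (sfun (p ^ 3 * (p\<^sup>2) ^ n)))"
      unfolding ser_def by (rule summable_norm[OF sn])
    also have "\<dots> \<le> (\<Sum>n. 4 * norm p ^ 3 * (1/2 :: real) ^ n)" by (rule suminf_le[OF t sn sm])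
    also have "\<dots> = 8 * norm p ^ 3" by (subst suminf_mult) (auto simp: suminf_geometric)
    finally show ?thesis .
  qed
  have small: "\<forall>\<^sub>F p in at (0::complex). norm p \<le> 1/2 \<and> p \<noteq> 0"
    unfolding eventually_at by (intro exI[of _ "1/2"]) auto
  have "((\<lambda>p. ser (p\<^sup>2) (p ^ 3) / p) \<longlongrightarrow> 0) (at 0)"
  proof (rule Lim_null_comparison[where g = "\<lambda>p. 8 * norm p ^ 2"])
    show "\<forall>\<^sub>F p in at 0. norm (ser (p\<^sup>2) (p ^ 3) / p) \<le> 8 * (norm p)\<^sup>2"
      using small
    proof eventually_elim
      case (elim p)
      then have "norm (ser (p\<^sup>2) (p ^ 3)) / norm p \<le> 8 * norm p ^ 3 / norm p"
        using bound by (intro divide_right_mono) auto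
      then show ?case using elim by (simp add: norm_divide power3_eq_cube power2_eq_square)
    qed
    have "((\<lambda>p::complex. 8 * (norm p)\<^sup>2) \<longlongrightarrow> 8 * (norm (0::complex))\<^sup>2) (at 0)" by (intro tendsto_intros)
    then show "((\<lambda>p::complex. 8 * (norm p)\<^sup>2) \<longlongrightarrow> 0) (at 0)" by simp
  qed
  then have "((\<lambda>p. 2 * (1 / (1 - p)\<^sup>2 + ser (p\<^sup>2) (p ^ 3) / p)) \<longlongrightarrow> 2 * (1 / (1 - 0)\<^sup>2 + 0)) (at 0)"
    by (intro tendsto_intros) auto
  then have "((\<lambda>p. 2 * (1 / (1 - p)\<^sup>2 + ser (p\<^sup>2) (p ^ 3) / p)) \<longlongrightarrow> 2) (at 0)" by simp
  then show ?thesis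
  proof (rule Lim_transform_eventually)
    show "\<forall>\<^sub>F p in at 0. 2 * (1 / (1 - p)\<^sup>2 + ser (p\<^sup>2) (p ^ 3) / p) = pe2 p / p"
      using small
    proof eventually_elim
      case (elim p)
      have "norm (p\<^sup>2) < 1" using elim by (simp add: norm_power power_less_one_iff)
      from ser_rec[OF this, of p] have "ser (p\<^sup>2) p = sfun p + ser (p\<^sup>2) (p ^ 3)"
        by (simp add: power2_eq_square power3_eq_cube mult.assoc)
      then show ?case using elim by (simp add: pe2_def sfun_def add_divide_distrib)
    qed
  qed
qed

text \<open>Up to constant factors, these are \<open>E\<^sub>4\<close>, \<open>\<Delta>\<close> and the \<open>j\<close>-invariant.\<close>

definition EE where "EE \<tau> = (e1 \<tau> - e2 \<tau>)\<^sup>2 + (e2 \<tau> - e3 \<tau>)\<^sup>2 + (e3 \<tau> - e1 \<tau>)\<^sup>2"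
definition DD where "DD \<tau> = ((e1 \<tau> - e2 \<tau>) * (e2 \<tau> - e3 \<tau>) * (e3 \<tau> - e1 \<tau>))\<^sup>2"
definition jj where "jj \<tau> = EE \<tau> ^ 3 / DD \<tau>"

lemma DD_nonzero: "Im \<tau> > 0 \<Longrightarrow> DD \<tau> \<noteq> 0"
  using e_distinct[of \<tau>] by (auto simp: DD_def)

lemma jj_eq_0_iff: "Im \<tau> > 0 \<Longrightarrow> jj \<tau> = 0 \<longleftrightarrow> EE \<tau> = 0"
  using DD_nonzero by (simp add: jj_def)

text \<open>Translation and inversion permute the half-period values, up to the weight factor and a
  common additive constant, so a symmetric expression in their differences is modular.\<close>

lemma EE_modular:
  assumes "Im z > 0" "a * d - b * c = 1"
  shows "EE (mob a b c d z) = (of_int c * z + of_int d) ^ 4 * EE z"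
proof (rule modular_if_S_T[OF _ _ _ assms(2,1)])
  fix z :: complex assume z: "Im z > 0"
  show "EE (z + 1) = EE z" unfolding EE_def e_add_1[OF z] by (simp add: power2_eq_square algebra_simps)
  obtain C where C: "e1 (- 1 / z) = z\<^sup>2 * e2 z + C" "e2 (- 1 / z) = z\<^sup>2 * e1 z + C" "e3 (- 1 / z) = z\<^sup>2 * e3 z + C"
    using e_neg_inverse[OF z] by blast
  show "EE (- 1 / z) = z ^ 4 * EE z" unfolding EE_def C by (simp add: power2_eq_square power4_eq_xxxx algebra_simps)
qed simp

lemma DD_modular:
  assumes "Im z > 0" "a * d - b * c = 1"
  shows "DD (mob a b c d z) = (of_int c * z + of_int d) ^ 12 * DD z"
proof (rule modular_if_S_T[OF _ _ _ assms(2,1)])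
  fix z :: complex assume z: "Im z > 0"
  show "DD (z + 1) = DD z" unfolding DD_def e_add_1[OF z] by (simp add: power2_eq_square algebra_simps)
  obtain C where C: "e1 (- 1 / z) = z\<^sup>2 * e2 z + C" "e2 (- 1 / z) = z\<^sup>2 * e1 z + C" "e3 (- 1 / z) = z\<^sup>2 * e3 z + C"
    using e_neg_inverse[OF z] by blast
  have "e1 (- 1 / z) - e2 (- 1 / z) = - z\<^sup>2 * (e1 z - e2 z)" "e2 (- 1 / z) - e3 (- 1 / z) = - z\<^sup>2 * (e3 z - e1 z)"
    "e3 (- 1 / z) - e1 (- 1 / z) = - z\<^sup>2 * (e2 z - e3 z)" unfolding C by (simp_all add: algebra_simps)
  then have "DD (- 1 / z) = (- z\<^sup>2 * (e1 z - e2 z) * (- z\<^sup>2 * (e3 z - e1 z)) * (- z\<^sup>2 * (e2 z - e3 z)))\<^sup>2"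
    unfolding DD_def by simp
  also have "\<dots> = (- ((z\<^sup>2) ^ 3 * ((e1 z - e2 z) * (e2 z - e3 z) * (e3 z - e1 z))))\<^sup>2"
    by (intro arg_cong[of _ _ "\<lambda>x. x\<^sup>2"]) (simp add: power3_eq_cube)
  also have "\<dots> = z ^ 12 * DD z" unfolding DD_def power2_minus power_mult_distrib by (simp flip: power_mult)
  finally show "DD (- 1 / z) = z ^ 12 * DD z" .
qed simp

lemma jj_invariant:
  assumes "Im z > 0" "a * d - b * c = 1"
  shows "jj (mob a b c d z) = jj z"
proof -
  have "of_int c * z + of_int d \<noteq> 0" using mob_denom_nonzero[OF assms] .
  then show ?thesis
    unfolding jj_def EE_modular[OF assms] DD_modular[OF assms] by (simp add: power_mult_distrib flip: power_mult)
qed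

lemma e_holomorphic: "e1 holomorphic_on upper_half_plane" "e2 holomorphic_on upper_half_plane" "e3 holomorphic_on upper_half_plane"
proof -
  have *: "(\<lambda>\<tau>. f (exp (of_real pi * \<i> * \<tau>))) holomorphic_on upper_half_plane" if "f holomorphic_on ball 0 1" for f
  proof -
    have "f \<circ> (\<lambda>\<tau>. exp (of_real pi * \<i> * \<tau>)) holomorphic_on upper_half_plane"
      by (intro holomorphic_on_compose_gen[OF _ that] holomorphic_intros) (auto simp: uhp_iff)
    then show ?thesis by (simp add: o_def)
  qed
  show "e1 holomorphic_on upper_half_plane"
    by (rule holomorphic_transform[OF *[OF pe_holomorphic(1)]]) (simp add: e_eq_pe uhp_iff)
  show "e2 holomorphic_on upper_half_plane"
    by (rule holomorphic_transform[OF *[OF pe_holomorphic(2)]]) (simp add: e_eq_pe uhp_iff)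
  show "e3 holomorphic_on upper_half_plane"
    by (rule holomorphic_transform[OF *[OF pe_holomorphic(3)]]) (simp add: e_eq_pe uhp_iff)
qed

lemma EE_holomorphic: "EE holomorphic_on upper_half_plane"
  unfolding EE_def[abs_def] by (intro holomorphic_intros e_holomorphic)

lemma DD_holomorphic: "DD holomorphic_on upper_half_plane"
  unfolding DD_def[abs_def] by (intro holomorphic_intros e_holomorphic)

lemma jj_holomorphic: "jj holomorphic_on upper_half_plane"
  unfolding jj_def[abs_def] by (intro holomorphic_intros EE_holomorphic DD_holomorphic) (auto simp: DD_nonzero uhp_iff)

lemma cusp_uhp: "\<forall>\<^sub>F \<tau> in cusp. Im \<tau> > 0"
  unfolding eventually_cusp by auto

lemma e_cusp: "(e1 \<longlongrightarrow> - 1/4) cusp" "(e2 \<longlongrightarrow> 0) cusp" "(e3 \<longlongrightarrow> 0) cusp"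
   "((\<lambda>\<tau>. (e2 \<tau> - e3 \<tau>) / exp (of_real pi * \<i> * \<tau>)) \<longlongrightarrow> 4) cusp"
proof -
  note p = exp_cusp[OF pi_gt_zero]
  have ser0: "ser 0 0 = 0" by (simp add: ser_def sfun_def)
  have *: "((\<lambda>\<tau>. f (exp (of_real pi * \<i> * \<tau>))) \<longlongrightarrow> f 0) cusp" if "f holomorphic_on ball 0 1" for f
  proof -
    have "isCont f 0" using holomorphic_on_imp_continuous_on[OF that] by (simp add: continuous_on_eq_continuous_at)
    then have "(f \<longlongrightarrow> f 0) (at 0)" by (simp add: isCont_def)
    then show ?thesis by (rule filterlim_compose[OF _ p])
  qed
  have ev: "\<forall>\<^sub>F \<tau> in cusp. pe1 (exp (of_real pi * \<i> * \<tau>)) = e1 \<tau>" "\<forall>\<^sub>F \<tau> in cusp. pe2 (exp (of_real pi * \<i> * \<tau>)) = e2 \<tau>"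
    "\<forall>\<^sub>F \<tau> in cusp. pe3 (exp (of_real pi * \<i> * \<tau>)) = e3 \<tau>"
    using cusp_uhp by (auto elim!: eventually_mono simp: e_eq_pe)
  have "(e1 \<longlongrightarrow> pe1 0) cusp" by (rule Lim_transform_eventually[OF *[OF pe_holomorphic(1)] ev(1)])
  then show "(e1 \<longlongrightarrow> - 1/4) cusp" by (simp add: pe1_def ser0)
  have "(e2 \<longlongrightarrow> pe2 0) cusp" by (rule Lim_transform_eventually[OF *[OF pe_holomorphic(2)] ev(2)])
  then show "(e2 \<longlongrightarrow> 0) cusp" by (simp add: pe2_def ser0)
  have "(e3 \<longlongrightarrow> pe3 0) cusp" by (rule Lim_transform_eventually[OF *[OF pe_holomorphic(3)] ev(3)])
  then show "(e3 \<longlongrightarrow> 0) cusp" by (simp add: pe3_def ser0)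
  have "filterlim (\<lambda>z::complex. - z) (at 0) (at 0)"
    by (auto simp: filterlim_at eventually_at_filter intro!: tendsto_eq_intros)
  from filterlim_compose[OF pe2_limit this] have "((\<lambda>p. - (pe3 p / p)) \<longlongrightarrow> 2) (at 0)"
    by (simp add: pe2_def pe3_def)
  from tendsto_add[OF pe2_limit this] have "((\<lambda>p. (pe2 p - pe3 p) / p) \<longlongrightarrow> 4) (at 0)"
    by (simp add: diff_divide_distrib)
  from filterlim_compose[OF this p]
  have "((\<lambda>\<tau>. (pe2 (exp (of_real pi * \<i> * \<tau>)) - pe3 (exp (of_real pi * \<i> * \<tau>))) / exp (of_real pi * \<i> * \<tau>)) \<longlongrightarrow> 4) cusp" .
  moreover have "\<forall>\<^sub>F \<tau> in cusp. (pe2 (exp (of_real pi * \<i> * \<tau>)) - pe3 (exp (of_real pi * \<i> * \<tau>))) / exp (of_real pi * \<i> * \<tau>)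
      = (e2 \<tau> - e3 \<tau>) / exp (of_real pi * \<i> * \<tau>)"
    using ev(2,3) by eventually_elim simp
  ultimately show "((\<lambda>\<tau>. (e2 \<tau> - e3 \<tau>) / exp (of_real pi * \<i> * \<tau>)) \<longlongrightarrow> 4) cusp"
    by (rule Lim_transform_eventually)
qed

lemma EE_cusp: "(EE \<longlongrightarrow> 1/8) cusp"
proof -
  have "(EE \<longlongrightarrow> (- 1/4 - 0)\<^sup>2 + (0 - 0)\<^sup>2 + (0 - (- 1/4))\<^sup>2) cusp"
    unfolding EE_def[abs_def] by (intro tendsto_intros e_cusp)
  then show ?thesis by (simp add: power_divide)
qed

text \<open>\<open>DD\<close> contains the square of \<open>e2 - e3\<close>, which behaves like
  \<open>16 * q\<close>; the value 1/32 is \<open>(1/8) ^ 3 / (1/4) ^ 2\<close>.\<close>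

lemma jj_cusp: "((\<lambda>\<tau>. jj \<tau> * exp (2 * of_real pi * \<i> * \<tau>)) \<longlongrightarrow> 1/32) cusp"
proof -
  have "((\<lambda>\<tau>. EE \<tau> ^ 3 / ((e1 \<tau> - e2 \<tau>) * ((e2 \<tau> - e3 \<tau>) / exp (of_real pi * \<i> * \<tau>)) * (e3 \<tau> - e1 \<tau>))\<^sup>2)
      \<longlongrightarrow> (1/8) ^ 3 / ((- 1/4 - 0) * 4 * (0 - (- 1/4)))\<^sup>2) cusp"
    by (intro tendsto_intros e_cusp EE_cusp) simp
  then have "((\<lambda>\<tau>. EE \<tau> ^ 3 / ((e1 \<tau> - e2 \<tau>) * ((e2 \<tau> - e3 \<tau>) / exp (of_real pi * \<i> * \<tau>)) * (e3 \<tau> - e1 \<tau>))\<^sup>2)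
      \<longlongrightarrow> 1/32) cusp" by (simp add: power_divide power2_eq_square)
  moreover have "EE \<tau> ^ 3 / ((e1 \<tau> - e2 \<tau>) * ((e2 \<tau> - e3 \<tau>) / exp (of_real pi * \<i> * \<tau>)) * (e3 \<tau> - e1 \<tau>))\<^sup>2 =
     jj \<tau> * exp (2 * of_real pi * \<i> * \<tau>)" for \<tau>
  proof -
    have "exp (2 * of_real pi * \<i> * \<tau>) = (exp (of_real pi * \<i> * \<tau>))\<^sup>2"
      unfolding exp_double[symmetric] by (simp only: mult.assoc)
    then show ?thesis by (simp add: jj_def DD_def power_mult_distrib power_divide)
  qed
  ultimately show ?thesis by simp
qed

lemma exp_2pii_eq: "exp (2 * of_real pi * \<i> * z) = exp (2 * of_real pi * \<i> * w) \<Longrightarrow> \<exists>n::int. z = w + of_int n"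
proof -
  assume "exp (2 * of_real pi * \<i> * z) = exp (2 * of_real pi * \<i> * w)"
  then have "exp (2 * of_real pi * \<i> * (z - w)) = 1" by (simp add: right_diff_distrib exp_diff)
  then have "z - w \<in> \<int>" by (simp only: exp_2pii_eq_1_iff)
  then obtain n where "z - w = of_int n" by (elim Ints_cases)
  then have "z = w + of_int n" by (simp add: algebra_simps)
  then show ?thesis by blast
qed

text \<open>Periodicity makes \<open>f\<close> a function of \<open>exp (2 \<pi> i z)\<close> for
  any choice of the logarithm, and the limit at the cusp removes the singularity at 0.\<close>

lemma q_expansion:
  assumes hol: "f holomorphic_on {z. Im z > B}" and per: "\<And>z. Im z > B \<Longrightarrow> f (z + 1) = f z"
    and lim: "(f \<longlongrightarrow> L) cusp"
  obtains F r where "r > 0" "F holomorphic_on ball 0 r" "F 0 = L" "\<And>z. Im z > B \<Longrightarrow> f z = F (exp (2 * of_real pi * \<i> * z))"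
proof -
  define r where "r = exp (- 2 * pi * B)"
  define lg where "lg q = Ln q / (2 * of_real pi * \<i>)" for q
  define F where "F q = (if q = 0 then L else f (lg q))" for q
  have pern: "f (z + of_nat n) = f z" if "Im z > B" for z n
  proof (induction n)
    case (Suc n)
    then show ?case using per[of "z + of_nat n"] that by (simp add: algebra_simps)
  qed simp
  have peri: "f (z + of_int n) = f z" if "Im z > B" for z n
  proof (cases "n \<ge> 0")
    case True
    then show ?thesis using pern[OF that, of "nat n"] by (simp add: of_nat_nat)
  next
    case False
    then show ?thesis using pern[of "z + of_int n" "nat (- n)"] that by (simp add: of_nat_nat)
  qed
  have exp_lg: "exp (2 * of_real pi * \<i> * lg q) = q" if "q \<noteq> 0" for q using that by (simp add: lg_def)
  have ball: "exp (2 * of_real pi * \<i> * z) \<in> ball 0 r \<longleftrightarrow> Im z > B" for z by (simp add: r_def)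
  have FE: "f z = F (exp (2 * of_real pi * \<i> * z))" if z: "Im z > B" for z
  proof -
    obtain n :: int where n: "lg (exp (2 * of_real pi * \<i> * z)) = z + of_int n"
      using exp_2pii_eq[OF exp_lg[OF exp_not_eq_zero]] by blast
    have "F (exp (2 * of_real pi * \<i> * z)) = f (lg (exp (2 * of_real pi * \<i> * z)))"
      by (simp only: F_def exp_not_eq_zero if_False)
    then show ?thesis unfolding n peri[OF z] by (rule sym)
  qed
  have "F field_differentiable (at q)" if q: "q \<in> ball 0 r - {0}" for q
  proof -
    define w where "w = lg q"
    have w: "exp (2 * of_real pi * \<i> * w) = q" using q exp_lg by (simp add: w_def)
    then have Imw: "Im w > B" using ball[of w] q by simp
    \<comment> \<open>A branch of the logarithm that is holomorphic near \<open>q\<close>, wherever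
      \<open>q\<close> lies relative to the cut of \<open>Ln\<close>.\<close>
    define g where "g t = w + Ln (t / q) / (2 * of_real pi * \<i>)" for t
    have gq: "g q = w" using q by (simp add: g_def)
    have "(\<lambda>t. f (g t)) field_differentiable (at q)"
    proof -
      have "f field_differentiable (at (g q))"
        using hol Imw gq open_halfspace_Im_gt[of B] 
        by (intro holomorphic_on_imp_differentiable_at[OF hol]) auto
      moreover have "g field_differentiable (at q)"
      proof -
        have "((\<lambda>t. t / q) has_field_derivative 1 / q) (at q)" using q by (auto intro!: derivative_eq_intros)
        moreover have "(Ln has_field_derivative inverse (q / q)) (at (q / q))"
          using q by (intro has_field_derivative_Ln) auto
        ultimately have "((\<lambda>t. Ln (t / q)) has_field_derivative inverse (q / q) * (1 / q)) (at q)"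
          by (rule DERIV_chain2[rotated])
        from DERIV_add[OF DERIV_const[of w] DERIV_cdivide[OF this, of "2 * of_real pi * \<i>"]]
        show ?thesis unfolding g_def[abs_def] field_differentiable_def by blast
      qed
      ultimately show ?thesis using field_differentiable_compose[of g q f] by (simp add: o_def)
    qed
    moreover have ev: "\<forall>\<^sub>F t in nhds q. f (g t) = F t"
    proof -
      have "\<forall>\<^sub>F t in nhds q. t \<in> ball 0 r - {0}" using q by (intro eventually_nhds_in_open) auto
      then show ?thesis
      proof eventually_elim
        case (elim t)
        then have e: "exp (2 * of_real pi * \<i> * g t) = t"
          using q by (simp add: g_def distrib_left exp_add w)
        then have "Im (g t) > B" using ball[of "g t"] elim by simp
        from FE[OF this] show ?case unfolding e .
      qed
    qed
    ultimately show ?thesis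
      unfolding field_differentiable_def using DERIV_cong_ev[OF refl ev refl] by blast
  qed
  then have "F holomorphic_on ball 0 r - {0}" by (simp add: holomorphic_on_def field_differentiable_at_within)
  moreover have "F \<midarrow>0\<rightarrow> L"
  proof (rule topological_tendstoI)
    fix S assume "open S" "L \<in> S"
    then have "\<forall>\<^sub>F z in cusp. f z \<in> S" using lim by (simp add: tendsto_def)
    then obtain B' where B': "\<And>z. Im z > B' \<Longrightarrow> f z \<in> S" unfolding eventually_cusp by blast
    define M where "M = max B B'"
    have "F q \<in> S" if q: "q \<noteq> 0" "norm q < exp (- 2 * pi * M)" for q
    proof -
      have "norm (exp (2 * of_real pi * \<i> * lg q)) < exp (- 2 * pi * M)" using q exp_lg by simp
      then have "exp (- 2 * pi * Im (lg q)) < exp (- 2 * pi * M)" by (simp only: norm_exp_2pii)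
      then have "Im (lg q) > B'" by (simp add: M_def)
      then show ?thesis using B' q by (simp add: F_def)
    qed
    then show "\<forall>\<^sub>F q in at 0. F q \<in> S"
      unfolding eventually_at by (intro exI[of _ "exp (- 2 * pi * M)"]) auto
  qed
  ultimately have "(\<lambda>q. if q = 0 then L else F q) holomorphic_on ball 0 r"
    by (intro removable_singularity open_ball) auto
  moreover have "(\<lambda>q. if q = 0 then L else F q) = F" by (auto simp: F_def)
  ultimately show ?thesis using FE by (intro that[of r F]) (auto simp: r_def F_def)
qed

section \<open>The fibres of the modular invariant\<close>

lemma filterlim_q_cusp: "filterlim (\<lambda>z. exp (2 * of_real pi * \<i> * z)) (at 0) cusp"
  using exp_cusp[of "2 * pi"] by simp

lemma jj_at_infinity: "filterlim jj at_infinity cusp"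
proof -
  have "filterlim (\<lambda>z. jj z * exp (2 * of_real pi * \<i> * z) / exp (2 * of_real pi * \<i> * z)) at_infinity cusp"
    by (rule filterlim_divide_at_infinity[OF jj_cusp filterlim_q_cusp]) simp
  then show ?thesis by simp
qed

lemma jj_large:
  obtains Y where "\<And>z. Im z > Y \<Longrightarrow> norm (jj z) > M"
proof -
  have "\<forall>\<^sub>F z in cusp. norm (jj z) > M" using jj_at_infinity unfolding filterlim_at_infinity_conv_norm_at_top filterlim_at_top_dense by blast
  then show ?thesis using that unfolding eventually_cusp by blast
qed

lemma uhp_Collect: "upper_half_plane = {z. Im z > 0}"
  by (simp add: upper_half_plane_def)

lemma jj_add_1: "Im z > 0 \<Longrightarrow> jj (z + 1) = jj z"
  using jj_invariant[of z 1 1 1 0] by (simp add: mob_def)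

text \<open>Near the cusp \<open>1 / jj\<close> is \<open>q / G q\<close> with
  \<open>G 0 = 1/32\<close>. It has a simple zero, hence is injective in \<open>q\<close> near 0,
  and \<open>q\<close> determines \<open>z\<close> up to integers.\<close>

lemma jj_injective_at_cusp:
  obtains Y where "Y > 0" "\<And>z w. Im z > Y \<Longrightarrow> Im w > Y \<Longrightarrow> jj z = jj w \<Longrightarrow> SL2Z_equiv z w"
proof -
  let ?q = "\<lambda>z. exp (2 * of_real pi * \<i> * z)"
  obtain G r where G: "r > 0" "G holomorphic_on ball 0 r" "G 0 = 1/32" "\<And>z. Im z > 0 \<Longrightarrow> jj z * ?q z = G (?q z)"
  proof (rule q_expansion[of "\<lambda>z. jj z * ?q z" 0 "1/32"])
    show "(\<lambda>z. jj z * ?q z) holomorphic_on {z. Im z > 0}"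
      using jj_holomorphic unfolding uhp_Collect by (intro holomorphic_intros)
    show "jj (z + 1) * ?q (z + 1) = jj z * ?q z" if "Im z > 0" for z
      unfolding jj_add_1[OF that] exp_2pii_add_1 ..
  qed (use jj_cusp that in auto)
  have "isCont G 0" using holomorphic_on_imp_continuous_on[OF G(2)] G(1) by (simp add: continuous_on_eq_continuous_at)
  then have "(G \<longlongrightarrow> G 0) (nhds 0)" unfolding isCont_def tendsto_at_iff_tendsto_nhds .
  then have "\<forall>\<^sub>F x in nhds 0. G x \<noteq> 0" by (rule tendsto_imp_eventually_ne) (simp add: G(3))
  then obtain s where s: "s > 0" "\<And>x. x \<in> ball 0 s \<Longrightarrow> G x \<noteq> 0"
    unfolding eventually_nhds_metric by (auto simp: dist_commute)
  define t where "t = min r s"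
  have t: "t > 0" "\<And>x. x \<in> ball 0 t \<Longrightarrow> G x \<noteq> 0" "G holomorphic_on ball 0 t"
    using G s by (auto simp: t_def intro: holomorphic_on_subset)
  have hol: "(\<lambda>x. x / G x) holomorphic_on ball 0 t" using t by (intro holomorphic_intros) auto
  have d: "deriv (\<lambda>x. x / G x) 0 \<noteq> 0"
  proof -
    have "(G has_field_derivative deriv G 0) (at 0)" using holomorphic_derivI[OF t(3) open_ball] t(1) by simp
    then have "((\<lambda>x. x / G x) has_field_derivative (1 * G 0 - 0 * deriv G 0) / (G 0 * G 0)) (at 0)"
      using G(3) by (intro DERIV_divide DERIV_ident) auto
    then show ?thesis using G(3) by (auto dest!: DERIV_imp_deriv)
  qed
  obtain u where u: "u > 0" "ball (0::complex) u \<subseteq> ball 0 t" "inj_on (\<lambda>x. x / G x) (ball 0 u)"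
  proof -
    have "0 \<in> ball (0::complex) t" using t(1) by simp
    then show ?thesis
    proof (rule has_complex_derivative_locally_injective[OF hol _ open_ball d])
      fix u assume "u > 0" "ball (0::complex) u \<subseteq> ball 0 t" "inj_on (\<lambda>x. x / G x) (ball 0 u)"
      then show ?thesis by (rule that)
    qed
  qed
  have "\<forall>\<^sub>F z in cusp. ?q z \<in> ball 0 u"
    using filterlim_q_cusp u(1) eventually_at_ball[of u 0 UNIV] by (auto simp: filterlim_iff)
  then obtain Y where Y: "\<And>z. Im z > Y \<Longrightarrow> ?q z \<in> ball 0 u" unfolding eventually_cusp by blast
  show ?thesis
  proof (rule that[of "max Y 1"])
    fix z w assume zw: "Im z > max Y 1" "Im w > max Y 1" "jj z = jj w"
    have b: "?q z \<in> ball 0 u" "?q w \<in> ball 0 u" using Y zw by auto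
    have v: "?q z / G (?q z) = 1 / jj z" if "Im z > max Y 1" for z
    proof -
      have "Im z > 0" "?q z \<in> ball 0 u" using that Y by auto
      then have "jj z * ?q z = G (?q z)" "G (?q z) \<noteq> 0" using G(4) t(2) u(2) by blast+
      then have "jj z \<noteq> 0" by auto
      then show ?thesis unfolding \<open>jj z * ?q z = G (?q z)\<close>[symmetric] by simp
    qed
    have "?q z = ?q w" using inj_onD[OF u(3) _ b] v[OF zw(1)] v[OF zw(2)] zw(3) by simp
    then obtain n :: int where "z = w + of_int n" using exp_2pii_eq by blast
    then have "SL2Z_equiv w z" using SL2Z_equiv_add_int by simp
    from SL2Z_equiv_sym[OF _ this] show "SL2Z_equiv z w" using zw by simp
  qed auto
qed

lemma jj_nonconstant: "\<not> jj constant_on upper_half_plane"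
proof
  assume "jj constant_on upper_half_plane"
  then obtain c where c: "\<And>z. Im z > 0 \<Longrightarrow> jj z = c" by (auto simp: constant_on_def uhp_iff)
  obtain Y where Y: "\<And>z. Im z > Y \<Longrightarrow> norm (jj z) > norm c" using jj_large by blast
  have "Im (Complex 0 (max Y 0 + 1)) > Y" "Im (Complex 0 (max Y 0 + 1)) > 0" by auto
  then show False using Y c by (metis less_irrefl)
qed

section \<open>The fundamental domain and global injectivity\<close>

definition FD :: "complex set" where
  "FD = {w. \<bar>Re w\<bar> \<le> 1/2 \<and> cmod w \<ge> 1 \<and> Im w > 0}"

definition Box :: "real \<Rightarrow> complex set" where
  "Box Y = {w. \<bar>Re w\<bar> \<le> 1/2 \<and> 1/2 \<le> Im w \<and> Im w \<le> Y}"

lemma FD_Box: "w \<in> FD \<Longrightarrow> Im w \<le> Y \<Longrightarrow> w \<in> Box Y"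
proof -
  assume w: "w \<in> FD" "Im w \<le> Y"
  have "(Re w)\<^sup>2 \<le> (1/2)\<^sup>2" using w by (intro abs_le_square_iff[THEN iffD1]) (simp add: FD_def)
  moreover have "1 \<le> (cmod w)\<^sup>2" using w by (simp add: FD_def)
  ultimately have "(1/2)\<^sup>2 \<le> (Im w)\<^sup>2" unfolding cmod_power2 by (simp add: power_divide)
  then have "1/2 \<le> Im w" by (rule power2_le_imp_le) (use w in \<open>auto simp: FD_def\<close>)
  then show "w \<in> Box Y" using w by (simp add: Box_def FD_def)
qed

lemma compact_Box: "compact (Box Y)"
proof -
  have "Box Y = {w. \<bar>Re w\<bar> \<le> 1/2} \<inter> {w. 1/2 \<le> Im w} \<inter> {w. Im w \<le> Y}" by (auto simp: Box_def)
  moreover have "closed \<dots>" by (intro closed_Int closed_Collect_le continuous_intros)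
  moreover have "bounded (Box Y)"
    unfolding bounded_iff
  proof (intro exI ballI)
    fix w assume "w \<in> Box Y"
    then show "norm w \<le> 1/2 + \<bar>Y\<bar>" using cmod_le[of w] by (auto simp: Box_def)
  qed
  ultimately show ?thesis by (simp add: compact_eq_bounded_closed)
qed

lemma Box_uhp: "Box Y \<subseteq> upper_half_plane"
  by (auto simp: Box_def uhp_iff)

lemma equiv_FD: "Im z > 0 \<Longrightarrow> \<exists>w\<in>FD. SL2Z_equiv z w"
  using fundamental_domain[of z] by (metis (mono_tags, lifting) FD_def mem_Collect_eq)

lemma invariant_equiv:
  assumes "\<And>a b c d z. Im z > 0 \<Longrightarrow> a * d - b * c = 1 \<Longrightarrow> f (mob a b c d z) = f z"
    and "Im z > 0" "SL2Z_equiv z w"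
  shows "f w = f z"
  using assms unfolding SL2Z_equiv_mob by blast

lemma jj_equiv: "Im z > 0 \<Longrightarrow> SL2Z_equiv z w \<Longrightarrow> jj w = jj z"
  using invariant_equiv[of jj] jj_invariant by blast

text \<open>Maximum principle on the quotient: because \<open>f\<close> decays at the cusp, its
  modulus attains a maximum in a compact box, and by invariance this is the maximum over the
  half-plane; so \<open>f\<close> is constant, and its limit at the cusp makes it 0.\<close>

lemma invariant_zero:
  assumes hol: "f holomorphic_on upper_half_plane"
    and inv: "\<And>a b c d z. Im z > 0 \<Longrightarrow> a * d - b * c = 1 \<Longrightarrow> f (mob a b c d z) = f z"
    and lim: "(f \<longlongrightarrow> 0) cusp" and z1: "Im z1 > 0"
  shows "f z1 = 0"
proof (rule ccontr)
  assume nz: "f z1 \<noteq> 0"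
  have "\<forall>\<^sub>F z in cusp. norm (f z) < norm (f z1)"
    using tendsto_norm[OF lim] nz by (intro order_tendstoD(2)) auto
  then obtain Y where Y: "\<And>z. Im z > Y \<Longrightarrow> norm (f z) < norm (f z1)" unfolding eventually_cusp by blast
  obtain w1 where w1: "w1 \<in> FD" "SL2Z_equiv z1 w1" using equiv_FD[OF z1] by blast
  have fw1: "f w1 = f z1" using invariant_equiv[of f, OF inv z1 w1(2)] by blast
  have w1B: "w1 \<in> Box Y" using FD_Box[OF w1(1), of Y] Y[of w1] fw1 by (cases "Im w1 \<le> Y") auto
  have "continuous_on (Box Y) (\<lambda>z. norm (f z))"
    using holomorphic_on_imp_continuous_on[OF hol] Box_uhp by (intro continuous_on_norm) (auto intro: continuous_on_subset)
  then obtain a where a: "a \<in> Box Y" "\<And>z. z \<in> Box Y \<Longrightarrow> norm (f z) \<le> norm (f a)"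
    using continuous_attains_sup[OF compact_Box, of Y] w1B by blast
  have max: "norm (f z) \<le> norm (f a)" if "z \<in> upper_half_plane" for z
  proof -
    have "Im z > 0" using that by (simp add: uhp_iff)
    then obtain w where w: "w \<in> FD" "SL2Z_equiv z w" using equiv_FD by blast
    have "f w = f z" using invariant_equiv[of f, OF inv \<open>Im z > 0\<close> w(2)] by blast
    moreover have "norm (f w) \<le> norm (f a)"
    proof (cases "Im w \<le> Y")
      case True
      then show ?thesis using a(2) FD_Box[OF w(1)] by blast
    next
      case False
      then have "norm (f w) < norm (f w1)" using Y fw1 by simp
      then show ?thesis using a(2)[OF w1B] by simp
    qed
    ultimately show ?thesis by simp
  qed
  have "f constant_on upper_half_plane"
    using maximum_modulus_principle[OF hol open_uhp convex_connected[OF convex_uhp] open_uhp order.refl, of a] max a(1) Box_uhp by blast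
  then obtain c where c: "\<And>z. Im z > 0 \<Longrightarrow> f z = c" by (auto simp: constant_on_def uhp_iff)
  have "\<forall>\<^sub>F z in cusp. f z = c" using cusp_uhp c by (auto elim: eventually_mono)
  then have "(f \<longlongrightarrow> c) cusp" by (rule tendsto_eventually)
  then have "c = 0" using lim tendsto_unique[OF cusp_neq_bot] by blast
  then show False using c[OF z1] nz by simp
qed

text \<open>
  A degree argument: the set \<open>N\<close> of values with two inequivalent preimages is open, and clopen in the
  connected complement of the countably many critical values; it misses all large values.
\<close>

lemma jj_inj:
  assumes "Im z > 0" "Im w > 0" "jj z = jj w"
  shows "SL2Z_equiv z w"
proof (rule ccontr)
  assume "\<not> SL2Z_equiv z w"
  define N where "N = {t. \<exists>z w. Im z > 0 \<and> Im w > 0 \<and> jj z = t \<and> jj w = t \<and> \<not> SL2Z_equiv z w}"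
  have "jj z \<in> N" using assms \<open>\<not> SL2Z_equiv z w\<close> unfolding N_def by force
  have conn: "connected upper_half_plane" by (rule convex_connected[OF convex_uhp])
  \<comment> \<open>Inequivalent points stay inequivalent under small perturbations, and by the open
    mapping theorem both images are neighbourhoods of \<open>t\<close>.\<close>
  have openN: "open N"
  proof (subst open_subopen, intro ballI)
    fix t assume "t \<in> N"
    then obtain z w where zw: "Im z > 0" "Im w > 0" "jj z = t" "jj w = t" "\<not> SL2Z_equiv z w" unfolding N_def by blast
    obtain \<epsilon> where \<epsilon>: "\<epsilon> > 0" "\<And>w1 w2 a b c d. dist w1 z < \<epsilon> \<Longrightarrow> dist w2 w < \<epsilon> \<Longrightarrow> a * d - b * c = 1 \<Longrightarrow>
      w2 = mob a b c d w1 \<Longrightarrow> w = mob a b c d z" using properly_discontinuous[OF zw(1,2)] by metis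
    have ne: "\<not> SL2Z_equiv w1 w2" if "dist w1 z < \<epsilon>" "dist w2 w < \<epsilon>" for w1 w2
      using \<epsilon>(2)[OF that] zw(5) unfolding SL2Z_equiv_mob by blast
    define A where "A = jj ` (ball z \<epsilon> \<inter> upper_half_plane)"
    define B where "B = jj ` (ball w \<epsilon> \<inter> upper_half_plane)"
    have "open A" "open B" unfolding A_def B_def
      by (auto intro!: open_mapping_thm[OF jj_holomorphic open_uhp conn _ _ jj_nonconstant] open_Int open_uhp)
    moreover have "t \<in> A" using zw \<epsilon>(1) unfolding A_def by (intro image_eqI[of _ _ z]) (auto simp: uhp_iff)
    moreover have "t \<in> B" using zw \<epsilon>(1) unfolding B_def by (intro image_eqI[of _ _ w]) (auto simp: uhp_iff)
    moreover have "A \<inter> B \<subseteq> N"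
    proof
      fix x assume "x \<in> A \<inter> B"
      then obtain w1 w2 where "w1 \<in> ball z \<epsilon>" "w2 \<in> ball w \<epsilon>" "Im w1 > 0" "Im w2 > 0" "jj w1 = x" "jj w2 = x"
        unfolding A_def B_def by (auto simp: uhp_iff)
      then show "x \<in> N" using ne[of w1 w2] unfolding N_def by (auto simp: dist_commute)
    qed
    ultimately show "\<exists>T. open T \<and> t \<in> T \<and> T \<subseteq> N" by (intro exI[of _ "A \<inter> B"]) auto
  qed
  define crit where "crit = {z \<in> upper_half_plane. deriv jj z = 0}"
  have cc: "countable (jj ` crit)"
  proof -
    have dh: "deriv jj holomorphic_on upper_half_plane" by (intro holomorphic_deriv jj_holomorphic open_uhp)
    have "countable crit"
    proof (cases "deriv jj constant_on upper_half_plane")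
      case False
      obtain C :: "nat \<Rightarrow> complex set" where "\<And>n. compact (C n)" "\<Union> (range C) = upper_half_plane"
        by (rule open_Union_compact_subsets[OF open_uhp]) blast
      then have "fsigma upper_half_plane" unfolding fsigma_Union_compact by (intro exI[of _ C]) auto
      then show ?thesis unfolding crit_def
        by (rule holomorphic_countable_zeros[OF dh open_uhp conn _ False])
    next
      case True
      then obtain c where c: "\<And>z. Im z > 0 \<Longrightarrow> deriv jj z = c" by (auto simp: constant_on_def uhp_iff)
      have "c \<noteq> 0"
      proof
        assume "c = 0"
        then have "(jj has_field_derivative 0) (at z)" if "z \<in> upper_half_plane" for z
          using holomorphic_derivI[OF jj_holomorphic open_uhp that] c[of z] that by (simp add: uhp_iff)
        then have "jj constant_on upper_half_plane"
          using DERIV_zero_connected_constant_on[OF conn open_uhp finite.emptyI holomorphic_on_imp_continuous_on[OF jj_holomorphic]]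
          by simp
        then show False using jj_nonconstant by blast
      qed
      then have "crit = {}" using c by (auto simp: crit_def uhp_iff)
      then show ?thesis by simp
    qed
    then show ?thesis by (rule countable_image)
  qed
  define W where "W = - (jj ` crit)"
  have connW: "connected W"
    unfolding W_def by (intro path_connected_imp_connected path_connected_complement_countable cc) simp
  \<comment> \<open>Preimages of convergent values stay in a compact box, because \<open>jj\<close>
    is large near the cusp, so a subsequence of the inequivalent pairs converges. The limits cannot
    be equivalent, since at a noncritical value \<open>jj\<close> is injective near
    \<open>a\<close>.\<close>
  have closedN: "closure N \<inter> W \<subseteq> N"
  proof
    fix t assume t: "t \<in> closure N \<inter> W"
    have "t \<in> closure N" using t by blast
    then obtain x where x: "\<forall>n. x n \<in> N" "x \<longlonglongrightarrow> t" unfolding closure_sequential by blast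
    have "\<exists>z w. z \<in> FD \<and> w \<in> FD \<and> jj z = x n \<and> jj w = x n \<and> \<not> SL2Z_equiv z w" for n
    proof -
      obtain z w where zw: "Im z > 0" "Im w > 0" "jj z = x n" "jj w = x n" "\<not> SL2Z_equiv z w"
        using x(1)[rule_format, of n] unfolding N_def by blast
      obtain z' w' where z': "z' \<in> FD" "SL2Z_equiv z z'" and w': "w' \<in> FD" "SL2Z_equiv w w'"
        using equiv_FD zw by meson
      have "\<not> SL2Z_equiv z' w'"
        using zw SL2Z_equiv_trans[OF zw(1) z'(2)] SL2Z_equiv_trans[OF zw(1) _ SL2Z_equiv_sym[OF zw(2) w'(2)]] by blast
      then show ?thesis using z' w' jj_equiv[OF zw(1) z'(2)] jj_equiv[OF zw(2) w'(2)] zw by auto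
    qed
    then obtain z w where zw: "\<And>n. z n \<in> FD" "\<And>n. w n \<in> FD" "\<And>n. jj (z n) = x n" "\<And>n. jj (w n) = x n" "\<And>n. \<not> SL2Z_equiv (z n) (w n)"
      by metis
    have "Bseq x" using x(2) by (meson convergentI convergent_imp_Bseq)
    then obtain M where M: "\<And>n. norm (x n) \<le> M" unfolding Bseq_def by blast
    obtain Y where Y: "\<And>z. Im z > Y \<Longrightarrow> norm (jj z) > M" using jj_large by blast
    have B: "z n \<in> Box Y" "w n \<in> Box Y" for n
      using Y[of "z n"] Y[of "w n"] M[of n] zw FD_Box by (metis not_le)+
    have "compact (Box Y \<times> Box Y)" by (intro compact_Times compact_Box)
    then obtain l r where l: "l \<in> Box Y \<times> Box Y" "strict_mono r" "((\<lambda>n. (z n, w n)) \<circ> r) \<longlonglongrightarrow> l"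
      using B unfolding compact_def by (elim allE[of _ "\<lambda>n. (z n, w n)"]) auto
    define a b where "a = fst l" and "b = snd l"
    have ab: "a \<in> Box Y" "b \<in> Box Y" using l(1) by (auto simp: a_def b_def)
    then have Iab: "Im a > 0" "Im b > 0" by (auto simp: Box_def)
    have za: "(\<lambda>n. z (r n)) \<longlonglongrightarrow> a" using tendsto_fst[OF l(3)] by (simp add: a_def o_def)
    have wb: "(\<lambda>n. w (r n)) \<longlonglongrightarrow> b" using tendsto_snd[OF l(3)] by (simp add: b_def o_def)
    have cont: "isCont jj u" if "Im u > 0" for u
      using holomorphic_on_imp_continuous_on[OF jj_holomorphic] that
      unfolding continuous_on_eq_continuous_at[OF open_uhp] by (simp add: uhp_iff)
    have xr: "(\<lambda>n. x (r n)) \<longlonglongrightarrow> t" using LIMSEQ_subseq_LIMSEQ[OF x(2) l(2)] by (simp add: o_def)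
    have ja: "jj a = t" using isCont_tendsto_compose[OF cont[OF Iab(1)] za] xr LIMSEQ_unique by (auto simp: zw)
    have jb: "jj b = t" using isCont_tendsto_compose[OF cont[OF Iab(2)] wb] xr LIMSEQ_unique by (auto simp: zw)
    have "\<not> SL2Z_equiv b a"
    proof
      assume "SL2Z_equiv b a"
      then obtain p q s u where g: "p * u - q * s = 1" "a = mob p q s u b" unfolding SL2Z_equiv_mob by blast
      have "deriv jj a \<noteq> 0" using t ja Iab by (auto simp: W_def crit_def uhp_iff)
      then obtain \<rho> where \<rho>: "\<rho> > 0" "inj_on jj (ball a \<rho>)"
        using has_complex_derivative_locally_injective[OF jj_holomorphic _ open_uhp, of a] Iab(1) by (auto simp: uhp_iff)
      have nz: "of_int s * b + of_int u \<noteq> 0" using mob_denom_nonzero[OF Iab(2) g(1)] .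
      have "(\<lambda>n. mob p q s u (w (r n))) \<longlonglongrightarrow> a"
        unfolding g(2) unfolding mob_def by (intro tendsto_intros wb nz)
      then have "\<forall>\<^sub>F n in sequentially. mob p q s u (w (r n)) \<in> ball a \<rho>"
        using \<rho>(1) by (auto simp: tendsto_iff dist_commute)
      moreover have "\<forall>\<^sub>F n in sequentially. z (r n) \<in> ball a \<rho>"
        using za \<rho>(1) by (auto simp: tendsto_iff dist_commute)
      ultimately have "\<forall>\<^sub>F n in sequentially. False"
      proof eventually_elim
        case (elim n)
        have Iw: "Im (w (r n)) > 0" using zw(2) by (simp add: FD_def)
        have "jj (mob p q s u (w (r n))) = jj (z (r n))" using jj_invariant[OF Iw g(1)] zw by simp
        then have "mob p q s u (w (r n)) = z (r n)" using inj_onD[OF \<rho>(2)] elim by blast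
        then have "SL2Z_equiv (w (r n)) (z (r n))" unfolding SL2Z_equiv_mob using g(1) by metis
        then show ?case using SL2Z_equiv_sym[OF Iw] zw(5) by blast
      qed
      then show False by simp
    qed
    then show "t \<in> N" unfolding N_def using ja jb Iab by blast
  qed
  have "N \<inter> W = {} \<or> N \<inter> W = W"
  proof -
    have "openin (top_of_set W) (N \<inter> W)" using openN by (auto simp: openin_open)
    moreover have "closedin (top_of_set W) (N \<inter> W)"
      unfolding closedin_closed using closedN closure_subset by (intro exI[of _ "closure N"]) auto
    ultimately show ?thesis using connW unfolding connected_clopen by blast
  qed
  moreover have "\<not> W \<subseteq> N"
  proof
    assume WN: "W \<subseteq> N"
    obtain Y where Y: "Y > 0" "\<And>z w. Im z > Y \<Longrightarrow> Im w > Y \<Longrightarrow> jj z = jj w \<Longrightarrow> SL2Z_equiv z w"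
      using jj_injective_at_cusp by blast
    have "compact (jj ` Box Y)"
      using compact_continuous_image[OF continuous_on_subset[OF holomorphic_on_imp_continuous_on[OF jj_holomorphic] Box_uhp] compact_Box] .
    then have "bounded (jj ` Box Y)" by (rule compact_imp_bounded)
    then obtain M where "\<forall>x\<in>jj ` Box Y. norm x \<le> M" unfolding bounded_iff by blast
    then have M: "\<And>z. z \<in> Box Y \<Longrightarrow> norm (jj z) \<le> M" by blast
    \<comment> \<open>A noncritical value larger than all values on \<open>Box Y\<close>: its
      preimages in the fundamental domain lie near the cusp, where equal values mean equivalent
      points.\<close>
    have "uncountable (ball (of_real (\<bar>M\<bar> + 2) :: complex) 1)" by (intro uncountable_ball) simp
    then have "\<not> ball (of_real (\<bar>M\<bar> + 2) :: complex) 1 \<subseteq> jj ` crit" using cc countable_subset by blast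
    then obtain t where t: "t \<in> ball (of_real (\<bar>M\<bar> + 2)) 1" "t \<in> W" unfolding W_def by blast
    have "norm t > M"
    proof -
      have "norm (of_real (\<bar>M\<bar> + 2) :: complex) \<le> norm t + norm (of_real (\<bar>M\<bar> + 2) - t)"
        using norm_triangle_ineq[of t "of_real (\<bar>M\<bar> + 2) - t"] by simp
      moreover have "norm (of_real (\<bar>M\<bar> + 2) :: complex) = \<bar>M\<bar> + 2" unfolding norm_of_real by linarith
      moreover have "norm (of_real (\<bar>M\<bar> + 2) - t) < 1" using t(1) by (simp add: dist_norm)
      ultimately show ?thesis by linarith
    qed
    have "t \<in> N" using t WN by blast
    then obtain z w where zw: "Im z > 0" "Im w > 0" "jj z = t" "jj w = t" "\<not> SL2Z_equiv z w" unfolding N_def by blast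
    obtain z' w' where z': "z' \<in> FD" "SL2Z_equiv z z'" and w': "w' \<in> FD" "SL2Z_equiv w w'"
      using equiv_FD zw by meson
    have jz: "jj z' = t" "jj w' = t" using jj_equiv[OF zw(1) z'(2)] jj_equiv[OF zw(2) w'(2)] zw by auto
    have "Im z' > Y" using M[of z'] FD_Box[OF z'(1), of Y] jz \<open>norm t > M\<close> by (cases "Im z' \<le> Y") auto
    moreover have "Im w' > Y" using M[of w'] FD_Box[OF w'(1), of Y] jz \<open>norm t > M\<close> by (cases "Im w' \<le> Y") auto
    ultimately have "SL2Z_equiv z' w'" using Y(2) jz by simp
    then have "SL2Z_equiv z w"
      by (intro SL2Z_equiv_trans[OF zw(1) _ SL2Z_equiv_sym[OF zw(2) w'(2)]] SL2Z_equiv_trans[OF zw(1) z'(2)])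
    then show False using zw by blast
  qed
  ultimately have "N \<inter> W = {}" by blast
  then have "N \<subseteq> jj ` crit" by (auto simp: W_def)
  \<comment> \<open>A nonempty open set cannot consist of critical values only.\<close>
  then have "countable N" using cc countable_subset by blast
  moreover obtain e where "e > 0" "ball (jj z) e \<subseteq> N" using openN \<open>jj z \<in> N\<close> open_contains_ball by blast
  ultimately show False using uncountable_ball[of e "jj z"] countable_subset by blast
qed

text \<open>A value near \<open>jj z0\<close> has \<open>n\<close> preimages near \<open>z0\<close>,
  one for each \<open>n\<close>-th root of unity. They are equivalent by \<open>jj_inj\<close>, and
  through elements fixing \<open>z0\<close> because the action is properly discontinuous; so the
  stabiliser bounds \<open>n\<close>.\<close>

lemma jj_ramification:
  assumes z0: "Im z0 > 0"
    and stab: "\<And>a b c d z. a * d - b * c = 1 \<Longrightarrow> mob a b c d z0 = z0 \<Longrightarrow> Im z > 0 \<Longrightarrow> mob a b c d z \<in> S z"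
    and S: "\<And>z. finite (S z)" "\<And>z. card (S z) \<le> N"
  obtains n L where "n > 0" "n \<le> N" "L \<noteq> 0" "((\<lambda>z. (jj z - jj z0) / (z - z0) ^ n) \<longlongrightarrow> L) (at z0)"
proof -
  have conn: "connected upper_half_plane" by (rule convex_connected[OF convex_uhp])
  have z0U: "z0 \<in> upper_half_plane" using z0 by (simp add: uhp_iff)
  have "\<exists>n>0. (deriv ^^ n) jj z0 \<noteq> 0"
  proof (rule ccontr)
    assume "\<not> ?thesis"
    then have "jj w = jj z0" if "w \<in> upper_half_plane" for w
      using holomorphic_fun_eq_const_on_connected[OF jj_holomorphic open_uhp conn _ z0U that] by blast
    then show False using jj_nonconstant unfolding constant_on_def by blast
  qed
  define n where "n = (LEAST n. n > 0 \<and> (deriv ^^ n) jj z0 \<noteq> 0)"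
  have n: "n > 0" "(deriv ^^ n) jj z0 \<noteq> 0"
    using LeastI_ex[OF \<open>\<exists>n>0. (deriv ^^ n) jj z0 \<noteq> 0\<close>] by (simp_all add: n_def)
  have least: "(deriv ^^ i) jj z0 = 0" if "0 < i" "i < n" for i
    using not_less_Least[of i "\<lambda>n. n > 0 \<and> (deriv ^^ n) jj z0 \<noteq> 0"] that unfolding n_def by blast
  obtain r g where g: "0 < r" "g holomorphic_on ball z0 r"
     "\<And>w. w \<in> ball z0 r \<Longrightarrow> jj w - jj z0 = ((w - z0) * g w) ^ n" "\<And>w. w \<in> ball z0 r \<Longrightarrow> g w \<noteq> 0"
  proof (rule holomorphic_factor_order_of_zero_strong[OF jj_holomorphic open_uhp z0U n least])
    fix g r assume "0 < r" "g holomorphic_on ball z0 r" "\<And>w. w \<in> ball z0 r \<Longrightarrow> jj w - jj z0 = ((w - z0) * g w) ^ n"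
      "\<And>w. w \<in> ball z0 r \<Longrightarrow> g w \<noteq> 0"
    then show ?thesis by (rule that)
  qed
  have gc: "(g \<longlongrightarrow> g z0) (at z0)"
    using holomorphic_on_imp_continuous_on[OF g(2)] g(1) by (simp add: continuous_on_eq_continuous_at isCont_def[symmetric])
  have "((\<lambda>z. g z ^ n) \<longlongrightarrow> g z0 ^ n) (at z0)" by (intro tendsto_intros gc)
  moreover have "\<forall>\<^sub>F z in at z0. g z ^ n = (jj z - jj z0) / (z - z0) ^ n"
    unfolding eventually_at using g by (intro exI[of _ r]) (auto simp: dist_commute power_mult_distrib)
  ultimately have lim: "((\<lambda>z. (jj z - jj z0) / (z - z0) ^ n) \<longlongrightarrow> g z0 ^ n) (at z0)" by (rule Lim_transform_eventually)
  have "n \<le> N"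
  proof -
    obtain \<epsilon> where \<epsilon>: "\<epsilon> > 0" "\<And>w1 w2 a b c d. dist w1 z0 < \<epsilon> \<Longrightarrow> dist w2 z0 < \<epsilon> \<Longrightarrow> a * d - b * c = 1 \<Longrightarrow>
      w2 = mob a b c d w1 \<Longrightarrow> z0 = mob a b c d z0" using properly_discontinuous[OF z0 z0] by metis
    define \<psi> where "\<psi> w = (w - z0) * g w" for w
    define \<delta> where "\<delta> = min (min r \<epsilon>) (Im z0)"
    have \<delta>: "\<delta> > 0" "\<delta> \<le> r" "\<delta> \<le> \<epsilon>" "\<delta> \<le> Im z0" using g(1) \<epsilon>(1) z0 by (auto simp: \<delta>_def)
    have Ipos: "Im w > 0" if "w \<in> ball z0 \<delta>" for w
    proof -
      have "\<bar>Im (z0 - w)\<bar> < \<delta>" using that abs_Im_le_cmod[of "z0 - w"] by (simp add: dist_norm)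
      then show ?thesis using \<delta>(4) by simp
    qed
    have hol: "\<psi> holomorphic_on ball z0 \<delta>" unfolding \<psi>_def
      using g(2) \<delta>(2) by (intro holomorphic_intros) (auto intro: holomorphic_on_subset)
    have "\<not> \<psi> constant_on ball z0 \<delta>"
    proof
      assume "\<psi> constant_on ball z0 \<delta>"
      then obtain c where c: "\<And>w. w \<in> ball z0 \<delta> \<Longrightarrow> \<psi> w = c" by (auto simp: constant_on_def)
      have "z0 + of_real (\<delta>/2) \<in> ball z0 \<delta>" "z0 \<in> ball z0 \<delta>" using \<delta> by (auto simp: dist_norm)
      then have "\<psi> (z0 + of_real (\<delta>/2)) = \<psi> z0" using c by simp
      then have "of_real (\<delta>/2) * g (z0 + of_real (\<delta>/2)) = 0" by (simp add: \<psi>_def)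
      then show False using g(4)[of "z0 + of_real (\<delta>/2)"] \<delta> by (auto simp: dist_norm)
    qed
    then have "open (\<psi> ` ball z0 \<delta>)"
      by (intro open_mapping_thm[OF hol]) auto
    moreover have "0 \<in> \<psi> ` ball z0 \<delta>" using \<delta>(1) by (intro image_eqI[of _ _ z0]) (auto simp: \<psi>_def)
    ultimately obtain e where e: "e > 0" "ball 0 e \<subseteq> \<psi> ` ball z0 \<delta>" unfolding open_contains_ball by blast
    define R where "R = {x::complex. x ^ n = 1}"
    have R: "card R = n" using card_roots_unity_eq[of n] n(1) by (simp add: R_def)
    have "\<exists>w\<in>ball z0 \<delta>. \<psi> w = of_real (e/2) * x" if "x \<in> R" for x
    proof -
      have "norm x = 1" using power_eq_imp_eq_norm[of x n 1] that n(1) by (simp add: R_def)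
      then have "of_real (e/2) * x \<in> ball 0 e" using e(1) by (simp add: norm_mult)
      then have "of_real (e/2) * x \<in> \<psi> ` ball z0 \<delta>" using e(2) by (rule subsetD[rotated])
      then show ?thesis by (elim imageE) (intro bexI, auto)
    qed
    then obtain W where W: "\<forall>x\<in>R. W x \<in> ball z0 \<delta> \<and> \<psi> (W x) = of_real (e/2) * x"
      using bchoice[of R "\<lambda>x w. w \<in> ball z0 \<delta> \<and> \<psi> w = of_real (e/2) * x"] by blast
    then have W: "\<And>x. x \<in> R \<Longrightarrow> W x \<in> ball z0 \<delta>" "\<And>x. x \<in> R \<Longrightarrow> \<psi> (W x) = of_real (e/2) * x" by blast+
    have jW: "jj (W x) = jj z0 + of_real (e/2) ^ n" if "x \<in> R" for x
    proof -
      have "jj (W x) - jj z0 = \<psi> (W x) ^ n" using g(3)[of "W x"] W(1)[OF that] \<delta>(2) by (simp add: \<psi>_def)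
      also have "\<dots> = of_real (e/2) ^ n" unfolding W(2)[OF that] power_mult_distrib using that by (simp add: R_def)
      finally show ?thesis by (simp add: algebra_simps)
    qed
    have "1 \<in> R" by (simp add: R_def)
    have "W ` R \<subseteq> S (W 1)"
    proof
      fix y assume "y \<in> W ` R"
      then obtain x where x: "x \<in> R" "y = W x" by blast
      have I: "Im (W 1) > 0" "Im (W x) > 0" using Ipos W(1) \<open>1 \<in> R\<close> x(1) by auto
      have "SL2Z_equiv (W 1) (W x)" using I jW[OF x(1)] jW[OF \<open>1 \<in> R\<close>] by (intro jj_inj) auto
      then obtain a b c d where m: "a * d - b * c = 1" "W x = mob a b c d (W 1)" unfolding SL2Z_equiv_mob by blast
      have "z0 = mob a b c d z0"
        using W(1)[OF x(1)] W(1)[OF \<open>1 \<in> R\<close>] \<delta>(3) by (intro \<epsilon>(2)[OF _ _ m]) (auto simp: dist_commute)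
      then show "y \<in> S (W 1)" using stab[OF m(1) _ I(1)] m(2) x(2) by simp
    qed
    moreover have "inj_on W R"
    proof (rule inj_onI)
      fix x y assume "x \<in> R" "y \<in> R" "W x = W y"
      then have "of_real (e/2) * x = of_real (e/2) * y" using W(2) by metis
      then show "x = y" using e(1) by simp
    qed
    ultimately have "n \<le> card (S (W 1))" using R card_mono[OF S(1)] card_image by metis
    then show ?thesis using S(2) le_trans by blast
  qed
  then show ?thesis using that[OF n(1) _ _ lim] g(4)[of z0] g(1) by simp
qed

lemma jj_simple:
  assumes "Im z0 > 0" "\<not> SL2Z_equiv z0 \<i>" "\<not> SL2Z_equiv z0 rho"
  obtains L where "L \<noteq> 0" "((\<lambda>z. (jj z - jj z0) / (z - z0)) \<longlongrightarrow> L) (at z0)"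
proof -
  obtain n L where "n > 0" "n \<le> 1" "L \<noteq> 0" "((\<lambda>z. (jj z - jj z0) / (z - z0) ^ n) \<longlongrightarrow> L) (at z0)"
  proof (rule jj_ramification[of z0 "\<lambda>z. {z}" 1])
    fix a b c d z assume "a * d - b * c = 1" "mob a b c d z0 = z0" "Im z > 0"
    then show "mob a b c d z \<in> {z}" using stabilizer_trivial[of a d b c z0 z] assms by simp
  qed (use assms in auto)
  then have "n = 1" by simp
  then show ?thesis using that \<open>L \<noteq> 0\<close> \<open>(_ \<longlongrightarrow> L) (at z0)\<close> by simp
qed

text \<open>To first order the map \<open>- 1 / z\<close> multiplies the local parameter at i by -1,
  so an invariant function has no simple pole coefficient.\<close>

lemma parity_i:
  assumes inv: "\<And>z. Im z > 0 \<Longrightarrow> f (- 1 / z) = f z" and lim: "((\<lambda>z. (z - \<i>) * f z) \<longlongrightarrow> L) (at \<i>)"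
  shows "L = 0"
proof -
  have ev: "\<forall>\<^sub>F z in at \<i>. z \<noteq> \<i> \<and> Im z > 0"
  proof -
    have "\<forall>\<^sub>F z in at \<i>. z \<in> upper_half_plane"
      using eventually_nhds_in_open[OF open_uhp, of \<i>] by (simp add: uhp_iff eventually_at_filter eventually_mono)
    then show ?thesis using eventually_neq_at_within[of \<i> \<i> UNIV] by eventually_elim (simp add: uhp_iff)
  qed
  have "filterlim (\<lambda>z. - 1 / z) (at \<i>) (at \<i>)"
    unfolding filterlim_at
  proof
    show "\<forall>\<^sub>F z in at \<i>. - 1 / z \<in> UNIV \<and> - 1 / z \<noteq> \<i>"
      using ev
    proof eventually_elim
      case (elim z)
      have "z = \<i>" if "- 1 / z = \<i>"
      proof -
        have "z \<noteq> 0" using elim by auto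
        have "\<i> * z = - 1 / z * z" by (simp only: that)
        also have "\<dots> = - 1" using \<open>z \<noteq> 0\<close> by simp
        finally have "\<i> * z = - 1" .
        then have "Re (\<i> * z) = Re (- 1)" "Im (\<i> * z) = Im (- 1)" by simp_all
        then show ?thesis by (simp add: complex_eq_iff)
      qed
      then show ?case using elim by auto
    qed
    have "((\<lambda>z. - 1 / z) \<longlongrightarrow> - 1 / \<i>) (at \<i>)" by (intro tendsto_intros) auto
    then show "((\<lambda>z. - 1 / z) \<longlongrightarrow> \<i>) (at \<i>)" by simp
  qed
  from filterlim_compose[OF lim this]
  have 1: "((\<lambda>z. (- 1 / z - \<i>) * f (- 1 / z)) \<longlongrightarrow> L) (at \<i>)" .
  have 2: "((\<lambda>z. - (\<i> / z) * ((z - \<i>) * f z)) \<longlongrightarrow> - (\<i> / \<i>) * L) (at \<i>)"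
    by (intro tendsto_intros lim) auto
  have "\<forall>\<^sub>F z in at \<i>. (- 1 / z - \<i>) * f (- 1 / z) = - (\<i> / z) * ((z - \<i>) * f z)"
    using ev
  proof eventually_elim
    case (elim z)
    then have "z \<noteq> 0" by auto
    then have "- 1 / z - \<i> = - (\<i> / z) * (z - \<i>)" by (simp add: field_simps)
    then show ?case using inv elim by simp
  qed
  then have "((\<lambda>z. - (\<i> / z) * ((z - \<i>) * f z)) \<longlongrightarrow> L) (at \<i>)" by (rule Lim_transform_eventually[OF 1])
  then have "L = - (\<i> / \<i>) * L" using 2 LIM_unique by blast
  then show ?thesis by simp
qed

lemma rho_powers: "rho ^ 3 = -1" "rho ^ 4 = - rho" "1 - 1 / rho = rho"
proof -
  have "rho ^ 3 = rho * rho\<^sup>2" by (simp add: power3_eq_cube power2_eq_square)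
  also have "\<dots> = rho\<^sup>2 - rho" unfolding rho_facts(4) by (simp add: algebra_simps rho_facts(4)[unfolded power2_eq_square])
  finally show 3: "rho ^ 3 = -1" unfolding rho_facts(4) by simp
  have "rho ^ 4 = rho ^ 3 * rho" by (simp add: eval_nat_numeral)
  then show "rho ^ 4 = - rho" by (simp add: 3)
  show "1 - 1 / rho = rho" using rho_facts(4,5) by (simp add: field_simps power2_eq_square)
qed

text \<open>To first order the map \<open>(z - 1) / z\<close> multiplies the local parameter at rho
  by \<open>- rho\<close>, a primitive cube root of unity, which leaves no room for a coefficient of
  order 1 or 2.\<close>

lemma parity_rho:
  assumes inv: "\<And>z. Im z > 0 \<Longrightarrow> f ((z - 1) / z) = f z" and k: "k = 1 \<or> k = 2"
    and lim: "((\<lambda>z. (z - rho) ^ k * f z) \<longlongrightarrow> L) (at rho)"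
  shows "L = 0"
proof -
  have ev: "\<forall>\<^sub>F z in at rho. z \<noteq> rho \<and> Im z > 0"
  proof -
    have "\<forall>\<^sub>F z in at rho. z \<in> upper_half_plane"
      using eventually_nhds_in_open[OF open_uhp, of rho] rho_facts(1) by (simp add: uhp_iff eventually_at_filter eventually_mono)
    then show ?thesis using eventually_neq_at_within[of rho rho UNIV] by eventually_elim (simp add: uhp_iff)
  qed
  have eq: "(z - 1) / z - rho = (1 - rho) / z * (z - rho)" if "z \<noteq> 0" for z
  proof -
    have "(1 - rho) * rho = 1" using rho_facts(4) by (simp add: algebra_simps power2_eq_square)
    then have "(1 - rho) * (z - rho) = (1 - rho) * z - 1" by (simp add: algebra_simps)
    then show ?thesis using that by (simp add: field_simps)
  qed
  have n1: "rho \<noteq> 1" using rho_facts(2) by auto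
  have "filterlim (\<lambda>z. (z - 1) / z) (at rho) (at rho)"
    unfolding filterlim_at
  proof
    show "\<forall>\<^sub>F z in at rho. (z - 1) / z \<in> UNIV \<and> (z - 1) / z \<noteq> rho"
      using ev
    proof eventually_elim
      case (elim z)
      then have "z \<noteq> 0" by auto
      then show ?case using eq[of z] elim n1 by auto
    qed
    have "((\<lambda>z. (z - 1) / z) \<longlongrightarrow> (rho - 1) / rho) (at rho)" by (intro tendsto_intros rho_facts)
    then show "((\<lambda>z. (z - 1) / z) \<longlongrightarrow> rho) (at rho)" using rho_powers(3) rho_facts(5) by (simp add: diff_divide_distrib)
  qed
  from filterlim_compose[OF lim this]
  have 1: "((\<lambda>z. ((z - 1) / z - rho) ^ k * f ((z - 1) / z)) \<longlongrightarrow> L) (at rho)" .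
  have 2: "((\<lambda>z. ((1 - rho) / z) ^ k * ((z - rho) ^ k * f z)) \<longlongrightarrow> ((1 - rho) / rho) ^ k * L) (at rho)"
    by (intro tendsto_intros lim rho_facts)
  have "\<forall>\<^sub>F z in at rho. ((z - 1) / z - rho) ^ k * f ((z - 1) / z) = ((1 - rho) / z) ^ k * ((z - rho) ^ k * f z)"
    using ev
  proof eventually_elim
    case (elim z)
    then have "z \<noteq> 0" by auto
    then show ?case unfolding eq[OF \<open>z \<noteq> 0\<close>] using inv elim by (simp only: power_mult_distrib) simp
  qed
  then have "((\<lambda>z. ((1 - rho) / z) ^ k * ((z - rho) ^ k * f z)) \<longlongrightarrow> L) (at rho)" by (rule Lim_transform_eventually[OF 1])
  then have eqL: "L = ((1 - rho) / rho) ^ k * L" using 2 LIM_unique by blast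
  have "(1 - rho) / rho = - (1 - 1 / rho)" using rho_facts(5) by (simp add: field_simps)
  then have "(1 - rho) / rho = - rho" by (simp only: rho_powers(3))
  then have "L = (- rho) ^ k * L" using eqL by simp
  moreover have "(- rho) ^ k \<noteq> 1"
  proof
    assume "(- rho) ^ k = 1"
    then have "- rho = 1 \<or> rho - 1 = 1" using k rho_facts(4) by auto
    then have "Re (- rho) = Re 1 \<or> Re (rho - 1) = Re 1" by metis
    then show False using rho_facts(2) by simp
  qed
  ultimately show ?thesis by (metis mult_cancel_right1)
qed

lemma limit_lower_power_zero:
  fixes f :: "complex \<Rightarrow> complex"
  assumes "((\<lambda>z. f z / (z - p) ^ n) \<longlongrightarrow> L) (at p)" "m < n"
  shows "((\<lambda>z. f z / (z - p) ^ m) \<longlongrightarrow> 0) (at p)"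
proof -
  have "((\<lambda>z. f z / (z - p) ^ n * (z - p) ^ (n - m)) \<longlongrightarrow> L * (p - p) ^ (n - m)) (at p)"
    by (intro tendsto_intros assms)
  moreover have "L * (p - p) ^ (n - m) = 0" using assms(2) by simp
  ultimately have 1: "((\<lambda>z. f z / (z - p) ^ n * (z - p) ^ (n - m)) \<longlongrightarrow> 0) (at p)" by (simp only:)
  have "\<forall>\<^sub>F z in at p. f z / (z - p) ^ n * (z - p) ^ (n - m) = f z / (z - p) ^ m"
    using eventually_neq_at_within[of p p UNIV]
  proof eventually_elim
    case (elim z)
    have "(z - p) ^ n = (z - p) ^ m * (z - p) ^ (n - m)" using assms(2) by (simp flip: power_add)
    then show ?case using elim by simp
  qed
  then show ?thesis by (rule Lim_transform_eventually[OF 1])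
qed

text \<open>The stabiliser allows order at most 2, and invariance under \<open>- 1 / z\<close>,
  whose derivative at i is -1, makes the derivative of \<open>jj\<close> vanish there.\<close>

lemma jj_double_at_i:
  obtains L where "L \<noteq> 0" "((\<lambda>z. (jj z - jj \<i>) / (z - \<i>)\<^sup>2) \<longlongrightarrow> L) (at \<i>)"
proof -
  obtain n L where nL: "n > 0" "n \<le> 2" "L \<noteq> 0" "((\<lambda>z. (jj z - jj \<i>) / (z - \<i>) ^ n) \<longlongrightarrow> L) (at \<i>)"
  proof (rule jj_ramification[of \<i> "\<lambda>z. {z, - 1 / z}" 2])
    show "card {z, - 1 / z} \<le> 2" for z :: complex by (simp add: card_insert_if)
  qed (use stabilizer_i in auto)
  have "n \<noteq> 1"
  proof
    assume "n = 1"
    have inv: "jj (- 1 / z) = jj z" if "Im z > 0" for z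
      using jj_invariant[OF that, of 0 0 "-1" 1] by (simp add: mob_def)
    have "((\<lambda>z. (jj z - jj \<i>) / (z - \<i>) ^ n) \<longlongrightarrow> 0) (at \<i>)"
    proof -
      have hol: "(\<lambda>z. (jj z - jj \<i>)) holomorphic_on upper_half_plane" by (intro holomorphic_intros jj_holomorphic)
      have "(jj has_field_derivative deriv jj \<i>) (at \<i>)"
        by (intro holomorphic_derivI[OF jj_holomorphic open_uhp]) (simp add: uhp_iff)
      moreover have "((\<lambda>z. jj (- 1 / z)) has_field_derivative deriv jj \<i> * (- 1)) (at \<i>)"
      proof -
        have "(jj has_field_derivative deriv jj \<i>) (at (- 1 / \<i>))" using calculation by simp
        moreover have "((\<lambda>z. - 1 / z) has_field_derivative - 1) (at \<i>)" by (auto intro!: derivative_eq_intros)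
        ultimately show ?thesis by (rule DERIV_chain'[rotated])
      qed
      moreover have "\<forall>\<^sub>F z in nhds \<i>. jj (- 1 / z) = jj z"
      proof -
        have "\<forall>\<^sub>F z in nhds \<i>. z \<in> upper_half_plane"
          by (rule eventually_nhds_in_open[OF open_uhp]) (simp add: uhp_iff)
        then show ?thesis
        proof eventually_elim
          case (elim z)
          then show ?case using inv[of z] by (simp only: uhp_iff)
        qed
      qed
      ultimately have "(jj has_field_derivative deriv jj \<i> * (- 1)) (at \<i>)"
        using DERIV_cong_ev[of \<i> \<i> "\<lambda>z. jj (- 1 / z)" jj] by blast
      then have "deriv jj \<i> = deriv jj \<i> * (- 1)" by (rule DERIV_imp_deriv)
      then have "deriv jj \<i> = 0" by simp
      then show ?thesis using \<open>(jj has_field_derivative deriv jj \<i>) (at \<i>)\<close> \<open>n = 1\<close> unfolding has_field_derivative_iff by simp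
    qed
    from LIM_unique[OF nL(4) this] show False using nL(3) by simp
  qed
  then have "n = 2" using nL(1,2) by simp
  show ?thesis by (rule that[OF nL(3)]) (use nL(4) \<open>n = 2\<close> in simp)
qed

text \<open>At the fixed point the transformation law reads
  \<open>EE rho = rho ^ 4 * EE rho\<close>, and \<open>rho ^ 4 \<noteq> 1\<close>.\<close>

lemma EE_rho: "EE rho = 0" "jj rho = 0"
proof -
  have "mob 1 (-1) 1 0 rho = rho" using rho_powers(3) rho_facts(5) by (simp add: mob_def diff_divide_distrib)
  then have "EE rho = rho ^ 4 * EE rho" using EE_modular[OF rho_facts(1), of 1 0 "-1" 1] by simp
  moreover have "rho ^ 4 \<noteq> 1"
  proof
    assume "rho ^ 4 = 1"
    then have "Re (- rho) = Re 1" by (simp add: rho_powers(2))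
    then show False using rho_facts(2) by simp
  qed
  ultimately show "EE rho = 0" by (metis mult_cancel_right1)
  then show "jj rho = 0" by (simp add: jj_def)
qed

text \<open>Since \<open>EE\<close> vanishes at rho, \<open>jj = EE ^ 3 / DD\<close> vanishes to
  order at least 3, and the stabiliser allows at most 3.\<close>

lemma EE_simple_at_rho:
  obtains L where "L \<noteq> 0" "((\<lambda>z. EE z / (z - rho)) \<longlongrightarrow> L) (at rho)" "((\<lambda>z. jj z / (z - rho) ^ 3) \<longlongrightarrow> L ^ 3 / DD rho) (at rho)"
proof -
  have rU: "rho \<in> upper_half_plane" using rho_facts(1) by (simp add: uhp_iff)
  obtain n L where nL: "n > 0" "n \<le> 3" "L \<noteq> 0" "((\<lambda>z. (jj z - jj rho) / (z - rho) ^ n) \<longlongrightarrow> L) (at rho)"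
  proof (rule jj_ramification[of rho "\<lambda>z. {z, (z - 1) / z, - 1 / (z - 1)}" 3])
    show "card {z, (z - 1) / z, - 1 / (z - 1)} \<le> 3" for z :: complex by (simp add: card_insert_if)
  qed (use stabilizer_rho rho_facts(1) in auto)
  have "(EE has_field_derivative deriv EE rho) (at rho)" by (rule holomorphic_derivI[OF EE_holomorphic open_uhp rU])
  then have E: "((\<lambda>z. EE z / (z - rho)) \<longlongrightarrow> deriv EE rho) (at rho)"
    unfolding has_field_derivative_iff by (simp add: EE_rho)
  have "(DD \<longlongrightarrow> DD rho) (at rho)"
    using holomorphic_on_imp_continuous_on[OF DD_holomorphic] open_uhp rU by (simp add: continuous_on_eq_continuous_at isCont_def[symmetric])
  then have "((\<lambda>z. (EE z / (z - rho)) ^ 3 / DD z) \<longlongrightarrow> deriv EE rho ^ 3 / DD rho) (at rho)"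
    using DD_nonzero[OF rho_facts(1)] by (intro tendsto_intros E)
  then have J: "((\<lambda>z. jj z / (z - rho) ^ 3) \<longlongrightarrow> deriv EE rho ^ 3 / DD rho) (at rho)"
    by (simp add: jj_def power_divide mult.commute)
  have "n = 3"
  proof (rule ccontr)
    assume "n \<noteq> 3"
    then have "n < 3" using nL by simp
    from limit_lower_power_zero[OF J this] have "((\<lambda>z. (jj z - jj rho) / (z - rho) ^ n) \<longlongrightarrow> 0) (at rho)"
      by (simp add: EE_rho)
    from LIM_unique[OF nL(4) this] have "L = 0" .
    then show False using nL by simp
  qed
  then have "((\<lambda>z. jj z / (z - rho) ^ 3) \<longlongrightarrow> L) (at rho)" using nL(4) by (simp add: EE_rho)
  from LIM_unique[OF this J] have "L = deriv EE rho ^ 3 / DD rho" .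
  then have "deriv EE rho \<noteq> 0" using nL(3) by auto
  then show ?thesis using that E J by blast
qed

lemma EE_eq_0_iff: "Im z > 0 \<Longrightarrow> EE z = 0 \<longleftrightarrow> SL2Z_equiv rho z"
proof -
  assume z: "Im z > 0"
  have "SL2Z_equiv rho z" if "jj z = 0" using jj_inj[OF rho_facts(1) z] that EE_rho(2) by simp
  moreover have "jj z = 0" if "SL2Z_equiv rho z" using jj_equiv[OF rho_facts(1) that] EE_rho(2) by simp
  ultimately show ?thesis using jj_eq_0_iff[OF z] by blast
qed

section \<open>Local expansions of the potential\<close>

lemma punctured_holomorphic:
  assumes "\<forall>\<^sub>F z in at p. f analytic_on {z}"
  obtains r where "r > 0" "f holomorphic_on ball p r - {p}"
proof -
  obtain r where r: "r > 0" "\<And>z. z \<noteq> p \<Longrightarrow> dist z p < r \<Longrightarrow> f analytic_on {z}"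
    using assms unfolding eventually_at by auto
  have "f analytic_on ball p r - {p}"
    by (subst analytic_on_analytic_at) (use r(2) in \<open>auto simp: dist_commute\<close>)
  then show ?thesis using that r(1) analytic_imp_holomorphic by blast
qed

lemma pole_lower:
  assumes "\<forall>\<^sub>F z in at p. f analytic_on {z}" "((\<lambda>z. (z - p) ^ Suc k * f z) \<longlongrightarrow> 0) (at p)"
  shows "\<exists>L. ((\<lambda>z. (z - p) ^ k * f z) \<longlongrightarrow> L) (at p)"
proof -
  obtain r where "r > 0" "f holomorphic_on ball p r - {p}" using punctured_holomorphic[OF assms(1)] .
  then show ?thesis using removable_to_limit[OF _ _ assms(2)] by blast
qed

text \<open>Once the double pole is gone, \<open>(z - p) * f z\<close> is holomorphic at
  \<open>p\<close>; its Taylor series is the series that \<open>expands\<close> asks for.\<close>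

lemma simple_pole_expansion:
  assumes an: "\<forall>\<^sub>F z in at p. f analytic_on {z}" and lim: "((\<lambda>z. (z - p)\<^sup>2 * f z) \<longlongrightarrow> 0) (at p)"
  obtains h H where "h has_fps_expansion H" "\<forall>\<^sub>F s in at 0. f (p + s) = h s / s" "((\<lambda>z. (z - p) * f z) \<longlongrightarrow> fps_nth H 0) (at p)"
proof -
  obtain L where L: "((\<lambda>z. (z - p) * f z) \<longlongrightarrow> L) (at p)"
    using pole_lower[OF an, of 1] lim by (auto simp: power2_eq_square)
  obtain r where r: "r > 0" "f holomorphic_on ball p r - {p}" using punctured_holomorphic[OF an] .
  define g where "g z = (if z = p then L else (z - p) * f z)" for z
  have "(\<lambda>z. (z - p) * f z) holomorphic_on ball p r - {p}" using r by (intro holomorphic_intros)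
  then have "g holomorphic_on ball p r - {p}" by (rule holomorphic_transform) (auto simp: g_def)
  moreover have "g \<midarrow>p\<rightarrow> L" by (rule Lim_transform_eventually[OF L]) (auto simp: g_def eventually_at_filter)
  ultimately have "(\<lambda>z. if z = p then L else g z) holomorphic_on ball p r" by (intro removable_singularity open_ball) auto
  then have "g holomorphic_on ball p r" by (rule holomorphic_transform) (auto simp: g_def)
  then have "g analytic_on {p}" using r(1) unfolding analytic_at by (intro exI[of _ "ball p r"]) auto
  then have h: "(\<lambda>s. g (p + s)) has_fps_expansion fps_expansion g p" by (rule analytic_at_imp_has_fps_expansion)
  from has_fps_expansion_imp_0_eq_fps_nth_0[OF h] have "fps_nth (fps_expansion g p) 0 = L" by (simp add: g_def)
  then show ?thesis using that[OF h] L by (auto simp: g_def eventually_at_filter)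
qed

lemma expandsI:
  assumes "h has_fps_expansion H" "\<forall>\<^sub>F s in at 0. Q (p + s) = ((of_nat n)\<^sup>2 - 1) / 4 / s\<^sup>2 + h s / s"
  shows "expands n Q p H"
proof -
  have "\<forall>\<^sub>F s in at 0. eval_fps H s = h s"
    using assms(1) unfolding has_fps_expansion_def by (auto simp: eventually_nhds_conv_at)
  with assms(2) have "\<forall>\<^sub>F s in at 0. Q (p + s) = ((of_nat n)\<^sup>2 - 1) / 4 / s\<^sup>2 + eval_fps H s / s"
    by eventually_elim simp
  then show ?thesis using assms(1) by (simp add: expands_def has_fps_expansion_def)
qed

lemma filterlim_moebius:
  fixes a b c d :: complex
  assumes det: "a * d - b * c \<noteq> 0" and nz: "c * p + d \<noteq> 0"
  shows "filterlim (\<lambda>z. (a * z + b) / (c * z + d)) (at ((a * p + b) / (c * p + d))) (at p)"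
proof -
  have t: "((\<lambda>z. c * z + d) \<longlongrightarrow> c * p + d) (at p)" by (intro tendsto_intros)
  have "\<forall>\<^sub>F z in at p. c * z + d \<noteq> 0" using tendsto_imp_eventually_ne[OF t nz] .
  then have "\<forall>\<^sub>F z in at p. (a * z + b) / (c * z + d) \<noteq> (a * p + b) / (c * p + d)"
    using eventually_neq_at_within[of p p UNIV]
  proof eventually_elim
    case (elim z)
    show ?case
    proof
      assume "(a * z + b) / (c * z + d) = (a * p + b) / (c * p + d)"
      then have "(a * z + b) * (c * p + d) = (a * p + b) * (c * z + d)" using elim nz by (simp add: frac_eq_eq)
      then have "(a * d - b * c) * (z - p) = 0" by (simp add: algebra_simps)
      then show False using det elim by simp
    qed
  qed
  moreover have "((\<lambda>z. (a * z + b) / (c * z + d)) \<longlongrightarrow> (a * p + b) / (c * p + d)) (at p)"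
    using nz by (intro tendsto_intros)
  ultimately show ?thesis by (simp add: filterlim_at)
qed

text \<open>The factor in front of \<open>Q\<close> is the squared derivative of the Moebius map,
  which compensates the change of \<open>(z - p)\<^sup>2\<close>; so local exponents are
  invariant.\<close>

lemma double_pole_moebius:
  fixes a b c d :: complex
  defines "\<delta> \<equiv> a * d - b * c"
  assumes Q: "((\<lambda>z. (z - (a * p + b) / (c * p + d))\<^sup>2 * Q z) \<longlongrightarrow> A) (at ((a * p + b) / (c * p + d)))"
    and nz: "c * p + d \<noteq> 0" "\<delta> \<noteq> 0"
    and Q': "\<forall>\<^sub>F z in at p. Q' z = \<delta>\<^sup>2 / (c * z + d) ^ 4 * Q ((a * z + b) / (c * z + d))"
  shows "((\<lambda>z. (z - p)\<^sup>2 * Q' z) \<longlongrightarrow> A) (at p)"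
proof -
  let ?g = "\<lambda>z. (a * z + b) / (c * z + d)"
  have "((\<lambda>z. (?g z - ?g p)\<^sup>2 * Q (?g z)) \<longlongrightarrow> A) (at p)"
    using filterlim_compose[OF Q filterlim_moebius[of a d b c p]] nz by (simp add: \<delta>_def)
  then have "((\<lambda>z. ((c * p + d) / (c * z + d))\<^sup>2 * ((?g z - ?g p)\<^sup>2 * Q (?g z))) \<longlongrightarrow> ((c * p + d) / (c * p + d))\<^sup>2 * A) (at p)"
    using nz by (intro tendsto_intros) auto
  then have 1: "((\<lambda>z. ((c * p + d) / (c * z + d))\<^sup>2 * ((?g z - ?g p)\<^sup>2 * Q (?g z))) \<longlongrightarrow> A) (at p)" using nz by simp
  have t: "((\<lambda>z. c * z + d) \<longlongrightarrow> c * p + d) (at p)" by (intro tendsto_intros)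
  have "\<forall>\<^sub>F z in at p. c * z + d \<noteq> 0" using tendsto_imp_eventually_ne[OF t nz(1)] .
  then have "\<forall>\<^sub>F z in at p. ((c * p + d) / (c * z + d))\<^sup>2 * ((?g z - ?g p)\<^sup>2 * Q (?g z)) = (z - p)\<^sup>2 * Q' z"
    using Q'
  proof eventually_elim
    case (elim z)
    have "?g z - ?g p = \<delta> * (z - p) / ((c * z + d) * (c * p + d))"
      using elim nz by (simp add: \<delta>_def field_simps)
    then show ?case unfolding elim(2) using elim(1) nz
      by (simp add: power_mult_distrib power_divide)
  qed
  then show ?thesis by (rule Lim_transform_eventually[OF 1])
qed

text \<open>Invariance of \<open>s * d(s)\<close> under \<open>s \<mapsto> \<zeta> * s\<close> is
  inherited by the Frobenius series, coefficient by coefficient.\<close>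

lemma frob_symmetric:
  assumes "\<And>k. d k \<noteq> 0 \<Longrightarrow> (\<zeta>::complex) ^ Suc k = 1" "frob \<nu> d (\<lambda>_. 0) k \<noteq> 0"
  shows "\<zeta> ^ k = 1"
  using assms(2)
proof (induction k rule: less_induct)
  case (less k)
  show ?case
  proof (cases "k = 0")
    case False
    then have "(\<Sum>i<k. d (k - 1 - i) * frob \<nu> d (\<lambda>_. 0) i) \<noteq> 0"
      using less.prems by (subst (asm) frob.simps) auto
    then obtain i where i: "i < k" "d (k - 1 - i) \<noteq> 0" "frob \<nu> d (\<lambda>_. 0) i \<noteq> 0"
      by (metis (no_types, lifting) lessThan_iff mult_eq_0_iff sum.neutral)
    have "\<zeta> ^ k = \<zeta> ^ Suc (k - 1 - i) * \<zeta> ^ i" using i(1) by (simp flip: power_add power_Suc)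
    then show ?thesis using assms(1)[OF i(2)] less.IH[OF i(1,3)] by simp
  qed simp
qed

text \<open>A nonzero summand with index \<open>i\<close> would need both
  \<open>\<zeta> ^ (n - i) = 1\<close> and \<open>\<zeta> ^ i = 1\<close>, hence
  \<open>\<zeta> ^ n = 1\<close>.\<close>

lemma obstr_symmetric:
  assumes d: "\<And>k. d k \<noteq> 0 \<Longrightarrow> (\<zeta>::complex) ^ Suc k = 1" and n: "\<zeta> ^ n \<noteq> 1"
  shows "obstr n d = 0"
  unfolding obstr_def
proof (rule sum.neutral, intro ballI, rule ccontr)
  fix i assume i: "i \<in> {..<n}" and nz: "d (n - 1 - i) * frob (- int n) d (\<lambda>_. 0) i \<noteq> 0"
  have "\<zeta> ^ n = \<zeta> ^ Suc (n - 1 - i) * \<zeta> ^ i" using i by (simp flip: power_add power_Suc)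
  then show False using d[of "n - 1 - i"] frob_symmetric[of d \<zeta> "- int n" i] d nz n by simp
qed

text \<open>
  In the Cayley coordinate at a fixed point of \<open>mob a b c d\<close> the potential is invariant under a
  rotation, which forces the obstruction to vanish.
\<close>

lemma riccati_at_fixed_point:
  assumes p: "Im p > 0" and det: "a * d - b * c = 1" and fixed: "mob a b c d p = p"
    and \<zeta>: "((of_int c * cnj p + of_int d) / (of_int c * p + of_int d)) ^ n \<noteq> 1" and n: "n \<ge> 1"
    and an: "\<forall>\<^sub>F z in at p. Q analytic_on {z}"
    and modular: "\<forall>\<^sub>F z in at p. Q (mob a b c d z) = (of_int c * z + of_int d) ^ 4 * Q z"
    and lim: "((\<lambda>z. (z - p)\<^sup>2 * Q z) \<longlongrightarrow> ((of_nat n)\<^sup>2 - 1) / 4) (at p)"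
  shows "riccati n Q p"
proof -
  define \<mu> \<mu>' where "\<mu> = of_int c * p + of_int d" and "\<mu>' = of_int c * cnj p + of_int d"
  define z where "z = \<mu>' / \<mu>"
  define \<delta> where "\<delta> = p - cnj p"
  have \<delta>: "\<delta> \<noteq> 0" using p by (auto simp: \<delta>_def complex_eq_iff)
  have \<mu>: "\<mu> \<noteq> 0" using mob_denom_nonzero[OF p det] by (simp add: \<mu>_def)
  have cnj\<mu>: "cnj \<mu> = \<mu>'" by (simp add: \<mu>_def \<mu>'_def)
  have fix1: "of_int a * p + of_int b = p * \<mu>" using fixed \<mu> by (simp add: mob_def \<mu>_def divide_eq_eq)
  then have "cnj (of_int a * p + of_int b) = cnj (p * \<mu>)" by simp
  then have fix2: "of_int a * cnj p + of_int b = cnj p * \<mu>'" by (simp add: cnj\<mu>)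
  \<comment> \<open>The height is preserved, so \<open>\<mu>\<close> has modulus 1 and its conjugate
    \<open>\<mu>'\<close> is its inverse; the local rotation is by
    \<open>z = \<mu>' / \<mu>\<close>.\<close>
  have "Im p = Im p / (cmod \<mu>)\<^sup>2" using Im_mob[OF det, of p] fixed by (simp add: \<mu>_def)
  then have "(cmod \<mu>)\<^sup>2 = 1" using p \<mu> by (simp add: field_simps)
  then have \<mu>\<mu>: "\<mu> * \<mu>' = 1" using complex_norm_square[of \<mu>] by (simp add: cnj\<mu>)
  have z: "z \<noteq> 0" using \<mu>\<mu> \<mu> by (auto simp: z_def)
  \<comment> \<open>Inverse Cayley map: 0 goes to \<open>p\<close> and infinity to
    \<open>cnj p\<close>, so the stabiliser element acts by
    \<open>w \<mapsto> z * w\<close>.\<close>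
  define C where "C w = (- cnj p * w + p) / (- 1 * w + 1)" for w
  define Q' where "Q' w = \<delta>\<^sup>2 / (- 1 * w + 1) ^ 4 * Q (C w)" for w
  have dd: "- cnj p * 1 - p * - 1 = \<delta>" by (simp add: \<delta>_def)
  have C0: "(- cnj p * 0 + p) / (- 1 * 0 + 1) = p" by simp
  have filC: "filterlim C (at p) (at 0)"
    using filterlim_moebius[of "- cnj p" 1 p "- 1" 0] \<delta> unfolding C_def dd by simp
  have lim': "((\<lambda>w. (w - 0)\<^sup>2 * Q' w) \<longlongrightarrow> ((of_nat n)\<^sup>2 - 1) / 4) (at 0)"
  proof (rule double_pole_moebius[of "- cnj p" 0 p "- 1" 1 Q])
    show "\<forall>\<^sub>F w in at 0. Q' w = (- cnj p * 1 - p * - 1)\<^sup>2 / (- 1 * w + 1) ^ 4 * Q ((- cnj p * w + p) / (- 1 * w + 1))"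
      unfolding dd Q'_def C_def by simp
    show "- cnj p * 1 - p * - 1 \<noteq> 0" unfolding dd by (rule \<delta>)
  qed (use lim in simp_all)
  have ev1: "\<forall>\<^sub>F w in at 0. (1::complex) - w \<noteq> 0"
    by (rule tendsto_imp_eventually_ne[of _ 1]) (auto intro!: tendsto_eq_intros)
  have anQ': "\<forall>\<^sub>F w in at 0. Q' analytic_on {w}"
    using eventually_compose_filterlim[OF an filC] ev1
  proof eventually_elim
    case (elim w)
    have "C analytic_on {w}" unfolding C_def using elim by (intro analytic_intros) auto
    then have "Q \<circ> C analytic_on {w}" using elim by (intro analytic_on_compose_gen[where T = "{C w}"]) auto
    then show ?case unfolding Q'_def using elim by (intro analytic_intros) (auto simp: o_def)
  qed
  have Q'z: "\<forall>\<^sub>F w in at 0. Q' (z * w) * z\<^sup>2 = Q' w"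
  proof -
    have ev2: "\<forall>\<^sub>F w in at 0. 1 - z * w \<noteq> 0"
      by (rule tendsto_imp_eventually_ne[of _ 1]) (auto intro!: tendsto_eq_intros)
    show ?thesis using eventually_compose_filterlim[OF modular filC] ev1 ev2
    proof eventually_elim
      case (elim w)
      have \<mu>w: "\<mu> - \<mu>' * w = \<mu> * (1 - z * w)" using \<mu> by (simp add: z_def algebra_simps)
      have den: "of_int c * C w + of_int d = \<mu> * (1 - z * w) / (1 - w)"
      proof -
        have "of_int c * C w + of_int d = (of_int c * (p - cnj p * w) + of_int d * (1 - w)) / (1 - w)"
          using elim by (simp add: C_def add_divide_distrib)
        also have "of_int c * (p - cnj p * w) + of_int d * (1 - w) = \<mu> - \<mu>' * w"
          by (simp add: \<mu>_def \<mu>'_def algebra_simps)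
        finally show ?thesis unfolding \<mu>w .
      qed
      have num: "of_int a * C w + of_int b = \<mu> * (p - cnj p * (z * w)) / (1 - w)"
      proof -
        have "of_int a * C w + of_int b = (of_int a * (p - cnj p * w) + of_int b * (1 - w)) / (1 - w)"
          using elim by (simp add: C_def add_divide_distrib)
        also have "of_int a * (p - cnj p * w) + of_int b * (1 - w) = (of_int a * p + of_int b) - (of_int a * cnj p + of_int b) * w"
          by (simp add: algebra_simps)
        also have "\<dots> = \<mu> * (p - cnj p * (z * w))" unfolding fix1 fix2 using \<mu> by (simp add: z_def algebra_simps)
        finally show ?thesis .
      qed
      have "mob a b c d (C w) = C (z * w)"
        unfolding mob_def num den using elim \<mu> by (simp add: C_def)
      then have "Q (C (z * w)) = (\<mu> * (1 - z * w) / (1 - w)) ^ 4 * Q (C w)" using elim(1) den by simp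
      then have "Q' (z * w) * z\<^sup>2 = \<delta>\<^sup>2 / (1 - z * w) ^ 4 * ((\<mu> * (1 - z * w) / (1 - w)) ^ 4 * Q (C w)) * z\<^sup>2"
        by (simp add: Q'_def)
      also have "\<dots> = (\<mu> ^ 4 * z\<^sup>2) * (\<delta>\<^sup>2 / (1 - w) ^ 4 * Q (C w))"
        using elim(3) by (simp add: power_mult_distrib power_divide)
      also have "\<mu> ^ 4 * z\<^sup>2 = (\<mu> * \<mu>')\<^sup>2" using \<mu> by (simp add: z_def power_divide power_mult_distrib eval_nat_numeral)
      finally show ?case by (simp add: \<mu>\<mu> Q'_def)
    qed
  qed
  define A :: complex where "A = ((of_nat n)\<^sup>2 - 1) / 4"
  have "\<forall>\<^sub>F w in at 0. (\<lambda>w. Q' w - A / w\<^sup>2) analytic_on {w}"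
    using anQ' eventually_neq_at_within[of 0 0 UNIV] by eventually_elim (auto intro!: analytic_intros)
  moreover have "((\<lambda>w. (w - 0)\<^sup>2 * (Q' w - A / w\<^sup>2)) \<longlongrightarrow> 0) (at 0)"
  proof -
    have "((\<lambda>w. (w - 0)\<^sup>2 * Q' w - A) \<longlongrightarrow> A - A) (at 0)" using lim' unfolding A_def by (intro tendsto_intros)
    then have "((\<lambda>w. (w - 0)\<^sup>2 * Q' w - A) \<longlongrightarrow> 0) (at 0)" by simp
    then show ?thesis by (rule Lim_transform_eventually) (auto simp: eventually_at_filter right_diff_distrib)
  qed
  ultimately obtain h H where h: "h has_fps_expansion H" "\<forall>\<^sub>F s in at 0. Q' (0 + s) - A / (0 + s)\<^sup>2 = h s / s"
    using simple_pole_expansion[of "\<lambda>w. Q' w - A / w\<^sup>2" 0] by blast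
  have h2: "\<forall>\<^sub>F s in at 0. Q' s = A / s\<^sup>2 + h s / s" using h(2) by eventually_elim (simp add: algebra_simps)
  have ex: "expands n Q' 0 H" using h2 by (intro expandsI[OF h(1)]) (simp add: A_def)
  have filz: "filterlim (\<lambda>w. z * w) (at 0) (at 0)"
    using z by (auto simp: filterlim_at eventually_at_filter intro!: tendsto_eq_intros)
  have "\<forall>\<^sub>F s in at 0. z * h (z * s) = h s"
    using h2 eventually_compose_filterlim[OF h2 filz] Q'z eventually_neq_at_within[of 0 0 UNIV]
  proof eventually_elim
    case (elim s)
    then have "(A / (z * s)\<^sup>2 + h (z * s) / (z * s)) * z\<^sup>2 = A / s\<^sup>2 + h s / s" by simp
    then have "z * h (z * s) / s = h s / s" using z elim(4) by (simp add: field_simps power2_eq_square)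
    then show ?case using elim(4) by simp
  qed
  moreover have lin: "(\<lambda>s. z * s) has_fps_expansion fps_const z * fps_X" by (intro fps_expansion_intros)
  then have hz: "(\<lambda>s. h (z * s)) has_fps_expansion (H oo (fps_const z * fps_X))"
    using has_fps_expansion_compose[OF h(1) lin] by (simp add: o_def)
  ultimately have sym: "fps_const z * (H oo (fps_const z * fps_X)) = H"
  proof -
    assume ev: "\<forall>\<^sub>F s in at 0. z * h (z * s) = h s"
    have 1: "(\<lambda>s. z * h (z * s)) has_fps_expansion fps_const z * (H oo (fps_const z * fps_X))"
      by (intro fps_expansion_intros hz)
    have "h 0 = fps_nth H 0" by (rule has_fps_expansion_imp_0_eq_fps_nth_0[OF h(1)])
    have l1: "((\<lambda>s. z * h (z * s)) \<longlongrightarrow> z * h (z * 0)) (at 0)"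
      using has_fps_expansion_imp_continuous[OF 1, of UNIV] by (simp add: isCont_def)
    have l2: "(h \<longlongrightarrow> h 0) (at 0)" using has_fps_expansion_imp_continuous[OF h(1), of UNIV] by (simp add: isCont_def)
    have "z * h (z * 0) = h 0" using LIM_unique[OF Lim_transform_eventually[OF l1 ev] l2] .
    then have "\<forall>\<^sub>F s in nhds 0. z * h (z * s) = h s" using ev by (simp add: eventually_nhds_conv_at)
    then have "(\<lambda>s. z * h (z * s)) has_fps_expansion H" using has_fps_expansion_cong[of "\<lambda>s. z * h (z * s)" h H H] h(1) by blast
    then show ?thesis using fps_expansion_unique_complex[OF 1] by blast
  qed
  \<comment> \<open>Coefficients of \<open>z * h (z * s) = h s\<close> are compared; the extra
    factor \<open>z\<close> is what remains of the weight factor \<open>z\<^sup>2\<close> after the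
    simple pole has absorbed one \<open>z\<close>.\<close>
  have "z ^ Suc k = 1" if "fps_nth H k \<noteq> 0" for k
  proof -
    have "fps_nth (fps_const z * (H oo (fps_const z * fps_X))) k = z ^ Suc k * fps_nth H k"
      by (simp add: fps_compose_linear)
    then have "z ^ Suc k * fps_nth H k = fps_nth H k" unfolding sym by simp
    then show ?thesis using that by simp
  qed
  then have "obstr n (fps_nth H) = 0" using \<zeta> by (intro obstr_symmetric[of _ z]) (auto simp: z_def \<mu>_def \<mu>'_def)
  then have ric: "riccati n Q' 0" by (rule obstr_zero_imp_riccati[OF ex n])
  show ?thesis
  proof (rule riccati_moebius[of n Q' 1 p "- p" 1 "- cnj p" Q])
    show "riccati n Q' ((1 * p + - p) / (1 * p + - cnj p))" using ric by simp
    show "1 * p + - cnj p \<noteq> 0" using \<delta> by (simp add: \<delta>_def)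
    show "1 * - cnj p - - p * 1 \<noteq> 0" using \<delta> by (simp add: \<delta>_def)
    have "((\<lambda>t. t - cnj p) \<longlongrightarrow> p - cnj p) (at p)" by (intro tendsto_intros)
    then have "\<forall>\<^sub>F t in at p. t - cnj p \<noteq> 0" by (rule tendsto_imp_eventually_ne) (use \<delta> in \<open>simp add: \<delta>_def\<close>)
    then show "\<forall>\<^sub>F t in at p. Q t = (1 * - cnj p - - p * 1)\<^sup>2 / (1 * t + - cnj p) ^ 4 * Q' ((1 * t + - p) / (1 * t + - cnj p))"
    proof eventually_elim
      case (elim t)
      define w where "w = (t - p) / (t - cnj p)"
      have w1: "1 - w = \<delta> / (t - cnj p)" using elim by (simp add: w_def \<delta>_def field_simps)
      have wn: "- cnj p * w + p = \<delta> * t / (t - cnj p)"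
      proof -
        have "- cnj p * w + p = (- cnj p * (t - p) + p * (t - cnj p)) / (t - cnj p)"
          unfolding w_def by (subst add_divide_distrib) (use elim in simp)
        also have "- cnj p * (t - p) + p * (t - cnj p) = \<delta> * t" by (simp add: \<delta>_def algebra_simps)
        finally show ?thesis .
      qed
      have "C w = (- cnj p * w + p) / (1 - w)" by (simp add: C_def)
      also have "\<dots> = t" unfolding wn w1 using elim \<delta> by simp
      finally have "C w = t" .
      moreover have "Q' w = \<delta>\<^sup>2 / (1 - w) ^ 4 * Q (C w)" by (simp add: Q'_def)
      ultimately have "\<delta>\<^sup>2 / (t - cnj p) ^ 4 * Q' w = Q t"
        unfolding w1 using elim \<delta> by (simp add: power_divide eval_nat_numeral)
      then show ?case by (simp add: w_def \<delta>_def)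
    qed
  qed
qed

lemma lead_sum_lower:
  assumes "lead I d f f'" "lowpol I d g"
  shows "lead I d (\<lambda>x. f x + g x) f'"
proof -
  have "lowpol I d (\<lambda>x. (f x - f' x) + g x)" using assms by (intro lowpol_add) (auto simp: lead_def)
  moreover have "(\<lambda>x. (f x - f' x) + g x) = (\<lambda>x. f x + g x - f' x)" by auto
  ultimately show ?thesis using assms by (simp add: lead_def)
qed

lemma lead_scale: "lead I d f f' \<Longrightarrow> lead I d (\<lambda>x. c * f x) (\<lambda>x. c * f' x)"
  using lead_mult[OF lead_refl[OF pol_const[of I 0 c]], of d f f'] by simp

text \<open>Each \<open>d x l\<close> has degree at most 1, so the summand \<open>i\<close> has
  degree at most \<open>i + 1\<close>, and only \<open>i = k - 1\<close> reaches degree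
  \<open>k\<close>.\<close>

lemma lead_sum_recursion:
  assumes d: "\<And>l. pol I 1 (\<lambda>x. d x l)" and d0: "lead I 1 (\<lambda>x. d x 0) (\<lambda>x. \<beta> * x j)"
    and g: "\<And>i. i < k \<Longrightarrow> lead I i (\<lambda>x. g x i) (\<lambda>x. \<gamma> i * (\<beta> * x j) ^ i)" and k: "k > 0"
  shows "lead I k (\<lambda>x. \<Sum>i<k. d x (k - 1 - i) * g x i) (\<lambda>x. \<gamma> (k - 1) * (\<beta> * x j) ^ k)"
proof -
  obtain l where l: "k = Suc l" using k by (cases k) auto
  have "lead I (1 + l) (\<lambda>x. d x 0 * g x l) (\<lambda>x. \<beta> * x j * (\<gamma> l * (\<beta> * x j) ^ l))"
    using g[of l] l by (intro lead_mult d0) auto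
  then have 1: "lead I k (\<lambda>x. d x 0 * g x l) (\<lambda>x. \<gamma> l * (\<beta> * x j) ^ k)" by (simp add: l mult_ac)
  have 2: "lowpol I k (\<lambda>x. \<Sum>i<l. d x (k - 1 - i) * g x i)"
  proof (rule lowpol_sum)
    fix i assume "i \<in> {..<l}"
    then have "pol I (1 + i) (\<lambda>x. d x (k - 1 - i) * g x i)"
      using g[of i] l by (intro pol_mult d lead_imp_pol) auto
    then show "lowpol I k (\<lambda>x. d x (k - 1 - i) * g x i)" unfolding lowpol_def using \<open>i \<in> {..<l}\<close> l by auto
  qed
  have "lead I k (\<lambda>x. d x 0 * g x l + (\<Sum>i<l. d x (k - 1 - i) * g x i)) (\<lambda>x. \<gamma> l * (\<beta> * x j) ^ k)"
    by (rule lead_sum_lower[OF 1 2])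
  then show ?thesis by (simp add: l add.commute)
qed

text \<open>By induction the top-degree part of the \<open>k\<close>-th Frobenius coefficient is a
  multiple of \<open>x j ^ k\<close>. The factor \<open>\<gamma>\<close> is the product of the
  reciprocal denominators, nonzero below the resonance \<open>n\<close>.\<close>

lemma obstr_lead:
  assumes d: "\<And>l. pol I 1 (\<lambda>x. d x l)" and d0: "lead I 1 (\<lambda>x. d x 0) (\<lambda>x. \<beta> * x j)" and n: "n \<ge> 1"
  obtains \<gamma> where "\<gamma> \<noteq> 0" "lead I n (\<lambda>x. obstr n (d x)) (\<lambda>x. \<gamma> * (\<beta> * x j) ^ n)"
proof -
  define \<gamma> :: "nat \<Rightarrow> complex" where "\<gamma> k = (\<Prod>i\<in>{1..k}. 1 / (of_nat i * (of_nat i + of_int (- int n))))" for k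
  have \<gamma>: "\<gamma> k \<noteq> 0" if "k < n" for k
  proof -
    have "of_nat i * (of_nat i + of_int (- int n)) \<noteq> (0::complex)" if "i \<in> {1..k}" for i
      using that \<open>k < n\<close> by auto
    then show ?thesis unfolding \<gamma>_def by (subst prod_zero_iff) auto
  qed
  have g: "lead I k (\<lambda>x. frob (- int n) (d x) (\<lambda>_. 0) k) (\<lambda>x. \<gamma> k * (\<beta> * x j) ^ k)" for k
  proof (induction k rule: less_induct)
    case (less k)
    show ?case
    proof (cases "k = 0")
      case True
      then show ?thesis using lead_refl[OF pol_const[of I 0 1]] by (simp add: \<gamma>_def)
    next
      case False
      let ?c = "1 / (of_nat k * (of_nat k + of_int (- int n))) :: complex"
      from False have k: "k > 0" by simp
      have "lead I k (\<lambda>x. ?c * (\<Sum>i<k. d x (k - 1 - i) * frob (- int n) (d x) (\<lambda>_. 0) i)) (\<lambda>x. ?c * (\<gamma> (k - 1) * (\<beta> * x j) ^ k))"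
        by (rule lead_scale, rule lead_sum_recursion[where d = d and \<beta> = \<beta> and j = j, OF d d0 less(1) k]) simp
      moreover have "(\<lambda>x. ?c * (\<gamma> (k - 1) * (\<beta> * x j) ^ k)) = (\<lambda>x. \<gamma> k * (\<beta> * x j) ^ k)"
      proof -
        have "?c * \<gamma> (k - 1) = \<gamma> k" using False by (cases k) (simp_all add: \<gamma>_def)
        then show ?thesis by (simp only: mult.assoc[symmetric])
      qed
      ultimately show ?thesis using False
        by (subst frob.simps) simp
    qed
  qed
  have "lead I n (\<lambda>x. obstr n (d x)) (\<lambda>x. \<gamma> (n - 1) * (\<beta> * x j) ^ n)"
    unfolding obstr_def using n by (intro lead_sum_recursion[where d = d and \<beta> = \<beta> and j = j and \<gamma> = \<gamma>] d d0 g) auto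
  then show ?thesis using \<gamma>[of "n - 1"] n that by simp
qed

lemma isolated_singularity_iff_eventually_analytic:
  "isolated_singularity_at f p \<longleftrightarrow> (\<forall>\<^sub>F z in at p. f analytic_on {z})"
proof
  assume "isolated_singularity_at f p"
  then obtain r where r: "r > 0" "f analytic_on ball p r - {p}" unfolding isolated_singularity_at_def by blast
  have "\<forall>\<^sub>F z in at p. z \<in> ball p r - {p}" using r by (intro eventually_at_in_open) auto
  then show "\<forall>\<^sub>F z in at p. f analytic_on {z}" by eventually_elim (use r in \<open>auto intro: analytic_on_subset\<close>)
next
  assume "\<forall>\<^sub>F z in at p. f analytic_on {z}"
  then obtain r where r: "r > 0" "f holomorphic_on ball p r - {p}" using punctured_holomorphic by blast
  have "f analytic_on ball p r - {p}" using r by (subst analytic_on_open) auto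
  then show "isolated_singularity_at f p" using r unfolding isolated_singularity_at_def by blast
qed

lemma double_pole_is_pole:
  assumes "((\<lambda>z. (z - p)\<^sup>2 * f z) \<longlongrightarrow> A) (at p)" "A \<noteq> 0"
  shows "is_pole f (p::complex)"
proof -
  have "filterlim (\<lambda>z. (z - p)\<^sup>2) (at 0) (at p)"
    by (auto simp: filterlim_at eventually_at_filter intro!: tendsto_eq_intros)
  then have "filterlim (\<lambda>z. (z - p)\<^sup>2 * f z / (z - p)\<^sup>2) at_infinity (at p)"
    by (rule filterlim_divide_at_infinity[OF assms(1) _ assms(2)])
  moreover have "\<forall>\<^sub>F z in at p. (z - p)\<^sup>2 * f z / (z - p)\<^sup>2 = f z" by (simp add: eventually_at_filter)
  ultimately have "filterlim f at_infinity (at p)" using filterlim_cong[OF refl refl] by fastforce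
  then show ?thesis by (simp add: is_pole_def)
qed

lemma double_pole_zorder:
  assumes an: "\<forall>\<^sub>F z in at p. f analytic_on {z}" and lim: "((\<lambda>z. (z - p)\<^sup>2 * f z) \<longlongrightarrow> A) (at p)" and A: "A \<noteq> 0"
  shows "zorder f p = -2"
proof -
  obtain r where r: "r > 0" "f holomorphic_on ball p r - {p}" using punctured_holomorphic[OF an] .
  define g where "g z = (if z = p then A else (z - p)\<^sup>2 * f z)" for z
  have "(\<lambda>z. (z - p)\<^sup>2 * f z) holomorphic_on ball p r - {p}" using r by (intro holomorphic_intros)
  then have "g holomorphic_on ball p r - {p}" by (rule holomorphic_transform) (auto simp: g_def)
  moreover have "g \<midarrow>p\<rightarrow> A" by (rule Lim_transform_eventually[OF lim]) (auto simp: g_def eventually_at_filter)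
  ultimately have "(\<lambda>z. if z = p then A else g z) holomorphic_on ball p r" by (intro removable_singularity open_ball) auto
  then have "g holomorphic_on ball p r" by (rule holomorphic_transform) (auto simp: g_def)
  moreover have "f w = g w * (w - p) powi - 2" if "w \<noteq> p" for w
    using that by (simp add: g_def power_int_minus)
  ultimately show ?thesis using r A by (intro zorder_eqI[of "ball p r" p g]) (auto simp: g_def)
qed

lemma local_exponents_iff:
  "local_exponents Q p (1/2 + k) (1/2 - k) \<longleftrightarrow> ((\<lambda>z. (z - p)\<^sup>2 * Q z) \<longlongrightarrow> k\<^sup>2 - 1/4) (at p)"
proof -
  have "[:- A, -1, 1:] = [:- (1/2 + k), 1:] * [:- (1/2 - k), 1:] \<longleftrightarrow> A = k\<^sup>2 - 1/4" for A
    by (auto simp: field_simps power2_eq_square)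
  then show ?thesis unfolding local_exponents_def by auto
qed

lemma analytic_double_zero:
  assumes "f analytic_on {p}"
  shows "((\<lambda>z. (z - p)\<^sup>2 * f z) \<longlongrightarrow> 0) (at p)"
proof -
  have "(f \<longlongrightarrow> f p) (at p)" using analytic_at_imp_isCont[OF assms] by (simp add: isCont_def)
  then have "((\<lambda>z. (z - p)\<^sup>2 * f z) \<longlongrightarrow> (p - p)\<^sup>2 * f p) (at p)" by (intro tendsto_intros)
  then show ?thesis by simp
qed

section \<open>Transport of local data along the modular group\<close>

definition weight4 :: "(complex \<Rightarrow> complex) \<Rightarrow> bool" where
  "weight4 f \<longleftrightarrow> (\<forall>a b c d z. a * d - b * c = 1 \<longrightarrow> Im z > 0 \<longrightarrow> f (mob a b c d z) = (of_int c * z + of_int d) ^ 4 * f z)"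

lemma weight4D: "weight4 f \<Longrightarrow> a * d - b * c = 1 \<Longrightarrow> Im z > 0 \<Longrightarrow> f (mob a b c d z) = (of_int c * z + of_int d) ^ 4 * f z"
  unfolding weight4_def by blast

lemma of_int_det: "a * d - b * c = 1 \<Longrightarrow> of_int a * of_int d - of_int b * of_int c = (1::complex)"
  by (metis of_int_1 of_int_diff of_int_mult)

lemma filterlim_mob:
  assumes "Im p > 0" "a * d - b * c = 1"
  shows "filterlim (mob a b c d) (at (mob a b c d p)) (at p)"
  using filterlim_moebius[of "of_int a" "of_int d" "of_int b" "of_int c" p] of_int_det[OF assms(2)] mob_denom_nonzero[OF assms]
  by (simp add: mob_def[abs_def])

lemma eventually_at_uhp: "Im p > 0 \<Longrightarrow> \<forall>\<^sub>F z in at p. Im z > 0"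
  using eventually_nhds_in_open[OF open_uhp, of p] by (simp add: uhp_iff eventually_at_filter eventually_mono)

text \<open>The transformation law of the inverse matrix, written as a Moebius pullback from
  \<open>p\<close> to \<open>p0\<close> in the form that \<open>riccati_moebius\<close> and
  \<open>double_pole_moebius\<close> consume.\<close>

lemma weight4_transport:
  assumes f: "weight4 f" and p0: "Im p0 > 0" and det: "a * d - b * c = 1"
  defines "p \<equiv> mob a b c d p0"
  shows "p0 = (of_int d * p + of_int (- b)) / (of_int (- c) * p + of_int a)"
    "of_int (- c) * p + of_int a \<noteq> (0::complex)"
    "of_int d * of_int a - of_int (- b) * of_int (- c) = (1::complex)"
    "\<forall>\<^sub>F z in at p. f z = (of_int d * of_int a - of_int (- b) * of_int (- c))\<^sup>2 / (of_int (- c) * z + of_int a) ^ 4 *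
       f ((of_int d * z + of_int (- b)) / (of_int (- c) * z + of_int a))"
proof -
  have p: "Im p > 0" unfolding p_def by (rule mob_uhp[OF p0 det])
  have det': "d * a - (- b) * (- c) = 1" using det by (simp add: algebra_simps)
  show "p0 = (of_int d * p + of_int (- b)) / (of_int (- c) * p + of_int a)"
    using mob_inverse[OF p0 det] unfolding p_def[symmetric] mob_def[of d] by simp
  show "of_int (- c) * p + of_int a \<noteq> (0::complex)" by (rule mob_denom_nonzero[OF p det'])
  show 1: "of_int d * of_int a - of_int (- b) * of_int (- c) = (1::complex)" by (rule of_int_det[OF det'])
  show "\<forall>\<^sub>F z in at p. f z = (of_int d * of_int a - of_int (- b) * of_int (- c))\<^sup>2 / (of_int (- c) * z + of_int a) ^ 4 *
       f ((of_int d * z + of_int (- b)) / (of_int (- c) * z + of_int a))"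
    using eventually_at_uhp[OF p]
  proof eventually_elim
    case (elim z)
    show ?case
      using weight4D[OF f det' elim] mob_denom_nonzero[OF elim det'] unfolding 1 mob_def by simp
  qed
qed

lemma weight4_double_pole:
  assumes f: "weight4 f" and p0: "Im p0 > 0" and eq: "SL2Z_equiv p0 p"
    and lim: "((\<lambda>z. (z - p0)\<^sup>2 * f z) \<longlongrightarrow> A) (at p0)"
  shows "((\<lambda>z. (z - p)\<^sup>2 * f z) \<longlongrightarrow> A) (at p)"
proof -
  obtain a b c d where g: "a * d - b * c = 1" "p = mob a b c d p0" using eq SL2Z_equiv_mob by blast
  note w = weight4_transport[OF f p0 g(1), folded g(2)]
  show ?thesis
    by (rule double_pole_moebius[OF _ w(2) _ w(4)]) (use lim w(1,3) in simp_all)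
qed

lemma weight4_riccati:
  assumes f: "weight4 f" and p0: "Im p0 > 0" and eq: "SL2Z_equiv p0 p" and ric: "riccati n f p0"
  shows "riccati n f p"
proof -
  obtain a b c d where g: "a * d - b * c = 1" "p = mob a b c d p0" using eq SL2Z_equiv_mob by blast
  note w = weight4_transport[OF f p0 g(1), folded g(2)]
  show ?thesis
    by (rule riccati_moebius[OF _ w(2) _ w(4)]) (use ric w(1,3) in simp_all)
qed

text \<open>\<open>remove_sings\<close> takes the limit where there is one and 0 elsewhere; limits
  carry over in both directions, and the value 0 satisfies the law.\<close>

lemma remove_sings_mob:
  assumes f: "\<And>z. Im z > 0 \<Longrightarrow> f (mob a b c d z) = (of_int c * z + of_int d) ^ k * f z"
    and det: "a * d - b * c = 1" and p: "Im p > 0"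
  shows "remove_sings f (mob a b c d p) = (of_int c * p + of_int d) ^ k * remove_sings f p"
proof -
  let ?q = "mob a b c d p" and ?\<mu> = "\<lambda>z. (of_int c * z + of_int d) ^ k :: complex" and ?\<psi> = "mob d (- b) (- c) a"
  have q: "Im ?q > 0" by (rule mob_uhp[OF p det])
  have det': "d * a - (- b) * (- c) = 1" using det by (simp add: algebra_simps)
  have f1: "filterlim (mob a b c d) (at ?q) (at p)" by (rule filterlim_mob[OF p det])
  have f2: "filterlim ?\<psi> (at p) (at ?q)" using filterlim_mob[OF q det'] unfolding mob_inverse[OF p det] .
  have \<mu>: "?\<mu> p \<noteq> 0" using mob_denom_nonzero[OF p det] by simp
  have t: "(?\<mu> \<longlongrightarrow> ?\<mu> p) (at p)" by (intro tendsto_intros)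
  show ?thesis
  proof (cases "\<exists>L. f \<midarrow>p\<rightarrow> L")
    case True
    then obtain L where L: "f \<midarrow>p\<rightarrow> L" by blast
    have "((\<lambda>v. ?\<mu> (?\<psi> v) * f (?\<psi> v)) \<longlongrightarrow> ?\<mu> p * L) (at ?q)"
      by (intro tendsto_mult filterlim_compose[OF t f2] filterlim_compose[OF L f2])
    moreover have "\<forall>\<^sub>F v in at ?q. ?\<mu> (?\<psi> v) * f (?\<psi> v) = f v"
      using eventually_at_uhp[OF q]
    proof eventually_elim
      case (elim v)
      show ?case using f[OF mob_uhp[OF elim det']] mob_inverse[OF elim det'] by simp
    qed
    ultimately have "f \<midarrow>?q\<rightarrow> ?\<mu> p * L" by (rule Lim_transform_eventually)
    then show ?thesis using L by (simp add: remove_sings_eqI)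
  next
    case False
    have "\<nexists>M. f \<midarrow>?q\<rightarrow> M"
    proof
      assume "\<exists>M. f \<midarrow>?q\<rightarrow> M"
      then obtain M where M: "f \<midarrow>?q\<rightarrow> M" by blast
      have "((\<lambda>z. f (mob a b c d z) / ?\<mu> z) \<longlongrightarrow> M / ?\<mu> p) (at p)"
        by (intro tendsto_divide filterlim_compose[OF M f1] t \<mu>)
      moreover have "\<forall>\<^sub>F z in at p. f (mob a b c d z) / ?\<mu> z = f z"
        using eventually_at_uhp[OF p] by eventually_elim (use f mob_denom_nonzero[OF _ det] in simp)
      ultimately have "f \<midarrow>p\<rightarrow> M / ?\<mu> p" by (rule Lim_transform_eventually)
      then show False using False by blast
    qed
    then show ?thesis using False by (simp add: remove_sings_def)
  qed
qed

text \<open>The height of an image of i is \<open>1 / N\<close> with an integer \<open>N\<close>,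
  and equality with \<open>sqrt 3 / 2\<close> would give \<open>3 * (N * N) = 4\<close>.\<close>

lemma not_equiv_i_rho: "\<not> SL2Z_equiv \<i> rho"
proof
  assume "SL2Z_equiv \<i> rho"
  then obtain a b c d where g: "a * d - b * c = 1" "rho = mob a b c d \<i>" using SL2Z_equiv_mob by blast
  have "sqrt 3 / 2 = 1 / (cmod (of_int c * \<i> + of_int d))\<^sup>2"
    using Im_mob[OF g(1), of \<i>] rho_facts(3) unfolding g(2) by simp
  also have "(cmod (of_int c * \<i> + of_int d))\<^sup>2 = of_int (c\<^sup>2 + d\<^sup>2)" by (simp add: cmod_power2)
  finally have *: "sqrt 3 / 2 = 1 / real_of_int (c\<^sup>2 + d\<^sup>2)" .
  define N where "N = c\<^sup>2 + d\<^sup>2"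
  have "N \<noteq> 0" using * unfolding N_def[symmetric] by auto
  then have "sqrt 3 * of_int N = 2" using * unfolding N_def[symmetric] by (simp add: field_simps)
  then have "(sqrt 3 * of_int N)\<^sup>2 = 2\<^sup>2" by simp
  then have "real_of_int (3 * (N * N)) = of_int 4" unfolding power_mult_distrib by (simp add: power2_eq_square)
  then have "3 * (N * N) = 4" by (simp only: of_int_eq_iff)
  then show False by presburger
qed

lemma EE_analytic: "Im p > 0 \<Longrightarrow> EE analytic_on {p}" and jj_analytic: "Im p > 0 \<Longrightarrow> jj analytic_on {p}"
  using EE_holomorphic jj_holomorphic open_uhp by (auto simp: analytic_at uhp_iff)

lemma EE_tendsto: "Im p > 0 \<Longrightarrow> (EE \<longlongrightarrow> EE p) (at p)"
  using analytic_at_imp_isCont[OF EE_analytic] by (simp add: isCont_def)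

lemma eventually_jj_neq:
  assumes "Im p > 0"
  shows "\<forall>\<^sub>F z in at p. jj z \<noteq> v"
proof -
  have "\<exists>\<beta>\<in>upper_half_plane. jj \<beta> \<noteq> v" using jj_nonconstant unfolding constant_on_def by blast
  then obtain \<beta> where "Im \<beta> > 0" "jj \<beta> \<noteq> v" by (auto simp: uhp_iff)
  then have "\<forall>\<^sub>F z in at p. jj z - v \<noteq> 0 \<and> z \<in> upper_half_plane"
    using assms by (intro non_zero_neighbour_alt[of _ _ _ \<beta>] open_uhp holomorphic_intros jj_holomorphic
        convex_connected convex_uhp) (auto simp: uhp_iff)
  then show ?thesis by eventually_elim auto
qed

lemma eventually_EE_neq_0: "Im p > 0 \<Longrightarrow> \<forall>\<^sub>F z in at p. EE z \<noteq> 0"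
  using eventually_jj_neq[of p 0] by (auto elim!: eventually_mono simp: jj_def)

text \<open>\<open>jj - jj \<i>\<close> has a double zero at i, where \<open>EE\<close> does not
  vanish.\<close>

lemma pole_coefficient_i:
  obtains L where "L \<noteq> 0" "((\<lambda>z. (z - \<i>)\<^sup>2 * (EE z / (jj z - jj \<i>))) \<longlongrightarrow> L) (at \<i>)"
proof -
  obtain L where L: "L \<noteq> 0" "((\<lambda>z. (jj z - jj \<i>) / (z - \<i>)\<^sup>2) \<longlongrightarrow> L) (at \<i>)" using jj_double_at_i .
  have "((\<lambda>z. EE z / ((jj z - jj \<i>) / (z - \<i>)\<^sup>2)) \<longlongrightarrow> EE \<i> / L) (at \<i>)"
    by (intro tendsto_divide EE_tendsto L) simp
  then have "((\<lambda>z. (z - \<i>)\<^sup>2 * (EE z / (jj z - jj \<i>))) \<longlongrightarrow> EE \<i> / L) (at \<i>)" by (simp add: mult.commute)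
  moreover have "EE \<i> \<noteq> 0" using EE_eq_0_iff[of \<i>] not_equiv_i_rho SL2Z_equiv_sym[OF rho_facts(1), of \<i>] by auto
  ultimately show ?thesis using that[of "EE \<i> / L"] L(1) by simp
qed

text \<open>A simple zero of \<open>EE\<close> over a triple zero of \<open>jj\<close> leaves a
  double pole.\<close>

lemma pole_coefficient_rho:
  obtains L where "L \<noteq> 0" "((\<lambda>z. (z - rho)\<^sup>2 * (EE z / jj z)) \<longlongrightarrow> L) (at rho)"
proof -
  obtain L where L: "L \<noteq> 0" "((\<lambda>z. EE z / (z - rho)) \<longlongrightarrow> L) (at rho)" "((\<lambda>z. jj z / (z - rho) ^ 3) \<longlongrightarrow> L ^ 3 / DD rho) (at rho)"
    using EE_simple_at_rho .
  have n: "L ^ 3 / DD rho \<noteq> 0" using L(1) DD_nonzero[OF rho_facts(1)] by simp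
  have "((\<lambda>z. (EE z / (z - rho)) / (jj z / (z - rho) ^ 3)) \<longlongrightarrow> L / (L ^ 3 / DD rho)) (at rho)"
    by (intro tendsto_divide L n)
  moreover have "\<forall>\<^sub>F z in at rho. (EE z / (z - rho)) / (jj z / (z - rho) ^ 3) = (z - rho)\<^sup>2 * (EE z / jj z)"
    using eventually_neq_at_within[of rho rho UNIV]
    by eventually_elim (simp add: power2_eq_square power3_eq_cube mult.commute)
  ultimately have "((\<lambda>z. (z - rho)\<^sup>2 * (EE z / jj z)) \<longlongrightarrow> L / (L ^ 3 / DD rho)) (at rho)" by (rule Lim_transform_eventually)
  then show ?thesis using that[of "L / (L ^ 3 / DD rho)"] L(1) n by simp
qed

lemma pole_coefficients_generic:
  assumes p: "Im p > 0" "\<not> SL2Z_equiv p \<i>" "\<not> SL2Z_equiv p rho"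
  obtains L M where "L \<noteq> 0" "((\<lambda>z. (z - p) * (EE z / (jj z - jj p))) \<longlongrightarrow> L) (at p)"
    "M \<noteq> 0" "((\<lambda>z. (z - p)\<^sup>2 * (EE z / (jj z - jj p)\<^sup>2)) \<longlongrightarrow> M) (at p)"
proof -
  obtain L where L: "L \<noteq> 0" "((\<lambda>z. (jj z - jj p) / (z - p)) \<longlongrightarrow> L) (at p)" using jj_simple[OF p] .
  have E: "EE p \<noteq> 0" using EE_eq_0_iff[OF p(1)] p(3) SL2Z_equiv_sym[OF rho_facts(1), of p] by auto
  have "((\<lambda>z. EE z / ((jj z - jj p) / (z - p))) \<longlongrightarrow> EE p / L) (at p)"
    by (intro tendsto_divide EE_tendsto L p)
  then have 1: "((\<lambda>z. (z - p) * (EE z / (jj z - jj p))) \<longlongrightarrow> EE p / L) (at p)" by (simp add: mult.commute)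
  have "((\<lambda>z. EE z / ((jj z - jj p) / (z - p))\<^sup>2) \<longlongrightarrow> EE p / L\<^sup>2) (at p)"
    by (intro tendsto_divide tendsto_power EE_tendsto L p) (use L in simp)
  then have "((\<lambda>z. (z - p)\<^sup>2 * (EE z / (jj z - jj p)\<^sup>2)) \<longlongrightarrow> EE p / L\<^sup>2) (at p)" by (simp add: power_divide mult.commute)
  with 1 show ?thesis using that[of "EE p / L" "EE p / L\<^sup>2"] L(1) E by simp
qed

lemma weight4_quotient_invariant:
  assumes "weight4 f" "a * d - b * c = 1" "Im z > 0"
  shows "f (mob a b c d z) / EE (mob a b c d z) = f z / EE z"
  using weight4D[OF assms] EE_modular[OF assms(3,2)] mob_denom_nonzero[OF assms(3,2)] by simp

text \<open>The quotient is invariant, so by parity the simple pole that could remain at i is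
  absent.\<close>

lemma quotient_limit_i:
  assumes f: "weight4 f" and an: "\<forall>\<^sub>F z in at \<i>. f analytic_on {z}" and lim: "((\<lambda>z. (z - \<i>)\<^sup>2 * f z) \<longlongrightarrow> 0) (at \<i>)"
  shows "\<exists>L. ((\<lambda>z. f z / EE z) \<longlongrightarrow> L) (at \<i>)"
proof -
  have E: "EE \<i> \<noteq> 0" using EE_eq_0_iff[of \<i>] not_equiv_i_rho SL2Z_equiv_sym[OF rho_facts(1), of \<i>] by auto
  have an': "\<forall>\<^sub>F z in at \<i>. (\<lambda>z. f z / EE z) analytic_on {z}"
    using an eventually_EE_neq_0[of \<i>, simplified] eventually_at_uhp[of \<i>, simplified]
    by eventually_elim (auto intro!: analytic_intros EE_analytic)
  have "((\<lambda>z. (z - \<i>)\<^sup>2 * f z / EE z) \<longlongrightarrow> 0 / EE \<i>) (at \<i>)" by (intro tendsto_divide lim EE_tendsto E) simp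
  then have "((\<lambda>z. (z - \<i>) ^ Suc 1 * (f z / EE z)) \<longlongrightarrow> 0) (at \<i>)" by (simp add: power2_eq_square)
  from pole_lower[OF an' this] obtain L where L: "((\<lambda>z. (z - \<i>) * (f z / EE z)) \<longlongrightarrow> L) (at \<i>)" by auto
  have "f (- 1 / z) / EE (- 1 / z) = f z / EE z" if "Im z > 0" for z
    using weight4_quotient_invariant[OF f _ that, of 0 0 "-1" 1] by (simp add: mob_def)
  from parity_i[OF this L] have "L = 0" .
  then have "((\<lambda>z. (z - \<i>) ^ Suc 0 * (f z / EE z)) \<longlongrightarrow> 0) (at \<i>)" using L by simp
  from pole_lower[OF an' this] show ?thesis by simp
qed

text \<open>Division by the simple zero of \<open>EE\<close> can raise the pole order to 2;
  invariance under a rotation of order 3 removes order 2 and then order 1.\<close>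

lemma quotient_limit_rho:
  assumes f: "weight4 f" and an: "\<forall>\<^sub>F z in at rho. f analytic_on {z}" and lim: "((\<lambda>z. (z - rho)\<^sup>2 * f z) \<longlongrightarrow> 0) (at rho)"
  shows "\<exists>L. ((\<lambda>z. f z / EE z) \<longlongrightarrow> L) (at rho)"
proof -
  note r = rho_facts(1)
  have an': "\<forall>\<^sub>F z in at rho. (\<lambda>z. f z / EE z) analytic_on {z}"
    using an eventually_EE_neq_0[OF r] eventually_at_uhp[OF r]
    by eventually_elim (auto intro!: analytic_intros EE_analytic)
  obtain L where L: "L \<noteq> 0" "((\<lambda>z. EE z / (z - rho)) \<longlongrightarrow> L) (at rho)" using EE_simple_at_rho by blast
  have "((\<lambda>z. (z - rho) ^ Suc 1 * f z) \<longlongrightarrow> 0) (at rho)" using lim by (simp add: power2_eq_square)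
  from pole_lower[OF an this] obtain M where "((\<lambda>z. (z - rho) * f z) \<longlongrightarrow> M) (at rho)" by auto
  then have "((\<lambda>z. (z - rho) * f z / (EE z / (z - rho))) \<longlongrightarrow> M / L) (at rho)" by (intro tendsto_divide L)
  then have 2: "((\<lambda>z. (z - rho) ^ 2 * (f z / EE z)) \<longlongrightarrow> M / L) (at rho)" by (simp add: power2_eq_square mult_ac)
  have inv: "f ((z - 1) / z) / EE ((z - 1) / z) = f z / EE z" if "Im z > 0" for z
    using weight4_quotient_invariant[OF f _ that, of 1 0 "-1" 1] by (simp add: mob_def)
  from parity_rho[OF inv _ 2] have 0: "M / L = 0" by simp
  have "((\<lambda>z. (z - rho) ^ Suc 1 * (f z / EE z)) \<longlongrightarrow> 0) (at rho)" using 2 unfolding 0 by (simp add: power2_eq_square)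
  from pole_lower[OF an' this] obtain N where N: "((\<lambda>z. (z - rho) ^ 1 * (f z / EE z)) \<longlongrightarrow> N) (at rho)" by auto
  from parity_rho[OF inv _ N] have "N = 0" by simp
  then have "((\<lambda>z. (z - rho) ^ Suc 0 * (f z / EE z)) \<longlongrightarrow> 0) (at rho)" using N by simp
  from pole_lower[OF an' this] show ?thesis by simp
qed

text \<open>The rotation is by -1, whose \<open>n\<close>-th power differs from 1 for odd
  \<open>n\<close>.\<close>

lemma riccati_at_i:
  assumes f: "weight4 f" and an: "\<forall>\<^sub>F z in at \<i>. f analytic_on {z}" and n: "odd n"
    and lim: "((\<lambda>z. (z - \<i>)\<^sup>2 * f z) \<longlongrightarrow> ((of_nat n)\<^sup>2 - 1) / 4) (at \<i>)"
  shows "riccati n f \<i>"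
proof (rule riccati_at_fixed_point[where a = 0 and b = "-1" and c = 1 and d = 0])
  show "mob 0 (- 1) 1 0 \<i> = \<i>" by (simp add: mob_def)
  show "((of_int 1 * cnj \<i> + of_int 0) / (of_int 1 * \<i> + of_int 0)) ^ n \<noteq> 1" using n by simp
  show "n \<ge> 1" using n by (cases n) auto
  show "\<forall>\<^sub>F z in at \<i>. f (mob 0 (- 1) 1 0 z) = (of_int 1 * z + of_int 0) ^ 4 * f z"
    using eventually_at_uhp[of \<i>, simplified] by eventually_elim (rule weight4D[OF f], auto)
qed (use an lim in auto)

text \<open>\<open>cnj rho / rho\<close> is a primitive cube root of unity.\<close>

lemma rho_power_neq_1:
  assumes "\<not> 3 dvd n"
  shows "(cnj rho / rho) ^ n \<noteq> 1"
proof -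
  have "rho * cnj rho = 1" using complex_norm_square[of rho] rho_facts(6) by simp
  then have "cnj rho / rho = cnj rho * cnj rho" using rho_facts(5) by (simp add: field_simps)
  also have "\<dots> = cnj (rho\<^sup>2)" by (simp add: power2_eq_square)
  finally have z: "cnj rho / rho = cnj (rho\<^sup>2)" .
  have z3: "(rho\<^sup>2) ^ 3 = 1"
  proof -
    have "(rho\<^sup>2) ^ 3 = (rho ^ 3)\<^sup>2" by (simp flip: power_mult add: mult.commute)
    then show ?thesis by (simp add: rho_powers(1))
  qed
  have Im2: "Im (rho\<^sup>2) \<noteq> 0" using rho_facts(1) unfolding rho_facts(4) by simp
  then have z1: "rho\<^sup>2 \<noteq> 1" by auto
  have z2: "(rho\<^sup>2)\<^sup>2 \<noteq> 1"
  proof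
    assume *: "(rho\<^sup>2)\<^sup>2 = 1"
    have "(rho\<^sup>2) ^ 3 = (rho\<^sup>2)\<^sup>2 * rho\<^sup>2" by (simp add: power3_eq_cube power2_eq_square)
    then have "1 = rho\<^sup>2" unfolding z3 * by simp
    then show False using z1 by simp
  qed
  have "(rho\<^sup>2) ^ n = (rho\<^sup>2) ^ (n mod 3)"
  proof -
    have "(rho\<^sup>2) ^ n = (rho\<^sup>2) ^ (3 * (n div 3) + n mod 3)" by simp
    also have "\<dots> = ((rho\<^sup>2) ^ 3) ^ (n div 3) * (rho\<^sup>2) ^ (n mod 3)" by (simp only: power_add power_mult)
    finally show ?thesis unfolding z3 by (simp only: power_one mult_1)
  qed
  moreover have "n mod 3 = 1 \<or> n mod 3 = 2" using assms by presburger
  ultimately have "(rho\<^sup>2) ^ n \<noteq> 1" using z1 z2 by auto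
  then have "cnj ((rho\<^sup>2) ^ n) \<noteq> 1" by (metis complex_cnj_cancel_iff complex_cnj_one)
  then show ?thesis unfolding z by simp
qed

lemma riccati_at_rho:
  assumes f: "weight4 f" and an: "\<forall>\<^sub>F z in at rho. f analytic_on {z}" and n: "\<not> 3 dvd n"
    and lim: "((\<lambda>z. (z - rho)\<^sup>2 * f z) \<longlongrightarrow> ((of_nat n)\<^sup>2 - 1) / 4) (at rho)"
  shows "riccati n f rho"
proof (rule riccati_at_fixed_point[where a = 1 and b = "-1" and c = 1 and d = 0])
  show "Im rho > 0" by (rule rho_facts)
  show "mob 1 (- 1) 1 0 rho = rho" using rho_powers(3) rho_facts(5) by (simp add: mob_def diff_divide_distrib)
  show "((of_int 1 * cnj rho + of_int 0) / (of_int 1 * rho + of_int 0)) ^ n \<noteq> 1" using rho_power_neq_1[OF n] by simp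
  show "n \<ge> 1" using n by (cases n) auto
  show "\<forall>\<^sub>F z in at rho. f (mob 1 (- 1) 1 0 z) = (of_int 1 * z + of_int 0) ^ 4 * f z"
    using eventually_at_uhp[OF rho_facts(1)] by eventually_elim (rule weight4D[OF f], auto)
qed (use an lim in auto)

section \<open>The family of potentials\<close>

text \<open>The double pole coefficient that belongs to the exponent difference
  \<open>k\<close>.\<close>

definition indicial :: "nat \<Rightarrow> complex" where
  "indicial k = ((of_nat k)\<^sup>2 - 1) / 4"

lemma indicial_eq_0_iff: "k \<ge> 1 \<Longrightarrow> indicial k = 0 \<longleftrightarrow> k = 1"
proof -
  assume k: "k \<ge> 1"
  have "indicial k = 0 \<longleftrightarrow> (of_nat (k\<^sup>2) :: complex) = of_nat 1" by (simp add: indicial_def)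
  also have "\<dots> \<longleftrightarrow> k\<^sup>2 = 1" by (simp only: of_nat_eq_iff)
  finally show ?thesis using k by simp
qed

lemma local_exponents_indicial:
  "local_exponents Q p (1/2 + of_nat k / 2) (1/2 - of_nat k / 2) \<longleftrightarrow> ((\<lambda>z. (z - p)\<^sup>2 * Q z) \<longlongrightarrow> indicial k) (at p)"
  unfolding local_exponents_iff indicial_def by (simp add: power_divide diff_divide_distrib)

lemma weight4_limit:
  assumes f: "weight4 f" and p0: "Im p0 > 0" and eq: "SL2Z_equiv p0 p" and lim: "(f \<longlongrightarrow> L) (at p0)"
  shows "\<exists>M. (f \<longlongrightarrow> M) (at p)"
proof -
  obtain a b c d where g: "a * d - b * c = 1" "p = mob a b c d p0" using eq SL2Z_equiv_mob by blast
  note w = weight4_transport[OF f p0 g(1), folded g(2)]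
  let ?\<psi> = "\<lambda>z. (of_int d * z + of_int (- b)) / (of_int (- c) * z + of_int a) :: complex"
  have "of_int d * of_int a - of_int (- b) * of_int (- c) \<noteq> (0::complex)" unfolding w(3) by simp
  from filterlim_moebius[OF this w(2)] have "filterlim ?\<psi> (at p0) (at p)" unfolding w(1)[symmetric] .
  from filterlim_compose[OF lim this] have "((\<lambda>z. f (?\<psi> z)) \<longlongrightarrow> L) (at p)" .
  then have "((\<lambda>z. (of_int d * of_int a - of_int (- b) * of_int (- c))\<^sup>2 / (of_int (- c) * z + of_int a) ^ 4 * f (?\<psi> z)) \<longlongrightarrow>
      (of_int d * of_int a - of_int (- b) * of_int (- c))\<^sup>2 / (of_int (- c) * p + of_int a) ^ 4 * L) (at p)"
    by (intro tendsto_intros) (use w(2) in auto)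
  from Lim_transform_eventually[OF this] w(4) show ?thesis by (auto simp: eq_commute)
qed

lemma jj_cusp_avoids: "finite T \<Longrightarrow> \<forall>\<^sub>F z in cusp. jj z \<notin> T"
proof -
  assume "finite T"
  then have "bounded T" by (rule finite_imp_bounded)
  then obtain B where B: "\<And>t. t \<in> T \<Longrightarrow> norm t \<le> B" unfolding bounded_iff by blast
  obtain Y where Y: "\<And>z. Im z > Y \<Longrightarrow> norm (jj z) > B" using jj_large by blast
  have "jj z \<notin> T" if "Im z > Y" for z using B[of "jj z"] Y[OF that] by auto
  then show ?thesis unfolding eventually_cusp by blast
qed

text \<open>The numbers \<open>n\<rho>\<close>, \<open>ni\<close> and \<open>n j\<close> are the
  exponent differences, twice the given half-integers. The value 1 of \<open>n\<rho>\<close> or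
  \<open>ni\<close> stands for a regular point.\<close>

locale potential_data =
  fixes n\<rho> ni m :: nat and z :: "nat \<Rightarrow> complex" and n :: "nat \<Rightarrow> nat" and \<kappa> :: real
  assumes n\<rho>: "\<not> 3 dvd n\<rho>" and ni: "odd ni"
    and z_uhp: "j \<in> {1..m} \<Longrightarrow> Im (z j) > 0"
    and z_inequivalent: "j \<in> {1..m} \<Longrightarrow> k \<in> {1..m} \<Longrightarrow> j \<noteq> k \<Longrightarrow> \<not> SL2Z_equiv (z j) (z k)"
    and z_generic: "j \<in> {1..m} \<Longrightarrow> \<not> SL2Z_equiv (z j) \<i>" "j \<in> {1..m} \<Longrightarrow> \<not> SL2Z_equiv (z j) rho"
    and n_ge_2: "j \<in> {1..m} \<Longrightarrow> n j \<ge> 2"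
begin

definition special :: "complex \<Rightarrow> nat \<Rightarrow> bool" where
  "special p k \<longleftrightarrow> p = rho \<and> k = n\<rho> \<or> p = \<i> \<and> k = ni \<or> (\<exists>j\<in>{1..m}. p = z j \<and> k = n j)"

lemma specialI: "special rho n\<rho>" "special \<i> ni" "j \<in> {1..m} \<Longrightarrow> special (z j) (n j)"
  unfolding special_def by blast+

lemma special_cases:
  assumes "special p k"
  obtains (rho) "p = rho" "k = n\<rho>" | (i) "p = \<i>" "k = ni" | (z) j where "j \<in> {1..m}" "p = z j" "k = n j"
  using assms unfolding special_def by blast

lemma special_uhp: "special p k \<Longrightarrow> Im p > 0"
  using rho_facts(1) z_uhp by (auto simp: special_def)

lemma special_ge_1: "special p k \<Longrightarrow> k \<ge> 1"
proof (erule special_cases)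
  show "k = n\<rho> \<Longrightarrow> k \<ge> 1" using n\<rho> by (cases k) auto
  show "k = ni \<Longrightarrow> k \<ge> 1" using ni by (cases k) auto
qed (use n_ge_2 in fastforce)

lemma finite_special: "finite {p. \<exists>k. special p k}"
proof -
  have "{p. \<exists>k. special p k} \<subseteq> insert rho (insert \<i> (z ` {1..m}))" by (auto simp: special_def)
  then show ?thesis by (rule finite_subset) simp
qed

text \<open>What is demanded of a solution apart from apparentness and normalised values, so that
  the explicit functions \<open>pot x\<close> qualify as well. The limit at the cusp is the value
  \<open>F 0\<close> for which \<open>x\<^sup>2 + F 0 / (4 \<pi>\<^sup>2)\<close> has the roots
  \<open>\<kappa>\<close> and \<open>- \<kappa>\<close>.\<close>

definition admissible :: "(complex \<Rightarrow> complex) \<Rightarrow> bool" where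
  "admissible f \<longleftrightarrow> weight4 f \<and> (\<forall>p. Im p > 0 \<longrightarrow> (\<forall>\<^sub>F w in at p. f analytic_on {w})) \<and>
     (\<forall>p k. special p k \<longrightarrow> ((\<lambda>w. (w - p)\<^sup>2 * f w) \<longlongrightarrow> indicial k) (at p)) \<and>
     (\<forall>p. Im p > 0 \<longrightarrow> (\<forall>q k. special q k \<longrightarrow> \<not> SL2Z_equiv q p) \<longrightarrow> f analytic_on {p}) \<and>
     (f \<longlongrightarrow> - 4 * (of_real pi)\<^sup>2 * (of_real \<kappa>)\<^sup>2) cusp"

lemma admissibleD:
  assumes "admissible f"
  shows "weight4 f" "\<And>p. Im p > 0 \<Longrightarrow> \<forall>\<^sub>F w in at p. f analytic_on {w}"
    "\<And>p k. special p k \<Longrightarrow> ((\<lambda>w. (w - p)\<^sup>2 * f w) \<longlongrightarrow> indicial k) (at p)"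
    "\<And>p. Im p > 0 \<Longrightarrow> (\<And>q k. special q k \<Longrightarrow> \<not> SL2Z_equiv q p) \<Longrightarrow> f analytic_on {p}"
    "(f \<longlongrightarrow> - 4 * (of_real pi)\<^sup>2 * (of_real \<kappa>)\<^sup>2) cusp"
  using assms unfolding admissible_def by blast+

lemma cusp_not_special: "\<forall>\<^sub>F w in cusp. Im w > 0 \<and> (\<forall>q k. special q k \<longrightarrow> \<not> SL2Z_equiv q w)"
  using jj_cusp_avoids[OF finite_imageI[OF finite_special], of jj] cusp_uhp
proof eventually_elim
  case (elim w)
  have "\<not> SL2Z_equiv q w" if s: "special q k" for q k
  proof
    assume "SL2Z_equiv q w"
    then have "jj w = jj q" using jj_equiv special_uhp[OF s] by blast
    then show False using elim(1) s by blast
  qed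
  then show ?case using elim(2) by blast
qed

text \<open>The difference, divided by \<open>EE\<close>, is invariant, has only removable
  singularities and tends to 0 at the cusp, so \<open>invariant_zero\<close> applies. The simple
  poles at the \<open>z j\<close> are the only freedom, and \<open>res\<close> excludes
  them.\<close>

lemma admissible_unique:
  assumes f: "admissible f" and g: "admissible g"
    and res: "\<And>j. j \<in> {1..m} \<Longrightarrow> ((\<lambda>w. (w - z j) * (f w - g w)) \<longlongrightarrow> 0) (at (z j))"
    and p: "Im p > 0"
  shows "\<forall>\<^sub>F w in at p. f w = g w"
proof -
  define d where "d w = f w - g w" for w
  define F where "F w = d w / EE w" for w
  have d: "weight4 d" unfolding weight4_def d_def
    using weight4D[OF admissibleD(1)[OF f]] weight4D[OF admissibleD(1)[OF g]] by (simp add: right_diff_distrib)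
  have d_an: "\<forall>\<^sub>F w in at p. d analytic_on {w}" if "Im p > 0" for p
    using admissibleD(2)[OF f that] admissibleD(2)[OF g that] unfolding d_def by eventually_elim (intro analytic_intros)
  have anF: "\<forall>\<^sub>F w in at p. F analytic_on {w}" if "Im p > 0" for p
    using d_an[OF that] eventually_EE_neq_0[OF that] eventually_at_uhp[OF that]
    unfolding F_def by eventually_elim (auto intro!: analytic_intros EE_analytic)
  have d2: "((\<lambda>w. (w - p)\<^sup>2 * d w) \<longlongrightarrow> 0) (at p)" if "special p k" for p k
    using tendsto_diff[OF admissibleD(3)[OF f that] admissibleD(3)[OF g that]] unfolding d_def by (simp add: right_diff_distrib)
  have inv: "F (mob a b c e w) = F w" if "Im w > 0" "a * e - b * c = 1" for a b c e w
    using weight4_quotient_invariant[OF d that(2,1)] by (simp add: F_def)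
  \<comment> \<open>By the parity arguments at rho and i, by \<open>res\<close> at the
    \<open>z j\<close>.\<close>
  have special: "\<exists>L. (F \<longlongrightarrow> L) (at p)" if s: "special p k" for p k
    using s
  proof (cases rule: special_cases)
    case rho
    show ?thesis using quotient_limit_rho[OF d d_an d2[OF s, unfolded rho]] rho_facts(1) unfolding F_def rho by blast
  next
    case i
    show ?thesis using quotient_limit_i[OF d d_an d2[OF s, unfolded i]] unfolding F_def i by simp
  next
    case (z j)
    have u: "Im (z j) > 0" using z_uhp z by blast
    have "((\<lambda>w. (w - z j) ^ Suc 0 * d w) \<longlongrightarrow> 0) (at (z j))" using res[OF z(1)] by (simp add: d_def)
    from pole_lower[OF d_an[OF u] this] obtain L where L: "(d \<longlongrightarrow> L) (at (z j))" by auto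
    have "EE (z j) \<noteq> 0" using EE_eq_0_iff[OF u] z_generic(2)[OF z(1)] SL2Z_equiv_sym[OF rho_facts(1), of "z j"] by auto
    then have "(F \<longlongrightarrow> L / EE (z j)) (at (z j))" unfolding F_def by (intro tendsto_divide L EE_tendsto u)
    then show ?thesis unfolding z by blast
  qed
  \<comment> \<open>Any other point is either equivalent to a special one, from which the limit is
    carried over by invariance, or both functions are regular there and \<open>EE\<close> is
    nonzero, its zeros being equivalent to rho.\<close>
  have lim: "\<exists>L. (F \<longlongrightarrow> L) (at p)" if p: "Im p > 0" for p
  proof (cases "\<exists>q k. special q k \<and> SL2Z_equiv q p")
    case True
    then obtain q k where q: "special q k" "SL2Z_equiv q p" by blast
    obtain L where L: "(F \<longlongrightarrow> L) (at q)" using special[OF q(1)] by blast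
    obtain a b c e where g: "a * e - b * c = 1" "q = mob a b c e p"
      using SL2Z_equiv_sym[OF special_uhp[OF q(1)] q(2)] SL2Z_equiv_mob by blast
    have "((\<lambda>w. F (mob a b c e w)) \<longlongrightarrow> L) (at p)" using filterlim_compose[OF L[unfolded g(2)] filterlim_mob[OF p g(1)]] .
    moreover have "\<forall>\<^sub>F w in at p. F (mob a b c e w) = F w"
      using eventually_at_uhp[OF p] by eventually_elim (rule inv[OF _ g(1)])
    ultimately show ?thesis using Lim_transform_eventually by blast
  next
    case False
    then have "d analytic_on {p}" unfolding d_def
      using admissibleD(4)[OF f p] admissibleD(4)[OF g p] by (intro analytic_intros) blast+
    then have "(d \<longlongrightarrow> d p) (at p)" using analytic_at_imp_isCont by (simp add: isCont_def)
    moreover have "EE p \<noteq> 0" using False EE_eq_0_iff[OF p] by (auto simp: special_def)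
    ultimately show ?thesis unfolding F_def using tendsto_divide[OF _ EE_tendsto[OF p]] by blast
  qed
  have iso: "isolated_singularity_at F p" if "Im p > 0" for p
    using anF[OF that] by (simp add: isolated_singularity_iff_eventually_analytic)
  have hol: "remove_sings F holomorphic_on upper_half_plane"
  proof (rule analytic_imp_holomorphic, subst analytic_on_analytic_at, intro ballI)
    fix p assume "p \<in> upper_half_plane"
    then have p: "Im p > 0" by (simp add: uhp_iff)
    then obtain L where "(F \<longlongrightarrow> L) (at p)" using lim by blast
    then show "remove_sings F analytic_on {p}" using remove_sings_analytic_at iso[OF p] by blast
  qed
  have rs0: "remove_sings F p = 0" if "Im p > 0" for p
  proof (rule invariant_zero[OF hol _ _ that])
    show "remove_sings F (mob a b c e w) = remove_sings F w" if "Im w > 0" "a * e - b * c = 1" for a b c e w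
      using remove_sings_mob[of F a b c e 0 w] inv that by simp
    have "(F \<longlongrightarrow> (- 4 * (of_real pi)\<^sup>2 * (of_real \<kappa>)\<^sup>2 - - 4 * (of_real pi)\<^sup>2 * (of_real \<kappa>)\<^sup>2) / (1/8)) cusp"
      unfolding F_def d_def by (intro tendsto_divide tendsto_diff EE_cusp admissibleD(5) f g) simp
    moreover have "\<forall>\<^sub>F w in cusp. F w = remove_sings F w"
      using cusp_not_special
    proof eventually_elim
      case (elim w)
      have "d analytic_on {w}" unfolding d_def
        using admissibleD(4)[OF f] admissibleD(4)[OF g] elim by (intro analytic_intros) blast+
      moreover have "EE w \<noteq> 0" using elim EE_eq_0_iff[of w] by (auto simp: special_def)
      ultimately have "F analytic_on {w}" unfolding F_def using elim by (intro analytic_intros EE_analytic) auto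
      then show ?case by simp
    qed
    ultimately show "(remove_sings F \<longlongrightarrow> 0) cusp" using Lim_transform_eventually by fastforce
  qed
  show ?thesis
    using eventually_remove_sings_eq_at[OF iso[OF p]] eventually_at_uhp[OF p] eventually_EE_neq_0[OF p]
  proof eventually_elim
    case (elim w)
    then have "d w / EE w = 0" using rs0[of w] unfolding F_def by simp
    then show ?case using elim(3) by (simp add: d_def)
  qed
qed

abbreviation solution :: "(complex \<Rightarrow> complex) \<Rightarrow> bool" where
  "solution Q \<equiv> meromorphic_modular_form 4 Q \<and> equipped Q (real n\<rho> / 2) (real ni / 2) m z (\<lambda>j. real (n j) / 2) \<kappa>"

lemma solution_admissible:
  assumes "solution Q"
  shows "admissible Q"
  unfolding admissible_def
proof (intro conjI allI impI)
  have nice: "Q nicely_meromorphic_on upper_half_plane" using assms by (simp add: meromorphic_modular_form_def)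
  have "Q ((of_int a * w + of_int b) / (of_int c * w + of_int d)) = (of_int c * w + of_int d) ^ 4 * Q w"
    if "a * d - b * c = 1" "w \<in> upper_half_plane" for a b c d w
    using assms that unfolding meromorphic_modular_form_def by blast
  then show "weight4 Q" unfolding weight4_def mob_def uhp_iff by blast
  show "\<forall>\<^sub>F w in at p. Q analytic_on {w}" if "Im p > 0" for p
    using nice that meromorphic_on_isolated_singularity[of Q p] meromorphic_on_subset[of Q upper_half_plane "{p}"]
    unfolding isolated_singularity_iff_eventually_analytic[symmetric] by (auto simp: nicely_meromorphic_on_def uhp_iff)
  show "((\<lambda>w. (w - p)\<^sup>2 * Q w) \<longlongrightarrow> indicial k) (at p)" if "special p k" for p k
    using that assms unfolding special_def equipped_def local_exponents_indicial[symmetric] by auto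
  show "Q analytic_on {p}" if p: "Im p > 0" and s: "\<forall>q k. special q k \<longrightarrow> \<not> SL2Z_equiv q p" for p
  proof (rule nicely_meromorphic_on_imp_analytic_at[OF nice])
    show "\<not> is_pole Q p"
    proof
      assume "is_pole Q p"
      moreover have "p \<in> upper_half_plane" using p by (simp add: uhp_iff)
      ultimately have "SL2Z_equiv rho p \<or> SL2Z_equiv \<i> p \<or> (\<exists>j\<in>{1..m}. SL2Z_equiv (z j) p)"
        using assms unfolding equipped_def by blast
      moreover have "special rho n\<rho>" "special \<i> ni" "\<And>j. j \<in> {1..m} \<Longrightarrow> special (z j) (n j)" by (auto simp: special_def)
      ultimately show False using s by blast
    qed
  qed (use p uhp_iff in simp)
  obtain F where F: "F analytic_on {0}" "q_expansion_at_infinity Q F"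
      "[:F 0 / (4 * (complex_of_real pi)\<^sup>2), 0, 1:] = [:- of_real \<kappa>, 1:] * [:- (- of_real \<kappa>), 1:]"
    using assms unfolding equipped_def local_exponents_at_infinity_def by blast
  have "F 0 / (4 * (complex_of_real pi)\<^sup>2) = - (of_real \<kappa>)\<^sup>2" using F(3) by (simp add: power2_eq_square)
  then have F0: "F 0 = - 4 * (of_real pi)\<^sup>2 * (of_real \<kappa>)\<^sup>2" by (simp add: divide_eq_eq)
  have "(F \<longlongrightarrow> F 0) (at 0)" using analytic_at_imp_isCont[OF F(1)] by (simp add: isCont_def)
  from filterlim_compose[OF this filterlim_q_cusp]
  have "((\<lambda>w. F (exp (2 * of_real pi * \<i> * w))) \<longlongrightarrow> F 0) cusp" .
  moreover have "\<forall>\<^sub>F w in cusp. F (exp (2 * of_real pi * \<i> * w)) = Q w"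
    using F(2) unfolding q_expansion_at_infinity_def eventually_cusp by (metis (no_types, lifting))
  ultimately show "(Q \<longlongrightarrow> - 4 * (of_real pi)\<^sup>2 * (of_real \<kappa>)\<^sup>2) cusp"
    unfolding F0 by (rule Lim_transform_eventually)
qed

text \<open>For exponent difference 1 the double pole coefficient is 0, which alone would allow a
  simple pole; at rho and i the limit of \<open>f / EE\<close> excludes it.\<close>

lemma admissible_regular:
  assumes f: "admissible f" and s: "special q 1" and eq: "SL2Z_equiv q p"
  shows "\<not> is_pole f p"
proof -
  have q: "Im q > 0" by (rule special_uhp[OF s])
  have lim: "((\<lambda>w. (w - q)\<^sup>2 * f w) \<longlongrightarrow> 0) (at q)" using admissibleD(3)[OF f s] by (simp add: indicial_def)
  have "\<exists>L. ((\<lambda>w. f w / EE w) \<longlongrightarrow> L) (at q)"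
    using s
  proof (cases rule: special_cases)
    case rho
    then show ?thesis using quotient_limit_rho[OF admissibleD(1,2)[OF f]] lim q by simp
  next
    case i
    then show ?thesis using quotient_limit_i[OF admissibleD(1,2)[OF f]] lim q by simp
  next
    case (z j)
    then show ?thesis using n_ge_2 by fastforce
  qed
  then obtain L where "((\<lambda>w. f w / EE w) \<longlongrightarrow> L) (at q)" by blast
  then have "((\<lambda>w. f w / EE w * EE w) \<longlongrightarrow> L * EE q) (at q)" by (intro tendsto_mult EE_tendsto q)
  moreover have "\<forall>\<^sub>F w in at q. f w / EE w * EE w = f w" using eventually_EE_neq_0[OF q] by eventually_elim simp
  ultimately have "(f \<longlongrightarrow> L * EE q) (at q)" by (rule Lim_transform_eventually)
  then obtain M where "(f \<longlongrightarrow> M) (at p)" using weight4_limit[OF admissibleD(1)[OF f] q eq] by blast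
  then show ?thesis unfolding is_pole_def using not_tendsto_and_filterlim_at_infinity[of "at p"] by auto
qed

lemma admissible_pole:
  assumes f: "admissible f" and p: "Im p > 0" and pole: "is_pole f p"
  obtains q k where "special q k" "k \<ge> 2" "SL2Z_equiv q p" "((\<lambda>w. (w - p)\<^sup>2 * f w) \<longlongrightarrow> indicial k) (at p)"
proof -
  have "\<not> f analytic_on {p}" using analytic_at_imp_no_pole pole by blast
  then obtain q k where q: "special q k" "SL2Z_equiv q p" using admissibleD(4)[OF f p] by blast
  have "k \<noteq> 1" using admissible_regular[OF f _ q(2)] q(1) pole by blast
  then have "k \<ge> 2" using special_ge_1[OF q(1)] by simp
  then show ?thesis using that q weight4_double_pole[OF admissibleD(1)[OF f] special_uhp[OF q(1)] q(2) admissibleD(3)[OF f q(1)]] by blast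
qed

lemma admissible_is_pole:
  assumes f: "admissible f" and s: "special q k" "k \<noteq> 1" and eq: "SL2Z_equiv q p"
  shows "is_pole f p"
  using double_pole_is_pole[OF weight4_double_pole[OF admissibleD(1)[OF f] special_uhp[OF s(1)] eq admissibleD(3)[OF f s(1)]]]
    indicial_eq_0_iff[OF special_ge_1[OF s(1)]] s(2) by blast

text \<open>At rho and i apparentness follows from the rotation symmetry, so \<open>ric\<close> is
  asked for at the \<open>z j\<close> only; \<open>weight4_riccati\<close> carries it to all
  equivalent poles.\<close>

lemma admissible_solution:
  assumes f: "admissible Q" and nice: "Q nicely_meromorphic_on upper_half_plane" and off: "\<And>w. Im w \<le> 0 \<Longrightarrow> Q w = 0"
    and ric: "\<And>j. j \<in> {1..m} \<Longrightarrow> riccati (n j) Q (z j)"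
  shows "solution Q"
proof -
  obtain B where B: "B > 0" "\<And>w. Im w > B \<Longrightarrow> (\<forall>q k. special q k \<longrightarrow> \<not> SL2Z_equiv q w)"
  proof -
    obtain B where "\<forall>w. Im w > B \<longrightarrow> Im w > 0 \<and> (\<forall>q k. special q k \<longrightarrow> \<not> SL2Z_equiv q w)"
      using cusp_not_special unfolding eventually_cusp by blast
    then show ?thesis using that[of "max B 1"] by auto
  qed
  obtain F r where F: "r > 0" "F holomorphic_on ball 0 r" "F 0 = - 4 * (of_real pi)\<^sup>2 * (of_real \<kappa>)\<^sup>2"
    "\<And>w. Im w > B \<Longrightarrow> Q w = F (exp (2 * of_real pi * \<i> * w))"
  proof (rule q_expansion[of Q B])
    show "Q holomorphic_on {w. Im w > B}"
    proof (rule analytic_imp_holomorphic, subst analytic_on_analytic_at, intro ballI)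
      fix w assume "w \<in> {w. Im w > B}"
      then have w: "Im w > B" by simp
      then have "Im w > 0" using B(1) by simp
      then show "Q analytic_on {w}" by (rule admissibleD(4)[OF f]) (use B(2)[OF w] in blast)
    qed
    show "Q (w + 1) = Q w" if "Im w > B" for w
      using weight4D[OF admissibleD(1)[OF f], of 1 1 1 0 w] that B(1) by (simp add: mob_def)
  qed (use admissibleD(5)[OF f] in auto)
  have F_an: "F analytic_on {0}" using F(1,2) unfolding analytic_at by (intro exI[of _ "ball 0 r"]) auto
  have F_exp: "q_expansion_at_infinity Q F" using F(4) B(1) unfolding q_expansion_at_infinity_def by blast
  have "meromorphic_modular_form 4 Q"
    unfolding meromorphic_modular_form_def
  proof (intro conjI allI impI ballI)
    show "Q w = 0" if "w \<notin> upper_half_plane" for w using off that by (simp add: uhp_iff)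
    show "Q ((of_int a * w + of_int b) / (of_int c * w + of_int d)) = (of_int c * w + of_int d) ^ 4 * Q w"
      if "a * d - b * c = 1" "w \<in> upper_half_plane" for a b c d w
      using weight4D[OF admissibleD(1)[OF f] that(1), of w] that(2) by (simp add: uhp_iff mob_def)
    show "\<exists>F. F meromorphic_on {0} \<and> q_expansion_at_infinity Q F"
      using F_an F_exp analytic_on_imp_meromorphic_on by blast
  qed (rule nice)
  moreover have "fuchsian Q"
    unfolding fuchsian_def
  proof (intro conjI ballI impI)
    fix p assume "p \<in> upper_half_plane" and pole: "is_pole Q p"
    then have p: "Im p > 0" by (simp add: uhp_iff)
    then obtain q k where q: "special q k" "k \<ge> 2" "SL2Z_equiv q p" "((\<lambda>w. (w - p)\<^sup>2 * Q w) \<longlongrightarrow> indicial k) (at p)"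
      by (rule admissible_pole[OF f _ pole])
    then show "zorder Q p \<ge> - 2"
      using double_pole_zorder[OF admissibleD(2)[OF f p] q(4)] indicial_eq_0_iff[of k] by simp
  qed (use F_an F_exp in blast)
  moreover have "is_pole Q w \<longleftrightarrow> (real n\<rho> / 2 \<noteq> 1/2 \<and> SL2Z_equiv rho w) \<or> (real ni / 2 \<noteq> 1/2 \<and> SL2Z_equiv \<i> w) \<or>
        (\<exists>j\<in>{1..m}. SL2Z_equiv (z j) w)" (is "_ \<longleftrightarrow> ?R") if "w \<in> upper_half_plane" for w
  proof
    assume pole: "is_pole Q w"
    have "Im w > 0" using that by (simp add: uhp_iff)
    then obtain q k where q: "special q k" "k \<ge> 2" "SL2Z_equiv q w" "((\<lambda>v. (v - w)\<^sup>2 * Q v) \<longlongrightarrow> indicial k) (at w)"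
      by (rule admissible_pole[OF f _ pole])
    then show ?R by (auto simp: special_def)
  next
    assume ?R
    then consider "n\<rho> \<noteq> 1" "SL2Z_equiv rho w" | "ni \<noteq> 1" "SL2Z_equiv \<i> w" | j where "j \<in> {1..m}" "SL2Z_equiv (z j) w" by auto
    then show "is_pole Q w"
    proof cases
      case 1
      then show ?thesis using admissible_is_pole[OF f, of rho n\<rho>] by (simp add: special_def)
    next
      case 2
      then show ?thesis using admissible_is_pole[OF f, of \<i> ni] by (simp add: special_def)
    next
      case 3
      then have "special (z j) (n j)" unfolding special_def by blast
      then show ?thesis by (rule admissible_is_pole[OF f]) (use 3 n_ge_2[of j] in auto)
    qed
  qed
  moreover have exps: "local_exponents Q p (1/2 + of_nat k / 2) (1/2 - of_nat k / 2)" if "special p k" for p k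
    unfolding local_exponents_indicial by (rule admissibleD(3)[OF f that])
  moreover have "apparent Q"
    unfolding apparent_def
  proof (intro ballI impI)
    fix p assume "p \<in> upper_half_plane" and pole: "is_pole Q p"
    then have p: "Im p > 0" by (simp add: uhp_iff)
    then obtain q k where q: "special q k" "k \<ge> 2" "SL2Z_equiv q p" "((\<lambda>w. (w - p)\<^sup>2 * Q w) \<longlongrightarrow> indicial k) (at p)"
      by (rule admissible_pole[OF f _ pole])
    have lim: "((\<lambda>w. (w - q)\<^sup>2 * Q w) \<longlongrightarrow> ((of_nat k)\<^sup>2 - 1) / 4) (at q)"
      using admissibleD(3)[OF f q(1)] unfolding indicial_def .
    have "riccati k Q q"
      using q(1)
    proof (cases rule: special_cases)
      case rho
      show ?thesis using riccati_at_rho[OF admissibleD(1,2)[OF f] n\<rho>] lim rho_facts(1) unfolding rho by blast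
    next
      case i
      show ?thesis using riccati_at_i[OF admissibleD(1,2)[OF f] ni] lim unfolding i by simp
    qed (use ric in blast)
    then have "riccati k Q p" by (rule weight4_riccati[OF admissibleD(1)[OF f] special_uhp[OF q(1)] q(3)])
    then show "apparent_at Q p"
      by (rule riccati_imp_apparent_at) (use q(2,4) local_exponents_indicial in auto)
  qed
  moreover have "local_exponents_at_infinity Q (of_real \<kappa>) (- of_real \<kappa>)"
    unfolding local_exponents_at_infinity_def using F_an F_exp
    by (intro exI[of _ F]) (simp add: F(3) power2_eq_square)
  ultimately show ?thesis
    unfolding equipped_def using exps[OF specialI(1)] exps[OF specialI(2)] exps[OF specialI(3)] by simp
qed


section \<open>The explicit family and its expansions\<close>

definition res_i :: complex where
  "res_i = (SOME L. L \<noteq> 0 \<and> ((\<lambda>w. (w - \<i>)\<^sup>2 * (EE w / (jj w - jj \<i>))) \<longlongrightarrow> L) (at \<i>))"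

definition res_rho :: complex where
  "res_rho = (SOME L. L \<noteq> 0 \<and> ((\<lambda>w. (w - rho)\<^sup>2 * (EE w / jj w)) \<longlongrightarrow> L) (at rho))"

definition res1 :: "nat \<Rightarrow> complex" where
  "res1 j = (SOME L. L \<noteq> 0 \<and> ((\<lambda>w. (w - z j) * (EE w / (jj w - jj (z j)))) \<longlongrightarrow> L) (at (z j)))"

definition res2 :: "nat \<Rightarrow> complex" where
  "res2 j = (SOME L. L \<noteq> 0 \<and> ((\<lambda>w. (w - z j)\<^sup>2 * (EE w / (jj w - jj (z j))\<^sup>2)) \<longlongrightarrow> L) (at (z j)))"

lemma res_i: "res_i \<noteq> 0" "((\<lambda>w. (w - \<i>)\<^sup>2 * (EE w / (jj w - jj \<i>))) \<longlongrightarrow> res_i) (at \<i>)"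
proof -
  have "\<exists>L. L \<noteq> 0 \<and> ((\<lambda>w. (w - \<i>)\<^sup>2 * (EE w / (jj w - jj \<i>))) \<longlongrightarrow> L) (at \<i>)" using pole_coefficient_i by blast
  from someI_ex[OF this] show "res_i \<noteq> 0" "((\<lambda>w. (w - \<i>)\<^sup>2 * (EE w / (jj w - jj \<i>))) \<longlongrightarrow> res_i) (at \<i>)"
    unfolding res_i_def by blast+
qed

lemma res_rho: "res_rho \<noteq> 0" "((\<lambda>w. (w - rho)\<^sup>2 * (EE w / jj w)) \<longlongrightarrow> res_rho) (at rho)"
proof -
  have "\<exists>L. L \<noteq> 0 \<and> ((\<lambda>w. (w - rho)\<^sup>2 * (EE w / jj w)) \<longlongrightarrow> L) (at rho)" using pole_coefficient_rho by blast
  from someI_ex[OF this] show "res_rho \<noteq> 0" "((\<lambda>w. (w - rho)\<^sup>2 * (EE w / jj w)) \<longlongrightarrow> res_rho) (at rho)"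
    unfolding res_rho_def by blast+
qed

lemma res12:
  assumes j: "j \<in> {1..m}"
  shows "res1 j \<noteq> 0" "((\<lambda>w. (w - z j) * (EE w / (jj w - jj (z j)))) \<longlongrightarrow> res1 j) (at (z j))"
    "res2 j \<noteq> 0" "((\<lambda>w. (w - z j)\<^sup>2 * (EE w / (jj w - jj (z j))\<^sup>2)) \<longlongrightarrow> res2 j) (at (z j))"
proof -
  obtain L M where LM: "L \<noteq> 0" "((\<lambda>w. (w - z j) * (EE w / (jj w - jj (z j)))) \<longlongrightarrow> L) (at (z j))"
    "M \<noteq> 0" "((\<lambda>w. (w - z j)\<^sup>2 * (EE w / (jj w - jj (z j))\<^sup>2)) \<longlongrightarrow> M) (at (z j))"
    by (rule pole_coefficients_generic[OF z_uhp[OF j] z_generic[OF j]])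
  have "\<exists>L. L \<noteq> 0 \<and> ((\<lambda>w. (w - z j) * (EE w / (jj w - jj (z j)))) \<longlongrightarrow> L) (at (z j))" using LM(1,2) by blast
  from someI_ex[OF this] show "res1 j \<noteq> 0" "((\<lambda>w. (w - z j) * (EE w / (jj w - jj (z j)))) \<longlongrightarrow> res1 j) (at (z j))"
    unfolding res1_def by blast+
  have "\<exists>L. L \<noteq> 0 \<and> ((\<lambda>w. (w - z j)\<^sup>2 * (EE w / (jj w - jj (z j))\<^sup>2)) \<longlongrightarrow> L) (at (z j))" using LM(3,4) by blast
  from someI_ex[OF this] show "res2 j \<noteq> 0" "((\<lambda>w. (w - z j)\<^sup>2 * (EE w / (jj w - jj (z j))\<^sup>2)) \<longlongrightarrow> res2 j) (at (z j))"
    unfolding res2_def by blast+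
qed

text \<open>
  \<open>EE\<close> tends to \<open>1/8\<close> at the cusp and \<open>jj\<close> to infinity, so the constant is chosen to give the
  prescribed exponents there; the other coefficients give the prescribed double poles. What
  remains free are the coefficients \<open>x j\<close> of the simple poles.
\<close>

definition base :: "complex \<Rightarrow> complex" where
  "base w = - 32 * (of_real pi)\<^sup>2 * (of_real \<kappa>)\<^sup>2 * EE w + indicial ni / res_i * (EE w / (jj w - jj \<i>))
     + indicial n\<rho> / res_rho * (EE w / jj w) + (\<Sum>j\<in>{1..m}. indicial (n j) / res2 j * (EE w / (jj w - jj (z j))\<^sup>2))"

definition pot :: "(nat \<Rightarrow> complex) \<Rightarrow> complex \<Rightarrow> complex" where
  "pot x w = base w + (\<Sum>j\<in>{1..m}. x j * (EE w / (jj w - jj (z j))))"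

lemma jj_neq: "Im p > 0 \<Longrightarrow> Im q > 0 \<Longrightarrow> \<not> SL2Z_equiv q p \<Longrightarrow> jj p \<noteq> jj q"
  using jj_inj[of q p] by auto

lemma quotient_analytic:
  assumes "Im p > 0" "jj p \<noteq> v"
  shows "(\<lambda>w. EE w / (jj w - v)) analytic_on {p}" "(\<lambda>w. EE w / (jj w - v)\<^sup>2) analytic_on {p}"
  using assms by (auto intro!: analytic_intros EE_analytic jj_analytic)

lemma pot_analytic:
  assumes p: "Im p > 0" "jj p \<noteq> jj \<i>" "jj p \<noteq> 0" "\<And>j. j \<in> {1..m} \<Longrightarrow> jj p \<noteq> jj (z j)"
  shows "pot x analytic_on {p}"
  unfolding pot_def[abs_def] base_def[abs_def] using p
  by (intro analytic_intros EE_analytic quotient_analytic jj_analytic) auto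

lemma pot_eventually_analytic:
  assumes p: "Im p > 0"
  shows "\<forall>\<^sub>F w in at p. pot x analytic_on {w}"
proof -
  have "\<forall>\<^sub>F w in at p. \<forall>j\<in>{1..m}. jj w \<noteq> jj (z j)"
    by (intro eventually_ball_finite ballI eventually_jj_neq p) simp
  then show ?thesis using eventually_at_uhp[OF p] eventually_jj_neq[OF p, of 0] eventually_jj_neq[OF p, of "jj \<i>"]
    by eventually_elim (rule pot_analytic, auto)
qed

lemma pot_weight4: "weight4 (pot x)"
  unfolding weight4_def pot_def base_def
proof (intro allI impI)
  fix a b c d :: int and w :: complex assume g: "a * d - b * c = 1" and w: "Im w > 0"
  show "- 32 * (of_real pi)\<^sup>2 * (of_real \<kappa>)\<^sup>2 * EE (mob a b c d w) + indicial ni / res_i * (EE (mob a b c d w) / (jj (mob a b c d w) - jj \<i>))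
     + indicial n\<rho> / res_rho * (EE (mob a b c d w) / jj (mob a b c d w))
     + (\<Sum>j\<in>{1..m}. indicial (n j) / res2 j * (EE (mob a b c d w) / (jj (mob a b c d w) - jj (z j))\<^sup>2))
     + (\<Sum>j\<in>{1..m}. x j * (EE (mob a b c d w) / (jj (mob a b c d w) - jj (z j)))) =
   (of_int c * w + of_int d) ^ 4 *
   (- 32 * (of_real pi)\<^sup>2 * (of_real \<kappa>)\<^sup>2 * EE w + indicial ni / res_i * (EE w / (jj w - jj \<i>)) + indicial n\<rho> / res_rho * (EE w / jj w)
     + (\<Sum>j\<in>{1..m}. indicial (n j) / res2 j * (EE w / (jj w - jj (z j))\<^sup>2)) + (\<Sum>j\<in>{1..m}. x j * (EE w / (jj w - jj (z j)))))"
    unfolding EE_modular[OF w g] jj_invariant[OF w g]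
    by (simp only: distrib_left sum_distrib_left divide_inverse mult_ac)
qed

text \<open>The double pole coefficients of the building blocks at \<open>p\<close> are parameters,
  so that one computation serves all three kinds of special points.\<close>

lemma pot_double_pole:
  assumes p: "Im p > 0" and a: "((\<lambda>w. (w - p)\<^sup>2 * (EE w / (jj w - jj \<i>))) \<longlongrightarrow> a) (at p)"
    and b: "((\<lambda>w. (w - p)\<^sup>2 * (EE w / jj w)) \<longlongrightarrow> b) (at p)"
    and c: "\<And>j. j \<in> {1..m} \<Longrightarrow> ((\<lambda>w. (w - p)\<^sup>2 * (EE w / (jj w - jj (z j))\<^sup>2)) \<longlongrightarrow> c j) (at p)"
    and d: "\<And>j. j \<in> {1..m} \<Longrightarrow> ((\<lambda>w. (w - p)\<^sup>2 * (EE w / (jj w - jj (z j)))) \<longlongrightarrow> 0) (at p)"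
  shows "((\<lambda>w. (w - p)\<^sup>2 * pot x w) \<longlongrightarrow> indicial ni / res_i * a + indicial n\<rho> / res_rho * b
      + (\<Sum>j\<in>{1..m}. indicial (n j) / res2 j * c j)) (at p)"
proof -
  have "((\<lambda>w. - 32 * (of_real pi)\<^sup>2 * (of_real \<kappa>)\<^sup>2 * ((w - p)\<^sup>2 * EE w) + indicial ni / res_i * ((w - p)\<^sup>2 * (EE w / (jj w - jj \<i>)))
     + indicial n\<rho> / res_rho * ((w - p)\<^sup>2 * (EE w / jj w))
     + (\<Sum>j\<in>{1..m}. indicial (n j) / res2 j * ((w - p)\<^sup>2 * (EE w / (jj w - jj (z j))\<^sup>2)))
     + (\<Sum>j\<in>{1..m}. x j * ((w - p)\<^sup>2 * (EE w / (jj w - jj (z j)))))) \<longlongrightarrow>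
    - 32 * (of_real pi)\<^sup>2 * (of_real \<kappa>)\<^sup>2 * 0 + indicial ni / res_i * a + indicial n\<rho> / res_rho * b
      + (\<Sum>j\<in>{1..m}. indicial (n j) / res2 j * c j) + (\<Sum>j\<in>{1..m}. x j * 0)) (at p)"
    by (intro tendsto_add tendsto_mult_left tendsto_sum a b c d analytic_double_zero EE_analytic p)
  moreover have "- 32 * (of_real pi)\<^sup>2 * (of_real \<kappa>)\<^sup>2 * ((w - p)\<^sup>2 * EE w) + indicial ni / res_i * ((w - p)\<^sup>2 * (EE w / (jj w - jj \<i>)))
     + indicial n\<rho> / res_rho * ((w - p)\<^sup>2 * (EE w / jj w))
     + (\<Sum>j\<in>{1..m}. indicial (n j) / res2 j * ((w - p)\<^sup>2 * (EE w / (jj w - jj (z j))\<^sup>2)))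
     + (\<Sum>j\<in>{1..m}. x j * ((w - p)\<^sup>2 * (EE w / (jj w - jj (z j))))) = (w - p)\<^sup>2 * pot x w" for w
    unfolding pot_def base_def by (simp only: distrib_left sum_distrib_left mult_ac)
  ultimately show ?thesis by simp
qed

lemma z_jj:
  assumes j: "j \<in> {1..m}"
  shows "jj (z j) \<noteq> jj \<i>" "jj (z j) \<noteq> 0" "k \<in> {1..m} \<Longrightarrow> k \<noteq> j \<Longrightarrow> jj (z j) \<noteq> jj (z k)"
proof -
  show "jj (z j) \<noteq> jj \<i>" using jj_inj[of "z j" \<i>] z_uhp[OF j] z_generic(1)[OF j] by auto
  show "jj (z j) \<noteq> 0" using jj_inj[of "z j" rho] z_uhp[OF j] z_generic(2)[OF j] rho_facts(1) EE_rho(2) by auto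
  show "jj (z j) \<noteq> jj (z k)" if "k \<in> {1..m}" "k \<noteq> j"
    using jj_inj[of "z j" "z k"] z_uhp[OF j] z_uhp[OF that(1)] z_inequivalent[OF j that(1)] that(2) by auto
qed

lemma jj_i_neq_0: "jj \<i> \<noteq> 0"
  using jj_inj[of \<i> rho] not_equiv_i_rho rho_facts(1) EE_rho(2) by auto

lemma simple_term_double_zero:
  assumes "((\<lambda>w. (w - p) * f w) \<longlongrightarrow> L) (at (p::complex))"
  shows "((\<lambda>w. (w - p)\<^sup>2 * f w) \<longlongrightarrow> 0) (at p)"
proof -
  have "((\<lambda>w. (w - p) * ((w - p) * f w)) \<longlongrightarrow> (p - p) * L) (at p)" by (intro tendsto_intros assms)
  then show ?thesis by (simp add: power2_eq_square mult.assoc)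
qed

lemma simple_term_limit:
  assumes j: "j \<in> {1..m}" and k: "k \<in> {1..m}"
  shows "((\<lambda>w. (w - z j) * (EE w / (jj w - jj (z k)))) \<longlongrightarrow> (if k = j then res1 j else 0)) (at (z j))"
proof (cases "k = j")
  case True
  then show ?thesis using res12(2)[OF j] by simp
next
  case False
  have "isCont (\<lambda>w. EE w / (jj w - jj (z k))) (z j)"
    by (intro analytic_at_imp_isCont quotient_analytic z_uhp j z_jj(3) k False)
  then have "((\<lambda>w. (w - z j) * (EE w / (jj w - jj (z k)))) \<longlongrightarrow> (z j - z j) * (EE (z j) / (jj (z j) - jj (z k)))) (at (z j))"
    unfolding isCont_def by (intro tendsto_mult tendsto_diff tendsto_ident_at tendsto_const)
  then show ?thesis using False by simp
qed

text \<open>At each special point exactly one building block has a double pole, and it has been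
  divided by its own leading coefficient; the others are holomorphic there or have a simple
  pole.\<close>

lemma pot_special:
  assumes "special p k"
  shows "((\<lambda>w. (w - p)\<^sup>2 * pot x w) \<longlongrightarrow> indicial k) (at p)"
proof -
  have p: "Im p > 0" by (rule special_uhp[OF assms])
  note zero = analytic_double_zero[OF quotient_analytic(1)[OF p]] analytic_double_zero[OF quotient_analytic(2)[OF p]]
  have zero3: "((\<lambda>w. (w - p)\<^sup>2 * (EE w / jj w)) \<longlongrightarrow> 0) (at p)" if "jj p \<noteq> 0"
    using zero(1)[OF that] by simp
  show ?thesis
    using assms
  proof (cases rule: special_cases)
    case i
    have n: "jj p \<noteq> jj (z j)" if "j \<in> {1..m}" for j using z_jj(1)[OF that] i by auto
    have "jj p \<noteq> 0" using jj_i_neq_0 i by simp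
    have "((\<lambda>w. (w - p)\<^sup>2 * pot x w) \<longlongrightarrow> indicial ni / res_i * res_i + indicial n\<rho> / res_rho * 0
        + (\<Sum>j\<in>{1..m}. indicial (n j) / res2 j * 0)) (at p)"
      by (rule pot_double_pole[OF p]) (use res_i(2) zero zero3 n \<open>jj p \<noteq> 0\<close> i in auto)
    then show ?thesis using res_i(1) i by simp
  next
    case rho
    have n: "jj p \<noteq> jj (z j)" if "j \<in> {1..m}" for j using z_jj(2)[OF that] rho EE_rho(2) by auto
    have "jj p \<noteq> jj \<i>" using jj_i_neq_0 rho EE_rho(2) by simp
    have "((\<lambda>w. (w - p)\<^sup>2 * pot x w) \<longlongrightarrow> indicial ni / res_i * 0 + indicial n\<rho> / res_rho * res_rho
        + (\<Sum>j\<in>{1..m}. indicial (n j) / res2 j * 0)) (at p)"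
      by (rule pot_double_pole[OF p]) (use res_rho(2) zero n \<open>jj p \<noteq> jj \<i>\<close> rho in auto)
    then show ?thesis using res_rho(1) rho by simp
  next
    case (z j)
    have "((\<lambda>w. (w - p)\<^sup>2 * pot x w) \<longlongrightarrow> indicial ni / res_i * 0 + indicial n\<rho> / res_rho * 0
        + (\<Sum>l\<in>{1..m}. indicial (n l) / res2 l * (if l = j then res2 j else 0))) (at p)"
    proof (rule pot_double_pole[OF p])
      show "((\<lambda>w. (w - p)\<^sup>2 * (EE w / (jj w - jj (z l))\<^sup>2)) \<longlongrightarrow> (if l = j then res2 j else 0)) (at p)" if "l \<in> {1..m}" for l
        using zero(2)[of "jj (z l)"] z_jj(3)[OF z(1) that] res12(4)[OF z(1)] z(2) by (cases "l = j") auto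
      show "((\<lambda>w. (w - p)\<^sup>2 * (EE w / (jj w - jj (z l)))) \<longlongrightarrow> 0) (at p)" if "l \<in> {1..m}" for l
        using simple_term_double_zero[OF simple_term_limit[OF z(1) that]] z(2) by simp
      show "((\<lambda>w. (w - p)\<^sup>2 * (EE w / (jj w - jj \<i>))) \<longlongrightarrow> 0) (at p)"
        by (rule zero(1)) (use z_jj(1)[OF z(1)] z(2) in simp)
      show "((\<lambda>w. (w - p)\<^sup>2 * (EE w / jj w)) \<longlongrightarrow> 0) (at p)"
        by (rule zero3) (use z_jj(2)[OF z(1)] z(2) in simp)
    qed
    moreover have "indicial ni / res_i * 0 + indicial n\<rho> / res_rho * 0
        + (\<Sum>l\<in>{1..m}. indicial (n l) / res2 l * (if l = j then res2 j else 0)) = indicial k"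
    proof -
      have "(\<Sum>l\<in>{1..m}. indicial (n l) / res2 l * (if l = j then res2 j else 0)) = (\<Sum>l\<in>{1..m}. if l = j then indicial (n j) else 0)"
        using res12(3)[OF z(1)] by (intro sum.cong) auto
      also have "\<dots> = indicial (n j)" using z(1) by (simp only: sum.delta finite_atLeastAtMost if_True)
      finally show ?thesis by (simp only: z(3)) simp
    qed
    ultimately show ?thesis by (simp only:)
  qed
qed

lemma pot_admissible: "admissible (pot x)"
  unfolding admissible_def
proof (intro conjI allI impI pot_weight4 pot_eventually_analytic pot_special)
  fix p assume p: "Im p > 0" and s: "\<forall>q k. special q k \<longrightarrow> \<not> SL2Z_equiv q p"
  show "pot x analytic_on {p}"
  proof (rule pot_analytic[OF p])
    show "jj p \<noteq> jj \<i>" using s by (intro jj_neq p) (auto simp: special_def)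
    have "jj p \<noteq> jj rho" using s by (intro jj_neq p) (auto simp: special_def rho_facts(1))
    then show "jj p \<noteq> 0" by (simp add: EE_rho)
    show "jj p \<noteq> jj (z j)" if "j \<in> {1..m}" for j
    proof -
      have "special (z j) (n j)" unfolding special_def using that by blast
      then show ?thesis using s by (intro jj_neq p z_uhp that) blast
    qed
  qed
next
  \<comment> \<open>All quotients tend to 0 at the cusp since \<open>jj\<close> tends to infinity;
    only the multiple of \<open>EE\<close> contributes, and \<open>- 32 / 8 = - 4\<close>.\<close>
  have inf: "filterlim (\<lambda>w. jj w - v) at_infinity cusp" for v
    using tendsto_add_filterlim_at_infinity[OF tendsto_const jj_at_infinity, of "- v"] by (simp add: add.commute)
  have t: "((\<lambda>w. EE w / (jj w - v)) \<longlongrightarrow> 0) cusp" for v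
    using tendsto_divide_0[OF EE_cusp inf] .
  have t2: "((\<lambda>w. EE w / (jj w - v)\<^sup>2) \<longlongrightarrow> 0) cusp" for v
    using tendsto_divide_0[OF EE_cusp filterlim_compose[OF filterlim_power_at_infinity[of 2] inf]] by simp
  have "(pot x \<longlongrightarrow> - 32 * (of_real pi)\<^sup>2 * (of_real \<kappa>)\<^sup>2 * (1/8) + indicial ni / res_i * 0 + indicial n\<rho> / res_rho * 0
      + (\<Sum>j\<in>{1..m}. indicial (n j) / res2 j * 0) + (\<Sum>j\<in>{1..m}. x j * 0)) cusp"
    unfolding pot_def[abs_def] base_def[abs_def]
    by (intro tendsto_add tendsto_mult_left tendsto_sum t t2 t[of 0, simplified] EE_cusp)
  then show "(pot x \<longlongrightarrow> - 4 * (of_real pi)\<^sup>2 * (of_real \<kappa>)\<^sup>2) cusp" by (simp add: mult.assoc)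
qed

text \<open>\<open>D x\<close> is affine in \<open>x\<close>: the expansion of \<open>base\<close>
  plus \<open>x k\<close> times those of the simple quotients. Only the quotient with
  \<open>k = j\<close> has a pole at \<open>z j\<close>, so only \<open>x j\<close> enters the
  coefficient of index 0.\<close>

lemma pot_expansion:
  assumes j: "j \<in> {1..m}"
  shows "\<exists>D. (\<forall>x. expands (n j) (pot x) (z j) (D x)) \<and> (\<forall>l. pol {1..m} 1 (\<lambda>x. fps_nth (D x) l)) \<and>
    lead {1..m} 1 (\<lambda>x. fps_nth (D x) 0) (\<lambda>x. res1 j * x j)"
proof -
  let ?p = "z j"
  have p: "Im ?p > 0" by (rule z_uhp[OF j])
  have base: "base w = pot (\<lambda>_. 0) w" for w by (simp add: pot_def)
  have "special ?p (n j)" unfolding special_def using j by blast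
  from pot_special[OF this, of "\<lambda>_. 0"] have lim: "((\<lambda>w. (w - ?p)\<^sup>2 * base w) \<longlongrightarrow> indicial (n j)) (at ?p)" by (simp add: base)
  define B where "B w = base w - indicial (n j) / (w - ?p)\<^sup>2" for w
  have "\<forall>\<^sub>F w in at ?p. B analytic_on {w}"
    using pot_eventually_analytic[OF p, of "\<lambda>_. 0"] eventually_neq_at_within[of ?p ?p UNIV]
    unfolding B_def base by eventually_elim (auto intro!: analytic_intros)
  moreover have "((\<lambda>w. (w - ?p)\<^sup>2 * B w) \<longlongrightarrow> 0) (at ?p)"
  proof -
    have "((\<lambda>w. (w - ?p)\<^sup>2 * base w - indicial (n j)) \<longlongrightarrow> indicial (n j) - indicial (n j)) (at ?p)" by (intro tendsto_intros lim)
    then have "((\<lambda>w. (w - ?p)\<^sup>2 * base w - indicial (n j)) \<longlongrightarrow> 0) (at ?p)" by simp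
    then show ?thesis by (rule Lim_transform_eventually) (auto simp: eventually_at_filter right_diff_distrib B_def)
  qed
  ultimately obtain h0 H0 where h0: "h0 has_fps_expansion H0" "\<forall>\<^sub>F s in at 0. B (?p + s) = h0 s / s"
    by (rule simple_pole_expansion)
  let ?G = "\<lambda>k w. EE w / (jj w - jj (z k))"
  have "\<exists>u. fst u has_fps_expansion snd u \<and> (\<forall>\<^sub>F s in at 0. ?G k (?p + s) = fst u s / s) \<and>
      fps_nth (snd u) 0 = (if k = j then res1 j else 0)" if k: "k \<in> {1..m}" for k
  proof -
    have "\<forall>\<^sub>F w in at ?p. ?G k analytic_on {w}"
      using eventually_at_uhp[OF p] eventually_jj_neq[OF p, of "jj (z k)"] by eventually_elim (rule quotient_analytic)
    then obtain h H where h: "h has_fps_expansion H" "\<forall>\<^sub>F s in at 0. ?G k (?p + s) = h s / s"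
        "((\<lambda>w. (w - ?p) * ?G k w) \<longlongrightarrow> fps_nth H 0) (at ?p)"
      by (rule simple_pole_expansion[OF _ simple_term_double_zero[OF simple_term_limit[OF j k]]])
    have "fps_nth H 0 = (if k = j then res1 j else 0)" by (rule LIM_unique[OF h(3) simple_term_limit[OF j k]])
    then show ?thesis using h by (intro exI[of _ "(h, H)"]) simp
  qed
  then have "\<forall>k\<in>{1..m}. \<exists>u. fst u has_fps_expansion snd u \<and> (\<forall>\<^sub>F s in at 0. ?G k (?p + s) = fst u s / s) \<and>
      fps_nth (snd u) 0 = (if k = j then res1 j else 0)" by blast
  from bchoice[OF this] obtain u where u: "\<And>k. k \<in> {1..m} \<Longrightarrow> fst (u k) has_fps_expansion snd (u k)"
    "\<And>k. k \<in> {1..m} \<Longrightarrow> \<forall>\<^sub>F s in at 0. ?G k (?p + s) = fst (u k) s / s"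
    "\<And>k. k \<in> {1..m} \<Longrightarrow> fps_nth (snd (u k)) 0 = (if k = j then res1 j else 0)" by blast
  define D where "D x = H0 + (\<Sum>k\<in>{1..m}. fps_const (x k) * snd (u k))" for x :: "nat \<Rightarrow> complex"
  have D_nth: "fps_nth (D x) l = fps_nth H0 l + (\<Sum>k\<in>{1..m}. fps_nth (snd (u k)) l * x k)" for x l
    by (simp add: D_def fps_sum_nth mult.commute)
  have "expands (n j) (pot x) ?p (D x)" for x
  proof (rule expandsI[where h = "\<lambda>s. h0 s + (\<Sum>k\<in>{1..m}. x k * fst (u k) s)"])
    show "(\<lambda>s. h0 s + (\<Sum>k\<in>{1..m}. x k * fst (u k) s)) has_fps_expansion D x"
      unfolding D_def by (intro fps_expansion_intros h0(1) u(1))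
    have "\<forall>\<^sub>F s in at 0. \<forall>k\<in>{1..m}. ?G k (?p + s) = fst (u k) s / s" by (intro eventually_ball_finite ballI u(2)) auto
    then show "\<forall>\<^sub>F s in at 0. pot x (?p + s) = ((of_nat (n j))\<^sup>2 - 1) / 4 / s\<^sup>2 + (h0 s + (\<Sum>k\<in>{1..m}. x k * fst (u k) s)) / s"
      using h0(2)
    proof eventually_elim
      case (elim s)
      have "base (?p + s) = indicial (n j) / s\<^sup>2 + h0 s / s" using elim(2) by (simp add: B_def algebra_simps)
      moreover have "(\<Sum>k\<in>{1..m}. x k * ?G k (?p + s)) = (\<Sum>k\<in>{1..m}. x k * fst (u k) s) / s"
        unfolding sum_divide_distrib using elim(1) by (intro sum.cong) auto
      ultimately show ?case unfolding pot_def indicial_def by (simp add: add_divide_distrib)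
    qed
  qed
  moreover have "pol {1..m} 1 (\<lambda>x. fps_nth (D x) l)" for l
    unfolding D_nth by (intro pol_add pol_const pol_sum pol_scale pol_coord)
  moreover have "lead {1..m} 1 (\<lambda>x. fps_nth (D x) 0) (\<lambda>x. res1 j * x j)"
  proof -
    have "(\<Sum>k\<in>{1..m}. fps_nth (snd (u k)) 0 * x k) = (\<Sum>k\<in>{1..m}. if k = j then res1 j * x j else 0)" for x
      by (intro sum.cong) (auto simp: u(3))
    then have "fps_nth (D x) 0 = res1 j * x j + fps_nth H0 0" for x
      unfolding D_nth using j by (simp add: sum.delta)
    moreover have "lead {1..m} 1 (\<lambda>x. res1 j * x j + fps_nth H0 0) (\<lambda>x. res1 j * x j)"
      by (rule lead_sum_lower[OF lead_refl[OF pol_scale[OF pol_coord[OF j]]]]) (auto simp: lowpol_def intro: pol_const)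
    ultimately show ?thesis by simp
  qed
  ultimately show ?thesis by blast
qed

end

lemma eventually_at_shift: "(\<forall>\<^sub>F w in at p. P w) \<Longrightarrow> (\<forall>\<^sub>F s in at 0. P (p + s))" for p :: complex
  using eventually_at_to_0[of P p] by (simp add: add.commute)

lemma expands_cong:
  assumes "\<forall>\<^sub>F w in at p. f w = g w" "expands n f p D"
  shows "expands n g p D"
proof -
  have "\<forall>\<^sub>F s in at 0. g (p + s) = ((of_nat n)\<^sup>2 - 1) / 4 / s\<^sup>2 + eval_fps D s / s"
    using eventually_at_shift[OF assms(1)] assms(2)[unfolded expands_def, THEN conjunct2] by eventually_elim simp
  then show ?thesis using assms(2) by (simp add: expands_def)
qed

context potential_data
begin

text \<open>The representative with the values that \<open>meromorphic_modular_form\<close>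
  prescribes, so that distinct solutions are distinct functions.\<close>

definition nice :: "(nat \<Rightarrow> complex) \<Rightarrow> complex \<Rightarrow> complex" where
  "nice x w = (if Im w > 0 then remove_sings (pot x) w else 0)"

lemma nice_eq_pot:
  assumes p: "Im p > 0"
  shows "\<forall>\<^sub>F w in at p. nice x w = pot x w"
proof -
  have "isolated_singularity_at (pot x) p"
    using pot_eventually_analytic[OF p] by (simp add: isolated_singularity_iff_eventually_analytic)
  from eventually_remove_sings_eq_at[OF this] eventually_at_uhp[OF p] show ?thesis
    by eventually_elim (simp add: nice_def)
qed

lemma nice_nicely_meromorphic: "nice x nicely_meromorphic_on upper_half_plane"
proof -
  have "pot x meromorphic_on upper_half_plane"
    unfolding pot_def[abs_def] base_def[abs_def]
    by (intro meromorphic_intros analytic_on_imp_meromorphic_on)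
      (use EE_holomorphic jj_holomorphic open_uhp in \<open>simp_all add: analytic_on_open\<close>)
  then have *: "remove_sings (pot x) nicely_meromorphic_on upper_half_plane" by (rule remove_sings_nicely_meromorphic)
  have ev: "\<forall>\<^sub>F w in at p. remove_sings (pot x) w = nice x w" if "Im p > 0" for p
    using eventually_at_uhp[OF that] by eventually_elim (simp add: nice_def)
  show ?thesis
    unfolding nicely_meromorphic_on_def
  proof (intro conjI ballI)
    show "nice x meromorphic_on upper_half_plane"
    proof (subst meromorphic_on_meromorphic_at, intro ballI)
      fix p assume p: "p \<in> upper_half_plane"
      have "remove_sings (pot x) meromorphic_on {p}"
        using * p meromorphic_on_subset unfolding nicely_meromorphic_on_def by blast
      moreover have "nice x meromorphic_on {p} \<longleftrightarrow> remove_sings (pot x) meromorphic_on {p}"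
        using ev[of p] p by (intro meromorphic_on_cong) (auto simp: uhp_iff eq_commute)
      ultimately show "nice x meromorphic_on {p}" by simp
    qed
    fix p assume p: "p \<in> upper_half_plane"
    then have u: "Im p > 0" by (simp add: uhp_iff)
    have eq: "nice x p = remove_sings (pot x) p" using u by (simp add: nice_def)
    have "is_pole (remove_sings (pot x)) p \<longleftrightarrow> is_pole (nice x) p" by (rule is_pole_cong[OF ev[OF u] refl])
    moreover have "(remove_sings (pot x) \<midarrow>p\<rightarrow> nice x p) \<longleftrightarrow> (nice x \<midarrow>p\<rightarrow> nice x p)"
      by (rule filterlim_cong[OF refl refl ev[OF u]])
    ultimately show "is_pole (nice x) p \<and> nice x p = 0 \<or> nice x \<midarrow>p\<rightarrow> nice x p"
      using * p unfolding nicely_meromorphic_on_def eq by blast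
  qed
qed

lemma nice_admissible: "admissible (nice x)"
  unfolding admissible_def
proof (intro conjI allI impI)
  show "weight4 (nice x)"
    unfolding weight4_def
  proof (intro allI impI)
    fix a b c d :: int and w :: complex assume g: "a * d - b * c = 1" and w: "Im w > 0"
    have "remove_sings (pot x) (mob a b c d w) = (of_int c * w + of_int d) ^ 4 * remove_sings (pot x) w"
      by (rule remove_sings_mob[OF weight4D[OF pot_weight4 g] g w])
    then show "nice x (mob a b c d w) = (of_int c * w + of_int d) ^ 4 * nice x w"
      using w mob_uhp[OF w g] by (simp add: nice_def)
  qed
  show "\<forall>\<^sub>F w in at p. nice x analytic_on {w}" if "Im p > 0" for p
    using nice_nicely_meromorphic that meromorphic_on_isolated_singularity[of "nice x" p]
      meromorphic_on_subset[of "nice x" upper_half_plane "{p}"]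
    unfolding isolated_singularity_iff_eventually_analytic[symmetric] by (auto simp: nicely_meromorphic_on_def uhp_iff)
  show "((\<lambda>w. (w - p)\<^sup>2 * nice x w) \<longlongrightarrow> indicial k) (at p)" if s: "special p k" for p k
  proof (rule Lim_transform_eventually[OF pot_special[OF s, of x]])
    show "\<forall>\<^sub>F w in at p. (w - p)\<^sup>2 * pot x w = (w - p)\<^sup>2 * nice x w"
      using nice_eq_pot[where x = x, OF special_uhp[OF s]] by eventually_elim simp
  qed
  show "nice x analytic_on {p}" if p: "Im p > 0" and s: "\<forall>q k. special q k \<longrightarrow> \<not> SL2Z_equiv q p" for p
  proof (rule nicely_meromorphic_on_imp_analytic_at[OF nice_nicely_meromorphic])
    have "pot x analytic_on {p}" by (rule admissibleD(4)[OF pot_admissible p]) (use s in blast)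
    then have "\<not> is_pole (pot x) p" by (rule analytic_at_imp_no_pole)
    then show "\<not> is_pole (nice x) p" using is_pole_cong[OF nice_eq_pot[OF p] refl] by simp
  qed (use p uhp_iff in simp)
  have "\<forall>\<^sub>F w in cusp. pot x w = nice x w"
    using cusp_not_special
  proof eventually_elim
    case (elim w)
    have "pot x analytic_on {w}" by (rule admissibleD(4)[OF pot_admissible]) (use elim in blast)+
    then show ?case using elim by (simp add: nice_def)
  qed
  then show "(nice x \<longlongrightarrow> - 4 * (of_real pi)\<^sup>2 * (of_real \<kappa>)\<^sup>2) cusp"
    by (rule Lim_transform_eventually[OF admissibleD(5)[OF pot_admissible]])
qed

text \<open>The coordinates \<open>x j\<close> are read off from the simple pole coefficients of
  \<open>Q - pot (\<lambda>_. 0)\<close> at the \<open>z j\<close>, and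
  \<open>admissible_unique\<close> does the rest.\<close>

lemma solution_eq_nice:
  assumes Q: "solution Q"
  obtains x where "\<And>j. j \<notin> {1..m} \<Longrightarrow> x j = 0" "Q = nice x" "\<And>p. Im p > 0 \<Longrightarrow> \<forall>\<^sub>F w in at p. pot x w = Q w"
proof -
  note ad = solution_admissible[OF Q]
  have "\<exists>L. ((\<lambda>w. (w - z j) * (Q w - pot (\<lambda>_. 0) w)) \<longlongrightarrow> L) (at (z j))" if j: "j \<in> {1..m}" for j
  proof -
    have "\<forall>\<^sub>F w in at (z j). (\<lambda>w. Q w - pot (\<lambda>_. 0) w) analytic_on {w}"
      using admissibleD(2)[OF ad z_uhp[OF j]] pot_eventually_analytic[OF z_uhp[OF j], of "\<lambda>_. 0"]
      by eventually_elim (intro analytic_intros)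
    moreover have "((\<lambda>w. (w - z j) ^ Suc 1 * (Q w - pot (\<lambda>_. 0) w)) \<longlongrightarrow> 0) (at (z j))"
      using tendsto_diff[OF admissibleD(3)[OF ad specialI(3)[OF j]] pot_special[OF specialI(3)[OF j], of "\<lambda>_. 0"]]
      by (simp add: right_diff_distrib power2_eq_square)
    ultimately show ?thesis using pole_lower[of "\<lambda>w. Q w - pot (\<lambda>_. 0) w" "z j" 1] by simp
  qed
  then have "\<forall>j\<in>{1..m}. \<exists>L. ((\<lambda>w. (w - z j) * (Q w - pot (\<lambda>_. 0) w)) \<longlongrightarrow> L) (at (z j))" by blast
  from bchoice[OF this] obtain L where
    L: "\<And>j. j \<in> {1..m} \<Longrightarrow> ((\<lambda>w. (w - z j) * (Q w - pot (\<lambda>_. 0) w)) \<longlongrightarrow> L j) (at (z j))" by blast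
  define x where "x j = (if j \<in> {1..m} then L j / res1 j else 0)" for j
  have res: "((\<lambda>w. (w - z j) * (Q w - pot x w)) \<longlongrightarrow> 0) (at (z j))" if j: "j \<in> {1..m}" for j
  proof -
    have "((\<lambda>w. (w - z j) * (Q w - pot (\<lambda>_. 0) w) - (\<Sum>k\<in>{1..m}. x k * ((w - z j) * (EE w / (jj w - jj (z k)))))) \<longlongrightarrow>
        L j - (\<Sum>k\<in>{1..m}. x k * (if k = j then res1 j else 0))) (at (z j))"
      by (intro tendsto_diff tendsto_sum tendsto_mult_left L simple_term_limit j)
    moreover have "(\<Sum>k\<in>{1..m}. x k * (if k = j then res1 j else 0)) = x j * res1 j"
    proof -
      have "(\<Sum>k\<in>{1..m}. x k * (if k = j then res1 j else 0)) = (\<Sum>k\<in>{1..m}. if k = j then x j * res1 j else 0)"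
        by (intro sum.cong) auto
      also have "\<dots> = x j * res1 j" using j by (simp only: sum.delta finite_atLeastAtMost if_True)
      finally show ?thesis .
    qed
    moreover have "x j * res1 j = L j" using j res12(1)[OF j] by (simp add: x_def)
    moreover have "(w - z j) * (Q w - pot (\<lambda>_. 0) w) - (\<Sum>k\<in>{1..m}. x k * ((w - z j) * (EE w / (jj w - jj (z k))))) =
        (w - z j) * (Q w - pot x w)" for w
    proof -
      have "(\<Sum>k\<in>{1..m}. x k * ((w - z j) * (EE w / (jj w - jj (z k))))) = (w - z j) * (\<Sum>k\<in>{1..m}. x k * (EE w / (jj w - jj (z k))))"
        unfolding sum_distrib_left by (intro sum.cong) (simp_all only: mult.left_commute)
      then show ?thesis by (simp add: pot_def algebra_simps)
    qed
    ultimately show ?thesis by simp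
  qed
  have eq: "\<forall>\<^sub>F w in at p. Q w = pot x w" if "Im p > 0" for p
    by (rule admissible_unique[OF ad pot_admissible res that])
  \<comment> \<open>Equality off isolated points becomes equality everywhere because both functions
    carry the same normalised values.\<close>
  have "Q w = nice x w" for w
  proof (cases "Im w > 0")
    case True
    have "Q nicely_meromorphic_on upper_half_plane" using Q by (simp add: meromorphic_modular_form_def)
    then have "is_pole Q w \<and> Q w = 0 \<or> Q \<midarrow>w\<rightarrow> Q w" using True unfolding nicely_meromorphic_on_def by (simp add: uhp_iff)
    then have "remove_sings Q w = Q w" by auto
    then show ?thesis using remove_sings_cong[OF eq[OF True] refl] True by (simp add: nice_def)
  next
    case False
    then show ?thesis using Q by (simp add: nice_def meromorphic_modular_form_def uhp_iff)
  qed
  then have "Q = nice x" by blast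
  moreover have "\<forall>\<^sub>F w in at p. pot x w = Q w" if "Im p > 0" for p using eq[OF that] by eventually_elim simp
  moreover have "x j = 0" if "j \<notin> {1..m}" for j using that unfolding x_def by (rule if_not_P)
  ultimately show ?thesis using that[of x] by blast
qed

text \<open>The solutions are the image under \<open>nice\<close> of the zero set \<open>Z\<close>
  of the obstructions: existence comes from a point of \<open>Z\<close>, and the bound on
  \<open>Z\<close> passes to the image.\<close>

lemma solution_count:
  "{Q. solution Q} \<noteq> {}" "finite {Q. solution Q}" "card {Q. solution Q} \<le> prod n {1..m}"
proof -
  have "\<forall>j\<in>{1..m}. \<exists>D. (\<forall>x. expands (n j) (pot x) (z j) (D x)) \<and> (\<forall>l. pol {1..m} 1 (\<lambda>x. fps_nth (D x) l)) \<and>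
    lead {1..m} 1 (\<lambda>x. fps_nth (D x) 0) (\<lambda>x. res1 j * x j)"
    using pot_expansion by blast
  from bchoice[OF this] obtain D where
    D: "\<And>j x. j \<in> {1..m} \<Longrightarrow> expands (n j) (pot x) (z j) (D j x)"
      "\<And>j l. j \<in> {1..m} \<Longrightarrow> pol {1..m} 1 (\<lambda>x. fps_nth (D j x) l)"
      "\<And>j. j \<in> {1..m} \<Longrightarrow> lead {1..m} 1 (\<lambda>x. fps_nth (D j x) 0) (\<lambda>x. res1 j * x j)" by blast
  have n1: "n j \<ge> 1" if "j \<in> {1..m}" for j using n_ge_2[OF that] by simp
  have "\<exists>c. c \<noteq> 0 \<and> lead {1..m} (n j) (\<lambda>x. obstr (n j) (fps_nth (D j x))) (\<lambda>x. c * x j ^ n j)" if j: "j \<in> {1..m}" for j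
  proof -
    obtain \<gamma> where \<gamma>: "\<gamma> \<noteq> 0" "lead {1..m} (n j) (\<lambda>x. obstr (n j) (fps_nth (D j x))) (\<lambda>x. \<gamma> * (res1 j * x j) ^ n j)"
      by (rule obstr_lead[where d = "\<lambda>x. fps_nth (D j x)" and \<beta> = "res1 j" and j = j, OF D(2)[OF j] D(3)[OF j] n1[OF j]])
    then show ?thesis using res12(1)[OF j]
      by (intro exI[of _ "\<gamma> * res1 j ^ n j"]) (simp add: power_mult_distrib mult.assoc)
  qed
  then have "\<forall>j\<in>{1..m}. \<exists>c. c \<noteq> 0 \<and> lead {1..m} (n j) (\<lambda>x. obstr (n j) (fps_nth (D j x))) (\<lambda>x. c * x j ^ n j)" by blast
  from bchoice[OF this] obtain c where c: "\<And>j. j \<in> {1..m} \<Longrightarrow> c j \<noteq> 0"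
    "\<And>j. j \<in> {1..m} \<Longrightarrow> lead {1..m} (n j) (\<lambda>x. obstr (n j) (fps_nth (D j x))) (\<lambda>x. c j * x j ^ n j)" by blast
  \<comment> \<open>Division by \<open>c j\<close> makes the top-degree part exactly
    \<open>x j ^ n j\<close>, as \<open>power_system\<close> requires.\<close>
  define P where "P j x = 1 / c j * obstr (n j) (fps_nth (D j x))" for j x
  interpret sys: power_system "{1..m}" n P
  proof
    show "lead {1..m} (n j) (P j) (\<lambda>x. x j ^ n j)" if "j \<in> {1..m}" for j
      using lead_scale[OF c(2)[OF that], of "1 / c j"] c(1)[OF that] unfolding P_def[abs_def] by simp
  qed (use n1 in auto)
  define Z where "Z = {x. (\<forall>i\<in>{1..m}. P i x = 0) \<and> (\<forall>i. i \<notin> {1..m} \<longrightarrow> x i = 0)}"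
  have solves: "solution (nice x)" if x: "x \<in> Z" for x
  proof (rule admissible_solution[OF nice_admissible nice_nicely_meromorphic])
    show "nice x w = 0" if "Im w \<le> 0" for w using that by (simp add: nice_def)
    fix j assume j: "j \<in> {1..m}"
    then have ob: "obstr (n j) (fps_nth (D j x)) = 0" using x c(1)[OF j] by (auto simp: Z_def P_def)
    have "\<forall>\<^sub>F w in at (z j). pot x w = nice x w" using nice_eq_pot[where x = x, OF z_uhp[OF j]] by eventually_elim simp
    from obstr_zero_imp_riccati[OF expands_cong[OF this D(1)[OF j]] n1[OF j] ob] show "riccati (n j) (nice x) (z j)" .
  qed
  have "{Q. solution Q} \<subseteq> nice ` Z"
  proof
    fix Q assume "Q \<in> {Q. solution Q}"
    then have Q: "solution Q" by simp
    obtain x where x: "\<And>j. j \<notin> {1..m} \<Longrightarrow> x j = 0" "Q = nice x" "\<And>p. Im p > 0 \<Longrightarrow> \<forall>\<^sub>F w in at p. pot x w = Q w"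
      by (rule solution_eq_nice[OF Q]) blast
    have "P j x = 0" if j: "j \<in> {1..m}" for j
    proof -
      \<comment> \<open>\<open>apparent\<close> speaks of poles only; \<open>n j \<ge> 2\<close>
        ensures that \<open>z j\<close> is one.\<close>
      have "is_pole Q (z j)" using admissible_is_pole[OF solution_admissible[OF Q] specialI(3)[OF j] _ SL2Z_equiv_refl] n_ge_2[OF j] by simp
      moreover have "apparent Q" using Q by (simp add: equipped_def)
      ultimately have "apparent_at Q (z j)" using z_uhp[OF j] by (simp add: apparent_def uhp_iff)
      then have "obstr (n j) (fps_nth (D j x)) = 0"
        by (rule apparent_at_imp_obstr_zero[OF expands_cong[OF x(3)[OF z_uhp[OF j]] D(1)[OF j]] n1[OF j]])
      then show ?thesis by (simp add: P_def)
    qed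
    then show "Q \<in> nice ` Z" using x(1,2) unfolding Z_def by blast
  qed
  then have eq: "{Q. solution Q} = nice ` Z" using solves by blast
  show "{Q. solution Q} \<noteq> {}" unfolding eq using sys.exists_zero by (auto simp: Z_def)
  note fin = sys.finite_zero_set[folded Z_def]
  show "finite {Q. solution Q}" unfolding eq using fin by simp
  show "card {Q. solution Q} \<le> prod n {1..m}" unfolding eq using card_image_le[OF fin(1), of nice] fin(2) by simp
qed

end

theorem theorem1p3:
  fixes \<kappa>\<^sub>\<rho> \<kappa>\<^sub>i \<kappa>\<^sub>q :: real
    and m :: nat
    and z :: "nat \<Rightarrow> complex"
    and \<kappa> :: "nat \<Rightarrow> real"
  assumes "\<kappa>\<^sub>\<rho> \<in> half_pos_nats" and "2 * \<kappa>\<^sub>\<rho> / 3 \<notin> pos_nats"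
    and "\<kappa>\<^sub>i \<in> half_pos_nats" and "\<kappa>\<^sub>i \<notin> pos_nats"
    and "\<And>j. j \<in> {1..m} \<Longrightarrow> z j \<in> upper_half_plane"
    and "\<And>j k. j \<in> {1..m} \<Longrightarrow> k \<in> {1..m} \<Longrightarrow> j \<noteq> k \<Longrightarrow> \<not> SL2Z_equiv (z j) (z k)"
    and "\<And>j. j \<in> {1..m} \<Longrightarrow> \<not> SL2Z_equiv (z j) \<i> \<and> \<not> SL2Z_equiv (z j) rho"
    and "\<And>j. j \<in> {1..m} \<Longrightarrow> \<kappa> j \<in> half_pos_nats \<and> \<kappa> j > 1/2"
    and "\<kappa>\<^sub>q > 0"
  shows "{Q. meromorphic_modular_form 4 Q \<and> equipped Q \<kappa>\<^sub>\<rho> \<kappa>\<^sub>i m z \<kappa> \<kappa>\<^sub>q} \<noteq> {}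
    \<and> finite {Q. meromorphic_modular_form 4 Q \<and> equipped Q \<kappa>\<^sub>\<rho> \<kappa>\<^sub>i m z \<kappa> \<kappa>\<^sub>q}
    \<and> real (card {Q. meromorphic_modular_form 4 Q \<and> equipped Q \<kappa>\<^sub>\<rho> \<kappa>\<^sub>i m z \<kappa> \<kappa>\<^sub>q})
        \<le> (\<Prod>j=1..m. 2 * \<kappa> j)"
proof -
  obtain n\<rho> where \<kappa>\<rho>: "\<kappa>\<^sub>\<rho> = real n\<rho> / 2" "n\<rho> \<ge> 1" using assms(1) unfolding half_pos_nats_def by blast
  obtain ni where \<kappa>i: "\<kappa>\<^sub>i = real ni / 2" "ni \<ge> 1" using assms(3) unfolding half_pos_nats_def by blast
  have "\<forall>j\<in>{1..m}. \<exists>k. \<kappa> j = real k / 2" using assms(8) unfolding half_pos_nats_def by blast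
  from bchoice[OF this] obtain n where n: "\<And>j. j \<in> {1..m} \<Longrightarrow> \<kappa> j = real (n j) / 2" by blast
  \<comment> \<open>Doubling turns the excluded values of \<open>\<kappa>\<^sub>\<rho>\<close> and
    \<open>\<kappa>\<^sub>i\<close> into \<open>\<not> 3 dvd n\<rho>\<close> and
    \<open>odd ni\<close>, and \<open>\<kappa> j > 1/2\<close> into
    \<open>n j \<ge> 2\<close>.\<close>
  interpret potential_data n\<rho> ni m z n \<kappa>\<^sub>q
  proof
    show "\<not> 3 dvd n\<rho>"
    proof
      assume "3 dvd n\<rho>"
      then obtain k where k: "n\<rho> = 3 * k" by blast
      then have "2 * \<kappa>\<^sub>\<rho> / 3 = real k" "k \<ge> 1" using \<kappa>\<rho> by auto
      then show False using assms(2) unfolding pos_nats_def by blast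
    qed
    show "odd ni"
    proof
      assume "even ni"
      then obtain k where k: "ni = 2 * k" by blast
      then have "\<kappa>\<^sub>i = real k" "k \<ge> 1" using \<kappa>i by auto
      then show False using assms(4) unfolding pos_nats_def by blast
    qed
    show "Im (z j) > 0" if "j \<in> {1..m}" for j using assms(5)[OF that] by (simp add: uhp_iff)
    show "2 \<le> n j" if "j \<in> {1..m}" for j using assms(8)[OF that] n[OF that] by auto
  qed (use assms(6,7) in blast)+
  have exps: "(\<forall>j\<in>{1..m}. local_exponents Q (z j) (1/2 + of_real (\<kappa> j)) (1/2 - of_real (\<kappa> j))) \<longleftrightarrow>
      (\<forall>j\<in>{1..m}. local_exponents Q (z j) (1/2 + of_real (real (n j) / 2)) (1/2 - of_real (real (n j) / 2)))" for Q
    by (intro ball_cong refl) (simp only: n)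
  have eq: "equipped Q \<kappa>\<^sub>\<rho> \<kappa>\<^sub>i m z \<kappa> \<kappa>\<^sub>q \<longleftrightarrow> equipped Q (real n\<rho> / 2) (real ni / 2) m z (\<lambda>j. real (n j) / 2) \<kappa>\<^sub>q" for Q
    by (simp only: equipped_def exps \<kappa>\<rho>(1) \<kappa>i(1))
  have "(\<Prod>j=1..m. 2 * \<kappa> j) = real (prod n {1..m})" unfolding of_nat_prod
  proof (intro prod.cong refl)
    fix j assume "j \<in> {1..m}"
    from n[OF this] show "2 * \<kappa> j = real (n j)" by simp
  qed
  then show ?thesis unfolding eq using solution_count by (simp only: of_nat_le_iff) blast
qed

end
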